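(* Let $1\leq l\leq l'<n$ and $r,r'\in\mathbb{Z}_n$. Assume $l+l'\leq n$. Then, as $H_n(1,q)$-modules, $$\begin{aligned}P(l,r)\otimes P(l',r')\cong&\Big(\bigoplus_{i=0}^{l-1}2P(l+l'-1-2i,\,r+r'+i)\Big)\\&\oplus\Big(\bigoplus_{i=l'}^{l'+l-1}2P(n+l+l'-1-2i,\,r+r'+i)\Big)\\&\oplus\Big(\bigoplus_{c(l'+l-1)\leq i\leq l'-1}4P(n+l+l'-1-2i,\,r+r'+i)\Big)\\&\oplus\Big(\bigoplus_{1\leq i\leq c(n-l-l')}4P(l+l'-1+2i,\,r+r'-i)\Big).\end{aligned}$$
   Context: Setting: $k$ is an algebraically closed field, $n>2$ is a fixed integer, $q\in k$ is a primitive $n$-th root of unity, $\mathbb{Z}_n=\mathbb{Z}/n\mathbb{Z}$, and $(i)_q=1+q+\cdots+q^{i-1}$. $H_n(1,q)$ is the Hopf algebra over $k$ (isomorphic to the Drinfeld double of the Taft algebra $H_n(q)$) generated as an algebra by $a,b,c,d$ with relations $ba=qab$, $db=qbd$, $ca=qac$, $dc=qcd$, $bc=cb$, $a^n=0$, $b^n=1$, $c^n=1$, $d^n=0$, $da-qad=1-bc$, with comultiplication $\Delta(a)=a\otimes b+1\otimes a$, $\Delta(b)=b\otimes b$, $\Delta(c)=c\otimes c$, $\Delta(d)=d\otimes c+1\otimes d$, counit $\varepsilon(a)=\varepsilon(d)=0$, $\varepsilon(b)=\varepsilon(c)=1$, and antipode $S(a)=-ab^{-1}$, $S(b)=b^{-1}$,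 $S(c)=c^{-1}$, $S(d)=-dc^{-1}$. All modules are finite-dimensional left $H_n(1,q)$-modules, $\otimes=\otimes_k$ with action through $\Delta$, and $sM$ is the direct sum of $s$ copies of $M$ ($sM=0$ if $s=0$). Simple modules: for $1\leq l\leq n$, $r\in\mathbb{Z}_n$, $V(l,r)$ has basis $v_1,\dots,v_l$ with $av_i=v_{i+1}$ for $i<l$, $av_l=0$, $bv_i=q^{r+i-1}v_i$, $cv_i=q^{i-r-l}v_i$, $dv_1=0$, $dv_i=\alpha_{i-1}(l)v_{i-1}$ for $1<i\leq l$, where $\alpha_i(l)=(i)_q(1-q^{i-l})$. For $1\leq l<n$, $P(l,r)$ is the projective cover of $V(l,r)$, and $P(n,r)=V(n,r)$ (which is projective). Conventions: integers in the second argument of $V$ and $P$ are read modulo $n$; $c(t)=\lfloor (t+1)/2\rfloor$ for $t\in\mathbb{Z}$ (the function $c(\cdot)$ is not to be confused with the generator $c$); a direct sum over an empty range of indices is zero. *)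

theory Defs
  imports
    "HOL-Algebra.QuotRing"
    "HOL-Computational_Algebra.Polynomial"
    "HOL-Library.Poly_Mapping"
    "HOL-Library.Product_Plus"
    "Jordan_Normal_Form.Matrix"
begin

definition primitive_root_of_unity :: "nat \<Rightarrow> 'k::field \<Rightarrow> bool" where
  "primitive_root_of_unity n q \<longleftrightarrow> 0 < n \<and> q ^ n = 1 \<and> (\<forall>j. 0 < j \<and> j < n \<longrightarrow> q ^ j \<noteq> 1)"


section \<open>The algebra $H_n(1,q)$\<close>

text \<open>
  The free algebra on \<open>a, b, c, d\<close> is the monoid algebra of the free monoid, that is, the
  finitely supported functions on words with the convolution product of
  \<^theory>\<open>HOL-Library.Poly_Mapping\<close>. That product is indexed by an additive monoid, so
  concatenation of words is written \<open>+\<close>.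
\<close>

datatype hgen = Gen_a | Gen_b | Gen_c | Gen_d

datatype word = Word (letters: "hgen list")

instantiation word :: monoid_add
begin

definition zero_word :: word where "0 = Word []"

definition plus_word :: "word \<Rightarrow> word \<Rightarrow> word" where
  "u + v = Word (letters u @ letters v)"

instance
  by standard (simp_all add: zero_word_def plus_word_def)

end

type_synonym 'k free_alg = "word \<Rightarrow>\<^sub>0 'k"

definition gen :: "hgen \<Rightarrow> 'k::field free_alg" where
  "gen g = Poly_Mapping.single (Word [g]) 1"

definition scal :: "'k::field \<Rightarrow> 'k free_alg" where
  "scal t = Poly_Mapping.single 0 t"

definition free_ring :: "'k::field free_alg ring" where
  "free_ring = \<lparr>carrier = UNIV, monoid.mult = (*), one = 1, zero = 0, add = (+)\<rparr>"

text \<open>A relation \<open>x = y\<close> is recorded as the element \<open>x - y\<close>.\<close>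

definition H_relations :: "nat \<Rightarrow> 'k::field \<Rightarrow> 'k free_alg set" where
  "H_relations n q =
    (let a = gen Gen_a; b = gen Gen_b; c = gen Gen_c; d = gen Gen_d in
      {b * a - scal q * a * b,
       d * b - scal q * b * d,
       c * a - scal q * a * c,
       d * c - scal q * c * d,
       b * c - c * b,
       a ^ n,
       b ^ n - 1,
       c ^ n - 1,
       d ^ n,
       (d * a - scal q * a * d) - (1 - b * c)})"

definition H_ideal :: "nat \<Rightarrow> 'k::field \<Rightarrow> 'k free_alg set" where
  "H_ideal n q = genideal free_ring (H_relations n q)"

definition H_alg :: "nat \<Rightarrow> 'k::field \<Rightarrow> 'k free_alg set ring" where
  "H_alg n q = free_ring Quot (H_ideal n q)"

definition H_class :: "nat \<Rightarrow> 'k::field \<Rightarrow> 'k free_alg \<Rightarrow> 'k free_alg set" where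
  "H_class n q x = H_ideal n q +>\<^bsub>free_ring\<^esub> x"

text \<open>
  The comultiplication, lifted to an algebra map from the free algebra to its tensor square. The
  tensor square is the monoid algebra of pairs of words, with \<open>u \<otimes> v\<close> the basis element at
  \<open>(u, v)\<close>. The tensor product of modules depends on no other part of the Hopf structure.
\<close>

definition tens :: "word \<Rightarrow> word \<Rightarrow> (word \<times> word) \<Rightarrow>\<^sub>0 'k::field" where
  "tens u v = Poly_Mapping.single (u, v) 1"

fun comult_gen :: "hgen \<Rightarrow> (word \<times> word) \<Rightarrow>\<^sub>0 'k::field" where
  "comult_gen Gen_a = tens (Word [Gen_a]) (Word [Gen_b]) + tens 0 (Word [Gen_a])"
| "comult_gen Gen_b = tens (Word [Gen_b]) (Word [Gen_b])"
| "comult_gen Gen_c = tens (Word [Gen_c]) (Word [Gen_c])"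
| "comult_gen Gen_d = tens (Word [Gen_d]) (Word [Gen_c]) + tens 0 (Word [Gen_d])"

definition comult :: "'k::field free_alg \<Rightarrow> (word \<times> word) \<Rightarrow>\<^sub>0 'k" where
  "comult x = (\<Sum>w\<in>Poly_Mapping.keys x.
      Poly_Mapping.single 0 (Poly_Mapping.lookup x w) * prod_list (map comult_gen (letters w)))"


section \<open>Finite-dimensional left modules\<close>

text \<open>
  The underlying space is $k^m$, acted on by matrices. Up to isomorphism these are all the
  finite-dimensional modules. Only the values of \<open>hm_act\<close> on the carrier of \<open>H_alg n q\<close> matter.
\<close>

record (overloaded) 'k hmod =
  hm_dim :: nat
  hm_act :: "'k free_alg set \<Rightarrow> 'k mat"

definition is_hmod :: "nat \<Rightarrow> 'k::field \<Rightarrow> 'k hmod \<Rightarrow> bool" where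
  "is_hmod n q M \<longleftrightarrow>
     hm_act M \<in> Ring.ring_hom (H_alg n q) (ring_mat TYPE('k) (hm_dim M) ()) \<and>
     (\<forall>t. hm_act M (H_class n q (scal t)) = t \<cdot>\<^sub>m 1\<^sub>m (hm_dim M))"

definition hm_hom :: "nat \<Rightarrow> 'k::field \<Rightarrow> 'k hmod \<Rightarrow> 'k hmod \<Rightarrow> 'k mat set" where
  "hm_hom n q M N =
     {X \<in> carrier_mat (hm_dim N) (hm_dim M).
        \<forall>h\<in>carrier (H_alg n q). X * hm_act M h = hm_act N h * X}"

definition hm_iso :: "nat \<Rightarrow> 'k::field \<Rightarrow> 'k hmod \<Rightarrow> 'k hmod \<Rightarrow> bool" where
  "hm_iso n q M N \<longleftrightarrow>
     (\<exists>X\<in>hm_hom n q M N. \<exists>Y\<in>hm_hom n q N M.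
        X * Y = 1\<^sub>m (hm_dim N) \<and> Y * X = 1\<^sub>m (hm_dim M))"

definition hm_surj :: "'k::field hmod \<Rightarrow> 'k hmod \<Rightarrow> 'k mat \<Rightarrow> bool" where
  "hm_surj M N X \<longleftrightarrow>
     (\<forall>w\<in>carrier_vec (hm_dim N). \<exists>v\<in>carrier_vec (hm_dim M). X *\<^sub>v v = w)"

definition hm_kernel :: "'k::field hmod \<Rightarrow> 'k hmod \<Rightarrow> 'k mat \<Rightarrow> 'k vec set" where
  "hm_kernel M N X = {v \<in> carrier_vec (hm_dim M). X *\<^sub>v v = 0\<^sub>v (hm_dim N)}"

text \<open>Closure under scalars is part of closure under the action.\<close>

definition hm_submodule :: "nat \<Rightarrow> 'k::field \<Rightarrow> 'k hmod \<Rightarrow> 'k vec set \<Rightarrow> bool" where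
  "hm_submodule n q M U \<longleftrightarrow>
     U \<subseteq> carrier_vec (hm_dim M) \<and> 0\<^sub>v (hm_dim M) \<in> U \<and>
     (\<forall>u\<in>U. \<forall>v\<in>U. u + v \<in> U) \<and>
     (\<forall>h\<in>carrier (H_alg n q). \<forall>u\<in>U. hm_act M h *\<^sub>v u \<in> U)"

definition hm_projective :: "nat \<Rightarrow> 'k::field \<Rightarrow> 'k hmod \<Rightarrow> bool" where
  "hm_projective n q P \<longleftrightarrow> is_hmod n q P \<and>
     (\<forall>M N g f. is_hmod n q M \<and> is_hmod n q N \<and>
        g \<in> hm_hom n q M N \<and> hm_surj M N g \<and> f \<in> hm_hom n q P N
        \<longrightarrow> (\<exists>f'\<in>hm_hom n q P M. g * f' = f))"

definition hm_projective_cover :: "nat \<Rightarrow> 'k::field \<Rightarrow> 'k hmod \<Rightarrow> 'k hmod \<Rightarrow> bool" where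
  "hm_projective_cover n q P M \<longleftrightarrow> hm_projective n q P \<and>
     (\<exists>p\<in>hm_hom n q P M. hm_surj P M p \<and>
        (\<forall>U. hm_submodule n q P U \<and>
             {u + v | u v. u \<in> U \<and> v \<in> hm_kernel P M p} = carrier_vec (hm_dim P)
             \<longrightarrow> U = carrier_vec (hm_dim P)))"

definition hm_dsum :: "'k::field hmod list \<Rightarrow> 'k hmod" where
  "hm_dsum Ms = \<lparr>hm_dim = sum_list (map hm_dim Ms),
     hm_act = (\<lambda>h. diag_block_mat (map (\<lambda>M. hm_act M h) Ms))\<rparr>"

abbreviation hm_plus :: "'k::field hmod \<Rightarrow> 'k hmod \<Rightarrow> 'k hmod" (infixr "\<oplus>\<^sub>H" 65) where
  "M \<oplus>\<^sub>H N \<equiv> hm_dsum [M, N]"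

definition hm_copies :: "nat \<Rightarrow> 'k::field hmod \<Rightarrow> 'k hmod" where
  "hm_copies s M = hm_dsum (replicate s M)"

definition hm_sum :: "int \<Rightarrow> int \<Rightarrow> (int \<Rightarrow> 'k::field hmod) \<Rightarrow> 'k hmod" where
  "hm_sum i j F = hm_dsum (map F [i..j])"

text \<open>The basis vector $e_i \otimes f_j$ of $k^m \otimes k^{m'}$ is the one with index $i m' + j$.\<close>

definition kron_mat :: "'k::field mat \<Rightarrow> 'k mat \<Rightarrow> 'k mat" where
  "kron_mat A B = mat (dim_row A * dim_row B) (dim_col A * dim_col B)
     (\<lambda>(i, j). A $$ (i div dim_row B, j div dim_col B) * B $$ (i mod dim_row B, j mod dim_col B))"

definition mat_lincomb :: "nat \<Rightarrow> ('x \<Rightarrow>\<^sub>0 'k::field) \<Rightarrow> ('x \<Rightarrow> 'k mat) \<Rightarrow> 'k mat" where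
  "mat_lincomb m x X =
     mat m m (\<lambda>ij. \<Sum>w\<in>Poly_Mapping.keys x. Poly_Mapping.lookup x w * X w $$ ij)"

text \<open>
  An element of \<open>H_alg n q\<close> is a coset in the free algebra. An operator given by representatives
  acts through \<open>the_elem\<close>, which yields the value shared by all representatives.
\<close>

definition hm_tensor :: "nat \<Rightarrow> 'k::field \<Rightarrow> 'k hmod \<Rightarrow> 'k hmod \<Rightarrow> 'k hmod" where
  "hm_tensor n q M N =
     (let m = hm_dim M * hm_dim N;
          mon = (\<lambda>w. H_class n q (Poly_Mapping.single w 1))
      in \<lparr>hm_dim = m,
          hm_act = (\<lambda>h. the_elem ((\<lambda>x. mat_lincomb m (comult x)
            (\<lambda>(u, v). kron_mat (hm_act M (mon u)) (hm_act N (mon v)))) ` h))\<rparr>)"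

definition hm_of_gens :: "nat \<Rightarrow> (hgen \<Rightarrow> 'k::field mat) \<Rightarrow> 'k hmod" where
  "hm_of_gens m G =
     \<lparr>hm_dim = m,
      hm_act = (\<lambda>h. the_elem ((\<lambda>x. mat_lincomb m x
        (\<lambda>w. foldr (*) (map G (letters w)) (1\<^sub>m m))) ` h))\<rparr>"


section \<open>The simple modules\<close>

definition q_int :: "'k::field \<Rightarrow> nat \<Rightarrow> 'k" where
  "q_int q i = (\<Sum>j<i. q ^ j)"

definition V_alpha :: "'k::field \<Rightarrow> nat \<Rightarrow> nat \<Rightarrow> 'k" where
  "V_alpha q l i = q_int q i * (1 - q powi (int i - int l))"

text \<open>
  Matrix indices start at 0, so the basis vector $v_i$ has index $i - 1$: the exponents below are
  those of $b v_{j+1}$ and $c v_{j+1}$, and $d v_{j+1} = \alpha_j(l) v_j$. As \<open>q\<close> is an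
  \<open>n\<close>-th root of unity, only the class of \<open>r\<close> modulo \<open>n\<close> matters.
\<close>

fun V_gen :: "'k::field \<Rightarrow> nat \<Rightarrow> int \<Rightarrow> hgen \<Rightarrow> 'k mat" where
  "V_gen q l r Gen_a = mat l l (\<lambda>(i, j). if i = j + 1 then 1 else 0)"
| "V_gen q l r Gen_b = mat l l (\<lambda>(i, j). if i = j then q powi (r + int j) else 0)"
| "V_gen q l r Gen_c = mat l l (\<lambda>(i, j). if i = j then q powi (int j + 1 - r - int l) else 0)"
| "V_gen q l r Gen_d = mat l l (\<lambda>(i, j). if j = i + 1 then V_alpha q l j else 0)"

definition V :: "'k::field \<Rightarrow> nat \<Rightarrow> int \<Rightarrow> 'k hmod" where
  "V q l r = hm_of_gens l (V_gen q l r)"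

definition c_half :: "int \<Rightarrow> int" where
  "c_half t = \<lfloor>(rat_of_int t + 1) / 2\<rfloor>"

end

(*
  A finitely generated projective module is determined by its simple quotients. Precisely, if M is
  projective and maps jointly onto simple modules S_1, ..., S_k with projective covers P_1, ..., P_k,
  then M maps onto the direct sum of the P_i, and this is an isomorphism as soon as the dimensions
  agree. So it suffices to exhibit enough simple quotients of the projective module
  P(l,r) (x) P(l',r'), and no decomposition has to be carried out inside it.

  The module P(l,r) maps onto an explicit extension Q(l,r) of one Verma module by another, of
  dimension 2n. By the adjunction Hom(Q (x) W, S) = Hom(Q, Hom(W, S)), the simple quotients of
  Q(l,r) (x) V(m,s) come from vectors killed by d (highest) or by a (lowest) in the internal homs
  from V(m,s) to simple modules; their joint surjectivity is a triangularity statement. Since P(l,r)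
  is projective, simple quotients of P(l,r) (x) W' and P(l,r) (x) W'' add up along a short exact
  sequence of W', W, W''. Applying this to the filtration of Q(l',r') by two copies each of V(l',r')
  and V(n-l',r'+l') produces all the summands, and the dimensions add up to 4n^2 = dim P(l,r) dim P(l',r').
*)
theory Submission
  imports Defs "Jordan_Normal_Form.Determinant"
begin

section \<open>Modules as representations of the generators\<close>

text \<open>The family \<open>P\<close> is known only by the universal property of projective
  covers: it is not constructed and its dimensions are not given. So the argument runs in one
  direction only, from quotients to direct sums, and dimension counts close the gap. Q(l,r) enters
  just as an essential extension of V(l,r): this forces P(l,r) onto it, hence dim P(l,r) >= 2n, and
  the equality comes from the projective modules V(n,r) (x) V(k,s). The multiplicities arise as
  follows. In P(l,r) (x) V(m,s) vectors killed by \<open>d\<close> give every simple quotient once;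
  those with p = n+l+m-1-2i, where i is at least l, are reached a second time from vectors killed by
  \<open>a\<close>, through the lower Verma module of Q(l,r). The two copies each of V(l',r') and
  V(n-l',r'+l') in Q(l',r') double these counts to 2 and 4. The count for V(m,s) is valid for l <= m
  and l + m <= n, and the conditions l <= l' and l + l' <= n are exactly what allows both m = l' and
  m = n - l'.\<close>

lemma poly_mapping_single_induct:
  fixes x :: "'a \<Rightarrow>\<^sub>0 'b::comm_monoid_add"
  assumes "\<And>w t. Q (Poly_Mapping.single w t)" and "\<And>x y. Q x \<Longrightarrow> Q y \<Longrightarrow> Q (x + y)"
  shows "Q x"
proof (induction x rule: update_induct)
  case const
  have "Q (Poly_Mapping.single undefined 0)" by (rule assms(1))
  then show ?case by simp
next
  case (update f a b)
  have "Poly_Mapping.update a b f = f + Poly_Mapping.single a b"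
    using update.hyps
    by (intro poly_mapping_eqI) (auto simp: lookup_update lookup_add lookup_single in_keys_iff when_def)
  then show ?case using assms update by metis
qed

section \<open>Linear extension of matrix families and evaluation of the free algebra\<close>

lemma mat_lincomb_carrier [simp]: "mat_lincomb m x X \<in> carrier_mat m m"
  by (simp add: mat_lincomb_def)

lemma mat_lincomb_dim [simp]:
  "dim_row (mat_lincomb m x X) = m" "dim_col (mat_lincomb m x X) = m"
  by (simp_all add: mat_lincomb_def)

text \<open>Sums over the \<open>keys\<close> of different elements become comparable once all of
  them are extended to one common finite index set.\<close>

lemma mat_lincomb_superset:
  assumes "finite S" "Poly_Mapping.keys x \<subseteq> S"
  shows "mat_lincomb m x X = mat m m (\<lambda>ij. \<Sum>w\<in>S. Poly_Mapping.lookup x w * X w $$ ij)"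
  unfolding mat_lincomb_def
  by (intro eq_matI) (auto intro!: sum.mono_neutral_left assms simp: in_keys_iff)

lemma mat_lincomb_add:
  "mat_lincomb m (x + y) X = mat_lincomb m x X + mat_lincomb m y X"
proof -
  let ?S = "Poly_Mapping.keys x \<union> Poly_Mapping.keys y"
  have "Poly_Mapping.keys (x + y) \<subseteq> ?S" by (rule Poly_Mapping.keys_add)
  then show ?thesis
    by (subst (1 2 3) mat_lincomb_superset[of ?S])
       (auto simp: lookup_add sum.distrib ring_distribs)
qed

lemma mat_lincomb_single:
  assumes "X w \<in> carrier_mat m m"
  shows "mat_lincomb m (Poly_Mapping.single w t) X = t \<cdot>\<^sub>m X w"
  using assms by (subst mat_lincomb_superset[of "{w}"]) auto

lemma mat_lincomb_0 [simp]: "mat_lincomb m 0 X = 0\<^sub>m m m"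
  by (intro eq_matI) (auto simp: mat_lincomb_def)

text \<open>Kept for an arbitrary monoid because it serves twice: for words, in
  \<open>eval_free\<close>, and for pairs of words, on which the comultiplication takes its
  values.\<close>

lemma mat_lincomb_mult:
  fixes X :: "'x::monoid_add \<Rightarrow> 'k::field mat"
  assumes X: "\<And>u. X u \<in> carrier_mat m m" and mult: "\<And>u v. X (u + v) = X u * X v"
  shows "mat_lincomb m (x * y) X = mat_lincomb m x X * mat_lincomb m y X"
proof (induction x rule: poly_mapping_single_induct)
  case (1 u s)
  show ?case
  proof (induction y rule: poly_mapping_single_induct)
    case (1 v t)
    show ?case
      using X[of u] X[of v] X[of "u + v"]
      by (simp add: mult_single mat_lincomb_single mult mult_smult_distrib[OF X X]
          mult_smult_assoc_mat[OF X] mult.commute)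
         (intro eq_matI; simp)
  next
    case (2 x y)
    then show ?case
      by (simp add: distrib_left mat_lincomb_add mult_add_distrib_mat[of _ m m _ m])
  qed
next
  case (2 x y)
  then show ?case
    by (simp add: distrib_right mat_lincomb_add add_mult_distrib_mat[of _ m m _ _ m])
qed

lemma mat_lincomb_uminus:
  "mat_lincomb m (- x) X = - mat_lincomb m x (X :: _ \<Rightarrow> 'k::field mat)"
  unfolding mat_lincomb_def by (intro eq_matI) (auto simp: sum_negf)

lemma mat_lincomb_diff:
  "mat_lincomb m (x - y) X = mat_lincomb m x X - mat_lincomb m y (X :: _ \<Rightarrow> 'k::field mat)"
  using mat_lincomb_add[of m x "- y" X]
  by (simp add: mat_lincomb_uminus) (intro eq_matI; simp)

definition word_mat :: "nat \<Rightarrow> (hgen \<Rightarrow> 'k::field mat) \<Rightarrow> word \<Rightarrow> 'k mat" where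
  "word_mat m G w = foldr (*) (map G (letters w)) (1\<^sub>m m)"

definition eval_free :: "nat \<Rightarrow> (hgen \<Rightarrow> 'k::field mat) \<Rightarrow> 'k free_alg \<Rightarrow> 'k mat" where
  "eval_free m G x = mat_lincomb m x (word_mat m G)"

lemma foldr_mat_carrier:
  assumes "\<And>g. G g \<in> carrier_mat m m"
  shows "foldr (*) (map G ls) (1\<^sub>m m) \<in> carrier_mat m m"
  using assms by (induction ls) (auto intro: mult_carrier_mat)

lemma word_mat_carrier:
  "(\<And>g. G g \<in> carrier_mat m m) \<Longrightarrow> word_mat m G w \<in> carrier_mat m m"
  unfolding word_mat_def by (rule foldr_mat_carrier)

lemma word_mat_add:
  assumes G: "\<And>g. G g \<in> carrier_mat m m"
  shows "word_mat m G (u + v) = word_mat m G u * word_mat m G v"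
proof -
  have "foldr (*) (map G (ls @ ls')) (1\<^sub>m m) = foldr (*) (map G ls) (1\<^sub>m m) * foldr (*) (map G ls') (1\<^sub>m m)" for ls ls'
  proof (induction ls)
    case Nil
    then show ?case using foldr_mat_carrier[of G m ls'] G by simp
  next
    case (Cons g ls)
    then show ?case
      using assoc_mult_mat[OF G foldr_mat_carrier[of G m ls] foldr_mat_carrier[of G m ls']] G
      by simp
  qed
  then show ?thesis by (simp add: word_mat_def plus_word_def)
qed

lemma eval_free_carrier [simp]: "eval_free m G x \<in> carrier_mat m m"
  by (simp add: eval_free_def)

lemma eval_free_dim [simp]: "dim_row (eval_free m G x) = m" "dim_col (eval_free m G x) = m"
  by (simp_all add: eval_free_def)

lemma eval_free_add: "eval_free m G (x + y) = eval_free m G x + eval_free m G y"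
  and eval_free_diff: "eval_free m G (x - y) = eval_free m G x - eval_free m G y"
  and eval_free_0 [simp]: "eval_free m G 0 = 0\<^sub>m m m"
  by (simp_all add: eval_free_def mat_lincomb_add mat_lincomb_diff)

lemma word_mat_Nil [simp]: "word_mat m G 0 = 1\<^sub>m m" "word_mat m G (Word []) = 1\<^sub>m m"
  by (simp_all add: word_mat_def zero_word_def)

lemma eval_free_mult:
  "(\<And>g. G g \<in> carrier_mat m m) \<Longrightarrow> eval_free m G (x * y) = eval_free m G x * eval_free m G y"
  unfolding eval_free_def by (rule mat_lincomb_mult) (simp_all add: word_mat_carrier word_mat_add)

lemma eval_free_scal: "eval_free m G (scal t) = t \<cdot>\<^sub>m 1\<^sub>m m"
  by (simp add: eval_free_def scal_def mat_lincomb_single)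

lemma eval_free_1: "eval_free m G 1 = 1\<^sub>m m"
  using eval_free_scal[of m G 1] by (simp add: scal_def) (intro eq_matI; simp)

lemma eval_free_gen: "G g \<in> carrier_mat m m \<Longrightarrow> eval_free m G (gen g) = G g"
  using mat_lincomb_single[of "word_mat m G" "Word [g]" m 1]
  by (simp add: eval_free_def gen_def word_mat_def) (intro eq_matI; simp)

lemma eval_free_power:
  assumes "\<And>g. G g \<in> carrier_mat m m"
  shows "eval_free m G (x ^ k) = eval_free m G x ^\<^sub>m k"
  by (induction k) (simp_all add: eval_free_1 eval_free_mult[OF assms] power_Suc2 del: power_Suc)

text \<open>Together with \<open>hmod_of_gens\<close> and \<open>hmod_gens_rep\<close> this replaces
  cosets of the free algebra by four matrices in nearly all later arguments.\<close>

definition gens_rep :: "nat \<Rightarrow> 'k::field \<Rightarrow> nat \<Rightarrow> (hgen \<Rightarrow> 'k mat) \<Rightarrow> bool" where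
  "gens_rep n q m G \<longleftrightarrow> (\<forall>g. G g \<in> carrier_mat m m) \<and>
     G Gen_b * G Gen_a = q \<cdot>\<^sub>m (G Gen_a * G Gen_b) \<and>
     G Gen_d * G Gen_b = q \<cdot>\<^sub>m (G Gen_b * G Gen_d) \<and>
     G Gen_c * G Gen_a = q \<cdot>\<^sub>m (G Gen_a * G Gen_c) \<and>
     G Gen_d * G Gen_c = q \<cdot>\<^sub>m (G Gen_c * G Gen_d) \<and>
     G Gen_b * G Gen_c = G Gen_c * G Gen_b \<and>
     G Gen_a ^\<^sub>m n = 0\<^sub>m m m \<and> G Gen_b ^\<^sub>m n = 1\<^sub>m m \<and>
     G Gen_c ^\<^sub>m n = 1\<^sub>m m \<and> G Gen_d ^\<^sub>m n = 0\<^sub>m m m \<and>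
     G Gen_d * G Gen_a = q \<cdot>\<^sub>m (G Gen_a * G Gen_d) + (1\<^sub>m m - G Gen_b * G Gen_c)"

text \<open>Cited by number below: 1 is the carrier condition, 2 to 6 are the commutation rules for
  ba, db, ca, dc, bc, 7 to 10 the n-th powers of a, b, c, d, and 11 the rule for da.\<close>

lemmas gens_repD =
  gens_rep_def[THEN iffD1, THEN conjunct1, THEN spec]
  gens_rep_def[THEN iffD1, THEN conjunct2, THEN conjunct1]
  gens_rep_def[THEN iffD1, THEN conjunct2, THEN conjunct2, THEN conjunct1]
  gens_rep_def[THEN iffD1, THEN conjunct2, THEN conjunct2, THEN conjunct2, THEN conjunct1]
  gens_rep_def[THEN iffD1, THEN conjunct2, THEN conjunct2, THEN conjunct2, THEN conjunct2, THEN conjunct1]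
  gens_rep_def[THEN iffD1, THEN conjunct2, THEN conjunct2, THEN conjunct2, THEN conjunct2, THEN conjunct2, THEN conjunct1]
  gens_rep_def[THEN iffD1, THEN conjunct2, THEN conjunct2, THEN conjunct2, THEN conjunct2, THEN conjunct2, THEN conjunct2, THEN conjunct1]
  gens_rep_def[THEN iffD1, THEN conjunct2, THEN conjunct2, THEN conjunct2, THEN conjunct2, THEN conjunct2, THEN conjunct2, THEN conjunct2, THEN conjunct1]
  gens_rep_def[THEN iffD1, THEN conjunct2, THEN conjunct2, THEN conjunct2, THEN conjunct2, THEN conjunct2, THEN conjunct2, THEN conjunct2, THEN conjunct2, THEN conjunct1]
  gens_rep_def[THEN iffD1, THEN conjunct2, THEN conjunct2, THEN conjunct2, THEN conjunct2, THEN conjunct2, THEN conjunct2, THEN conjunct2, THEN conjunct2, THEN conjunct2, THEN conjunct1]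
  gens_rep_def[THEN iffD1, THEN conjunct2, THEN conjunct2, THEN conjunct2, THEN conjunct2, THEN conjunct2, THEN conjunct2, THEN conjunct2, THEN conjunct2, THEN conjunct2, THEN conjunct2]

section \<open>Modules over the quotient algebra as evaluations at the generators\<close>

lemma ring_free_ring: "ring (free_ring :: 'k::field free_alg ring)"
proof (rule ringI)
  show "abelian_group (free_ring :: 'k free_alg ring)"
    by (rule abelian_groupI) (auto simp: free_ring_def ac_simps intro: exI[of _ "- _"] add.right_inverse add.left_inverse)
  show "monoid (free_ring :: 'k free_alg ring)"
    by (rule monoidI) (auto simp: free_ring_def ac_simps)
qed (auto simp: free_ring_def ring_distribs)

lemma free_ring_simps [simp]:
  "carrier free_ring = UNIV" "monoid.mult free_ring = (*)" "add free_ring = (+)"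
  "one free_ring = 1" "zero free_ring = 0"
  by (simp_all add: free_ring_def)

lemma ideal_H_ideal: "ideal (H_ideal n q) (free_ring :: 'k::field free_alg ring)"
  unfolding H_ideal_def by (rule ring.genideal_ideal[OF ring_free_ring]) simp

lemma H_relations_subset: "H_relations n q \<subseteq> H_ideal n q"
  unfolding H_ideal_def by (rule ring.genideal_self[OF ring_free_ring]) simp

lemma H_class_hom: "H_class n q \<in> Ring.ring_hom free_ring (H_alg n q)"
proof -
  have "H_class n q = (\<lambda>x. H_ideal n q +>\<^bsub>free_ring\<^esub> x)" by (rule ext) (simp add: H_class_def)
  then show ?thesis unfolding H_alg_def using ideal.rcos_ring_hom[OF ideal_H_ideal] by simp
qed

lemma H_class_carrier: "carrier (H_alg n q) = range (H_class n q)"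
  unfolding H_alg_def FactRing_def A_RCOSETS_def' H_class_def by auto

lemma H_class_eq: "H_class n q x = {h + x | h. h \<in> H_ideal n q}"
  unfolding H_class_def a_r_coset_def' by auto

lemma H_class_self: "x \<in> H_class n q x"
  using additive_subgroup.zero_closed[OF ideal.axioms(1)[OF ideal_H_ideal]]
  unfolding H_class_eq by force

lemma H_class_ideal:
  fixes x :: "'k::field free_alg"
  assumes x: "x \<in> H_ideal n q"
  shows "H_class n q x = H_class n q 0"
proof -
  have add: "h + h' \<in> H_ideal n q" if "h \<in> H_ideal n q" "h' \<in> H_ideal n q" for h h' :: "'k free_alg"
    using additive_subgroup.a_closed[OF ideal.axioms(1)[OF ideal_H_ideal[of n q]] that] by simp
  have neg: "- x \<in> H_ideal n q"
    using ideal.I_l_closed[OF ideal_H_ideal x, of "- 1"] by simp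
  show ?thesis
  proof (rule Set.set_eqI, rule iffI)
    fix y assume "y \<in> H_class n q x"
    then show "y \<in> H_class n q 0" using add x by (auto simp: H_class_eq)
  next
    fix y assume "y \<in> H_class n q 0"
    then have "y \<in> H_ideal n q" by (auto simp: H_class_eq)
    then have "y + - x \<in> H_ideal n q" using add neg by blast
    moreover have "y = (y + - x) + x" by simp
    ultimately show "y \<in> H_class n q x" unfolding H_class_eq by blast
  qed
qed

lemma ring_hom_eval_free:
  assumes "\<And>g. G g \<in> carrier_mat m m"
  shows "ring_hom_ring free_ring (ring_mat TYPE('k::field) m ()) (eval_free m G :: 'k free_alg \<Rightarrow> 'k mat)"
  by (rule ring_hom_ringI2[OF ring_free_ring ring_mat])
     (auto intro!: ring_hom_memI simp: ring_mat_simps eval_free_add eval_free_mult[OF assms] eval_free_1)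

lemma eval_free_relation:
  assumes "gens_rep n q m G" and "x \<in> H_relations n q"
  shows "eval_free m G x = 0\<^sub>m m m"
proof -
  have G: "G g \<in> carrier_mat m m" for g by (rule gens_repD(1)[OF assms(1)])
  have s: "(t \<cdot>\<^sub>m 1\<^sub>m m) * X = t \<cdot>\<^sub>m X" if "X \<in> carrier_mat m m" for t and X :: "'a mat"
    using that by (metis left_mult_one_mat mult_smult_assoc_mat one_carrier_mat)
  have ss: "t \<cdot>\<^sub>m X * Y = t \<cdot>\<^sub>m (X * Y)" if "X \<in> carrier_mat m m" "Y \<in> carrier_mat m m" for t and X Y :: "'a mat"
    using that mult_smult_assoc_mat by blast
  have r: "X + (1\<^sub>m m - Y) - X - (1\<^sub>m m - Y) = 0\<^sub>m m m" if "X \<in> carrier_mat m m" "Y \<in> carrier_mat m m" for X Y :: "'a mat"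
    using that by (intro eq_matI) auto
  show ?thesis
    using assms(2) G assms(1)
    unfolding H_relations_def Let_def gens_rep_def
    by (elim insertE emptyE)
       (simp_all add: eval_free_diff eval_free_mult eval_free_scal eval_free_gen s ss
          eval_free_1 eval_free_power r minus_r_inv_mat[of _ m m] mult_carrier_mat[OF G G]
          carrier_matD[OF G])
qed

text \<open>The kernel of an evaluation is an ideal; since it contains the relations, it contains
  the ideal they generate.\<close>

lemma eval_free_ideal:
  assumes "gens_rep n q m G" and "x \<in> H_ideal n q"
  shows "eval_free m G x = 0\<^sub>m m m"
proof -
  have G: "G g \<in> carrier_mat m m" for g by (rule gens_repD(1)[OF assms(1)])
  let ?R = "ring_mat TYPE('a) m ()"
  have K: "ideal (a_kernel free_ring ?R (eval_free m G)) free_ring"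
    by (rule ring_hom_ring.kernel_is_ideal[OF ring_hom_eval_free[OF G]])
  have "y \<in> a_kernel free_ring ?R (eval_free m G)" if "y \<in> H_relations n q" for y
    using eval_free_relation[OF assms(1) that] by (simp add: a_kernel_def' ring_mat_simps)
  then have "H_relations n q \<subseteq> a_kernel free_ring ?R (eval_free m G)" by (rule subsetI)
  then have "H_ideal n q \<subseteq> a_kernel free_ring ?R (eval_free m G)"
    unfolding H_ideal_def by (rule ring.genideal_minimal[OF ring_free_ring K])
  then have "x \<in> a_kernel free_ring ?R (eval_free m G)" using assms(2) by (rule subsetD)
  then show ?thesis by (simp add: a_kernel_def' ring_mat_simps)
qed

lemma eval_free_class:
  assumes "gens_rep n q m G" and "y \<in> H_class n q x"
  shows "eval_free m G y = eval_free m G x"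
  using assms(2) eval_free_ideal[OF assms(1)]
  by (auto simp: H_class_eq eval_free_add)

text \<open>The image of a coset is a singleton, which is what \<open>the_elem\<close> in
  \<open>hm_of_gens\<close> and \<open>hm_tensor\<close> relies on. The separate \<open>f\<close>
  accommodates the two different forms in which these definitions write the operator.\<close>

lemma the_elem_eval_free:
  assumes "gens_rep n q m G" "\<And>x. f x = eval_free m G x"
  shows "the_elem (f ` H_class n q x) = eval_free m G x"
proof -
  have "f ` H_class n q x = {eval_free m G x}"
  proof (intro Set.equalityI subsetI)
    fix z assume "z \<in> f ` H_class n q x"
    then obtain y where "y \<in> H_class n q x" "z = f y" by blast
    then show "z \<in> {eval_free m G x}" using eval_free_class[OF assms(1)] assms(2) by (metis singletonI)
  qed (use assms(2) H_class_self[of x n q] in \<open>auto simp del: assms(2) intro!: image_eqI[of _ _ x]\<close>)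
  then show ?thesis by simp
qed

lemma is_hmod_if_eval:
  assumes "gens_rep n q (hm_dim M) G" "\<And>x. hm_act M (H_class n q x) = eval_free (hm_dim M) G x"
  shows "is_hmod n q M"
proof -
  have G: "G g \<in> carrier_mat (hm_dim M) (hm_dim M)" for g by (rule gens_repD(1)[OF assms(1)])
  have H: "H_class n q \<in> Ring.ring_hom free_ring (H_alg n q)" by (rule H_class_hom)
  have "hm_act M \<in> Ring.ring_hom (H_alg n q) (ring_mat TYPE('a) (hm_dim M) ())"
  proof (rule ring_hom_memI)
    fix x y assume "x \<in> carrier (H_alg n q)" "y \<in> carrier (H_alg n q)"
    then obtain u v where uv: "x = H_class n q u" "y = H_class n q v" by (auto simp: H_class_carrier)
    have "x \<otimes>\<^bsub>H_alg n q\<^esub> y = H_class n q (u * v)" "x \<oplus>\<^bsub>H_alg n q\<^esub> y = H_class n q (u + v)"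
      using ring_hom_mult[OF H] ring_hom_add[OF H] uv by auto
    then show "hm_act M (x \<otimes>\<^bsub>H_alg n q\<^esub> y) = hm_act M x \<otimes>\<^bsub>ring_mat TYPE('a) (hm_dim M) ()\<^esub> hm_act M y"
      "hm_act M (x \<oplus>\<^bsub>H_alg n q\<^esub> y) = hm_act M x \<oplus>\<^bsub>ring_mat TYPE('a) (hm_dim M) ()\<^esub> hm_act M y"
      by (auto simp: uv assms(2) ring_mat_simps eval_free_mult[OF G] eval_free_add)
  next
    show "hm_act M \<one>\<^bsub>H_alg n q\<^esub> = \<one>\<^bsub>ring_mat TYPE('a) (hm_dim M) ()\<^esub>"
      using ring_hom_one[OF H] by (simp add: ring_mat_simps assms(2) eval_free_1 flip: ring_hom_one[OF H])
  qed (auto simp: H_class_carrier assms(2) ring_mat_simps)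
  then show ?thesis by (auto simp: is_hmod_def assms(2) eval_free_scal)
qed

definition act :: "nat \<Rightarrow> 'k::field \<Rightarrow> 'k hmod \<Rightarrow> hgen \<Rightarrow> 'k mat" where
  "act n q M g = hm_act M (H_class n q (gen g))"

lemma hmod_of_gens:
  assumes G_rep: "gens_rep n q m G"
  shows "is_hmod n q (hm_of_gens m G)" and "act n q (hm_of_gens m G) g = G g"
    and "hm_dim (hm_of_gens m G) = m"
proof -
  have G: "G g \<in> carrier_mat m m" for g by (rule gens_repD(1)[OF G_rep])
  show d: "hm_dim (hm_of_gens m G) = m" by (simp add: hm_of_gens_def)
  have e: "hm_act (hm_of_gens m G) (H_class n q x) = eval_free m G x" for x
    unfolding hm_of_gens_def
    using the_elem_eval_free[OF G_rep, of "\<lambda>x. mat_lincomb m x (\<lambda>w. foldr (*) (map G (letters w)) (1\<^sub>m m))" x]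
    by (simp add: eval_free_def word_mat_def[abs_def])
  then show "is_hmod n q (hm_of_gens m G)"
    by (intro is_hmod_if_eval[of n q _ G]) (simp_all add: d G_rep)
  show "act n q (hm_of_gens m G) g = G g"
    by (simp add: act_def e eval_free_gen[OF G])
qed

text \<open>Words are products of generators and scalars act as scalars, so a module structure
  carries no data beyond the matrices of its generators.\<close>

lemma hmod_eval:
  fixes M :: "'k::field hmod"
  assumes "is_hmod n q M"
  shows "hm_act M (H_class n q x) = eval_free (hm_dim M) (act n q M) x"
    and "act n q M g \<in> carrier_mat (hm_dim M) (hm_dim M)"
proof -
  let ?m = "hm_dim M" and ?R = "ring_mat TYPE('k) (hm_dim M) ()"
  have H: "H_class n q \<in> Ring.ring_hom free_ring (H_alg n q)" by (rule H_class_hom)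
  have M: "hm_act M \<in> Ring.ring_hom (H_alg n q) ?R"
    and sc: "hm_act M (H_class n q (scal t)) = t \<cdot>\<^sub>m 1\<^sub>m ?m" for t
    using assms by (auto simp: is_hmod_def)
  have F: "(\<lambda>x. hm_act M (H_class n q x)) \<in> Ring.ring_hom free_ring ?R"
    using ring_hom_trans[OF H M] by (simp add: o_def)
  have G: "act n q M g \<in> carrier_mat ?m ?m" for g
    using ring_hom_closed[OF F, of "gen g"] by (simp add: act_def ring_mat_simps)
  then show "act n q M g \<in> carrier_mat ?m ?m" .
  have mul: "hm_act M (H_class n q (x * y)) = hm_act M (H_class n q x) * hm_act M (H_class n q y)" for x y
    using ring_hom_mult[OF F, of x y] by (simp add: ring_mat_simps)
  have add: "hm_act M (H_class n q (x + y)) = hm_act M (H_class n q x) + hm_act M (H_class n q y)" for x y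
    using ring_hom_add[OF F, of x y] by (simp add: ring_mat_simps)
  have one: "hm_act M (H_class n q 1) = 1\<^sub>m ?m"
    using ring_hom_one[OF F] by (simp add: ring_mat_simps)
  have w: "hm_act M (H_class n q (Poly_Mapping.single (Word ls) 1)) = word_mat ?m (act n q M) (Word ls)" for ls
  proof (induction ls)
    case Nil
    then show ?case using one by (simp add: zero_word_def[symmetric])
  next
    case (Cons g ls)
    have "Poly_Mapping.single (Word (g # ls)) (1::'k) = gen g * Poly_Mapping.single (Word ls) 1"
      by (simp add: gen_def mult_single plus_word_def)
    then show ?case using Cons by (simp add: mul act_def word_mat_def)
  qed
  show "hm_act M (H_class n q x) = eval_free ?m (act n q M) x"
  proof (induction x rule: poly_mapping_single_induct)
    case (1 w t)
    have W: "word_mat ?m (act n q M) w \<in> carrier_mat ?m ?m" by (rule word_mat_carrier[OF G])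
    have "Poly_Mapping.single w t = scal t * Poly_Mapping.single w 1"
      by (simp add: scal_def mult_single)
    then have "hm_act M (H_class n q (Poly_Mapping.single w t)) = (t \<cdot>\<^sub>m 1\<^sub>m ?m) * word_mat ?m (act n q M) w"
      using w[of "letters w"] by (simp add: mul sc)
    also have "\<dots> = t \<cdot>\<^sub>m word_mat ?m (act n q M) w"
      using W by (metis left_mult_one_mat mult_smult_assoc_mat one_carrier_mat)
    finally show ?case by (simp add: eval_free_def mat_lincomb_single W)
  qed (simp add: add eval_free_add)
qed

lemma H_relations_mem:
  shows "gen Gen_b * gen Gen_a - scal q * gen Gen_a * gen Gen_b \<in> H_relations n q"
    and "gen Gen_d * gen Gen_b - scal q * gen Gen_b * gen Gen_d \<in> H_relations n q"
    and "gen Gen_c * gen Gen_a - scal q * gen Gen_a * gen Gen_c \<in> H_relations n q"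
    and "gen Gen_d * gen Gen_c - scal q * gen Gen_c * gen Gen_d \<in> H_relations n q"
    and "gen Gen_b * gen Gen_c - gen Gen_c * gen Gen_b \<in> H_relations n q"
    and "gen Gen_a ^ n \<in> H_relations n q"
    and "gen Gen_b ^ n - 1 \<in> H_relations n q"
    and "gen Gen_c ^ n - 1 \<in> H_relations n q"
    and "gen Gen_d ^ n \<in> H_relations n q"
    and "(gen Gen_d * gen Gen_a - scal q * gen Gen_a * gen Gen_d) - (1 - gen Gen_b * gen Gen_c) \<in> H_relations n q"
  unfolding H_relations_def Let_def by (rule insertI1 | rule insertI2)+

text \<open>A relation lies in the ideal, so its coset is that of 0 and it evaluates to the zero
  matrix; the equations follow by moving terms across.\<close>

lemma hmod_gens_rep:
  fixes M :: "'k::field hmod"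
  assumes "is_hmod n q M"
  shows "gens_rep n q (hm_dim M) (act n q M)"
proof -
  let ?m = "hm_dim M" and ?G = "act n q M"
  have G: "?G g \<in> carrier_mat ?m ?m" for g by (rule hmod_eval(2)[OF assms])
  have z: "eval_free ?m ?G x = 0\<^sub>m ?m ?m" if "x \<in> H_relations n q" for x
  proof -
    have x: "x \<in> H_ideal n q" using that H_relations_subset by auto
    have "H_class n q x = H_class n q 0" by (rule H_class_ideal[OF x])
    then have "eval_free ?m ?G x = eval_free ?m ?G 0" using hmod_eval(1)[OF assms] by metis
    then show ?thesis by simp
  qed
  have s: "(t \<cdot>\<^sub>m 1\<^sub>m ?m) * X = t \<cdot>\<^sub>m X" if "X \<in> carrier_mat ?m ?m" for t and X :: "'k mat"
    using that by (metis left_mult_one_mat mult_smult_assoc_mat one_carrier_mat)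
  have ss: "t \<cdot>\<^sub>m X * Y = t \<cdot>\<^sub>m (X * Y)" if "X \<in> carrier_mat ?m ?m" "Y \<in> carrier_mat ?m ?m" for t and X Y :: "'k mat"
    using that mult_smult_assoc_mat by blast
  have d: "X = Y" if "X - Y = 0\<^sub>m ?m ?m" "X \<in> carrier_mat ?m ?m" "Y \<in> carrier_mat ?m ?m" for X Y :: "'k mat"
  proof (intro eq_matI)
    fix i j assume "i < dim_row Y" "j < dim_col Y"
    then have ij: "i < ?m" "j < ?m" using that(3) by auto
    then have "X $$ (i,j) - Y $$ (i,j) = (X - Y) $$ (i,j)" using that(2,3) by auto
    also have "\<dots> = 0" unfolding that(1) using ij by simp
    finally show "X $$ (i,j) = Y $$ (i,j)" by simp
  qed (use that in auto)
  have d2: "X = Y + Z" if "X - Y - Z = 0\<^sub>m ?m ?m" "X \<in> carrier_mat ?m ?m" "Y \<in> carrier_mat ?m ?m" "Z \<in> carrier_mat ?m ?m" for X Y Z :: "'k mat"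
  proof (intro eq_matI)
    fix i j assume "i < dim_row (Y + Z)" "j < dim_col (Y + Z)"
    then have ij: "i < ?m" "j < ?m" using that(3,4) by auto
    then have "X $$ (i,j) - Y $$ (i,j) - Z $$ (i,j) = (X - Y - Z) $$ (i,j)" using that(2-4) by auto
    also have "\<dots> = 0" unfolding that(1) using ij by simp
    finally show "X $$ (i,j) = (Y + Z) $$ (i,j)" using ij that(2-4) by (simp add: algebra_simps)
  qed (use that in auto)
  note ev = eval_free_diff eval_free_mult[OF G] eval_free_scal eval_free_gen[OF G] eval_free_1 eval_free_power[OF G] s[OF G] ss[OF G G]
  have C: "?G g * ?G g' \<in> carrier_mat ?m ?m" for g g' by (rule mult_carrier_mat[OF G G])
  show ?thesis
    unfolding gens_rep_def
    apply (intro conjI allI G)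
    subgoal by (rule d) (use z[OF H_relations_mem(1)] C G in \<open>simp_all add: ev pow_carrier_mat minus_carrier_mat\<close>)
    subgoal by (rule d) (use z[OF H_relations_mem(2)] C G in \<open>simp_all add: ev pow_carrier_mat minus_carrier_mat\<close>)
    subgoal by (rule d) (use z[OF H_relations_mem(3)] C G in \<open>simp_all add: ev pow_carrier_mat minus_carrier_mat\<close>)
    subgoal by (rule d) (use z[OF H_relations_mem(4)] C G in \<open>simp_all add: ev pow_carrier_mat minus_carrier_mat\<close>)
    subgoal by (rule d) (use z[OF H_relations_mem(5)] C G in \<open>simp_all add: ev pow_carrier_mat minus_carrier_mat\<close>)
    subgoal using z[OF H_relations_mem(6)] by (simp add: ev)
    subgoal by (rule d) (use z[OF H_relations_mem(7)] C G in \<open>simp_all add: ev pow_carrier_mat minus_carrier_mat\<close>)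
    subgoal by (rule d) (use z[OF H_relations_mem(8)] C G in \<open>simp_all add: ev pow_carrier_mat minus_carrier_mat\<close>)
    subgoal using z[OF H_relations_mem(9)] by (simp add: ev)
    subgoal by (rule d2) (use z[OF H_relations_mem(10)] C G in \<open>simp_all add: ev pow_carrier_mat minus_carrier_mat\<close>)
    done
qed

text \<open>Commutation with the generators passes to words by associativity and to all elements by
  linearity.\<close>

lemma hom_iff:
  assumes M: "is_hmod n q M" and N: "is_hmod n q N"
  shows "X \<in> hm_hom n q M N \<longleftrightarrow> X \<in> carrier_mat (hm_dim N) (hm_dim M) \<and>
    (\<forall>g. X * act n q M g = act n q N g * X)"
proof
  assume "X \<in> hm_hom n q M N"
  then show "X \<in> carrier_mat (hm_dim N) (hm_dim M) \<and> (\<forall>g. X * act n q M g = act n q N g * X)"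
    unfolding hm_hom_def by (auto simp: act_def H_class_carrier)
next
  assume a: "X \<in> carrier_mat (hm_dim N) (hm_dim M) \<and> (\<forall>g. X * act n q M g = act n q N g * X)"
  let ?m = "hm_dim M" and ?k = "hm_dim N"
  have X: "X \<in> carrier_mat ?k ?m" and c: "X * act n q M g = act n q N g * X" for g using a by auto
  have G: "act n q M g \<in> carrier_mat ?m ?m" and G': "act n q N g \<in> carrier_mat ?k ?k" for g
    by (rule hmod_eval(2)[OF M], rule hmod_eval(2)[OF N])
  have w: "X * word_mat ?m (act n q M) (Word ls) = word_mat ?k (act n q N) (Word ls) * X" for ls
  proof (induction ls)
    case Nil
    then show ?case using X by simp
  next
    case (Cons g ls)
    let ?W = "word_mat ?m (act n q M) (Word ls)" and ?W' = "word_mat ?k (act n q N) (Word ls)"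
    have W: "?W \<in> carrier_mat ?m ?m" "?W' \<in> carrier_mat ?k ?k"
      by (rule word_mat_carrier[OF G], rule word_mat_carrier[OF G'])
    have "X * (act n q M g * ?W) = (X * act n q M g) * ?W"
      by (rule assoc_mult_mat[OF X G W(1), symmetric])
    also have "\<dots> = act n q N g * (X * ?W)"
      unfolding c by (rule assoc_mult_mat[OF G' X W(1)])
    also have "\<dots> = act n q N g * ?W' * X"
      unfolding Cons by (rule assoc_mult_mat[OF G' W(2) X, symmetric])
    finally show ?case by (simp add: word_mat_def)
  qed
  have "X * eval_free ?m (act n q M) x = eval_free ?k (act n q N) x * X" for x
  proof (induction x rule: poly_mapping_single_induct)
    case (1 u t)
    have W: "word_mat ?m (act n q M) u \<in> carrier_mat ?m ?m" "word_mat ?k (act n q N) u \<in> carrier_mat ?k ?k"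
      by (rule word_mat_carrier[OF G], rule word_mat_carrier[OF G'])
    show ?case
      using w[of "letters u"] mult_smult_distrib[OF X W(1)] mult_smult_assoc_mat[OF W(2) X]
      by (simp add: eval_free_def mat_lincomb_single W)
  next
    case (2 x y)
    then show ?case
      by (simp add: eval_free_add mult_add_distrib_mat[OF X eval_free_carrier eval_free_carrier]
        add_mult_distrib_mat[OF eval_free_carrier eval_free_carrier X])
  qed
  then show "X \<in> hm_hom n q M N"
    unfolding hm_hom_def using X by (auto simp: H_class_carrier hmod_eval(1)[OF M] hmod_eval(1)[OF N])
qed

section \<open>Kronecker products\<close>

text \<open>The index arithmetic behind the convention that the basis tensor with factors i and j
  has index i * e + j. For e = 0 both sides vanish.\<close>

lemma sum_div_mod:
  fixes f :: "nat \<Rightarrow> nat \<Rightarrow> 'b::comm_monoid_add"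
  shows "(\<Sum>k = 0..<b * e. f (k div e) (k mod e)) = (\<Sum>i = 0..<b. \<Sum>j = 0..<e. f i j)"
proof (cases "e = 0")
  case False
  have "(\<Sum>k = 0..<b * e. f (k div e) (k mod e)) = (\<Sum>(i, j)\<in>{0..<b} \<times> {0..<e}. f i j)"
  proof (rule sum.reindex_bij_witness[of _ "\<lambda>(i, j). i * e + j" "\<lambda>k. (k div e, k mod e)"])
    fix p assume "p \<in> {0..<b} \<times> {0..<e}"
    then obtain i j where p: "p = (i, j)" "i < b" "j < e" by auto
    have "i * e + j < (i + 1) * e" using p by simp
    also have "\<dots> \<le> b * e" using p by (intro mult_le_mono1) auto
    finally show "(case p of (i, j) \<Rightarrow> i * e + j) \<in> {0..<b * e}" using p by simp
    show "((case p of (i, j) \<Rightarrow> i * e + j) div e, (case p of (i, j) \<Rightarrow> i * e + j) mod e) = p"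
      using p by simp
  qed (use False in \<open>auto simp: less_mult_imp_div_less\<close>)
  then show ?thesis by (simp add: sum.cartesian_product)
qed simp

lemma kron_mat_dim [simp]:
  "dim_row (kron_mat A B) = dim_row A * dim_row B" "dim_col (kron_mat A B) = dim_col A * dim_col B"
  by (simp_all add: kron_mat_def)

lemma kron_mat_carrier:
  "A \<in> carrier_mat a b \<Longrightarrow> B \<in> carrier_mat c d \<Longrightarrow> kron_mat A B \<in> carrier_mat (a * c) (b * d)"
  by (auto intro!: carrier_matI)

lemma kron_mat_index:
  "i < dim_row A * dim_row B \<Longrightarrow> j < dim_col A * dim_col B \<Longrightarrow>
   kron_mat A B $$ (i, j) = A $$ (i div dim_row B, j div dim_col B) * B $$ (i mod dim_row B, j mod dim_col B)"
  by (simp add: kron_mat_def)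

lemma div_mod_less:
  assumes "(i::nat) < a * b" shows "i div b < a" "i mod b < b"
proof -
  have "0 < b" using assms by (cases b) auto
  then show "i div b < a" "i mod b < b" using assms by (auto simp: less_mult_imp_div_less)
qed

lemma kron_mat_mult:
  fixes A B :: "'k::field mat"
  assumes A: "A \<in> carrier_mat a b" and B: "B \<in> carrier_mat d e"
    and C: "C \<in> carrier_mat b c" and D: "D \<in> carrier_mat e f"
  shows "kron_mat A B * kron_mat C D = kron_mat (A * C) (B * D)"
proof (rule eq_matI)
  fix i j assume "i < dim_row (kron_mat (A * C) (B * D))" "j < dim_col (kron_mat (A * C) (B * D))"
  then have i: "i < a * d" and j: "j < c * f" using A B C D by auto
  note ij = div_mod_less[OF i] div_mod_less[OF j]
  have "(kron_mat A B * kron_mat C D) $$ (i, j)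
      = (\<Sum>k = 0..<b * e. kron_mat A B $$ (i, k) * kron_mat C D $$ (k, j))"
    using i j A B C D by (simp add: scalar_prod_def)
  also have "\<dots> = (\<Sum>k = 0..<b * e. (A $$ (i div d, k div e) * C $$ (k div e, j div f)) *
      (B $$ (i mod d, k mod e) * D $$ (k mod e, j mod f)))"
    using i j A B C D by (intro sum.cong refl) (simp add: kron_mat_index algebra_simps)
  also have "\<dots> = (\<Sum>x = 0..<b. \<Sum>y = 0..<e. (A $$ (i div d, x) * C $$ (x, j div f)) *
      (B $$ (i mod d, y) * D $$ (y, j mod f)))"
    by (rule sum_div_mod)
  also have "\<dots> = (\<Sum>x = 0..<b. A $$ (i div d, x) * C $$ (x, j div f)) *
      (\<Sum>y = 0..<e. B $$ (i mod d, y) * D $$ (y, j mod f))"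
    by (simp add: sum_product)
  also have "\<dots> = kron_mat (A * C) (B * D) $$ (i, j)"
    using i j ij A B C D by (simp add: kron_mat_index scalar_prod_def)
  finally show "(kron_mat A B * kron_mat C D) $$ (i, j) = kron_mat (A * C) (B * D) $$ (i, j)" .
qed (use A B C D in auto)

lemma kron_mat_smult:
  fixes A B :: "'k::field mat"
  shows "kron_mat (t \<cdot>\<^sub>m A) B = t \<cdot>\<^sub>m kron_mat A B" "kron_mat A (t \<cdot>\<^sub>m B) = t \<cdot>\<^sub>m kron_mat A B"
  by (auto intro!: eq_matI simp: kron_mat_index div_mod_less ac_simps)

lemma kron_mat_zero:
  fixes A B :: "'k::field mat"
  shows "kron_mat (0\<^sub>m a b) B = 0\<^sub>m (a * dim_row B) (b * dim_col B)"
    and "kron_mat A (0\<^sub>m a b) = 0\<^sub>m (dim_row A * a) (dim_col A * b)"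
  by (auto intro!: eq_matI simp: kron_mat_index div_mod_less)

lemma kron_mat_one: "kron_mat (1\<^sub>m a) (1\<^sub>m b) = (1\<^sub>m (a * b) :: 'k::field mat)"
proof (rule eq_matI)
  fix i j assume "i < dim_row (1\<^sub>m (a * b) :: 'k mat)" "j < dim_col (1\<^sub>m (a * b) :: 'k mat)"
  then have i: "i < a * b" and j: "j < a * b" by auto
  have "i = j \<longleftrightarrow> i div b = j div b \<and> i mod b = j mod b" by (metis div_mult_mod_eq)
  then show "kron_mat (1\<^sub>m a) (1\<^sub>m b) $$ (i, j) = (1\<^sub>m (a * b) :: 'k mat) $$ (i, j)"
    using i j div_mod_less[OF i] div_mod_less[OF j] by (simp add: kron_mat_index)
qed auto

lemma kron_mat_add_right:
  fixes A B C :: "'k::field mat"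
  assumes "B \<in> carrier_mat c d" "C \<in> carrier_mat c d"
  shows "kron_mat A (B + C) = kron_mat A B + kron_mat A C"
  using assms by (auto intro!: eq_matI simp: kron_mat_index div_mod_less algebra_simps)

lemma kron_mat_diff_right:
  fixes A B C :: "'k::field mat"
  assumes "B \<in> carrier_mat c d" "C \<in> carrier_mat c d"
  shows "kron_mat A (B - C) = kron_mat A B - kron_mat A C"
  using assms by (auto intro!: eq_matI simp: kron_mat_index div_mod_less algebra_simps)

lemma kron_mat_uminus_right:
  fixes A B :: "'k::field mat"
  shows "kron_mat A (- B) = - kron_mat A B"
  by (auto intro!: eq_matI simp: kron_mat_index div_mod_less)

lemma kron_mat_pow:
  fixes A B :: "'k::field mat"
  assumes "A \<in> carrier_mat a a" "B \<in> carrier_mat b b"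
  shows "kron_mat A B ^\<^sub>m k = kron_mat (A ^\<^sub>m k) (B ^\<^sub>m k)"
proof (induction k)
  case 0
  then show ?case using assms by (simp add: kron_mat_one)
next
  case (Suc k)
  then show ?case using kron_mat_mult[of "A ^\<^sub>m k" a a "B ^\<^sub>m k" b b A a B b] assms
    by (simp add: pow_carrier_mat)
qed

section \<open>Powers of sums of $q$-commuting matrices\<close>

text \<open>Gaussian binomials. Of the two q-Pascal rules this is the one produced by carrying
  \<open>Y\<close> to the left across powers of \<open>X\<close> when \<open>X * Y\<close> is q
  times \<open>Y * X\<close>.\<close>

fun q_binom :: "'k::field \<Rightarrow> nat \<Rightarrow> nat \<Rightarrow> 'k" where
  "q_binom q 0 0 = 1"
| "q_binom q 0 (Suc i) = 0"
| "q_binom q (Suc k) 0 = q_binom q k 0"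
| "q_binom q (Suc k) (Suc i) = q_binom q k (Suc i) + q ^ (k - i) * q_binom q k i"

lemma q_binom_0 [simp]: "q_binom q k 0 = 1"
  by (induction k) auto

lemma q_binom_gt: "k < i \<Longrightarrow> q_binom q k i = 0"
proof (induction k arbitrary: i)
  case 0
  then show ?case by (cases i) auto
next
  case (Suc k)
  then show ?case by (cases i) auto
qed

lemma q_binom_self [simp]: "q_binom q k k = 1"
  by (induction k) (auto simp: q_binom_gt)

text \<open>The ratio of binomials in consecutive rows, derived from the ratio of neighbours within
  one row. It is separate because it is used inside the induction for \<open>q_binom_step\<close>
  and again after it.\<close>

lemma q_binom_absorb:
  assumes I1: "\<And>j. j \<le> k \<Longrightarrow> (1 - q ^ Suc j) * q_binom q k (Suc j) = (1 - q ^ (k - j)) * q_binom q k j"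
    and "i \<le> k"
  shows "(1 - q ^ Suc k) * q_binom q k i = (1 - q ^ (Suc k - i)) * q_binom q (Suc k) i"
proof (cases i)
  case (Suc j)
  then have j: "Suc j \<le> k" using assms(2) by simp
  have e: "q ^ (k - j) * q ^ Suc j = q ^ Suc k" using j by (simp flip: power_add)
  have "(1 - q ^ (k - j)) * q_binom q (Suc k) (Suc j)
     = (1 - q ^ (k - j)) * q_binom q k (Suc j) + q ^ (k - j) * ((1 - q ^ (k - j)) * q_binom q k j)"
    by (simp add: algebra_simps)
  also have "(1 - q ^ (k - j)) * q_binom q k j = (1 - q ^ Suc j) * q_binom q k (Suc j)"
    using I1[of j] j by simp
  also have "(1 - q ^ (k - j)) * q_binom q k (Suc j) + q ^ (k - j) * ((1 - q ^ Suc j) * q_binom q k (Suc j))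
     = (1 - q ^ (k - j) * q ^ Suc j) * q_binom q k (Suc j)"
    by (simp only: algebra_simps mult_1_left mult_1_right)
  finally show ?thesis using Suc by (simp only: e diff_Suc_Suc)
qed simp

lemma q_binom_step:
  "i \<le> k \<Longrightarrow> (1 - q ^ Suc i) * q_binom q k (Suc i) = (1 - q ^ (k - i)) * q_binom q k i"
proof (induction k arbitrary: i)
  case 0
  then show ?case by simp
next
  case (Suc k)
  show ?case
  proof (cases "i = Suc k")
    case True
    then show ?thesis by (simp add: q_binom_gt)
  next
    case False
    then have i: "i \<le> k" using Suc.prems by simp
    have e: "q ^ (k - i) * q ^ Suc i = q ^ Suc k" using i by (simp flip: power_add)
    have "(1 - q ^ Suc i) * q_binom q (Suc k) (Suc i)
      = (1 - q ^ Suc i) * q_binom q k (Suc i) + q ^ (k - i) * (1 - q ^ Suc i) * q_binom q k i"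
      by (simp add: algebra_simps)
    also have "\<dots> = (1 - q ^ (k - i)) * q_binom q k i + q ^ (k - i) * (1 - q ^ Suc i) * q_binom q k i"
      using Suc.IH[OF i] by simp
    also have "\<dots> = (1 - q ^ (k - i) * q ^ Suc i) * q_binom q k i" by (simp only: algebra_simps mult_1_left mult_1_right)
    also have "\<dots> = (1 - q ^ Suc k) * q_binom q k i" by (simp only: e)
    also have "\<dots> = (1 - q ^ (Suc k - i)) * q_binom q (Suc k) i"
      by (rule q_binom_absorb[OF Suc.IH i])
    finally show ?thesis .
  qed
qed

text \<open>In the absorption identity for row n the factor 1 - q^n vanishes, while 1 - q^(n - i)
  does not.\<close>

lemma q_binom_root:
  assumes "primitive_root_of_unity n q" "0 < i" "i < n"
  shows "q_binom q n i = 0"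
proof -
  obtain k where k: "n = Suc k" using assms by (cases n) auto
  have "(1 - q ^ Suc k) * q_binom q k i = (1 - q ^ (Suc k - i)) * q_binom q (Suc k) i"
    by (rule q_binom_absorb[OF q_binom_step]) (use assms k in auto)
  moreover have "q ^ Suc k = 1" "q ^ (Suc k - i) \<noteq> 1"
    using assms k by (auto simp: primitive_root_of_unity_def simp del: power_Suc)
  ultimately show ?thesis using k by simp
qed

lemma smult_smult_mat:
  fixes A :: "'k::field mat"
  shows "s \<cdot>\<^sub>m (t \<cdot>\<^sub>m A) = (s * t) \<cdot>\<^sub>m A"
  by (auto intro!: eq_matI)

lemma pow_mat_Suc_left:
  fixes A :: "'k::field mat"
  assumes "A \<in> carrier_mat m m"
  shows "A ^\<^sub>m Suc k = A * A ^\<^sub>m k"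
proof (induction k)
  case (Suc k)
  have "A ^\<^sub>m Suc (Suc k) = (A * A ^\<^sub>m k) * A" using Suc by simp
  also have "\<dots> = A * A ^\<^sub>m Suc k"
    using assoc_mult_mat[of A m m "A ^\<^sub>m k" m A m] assms by (simp add: pow_carrier_mat)
  finally show ?case .
qed (use assms in simp)

lemma pow_mat_q_commute:
  fixes X Y :: "'k::field mat"
  assumes X: "X \<in> carrier_mat m m" and Y: "Y \<in> carrier_mat m m" and c: "X * Y = q \<cdot>\<^sub>m (Y * X)"
  shows "X ^\<^sub>m k * Y = q ^ k \<cdot>\<^sub>m (Y * X ^\<^sub>m k)"
proof (induction k)
  case 0
  then show ?case using X Y by (auto intro!: eq_matI)
next
  case (Suc k)
  have P: "X ^\<^sub>m k \<in> carrier_mat m m" using X by (simp add: pow_carrier_mat)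
  have "X ^\<^sub>m Suc k * Y = X ^\<^sub>m k * (X * Y)" using assoc_mult_mat[OF P X Y] by simp
  also have "\<dots> = q \<cdot>\<^sub>m (X ^\<^sub>m k * (Y * X))"
    unfolding c by (rule mult_smult_distrib[OF P]) (use X Y in auto)
  also have "X ^\<^sub>m k * (Y * X) = (q ^ k \<cdot>\<^sub>m (Y * X ^\<^sub>m k)) * X"
    using assoc_mult_mat[OF P Y X] Suc by simp
  also have "\<dots> = q ^ k \<cdot>\<^sub>m (Y * X ^\<^sub>m k * X)" by (rule mult_smult_assoc_mat) (use P X Y in auto)
  also have "Y * X ^\<^sub>m k * X = Y * X ^\<^sub>m Suc k" using assoc_mult_mat[OF Y P X] by simp
  finally show ?case by (simp add: smult_smult_mat del: pow_mat.simps)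
qed

text \<open>Entrywise, so that the right side is a sum in the field. The trailing factor
  \<open>Z\<close> makes the induction work: one factor \<open>X + Y\<close> is split off on the
  right and absorbed, and the hypothesis is applied to \<open>X * Z\<close> and
  \<open>Y * Z\<close>.\<close>

lemma q_binomial_mat:
  fixes X Y :: "'k::field mat"
  assumes X: "X \<in> carrier_mat m m" and Y: "Y \<in> carrier_mat m m" and c: "X * Y = q \<cdot>\<^sub>m (Y * X)"
    and ab: "a < m" "b < m"
  shows "Z \<in> carrier_mat m m \<Longrightarrow> ((X + Y) ^\<^sub>m k * Z) $$ (a, b) =
    (\<Sum>i\<le>k. q_binom q k i * (Y ^\<^sub>m i * (X ^\<^sub>m (k - i) * Z)) $$ (a, b))"
proof (induction k arbitrary: Z)
  case 0
  then show ?case using X Y by simp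
next
  case (Suc k)
  have Z: "Z \<in> carrier_mat m m" by fact
  have px: "X ^\<^sub>m j \<in> carrier_mat m m" and py: "Y ^\<^sub>m j \<in> carrier_mat m m" for j
    using X Y by (simp_all add: pow_carrier_mat)
  let ?t = "\<lambda>i j. (Y ^\<^sub>m i * (X ^\<^sub>m j * Z)) $$ (a, b)"
  have S: "X + Y \<in> carrier_mat m m" using X Y by simp
  have "(X + Y) ^\<^sub>m Suc k * Z = (X + Y) ^\<^sub>m k * (X * Z + Y * Z)"
    using assoc_mult_mat[OF pow_carrier_mat[OF S, of k] S Z] add_mult_distrib_mat[OF X Y Z] by simp
  also have "\<dots> = (X + Y) ^\<^sub>m k * (X * Z) + (X + Y) ^\<^sub>m k * (Y * Z)"
    by (rule mult_add_distrib_mat[OF pow_carrier_mat[OF S]]) (use X Y Z in auto)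
  finally have "((X + Y) ^\<^sub>m Suc k * Z) $$ (a, b) =
      ((X + Y) ^\<^sub>m k * (X * Z)) $$ (a, b) + ((X + Y) ^\<^sub>m k * (Y * Z)) $$ (a, b)"
    using ab X Y Z by simp
  also have "((X + Y) ^\<^sub>m k * (X * Z)) $$ (a, b) = (\<Sum>i\<le>k. q_binom q k i * ?t i (Suc k - i))"
  proof (subst Suc.IH)
    show "X * Z \<in> carrier_mat m m" using X Z by simp
    have "X ^\<^sub>m (k - i) * (X * Z) = X ^\<^sub>m (Suc k - i) * Z" if "i \<le> k" for i
      using assoc_mult_mat[OF px[of "k - i"] X Z] that by (simp add: Suc_diff_le)
    then show "(\<Sum>i\<le>k. q_binom q k i * (Y ^\<^sub>m i * (X ^\<^sub>m (k - i) * (X * Z))) $$ (a, b)) =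
      (\<Sum>i\<le>k. q_binom q k i * ?t i (Suc k - i))" by (intro sum.cong) auto
  qed
  also have "((X + Y) ^\<^sub>m k * (Y * Z)) $$ (a, b) = (\<Sum>i\<le>k. q ^ (k - i) * q_binom q k i * ?t (Suc i) (k - i))"
  proof (subst Suc.IH)
    show YZ: "Y * Z \<in> carrier_mat m m" using Y Z by simp
    \<comment> \<open>Carrying \<open>Y\<close> to the left across the j-th power of
      \<open>X\<close> costs q^j, the weight in the recursion of \<open>q_binom\<close>.\<close>
    have "(Y ^\<^sub>m i * (X ^\<^sub>m j * (Y * Z))) = q ^ j \<cdot>\<^sub>m (Y ^\<^sub>m Suc i * (X ^\<^sub>m j * Z))" for i j
    proof -
      have XZ: "X ^\<^sub>m j * Z \<in> carrier_mat m m" by (rule mult_carrier_mat[OF px Z])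
      have "X ^\<^sub>m j * (Y * Z) = (q ^ j \<cdot>\<^sub>m (Y * X ^\<^sub>m j)) * Z"
        using assoc_mult_mat[OF px[of j] Y Z] pow_mat_q_commute[OF X Y c] by simp
      also have "\<dots> = q ^ j \<cdot>\<^sub>m (Y * X ^\<^sub>m j * Z)"
        by (rule mult_smult_assoc_mat[of _ m m]) (use Y px Z in auto)
      also have "Y * X ^\<^sub>m j * Z = Y * (X ^\<^sub>m j * Z)" by (rule assoc_mult_mat[OF Y px Z])
      finally have "Y ^\<^sub>m i * (X ^\<^sub>m j * (Y * Z)) = Y ^\<^sub>m i * (q ^ j \<cdot>\<^sub>m (Y * (X ^\<^sub>m j * Z)))" by simp
      also have "\<dots> = q ^ j \<cdot>\<^sub>m (Y ^\<^sub>m i * (Y * (X ^\<^sub>m j * Z)))"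
        by (rule mult_smult_distrib[OF py]) (use Y XZ in auto)
      also have "Y ^\<^sub>m i * (Y * (X ^\<^sub>m j * Z)) = Y ^\<^sub>m Suc i * (X ^\<^sub>m j * Z)"
        using assoc_mult_mat[OF py[of i] Y XZ] by simp
      finally show ?thesis .
    qed
    moreover have "dim_row (Y ^\<^sub>m Suc i * (X ^\<^sub>m j * Z)) = m" "dim_col (Y ^\<^sub>m Suc i * (X ^\<^sub>m j * Z)) = m" for i j
      using Y Z by simp_all
    ultimately show "(\<Sum>i\<le>k. q_binom q k i * (Y ^\<^sub>m i * (X ^\<^sub>m (k - i) * (Y * Z))) $$ (a, b)) =
      (\<Sum>i\<le>k. q ^ (k - i) * q_binom q k i * ?t (Suc i) (k - i))"
      using ab by (intro sum.cong) (auto simp del: pow_mat.simps)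
  qed
  also have "(\<Sum>i\<le>k. q_binom q k i * ?t i (Suc k - i)) = (\<Sum>i\<le>Suc k. q_binom q k i * ?t i (Suc k - i))"
    by (simp add: q_binom_gt)
  also have "\<dots> = ?t 0 (Suc k) + (\<Sum>i\<le>k. q_binom q k (Suc i) * ?t (Suc i) (k - i))"
    by (subst sum.atMost_Suc_shift) (simp del: pow_mat.simps)
  also have "?t 0 (Suc k) + (\<Sum>i\<le>k. q_binom q k (Suc i) * ?t (Suc i) (k - i)) +
      (\<Sum>i\<le>k. q ^ (k - i) * q_binom q k i * ?t (Suc i) (k - i)) =
      (\<Sum>i\<le>Suc k. q_binom q (Suc k) i * ?t i (Suc k - i))"
    by (subst sum.atMost_Suc_shift) (simp add: sum.distrib algebra_simps del: pow_mat.simps)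
  finally show ?case .
qed

text \<open>All middle Gaussian binomials vanish at a primitive n-th root of unity. This is why the
  n-th powers of \<open>a\<close> and \<open>d\<close> remain zero on tensor products.\<close>

lemma pow_q_commuting_sum:
  fixes X Y :: "'k::field mat"
  assumes q: "primitive_root_of_unity n q"
    and X: "X \<in> carrier_mat m m" and Y: "Y \<in> carrier_mat m m" and c: "X * Y = q \<cdot>\<^sub>m (Y * X)"
  shows "(X + Y) ^\<^sub>m n = X ^\<^sub>m n + Y ^\<^sub>m n"
proof (rule eq_matI)
  fix a b assume "a < dim_row (X ^\<^sub>m n + Y ^\<^sub>m n)" "b < dim_col (X ^\<^sub>m n + Y ^\<^sub>m n)"
  then have ab: "a < m" "b < m" using pow_carrier_mat[OF Y, of n] by auto
  have n: "n \<noteq> 0" using q by (simp add: primitive_root_of_unity_def)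
  have pn: "A ^\<^sub>m n * 1\<^sub>m m = A ^\<^sub>m n" "1\<^sub>m m * A ^\<^sub>m n = A ^\<^sub>m n" if "A \<in> carrier_mat m m" for A :: "'k mat"
    by (rule right_mult_one_mat[OF pow_carrier_mat[OF that]], rule left_mult_one_mat[OF pow_carrier_mat[OF that]])
  have "((X + Y) ^\<^sub>m n) $$ (a, b) = ((X + Y) ^\<^sub>m n * 1\<^sub>m m) $$ (a, b)" using X Y pn by simp
  also have "\<dots> = (\<Sum>i\<le>n. q_binom q n i * (Y ^\<^sub>m i * (X ^\<^sub>m (n - i) * 1\<^sub>m m)) $$ (a, b))"
    by (rule q_binomial_mat[OF X Y c ab]) simp
  also have "\<dots> = (\<Sum>i\<in>{0, n}. q_binom q n i * (Y ^\<^sub>m i * (X ^\<^sub>m (n - i) * 1\<^sub>m m)) $$ (a, b))"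
    using q_binom_root[OF q] by (intro sum.mono_neutral_right) auto
  also have "\<dots> = (X ^\<^sub>m n) $$ (a, b) + (Y ^\<^sub>m n) $$ (a, b)"
    using n X Y pn by simp
  also have "\<dots> = (X ^\<^sub>m n + Y ^\<^sub>m n) $$ (a, b)"
    using ab Y by simp
  finally show "((X + Y) ^\<^sub>m n) $$ (a, b) = (X ^\<^sub>m n + Y ^\<^sub>m n) $$ (a, b)" .
next
  have "X + Y \<in> carrier_mat m m" using X Y by simp
  note d = pow_carrier_mat[OF this, of n] pow_carrier_mat[OF Y, of n]
  show "dim_row ((X + Y) ^\<^sub>m n) = dim_row (X ^\<^sub>m n + Y ^\<^sub>m n)"
    "dim_col ((X + Y) ^\<^sub>m n) = dim_col (X ^\<^sub>m n + Y ^\<^sub>m n)"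
    using carrier_matD[OF d(1)] carrier_matD[OF d(2)] by auto
qed

section \<open>Tensor products and duals\<close>

lemma gens_repI:
  assumes "\<And>g. G g \<in> carrier_mat m m"
    and "G Gen_b * G Gen_a = q \<cdot>\<^sub>m (G Gen_a * G Gen_b)"
    and "G Gen_d * G Gen_b = q \<cdot>\<^sub>m (G Gen_b * G Gen_d)"
    and "G Gen_c * G Gen_a = q \<cdot>\<^sub>m (G Gen_a * G Gen_c)"
    and "G Gen_d * G Gen_c = q \<cdot>\<^sub>m (G Gen_c * G Gen_d)"
    and "G Gen_b * G Gen_c = G Gen_c * G Gen_b"
    and "G Gen_a ^\<^sub>m n = 0\<^sub>m m m" and "G Gen_b ^\<^sub>m n = 1\<^sub>m m"
    and "G Gen_c ^\<^sub>m n = 1\<^sub>m m" and "G Gen_d ^\<^sub>m n = 0\<^sub>m m m"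
    and "G Gen_d * G Gen_a = q \<cdot>\<^sub>m (G Gen_a * G Gen_d) + (1\<^sub>m m - G Gen_b * G Gen_c)"
  shows "gens_rep n q m G"
  unfolding gens_rep_def by (intro conjI allI assms)

lemmas sq_mat_simps =
  assoc_mult_mat[of _ m m _ m _ m]
  add_mult_distrib_mat[of _ m m _ _ m] mult_add_distrib_mat[of _ m m _ m]
  minus_mult_distrib_mat[of _ m m _ _ m] mult_minus_distrib_mat[of _ m m _ m]
  mult_smult_distrib[of _ m m _ m] mult_smult_assoc_mat[of _ m m _ m]
  mult_carrier_mat[of _ m m _ m] add_carrier_mat[of _ m m] minus_carrier_mat[of _ m m]
  left_mult_one_mat[of _ m m] right_mult_one_mat[of _ m m]
  for m

fun tensor_gens :: "nat \<Rightarrow> (hgen \<Rightarrow> 'k::field mat) \<Rightarrow> (hgen \<Rightarrow> 'k mat) \<Rightarrow> hgen \<Rightarrow> 'k mat" where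
  "tensor_gens m G H Gen_a = kron_mat (G Gen_a) (H Gen_b) + kron_mat (1\<^sub>m m) (H Gen_a)"
| "tensor_gens m G H Gen_b = kron_mat (G Gen_b) (H Gen_b)"
| "tensor_gens m G H Gen_c = kron_mat (G Gen_c) (H Gen_c)"
| "tensor_gens m G H Gen_d = kron_mat (G Gen_d) (H Gen_c) + kron_mat (1\<^sub>m m) (H Gen_d)"

lemma tensor_gens_carrier:
  assumes "\<And>g. G g \<in> carrier_mat m m" "\<And>g. H g \<in> carrier_mat k k"
  shows "tensor_gens m G H g \<in> carrier_mat (m * k) (m * k)"
  using assms by (cases g) (auto intro!: add_carrier_mat kron_mat_carrier)

lemma one_pow_mat: "(1\<^sub>m m :: 'k::field mat) ^\<^sub>m k = 1\<^sub>m m"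
  by (induction k) auto

lemma gens_rep_tensor:
  fixes q :: "'k::field"
  assumes pr: "primitive_root_of_unity n q" and G: "gens_rep n q m G" and H: "gens_rep n q k H"
  shows "gens_rep n q (m * k) (tensor_gens m G H)"
proof -
  note Gc = gens_repD(1)[OF G] and Hc = gens_repD(1)[OF H]
  have oc: "(1\<^sub>m m :: 'k mat) \<in> carrier_mat m m" by simp
  have c: "kron_mat X Y \<in> carrier_mat (m * k) (m * k)"
    if "X \<in> carrier_mat m m" "Y \<in> carrier_mat k k" for X Y :: "'k mat"
    using kron_mat_carrier[OF that] .
  have mul: "kron_mat X Y * kron_mat X' Y' = kron_mat (X * X') (Y * Y')"
    if "X \<in> carrier_mat m m" "Y \<in> carrier_mat k k" "X' \<in> carrier_mat m m" "Y' \<in> carrier_mat k k"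
    for X Y X' Y' :: "'k mat"
    by (rule kron_mat_mult[OF that])
  have mul3: "kron_mat X Y * (kron_mat X' Y' + kron_mat X'' Y'') = kron_mat (X * X') (Y * Y') + kron_mat (X * X'') (Y * Y'')"
    "(kron_mat X' Y' + kron_mat X'' Y'') * kron_mat X Y = kron_mat (X' * X) (Y' * Y) + kron_mat (X'' * X) (Y'' * Y)"
    if "X \<in> carrier_mat m m" "Y \<in> carrier_mat k k" "X' \<in> carrier_mat m m" "Y' \<in> carrier_mat k k"
      "X'' \<in> carrier_mat m m" "Y'' \<in> carrier_mat k k"
    for X Y X' Y' X'' Y'' :: "'k mat"
    using mult_add_distrib_mat[OF c[of X Y] c[of X' Y'] c[of X'' Y'']]
      add_mult_distrib_mat[OF c[of X' Y'] c[of X'' Y''] c[of X Y]] that by (simp_all add: mul)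
  have sm: "q \<cdot>\<^sub>m (X + Y) = q \<cdot>\<^sub>m X + q \<cdot>\<^sub>m Y"
    if "X \<in> carrier_mat (m * k) (m * k)" "Y \<in> carrier_mat (m * k) (m * k)" for X Y :: "'k mat"
    by (rule add_smult_distrib_left_mat[OF that])
  have g2: "G g * G g' \<in> carrier_mat m m" "H g * H g' \<in> carrier_mat k k" for g g'
    using mult_carrier_mat[OF Gc Gc] mult_carrier_mat[OF Hc Hc] by auto
  note simps = mul mul3 Gc Hc oc kron_mat_smult sm c g2 left_mult_one_mat[OF Gc] right_mult_one_mat[OF Gc]
    left_mult_one_mat[OF Hc] right_mult_one_mat[OF Hc]
  show ?thesis
  proof (rule gens_repI)
    show "tensor_gens m G H g \<in> carrier_mat (m * k) (m * k)" for g
      by (rule tensor_gens_carrier[OF Gc Hc])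
    show "tensor_gens m G H Gen_b * tensor_gens m G H Gen_a = q \<cdot>\<^sub>m (tensor_gens m G H Gen_a * tensor_gens m G H Gen_b)"
      using gens_repD(2)[OF G] gens_repD(2)[OF H] by (simp add: simps)
    show "tensor_gens m G H Gen_c * tensor_gens m G H Gen_a = q \<cdot>\<^sub>m (tensor_gens m G H Gen_a * tensor_gens m G H Gen_c)"
      using gens_repD(4)[OF G] gens_repD(4)[OF H] gens_repD(6)[OF H] by (simp add: simps)
    show "tensor_gens m G H Gen_d * tensor_gens m G H Gen_b = q \<cdot>\<^sub>m (tensor_gens m G H Gen_b * tensor_gens m G H Gen_d)"
      using gens_repD(3)[OF G] gens_repD(3)[OF H] gens_repD(6)[OF H] by (simp add: simps)
    show "tensor_gens m G H Gen_d * tensor_gens m G H Gen_c = q \<cdot>\<^sub>m (tensor_gens m G H Gen_c * tensor_gens m G H Gen_d)"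
      using gens_repD(5)[OF G] gens_repD(5)[OF H] by (simp add: simps)
    show "tensor_gens m G H Gen_b * tensor_gens m G H Gen_c = tensor_gens m G H Gen_c * tensor_gens m G H Gen_b"
      using gens_repD(6)[OF G] gens_repD(6)[OF H] by (simp add: simps)
    show "tensor_gens m G H Gen_b ^\<^sub>m n = 1\<^sub>m (m * k)"
      using gens_repD(8)[OF G] gens_repD(8)[OF H] by (simp add: kron_mat_pow[OF Gc Hc] kron_mat_one)
    show "tensor_gens m G H Gen_c ^\<^sub>m n = 1\<^sub>m (m * k)"
      using gens_repD(9)[OF G] gens_repD(9)[OF H] by (simp add: kron_mat_pow[OF Gc Hc] kron_mat_one)
    have "(kron_mat (G Gen_a) (H Gen_b) + kron_mat (1\<^sub>m m) (H Gen_a)) ^\<^sub>m n =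
        kron_mat (G Gen_a) (H Gen_b) ^\<^sub>m n + kron_mat (1\<^sub>m m) (H Gen_a) ^\<^sub>m n"
      by (rule pow_q_commuting_sum[OF pr c[OF Gc Hc] c[OF oc Hc]])
         (use gens_repD(2)[OF H] in \<open>simp add: simps\<close>)
    then show "tensor_gens m G H Gen_a ^\<^sub>m n = 0\<^sub>m (m * k) (m * k)"
      by (simp add: kron_mat_pow[OF Gc Hc] kron_mat_pow[OF oc Hc] one_pow_mat gens_repD(7)[OF G] gens_repD(7)[OF H]
          gens_repD(8)[OF H] kron_mat_zero)
    \<comment> \<open>The summands appear in the order opposite to the case of \<open>a\<close>:
      here it is 1 (x) d followed by d (x) c whose product is q times the reversed product.\<close>
    have "(kron_mat (1\<^sub>m m) (H Gen_d) + kron_mat (G Gen_d) (H Gen_c)) ^\<^sub>m n =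
        kron_mat (1\<^sub>m m) (H Gen_d) ^\<^sub>m n + kron_mat (G Gen_d) (H Gen_c) ^\<^sub>m n"
      by (rule pow_q_commuting_sum[OF pr c[OF oc Hc] c[OF Gc Hc]])
         (use gens_repD(5)[OF H] in \<open>simp add: simps\<close>)
    then show "tensor_gens m G H Gen_d ^\<^sub>m n = 0\<^sub>m (m * k) (m * k)"
      by (simp add: kron_mat_pow[OF Gc Hc] kron_mat_pow[OF oc Hc] one_pow_mat gens_repD(10)[OF G] gens_repD(10)[OF H]
          gens_repD(9)[OF H] kron_mat_zero comm_add_mat[OF c[OF Gc Hc] c[OF oc Hc]])
    let ?A = "G Gen_a" and ?B = "G Gen_b" and ?C = "G Gen_c" and ?D = "G Gen_d"
    let ?A' = "H Gen_a" and ?B' = "H Gen_b" and ?C' = "H Gen_c" and ?D' = "H Gen_d"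
    have four: "(X + Y) * (Z + W) = (X * Z + Y * Z) + (X * W + Y * W)"
      if "X \<in> carrier_mat j j" "Y \<in> carrier_mat j j" "Z \<in> carrier_mat j j" "W \<in> carrier_mat j j"
      for X Y Z W :: "'k mat" and j
      using mult_add_distrib_mat[OF add_carrier_mat[OF that(2)] that(3,4), of X]
        add_mult_distrib_mat[OF that(1-3)] add_mult_distrib_mat[OF that(1,2,4)] by simp
    have l: "tensor_gens m G H Gen_d * tensor_gens m G H Gen_a =
      (kron_mat (?D * ?A) (?C' * ?B') + kron_mat ?A (?D' * ?B')) + (kron_mat ?D (?C' * ?A') + kron_mat (1\<^sub>m m) (?D' * ?A'))"
      unfolding tensor_gens.simps four[OF c[OF Gc Hc] c[OF oc Hc] c[OF Gc Hc] c[OF oc Hc]]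
      by (simp add: mul Gc Hc oc left_mult_one_mat[OF Gc] right_mult_one_mat[OF Gc])
    have r: "tensor_gens m G H Gen_a * tensor_gens m G H Gen_d =
      (kron_mat (?A * ?D) (?B' * ?C') + kron_mat ?D (?A' * ?C')) + (kron_mat ?A (?B' * ?D') + kron_mat (1\<^sub>m m) (?A' * ?D'))"
      unfolding tensor_gens.simps four[OF c[OF Gc Hc] c[OF oc Hc] c[OF Gc Hc] c[OF oc Hc]]
      by (simp add: mul Gc Hc oc left_mult_one_mat[OF Gc] right_mult_one_mat[OF Gc])
    have e1: "kron_mat (?D * ?A) (?C' * ?B') = q \<cdot>\<^sub>m kron_mat (?A * ?D) (?B' * ?C') + (kron_mat (1\<^sub>m m) (?B' * ?C') - kron_mat (?B * ?C) (?B' * ?C'))"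
    proof -
      have "kron_mat (?D * ?A) (?C' * ?B') = kron_mat (q \<cdot>\<^sub>m (?A * ?D) + (1\<^sub>m m - ?B * ?C)) (?B' * ?C')"
        using gens_repD(11)[OF G] gens_repD(6)[OF H] by simp
      also have "\<dots> = q \<cdot>\<^sub>m kron_mat (?A * ?D) (?B' * ?C') + (kron_mat (1\<^sub>m m) (?B' * ?C') - kron_mat (?B * ?C) (?B' * ?C'))"
        using Gc Hc by (intro eq_matI) (auto simp: kron_mat_index div_mod_less algebra_simps carrier_matD[OF Gc] carrier_matD[OF Hc])
      finally show ?thesis .
    qed
    have e2: "kron_mat (1\<^sub>m m) (?D' * ?A') = q \<cdot>\<^sub>m kron_mat (1\<^sub>m m) (?A' * ?D') + (1\<^sub>m (m * k) - kron_mat (1\<^sub>m m) (?B' * ?C'))"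
      using gens_repD(11)[OF H] g2 by (simp add: kron_mat_add_right[of _ k k] kron_mat_diff_right[of _ k k] kron_mat_smult kron_mat_one minus_carrier_mat)
    have e3: "kron_mat ?A (?D' * ?B') = q \<cdot>\<^sub>m kron_mat ?A (?B' * ?D')" "kron_mat ?D (?C' * ?A') = q \<cdot>\<^sub>m kron_mat ?D (?A' * ?C')"
      using gens_repD(3)[OF H] gens_repD(4)[OF H] by (simp_all add: kron_mat_smult)
    have e4: "tensor_gens m G H Gen_b * tensor_gens m G H Gen_c = kron_mat (?B * ?C) (?B' * ?C')" by (simp add: simps)
    \<comment> \<open>\<open>Y\<close> stands for 1 (x) bc. It enters with opposite signs through
      \<open>e1\<close> and \<open>e2\<close> and cancels, leaving 1 minus the action of bc on the
      tensor product.\<close>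
    have fin: "(q \<cdot>\<^sub>m X + (Y - Z) + q \<cdot>\<^sub>m U) + (q \<cdot>\<^sub>m W + (q \<cdot>\<^sub>m T + (1\<^sub>m j - Y))) = q \<cdot>\<^sub>m ((X + W) + (U + T)) + (1\<^sub>m j - Z)"
      if "X \<in> carrier_mat j j" "Y \<in> carrier_mat j j" "Z \<in> carrier_mat j j" "U \<in> carrier_mat j j"
        "W \<in> carrier_mat j j" "T \<in> carrier_mat j j" for X Y Z U W T :: "'k mat" and j
      using that by (intro eq_matI) (auto simp: algebra_simps)
    show "tensor_gens m G H Gen_d * tensor_gens m G H Gen_a =
        q \<cdot>\<^sub>m (tensor_gens m G H Gen_a * tensor_gens m G H Gen_d) + (1\<^sub>m (m * k) - tensor_gens m G H Gen_b * tensor_gens m G H Gen_c)"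
      unfolding l r e4 unfolding e1 e2 e3 by (rule fin) (auto intro!: c g2 Gc Hc)
  qed
qed

section \<open>The comultiplication and the tensor product of modules\<close>

lemma comult_superset:
  assumes "finite S" "Poly_Mapping.keys x \<subseteq> S"
  shows "comult x = (\<Sum>w\<in>S. Poly_Mapping.single 0 (Poly_Mapping.lookup x w) * prod_list (map comult_gen (letters w)))"
  unfolding comult_def by (rule sum.mono_neutral_left) (use assms in \<open>auto simp: in_keys_iff\<close>)

lemma comult_add: "comult (x + y) = comult x + comult y"
proof -
  let ?S = "Poly_Mapping.keys x \<union> Poly_Mapping.keys y"
  have "Poly_Mapping.keys (x + y) \<subseteq> ?S" by (rule Poly_Mapping.keys_add)
  then show ?thesis
    by (subst (1 2 3) comult_superset[of ?S]) (auto simp: lookup_add single_add sum.distrib ring_distribs)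
qed

lemma comult_single: "comult (Poly_Mapping.single w t) = Poly_Mapping.single 0 t * prod_list (map comult_gen (letters w))"
  by (subst comult_superset[of "{w}"]) auto

text \<open>Both sides are linear and multiplicative in \<open>x\<close>, so comparing them on the
  four generators is enough. Multiplicativity on the left rests on \<open>?K\<close> turning sums of
  pairs of words into matrix products.\<close>

lemma eval_comult:
  fixes G H :: "hgen \<Rightarrow> 'k::field mat"
  assumes G: "\<And>g. G g \<in> carrier_mat m m" and H: "\<And>g. H g \<in> carrier_mat k k"
  shows "mat_lincomb (m * k) (comult x) (\<lambda>(u, v). kron_mat (word_mat m G u) (word_mat k H v))
    = eval_free (m * k) (tensor_gens m G H) x"
proof -
  let ?K = "\<lambda>(u, v). kron_mat (word_mat m G u) (word_mat k H v)"
  let ?L = "\<lambda>z. mat_lincomb (m * k) z ?K"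
  note T = tensor_gens_carrier[OF G H]
  have K: "?K p \<in> carrier_mat (m * k) (m * k)" for p
    by (cases p) (simp add: kron_mat_carrier[OF word_mat_carrier[OF G] word_mat_carrier[OF H]])
  have Km: "?K (p + p') = ?K p * ?K p'" for p p'
    by (cases p; cases p')
       (simp add: word_mat_add[OF G] word_mat_add[OF H]
          kron_mat_mult[OF word_mat_carrier[OF G] word_mat_carrier[OF H] word_mat_carrier[OF G] word_mat_carrier[OF H]])
  have Lm: "?L (y * z) = ?L y * ?L z" for y z
    by (rule mat_lincomb_mult[where X = ?K, OF K Km])
  have L0: "?L (Poly_Mapping.single 0 t) = t \<cdot>\<^sub>m 1\<^sub>m (m * k)" for t
    using mat_lincomb_single[where X = ?K, OF K, of 0 t] by (simp add: zero_prod_def kron_mat_one)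
  have Lt: "?L (tens u v) = kron_mat (word_mat m G u) (word_mat k H v)" for u v
    using mat_lincomb_single[where X = ?K, OF K, of "(u, v)" 1] by (simp add: tens_def) (intro eq_matI; simp)
  have w1: "word_mat m G (Word [g]) = G g" "word_mat k H (Word [g]) = H g" for g
    using right_mult_one_mat[OF G] right_mult_one_mat[OF H] by (simp_all add: word_mat_def)
  have Lg: "?L (comult_gen g) = tensor_gens m G H g" for g
    by (cases g) (simp_all add: mat_lincomb_add Lt w1)
  have Lp: "?L (prod_list (map comult_gen ls)) = foldr (*) (map (tensor_gens m G H) ls) (1\<^sub>m (m * k))" for ls
  proof (induction ls)
    case Nil
    show ?case using L0[of 1] by (simp add: single_one) (intro eq_matI; simp)
  next
    case (Cons g ls)
    then show ?case by (simp add: Lm Lg)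
  qed
  show ?thesis
  proof (induction x rule: poly_mapping_single_induct)
    case (1 w t)
    let ?W = "word_mat (m * k) (tensor_gens m G H) w"
    have W: "?W \<in> carrier_mat (m * k) (m * k)" by (rule word_mat_carrier[OF T])
    have "?L (comult (Poly_Mapping.single w t)) = (t \<cdot>\<^sub>m 1\<^sub>m (m * k)) * ?W"
      unfolding comult_single Lm L0 Lp word_mat_def[of "m * k" "tensor_gens m G H" w, symmetric] ..
    also have "\<dots> = t \<cdot>\<^sub>m ?W"
      using mult_smult_assoc_mat[OF one_carrier_mat W] left_mult_one_mat[OF W] by simp
    finally show ?case by (simp add: eval_free_def mat_lincomb_single W)
  next
    case (2 x y)
    then show ?case by (simp add: comult_add mat_lincomb_add eval_free_add)
  qed
qed

lemma hmod_tensor: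
  fixes M N :: "'k::field hmod"
  assumes q: "primitive_root_of_unity n q" and M: "is_hmod n q M" and N: "is_hmod n q N"
  shows "is_hmod n q (hm_tensor n q M N)"
    and "act n q (hm_tensor n q M N) g = tensor_gens (hm_dim M) (act n q M) (act n q N) g"
    and "hm_dim (hm_tensor n q M N) = hm_dim M * hm_dim N"
proof -
  let ?m = "hm_dim M * hm_dim N" and ?T = "tensor_gens (hm_dim M) (act n q M) (act n q N)"
  show d: "hm_dim (hm_tensor n q M N) = ?m" by (simp add: hm_tensor_def Let_def)
  note R = gens_rep_tensor[OF q hmod_gens_rep[OF M] hmod_gens_rep[OF N]]
  have w: "eval_free (hm_dim X) (act n q X) (Poly_Mapping.single w 1) = word_mat (hm_dim X) (act n q X) w"
    if "is_hmod n q X" for w and X :: "'k hmod"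
    using mat_lincomb_single[where X = "word_mat (hm_dim X) (act n q X)" and w = w and t = 1,
        OF word_mat_carrier[of "act n q X" "hm_dim X" w, OF hmod_eval(2)[OF that]]]
    by (simp add: eval_free_def) (intro eq_matI; simp)
  have f: "mat_lincomb ?m (comult x) (\<lambda>(u, v). kron_mat (hm_act M (H_class n q (Poly_Mapping.single u 1)))
      (hm_act N (H_class n q (Poly_Mapping.single v 1)))) = eval_free ?m ?T x" for x
    using eval_comult[OF hmod_eval(2)[OF M] hmod_eval(2)[OF N], of x]
    by (simp add: hmod_eval(1)[OF M] hmod_eval(1)[OF N] w[OF M] w[OF N])
  have e: "hm_act (hm_tensor n q M N) (H_class n q x) = eval_free ?m ?T x" for x
    using the_elem_eval_free[OF R f, of x] by (simp add: hm_tensor_def Let_def)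
  then show "is_hmod n q (hm_tensor n q M N)"
    by (intro is_hmod_if_eval[of n q _ ?T]) (simp_all add: d R)
  show "act n q (hm_tensor n q M N) g = ?T g"
    unfolding act_def[of n q "hm_tensor n q M N"] e by (rule eval_free_gen[OF gens_repD(1)[OF R]])
qed

text \<open>The contragredient action: transposes of the antipode images -a b^(-1), b^(-1), c^(-1),
  -d c^(-1). Inverses are written as (n-1)-th powers, since the n-th powers of \<open>b\<close> and
  \<open>c\<close> are 1.\<close>

fun dual_gens :: "nat \<Rightarrow> (hgen \<Rightarrow> 'k::field mat) \<Rightarrow> hgen \<Rightarrow> 'k mat" where
  "dual_gens n G Gen_a = - transpose_mat (G Gen_a * G Gen_b ^\<^sub>m (n - 1))"
| "dual_gens n G Gen_b = transpose_mat (G Gen_b ^\<^sub>m (n - 1))"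
| "dual_gens n G Gen_c = transpose_mat (G Gen_c ^\<^sub>m (n - 1))"
| "dual_gens n G Gen_d = - transpose_mat (G Gen_d * G Gen_c ^\<^sub>m (n - 1))"

lemma smult_one_mat: "(1::'k::field) \<cdot>\<^sub>m A = A"
  by (intro eq_matI) auto

lemma transpose_pow_mat:
  fixes A :: "'k::field mat"
  assumes A: "A \<in> carrier_mat m m"
  shows "transpose_mat A ^\<^sub>m k = transpose_mat (A ^\<^sub>m k)"
proof (induction k)
  case (Suc k)
  have "transpose_mat (A ^\<^sub>m Suc k) = transpose_mat (A * A ^\<^sub>m k)" using pow_mat_Suc_left[OF A] by simp
  also have "\<dots> = transpose_mat (A ^\<^sub>m k) * transpose_mat A"
    by (rule transpose_mult[OF A pow_carrier_mat[OF A]])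
  finally show ?case using Suc by simp
qed (use A in simp)

lemma uminus_pow_mat_zero:
  fixes A :: "'k::field mat"
  assumes A: "A \<in> carrier_mat m m" and z: "A ^\<^sub>m k = 0\<^sub>m m m"
  shows "(- A) ^\<^sub>m k = 0\<^sub>m m m"
proof -
  have "\<exists>s. (- A) ^\<^sub>m j = s \<cdot>\<^sub>m A ^\<^sub>m j" for j
  proof (induction j)
    case 0
    have "1\<^sub>m m = (1::'k) \<cdot>\<^sub>m 1\<^sub>m m" by (intro eq_matI) auto
    then show ?case using A by (intro exI[of _ 1]) simp
  next
    case (Suc j)
    then obtain s where "(- A) ^\<^sub>m j = s \<cdot>\<^sub>m A ^\<^sub>m j" by blast
    then have "(- A) ^\<^sub>m Suc j = (- s) \<cdot>\<^sub>m (A ^\<^sub>m j * A)"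
      using A mult_smult_assoc_mat[OF pow_carrier_mat[OF A, of j] A] by (auto intro!: eq_matI)
    then show ?case by auto
  qed
  then obtain s where "(- A) ^\<^sub>m k = s \<cdot>\<^sub>m A ^\<^sub>m k" by blast
  then show ?thesis using z by auto
qed

text \<open>The scalar is some power of \<open>t\<close>; its mere existence suffices for proving
  nilpotency.\<close>

lemma pow_mat_mult_q_commute:
  fixes X Y :: "'k::field mat"
  assumes X: "X \<in> carrier_mat m m" and Y: "Y \<in> carrier_mat m m" and c: "Y * X = t \<cdot>\<^sub>m (X * Y)"
  shows "\<exists>s. (X * Y) ^\<^sub>m k = s \<cdot>\<^sub>m (X ^\<^sub>m k * Y ^\<^sub>m k)"
proof (induction k)
  case 0
  have "1\<^sub>m m = (1::'k) \<cdot>\<^sub>m 1\<^sub>m m" by (intro eq_matI) auto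
  then show ?case using X Y by (intro exI[of _ 1]) simp
next
  case (Suc k)
  then obtain s where s: "(X * Y) ^\<^sub>m k = s \<cdot>\<^sub>m (X ^\<^sub>m k * Y ^\<^sub>m k)" by blast
  note p = pow_carrier_mat[OF X, of k] pow_carrier_mat[OF Y, of k]
  have "(X * Y) ^\<^sub>m Suc k = s \<cdot>\<^sub>m (X ^\<^sub>m k * Y ^\<^sub>m k) * (X * Y)" using s by simp
  also have "\<dots> = s \<cdot>\<^sub>m (X ^\<^sub>m k * ((Y ^\<^sub>m k * X) * Y))"
    by (simp add: sq_mat_simps[where m=m] smult_smult_mat p X Y)
  also have "Y ^\<^sub>m k * X = t ^ k \<cdot>\<^sub>m (X * Y ^\<^sub>m k)" by (rule pow_mat_q_commute[OF Y X c])
  also have "s \<cdot>\<^sub>m (X ^\<^sub>m k * (t ^ k \<cdot>\<^sub>m (X * Y ^\<^sub>m k) * Y)) = (s * t ^ k) \<cdot>\<^sub>m (X ^\<^sub>m Suc k * Y ^\<^sub>m Suc k)"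
    by (simp add: sq_mat_simps[where m=m] smult_smult_mat p X Y)
  finally show ?case by blast
qed

lemma inverse_q_commute:
  fixes B :: "'k::field mat"
  assumes q: "q \<noteq> 0" and c: "A \<in> carrier_mat m m" "B \<in> carrier_mat m m" "I \<in> carrier_mat m m"
    and i: "B * I = 1\<^sub>m m" "I * B = 1\<^sub>m m"
  shows "B * A = q \<cdot>\<^sub>m (A * B) \<Longrightarrow> A * I = q \<cdot>\<^sub>m (I * A)"
    and "A * B = q \<cdot>\<^sub>m (B * A) \<Longrightarrow> I * A = q \<cdot>\<^sub>m (A * I)"
proof -
  have e: "I * (B * A * I) = A * I" "I * (A * B * I) = I * A"
  proof -
    have "I * (B * A * I) = (I * B) * (A * I)" using c by (simp add: sq_mat_simps[where m=m] smult_smult_mat)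
    then show "I * (B * A * I) = A * I" using i c by (simp add: sq_mat_simps[where m=m] smult_smult_mat)
    have "I * (A * B * I) = I * (A * (B * I))" using c by (simp add: sq_mat_simps[where m=m] smult_smult_mat)
    then show "I * (A * B * I) = I * A" using i c by (simp add: sq_mat_simps[where m=m] smult_smult_mat)
  qed
  {
    assume h: "B * A = q \<cdot>\<^sub>m (A * B)"
    have "A * I = I * (q \<cdot>\<^sub>m (A * B) * I)" using e h by simp
    also have "\<dots> = q \<cdot>\<^sub>m (I * (A * B * I))" using c by (simp add: sq_mat_simps[where m=m] smult_smult_mat)
    finally show "A * I = q \<cdot>\<^sub>m (I * A)" using e by simp
  }
  {
    assume h: "A * B = q \<cdot>\<^sub>m (B * A)"
    have "I * A = I * (q \<cdot>\<^sub>m (B * A) * I)" using e h by simp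
    also have "\<dots> = q \<cdot>\<^sub>m (I * (B * A * I))" using c by (simp add: sq_mat_simps[where m=m] smult_smult_mat)
    finally show "I * A = q \<cdot>\<^sub>m (A * I)" using e by simp
  }
qed

lemma pow_inverse_mat:
  fixes B :: "'k::field mat"
  assumes B: "B \<in> carrier_mat m m" and "B ^\<^sub>m n = 1\<^sub>m m" "0 < n"
  shows "B * B ^\<^sub>m (n - 1) = 1\<^sub>m m" "B ^\<^sub>m (n - 1) * B = 1\<^sub>m m" "(B ^\<^sub>m (n - 1)) ^\<^sub>m n = 1\<^sub>m m"
proof -
  obtain k where k: "n = Suc k" using assms by (cases n) auto
  let ?I = "B ^\<^sub>m (n - 1)"
  show 1: "B * ?I = 1\<^sub>m m" "?I * B = 1\<^sub>m m" using assms k pow_mat_Suc_left[OF B, of k] by auto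
  have I: "?I \<in> carrier_mat m m" using B by (simp add: pow_carrier_mat)
  have "?I ^\<^sub>m j * B ^\<^sub>m j = 1\<^sub>m m" for j
  proof (induction j)
    case (Suc j)
    note p = pow_carrier_mat[OF I, of j] pow_carrier_mat[OF B, of j]
    have "?I ^\<^sub>m Suc j * B ^\<^sub>m Suc j = ?I ^\<^sub>m j * ?I * (B * B ^\<^sub>m j)"
      using pow_mat_Suc_left[OF B, of j] by simp
    also have "\<dots> = ?I ^\<^sub>m j * ((?I * B) * B ^\<^sub>m j)" using p I B by (simp add: sq_mat_simps[where m=m] smult_smult_mat)
    also have "\<dots> = 1\<^sub>m m" using 1 Suc p by (simp add: left_mult_one_mat[of _ m m])
    finally show ?case .
  qed (use B I in simp)
  from this[of n] show "?I ^\<^sub>m n = 1\<^sub>m m"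
    using assms right_mult_one_mat[OF pow_carrier_mat[OF I]] by simp
qed

text \<open>Transposition and antipode both reverse products, so their composite preserves the
  relations. The facts \<open>r1\<close> to \<open>r5\<close> are the relations for the antipode
  images in reversed order, before transposing.\<close>

lemma gens_rep_dual:
  fixes q :: "'k::field"
  assumes pr: "primitive_root_of_unity n q" and G: "gens_rep n q m G"
  shows "gens_rep n q m (dual_gens n G)"
proof -
  note Gc = gens_repD(1)[OF G]
  have n: "0 < n" and q0: "q \<noteq> 0" using pr by (auto simp: primitive_root_of_unity_def zero_power)
  define A B C D where "A = G Gen_a" "B = G Gen_b" "C = G Gen_c" "D = G Gen_d"
  define I J where "I = B ^\<^sub>m (n - 1)" "J = C ^\<^sub>m (n - 1)"
  note defs = A_B_C_D_def I_J_def
  have c: "A \<in> carrier_mat m m" "B \<in> carrier_mat m m" "C \<in> carrier_mat m m" "D \<in> carrier_mat m m"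
    using Gc by (auto simp: A_B_C_D_def)
  have ic: "I \<in> carrier_mat m m" "J \<in> carrier_mat m m" using c by (simp_all add: I_J_def pow_carrier_mat)
  have rel: "B * A = q \<cdot>\<^sub>m (A * B)" "D * B = q \<cdot>\<^sub>m (B * D)" "C * A = q \<cdot>\<^sub>m (A * C)" "D * C = q \<cdot>\<^sub>m (C * D)"
    "B * C = C * B" "D * A = q \<cdot>\<^sub>m (A * D) + (1\<^sub>m m - B * C)"
    using gens_repD[OF G] unfolding A_B_C_D_def by auto
  have inv: "B * I = 1\<^sub>m m" "I * B = 1\<^sub>m m" "I ^\<^sub>m n = 1\<^sub>m m" "C * J = 1\<^sub>m m" "J * C = 1\<^sub>m m" "J ^\<^sub>m n = 1\<^sub>m m"
    using pow_inverse_mat[OF c(2), of n] pow_inverse_mat[OF c(3), of n] gens_repD(8,9)[OF G] n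
    unfolding A_B_C_D_def I_J_def by auto
  note S = sq_mat_simps[where m=m] smult_smult_mat c ic
  have AI: "A * I = q \<cdot>\<^sub>m (I * A)" by (rule inverse_q_commute(1)[OF q0 c(1,2) ic(1) inv(1,2) rel(1)])
  have AJ: "A * J = q \<cdot>\<^sub>m (J * A)" by (rule inverse_q_commute(1)[OF q0 c(1,3) ic(2) inv(4,5) rel(3)])
  have ID: "I * D = q \<cdot>\<^sub>m (D * I)" by (rule inverse_q_commute(2)[OF q0 c(4,2) ic(1) inv(1,2) rel(2)])
  have JD: "J * D = q \<cdot>\<^sub>m (D * J)" by (rule inverse_q_commute(2)[OF q0 c(4,3) ic(2) inv(4,5) rel(4)])
  have IJ: "I * J = J * I"
  proof -
    have "C * B = 1 \<cdot>\<^sub>m (B * C)" using rel(5) c by (intro eq_matI) auto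
    from inverse_q_commute(2)[OF one_neq_zero c(3,2) ic(1) inv(1,2) this]
    have "I * C = 1 \<cdot>\<^sub>m (C * I)" .
    from inverse_q_commute(2)[OF one_neq_zero ic(1) c(3) ic(2) inv(4,5) this]
    have "J * I = 1 \<cdot>\<^sub>m (I * J)" .
    then show ?thesis by (simp add: smult_one_mat)
  qed
  have tm: "transpose_mat X * transpose_mat Y = transpose_mat (Y * X)"
    "- transpose_mat X * transpose_mat Y = - transpose_mat (Y * X)"
    "transpose_mat X * - transpose_mat Y = - transpose_mat (Y * X)"
    "- transpose_mat X * - transpose_mat Y = transpose_mat (Y * X)"
    if "X \<in> carrier_mat m m" "Y \<in> carrier_mat m m" for X Y :: "'k mat"
    using that transpose_mult[OF that(2,1)] by simp_all
  have ts: "q \<cdot>\<^sub>m transpose_mat X = transpose_mat (q \<cdot>\<^sub>m X)" "q \<cdot>\<^sub>m (- transpose_mat X) = - transpose_mat (q \<cdot>\<^sub>m X)"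
    for X :: "'k mat"
    by (auto intro!: eq_matI)
  have dual: "dual_gens n G Gen_a = - transpose_mat (A * I)" "dual_gens n G Gen_b = transpose_mat I"
    "dual_gens n G Gen_c = transpose_mat J" "dual_gens n G Gen_d = - transpose_mat (D * J)"
    by (simp_all add: defs)
  have cc: "A * I \<in> carrier_mat m m" "D * J \<in> carrier_mat m m" using c ic by auto
  have r1: "A * I * I = q \<cdot>\<^sub>m (I * (A * I))"
  proof -
    have "A * I * I = q \<cdot>\<^sub>m (I * A) * I" by (simp only: AI)
    then show ?thesis by (simp add: S)
  qed
  have r2: "I * (D * J) = q \<cdot>\<^sub>m (D * J * I)"
  proof -
    have "I * (D * J) = (I * D) * J" by (simp add: S)
    also have "\<dots> = q \<cdot>\<^sub>m (D * (I * J))" unfolding ID by (simp add: S)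
    also have "\<dots> = q \<cdot>\<^sub>m (D * J * I)" unfolding IJ by (simp add: S)
    finally show ?thesis .
  qed
  have r3: "A * I * J = q \<cdot>\<^sub>m (J * (A * I))"
  proof -
    have "A * I * J = A * (I * J)" by (simp add: S)
    also have "\<dots> = (A * J) * I" unfolding IJ by (simp add: S)
    also have "\<dots> = q \<cdot>\<^sub>m (J * (A * I))" unfolding AJ by (simp add: S)
    finally show ?thesis .
  qed
  have r4: "J * (D * J) = q \<cdot>\<^sub>m (D * J * J)"
  proof -
    have "J * (D * J) = (J * D) * J" by (simp add: S)
    also have "\<dots> = q \<cdot>\<^sub>m (D * J * J)" unfolding JD by (simp add: S)
    finally show ?thesis .
  qed
  have JA: "q \<cdot>\<^sub>m (J * A) = A * J" and IA: "I * A = inverse q \<cdot>\<^sub>m (A * I)"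
    using AJ AI q0 by (simp_all add: smult_smult_mat smult_one_mat)
  have ADc: "A * D \<in> carrier_mat m m" "B * C \<in> carrier_mat m m" "J * I \<in> carrier_mat m m" using c ic by auto
  \<comment> \<open>Both products are brought to the form A D J I, with \<open>I\<close> and
    \<open>J\<close> inverse to \<open>B\<close> and \<open>C\<close>. The difference comes from the
    term B C J I, which collapses to 1.\<close>
  have r5: "(A * I) * (D * J) = q \<cdot>\<^sub>m (D * J * (A * I)) + (1\<^sub>m m - J * I)"
  proof -
    have "(A * I) * (D * J) = A * ((I * D) * J)" by (simp add: S)
    also have "\<dots> = q \<cdot>\<^sub>m (A * (D * (I * J)))" unfolding ID by (simp add: S)
    finally have l: "(A * I) * (D * J) = q \<cdot>\<^sub>m (A * D * (J * I))" unfolding IJ by (simp add: S)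
    have "q \<cdot>\<^sub>m (D * J * (A * I)) = D * (q \<cdot>\<^sub>m (J * A) * I)" by (simp add: S)
    also have "\<dots> = (D * A) * (J * I)" unfolding JA by (simp add: S)
    also have "\<dots> = q \<cdot>\<^sub>m (A * D) * (J * I) + (1\<^sub>m m * (J * I) - B * C * (J * I))"
      unfolding rel(6) using ADc by (simp add: add_mult_distrib_mat[of _ m m] minus_mult_distrib_mat[of _ m m] minus_carrier_mat)
    also have "B * C * (J * I) = B * ((C * J) * I)" by (simp add: S)
    also have "\<dots> = 1\<^sub>m m" unfolding inv(4) using ic inv(1) by simp
    also have "1\<^sub>m m * (J * I) = J * I" by (rule left_mult_one_mat[OF ADc(3)])
    also have "q \<cdot>\<^sub>m (A * D) * (J * I) = q \<cdot>\<^sub>m (A * D * (J * I))"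
      by (rule mult_smult_assoc_mat[OF ADc(1,3)])
    finally have r: "q \<cdot>\<^sub>m (D * J * (A * I)) = q \<cdot>\<^sub>m (A * D * (J * I)) + (J * I - 1\<^sub>m m)" .
    have "X = (X + (Y - 1\<^sub>m m)) + (1\<^sub>m m - Y)" if "X \<in> carrier_mat m m" "Y \<in> carrier_mat m m" for X Y :: "'k mat"
      using that by (intro eq_matI) auto
    from this[of "q \<cdot>\<^sub>m (A * D * (J * I))" "J * I"] show ?thesis
      unfolding l r using ADc by auto
  qed
  \<comment> \<open>The n-th power of \<open>X * Y\<close> is a scalar multiple of the product of
    the n-th powers of \<open>X\<close> and \<open>Y\<close>, hence zero.\<close>
  have zero_pow: "(- transpose_mat (X * Y)) ^\<^sub>m n = 0\<^sub>m m m"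
    if X: "X \<in> carrier_mat m m" and Y: "Y \<in> carrier_mat m m" and XY: "Y * X = t \<cdot>\<^sub>m (X * Y)" and z: "X ^\<^sub>m n = 0\<^sub>m m m"
    for X Y :: "'k mat" and t
  proof -
    from pow_mat_mult_q_commute[OF X Y XY, of n] obtain s where "(X * Y) ^\<^sub>m n = s \<cdot>\<^sub>m (X ^\<^sub>m n * Y ^\<^sub>m n)" by blast
    moreover have "0\<^sub>m m m * Y ^\<^sub>m n = 0\<^sub>m m m" using left_mult_zero_mat[OF pow_carrier_mat[OF Y]] .
    ultimately have "(X * Y) ^\<^sub>m n = 0\<^sub>m m m" using z by simp
    then have "transpose_mat (X * Y) ^\<^sub>m n = 0\<^sub>m m m"
      using transpose_pow_mat[of "X * Y" m n] X Y by (auto intro!: eq_matI)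
    then show ?thesis by (rule uminus_pow_mat_zero[rotated]) (use X Y in auto)
  qed
  show ?thesis
  proof (rule gens_repI)
    show "dual_gens n G g \<in> carrier_mat m m" for g
      using cc ic by (cases g) (simp_all add: dual del: dual_gens.simps)
    show "dual_gens n G Gen_b * dual_gens n G Gen_a = q \<cdot>\<^sub>m (dual_gens n G Gen_a * dual_gens n G Gen_b)"
      unfolding dual tm(3)[OF ic(1) cc(1)] tm(2)[OF cc(1) ic(1)] ts r1 ..
    show "dual_gens n G Gen_d * dual_gens n G Gen_b = q \<cdot>\<^sub>m (dual_gens n G Gen_b * dual_gens n G Gen_d)"
      unfolding dual tm(2)[OF cc(2) ic(1)] tm(3)[OF ic(1) cc(2)] ts r2 ..
    show "dual_gens n G Gen_c * dual_gens n G Gen_a = q \<cdot>\<^sub>m (dual_gens n G Gen_a * dual_gens n G Gen_c)"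
      unfolding dual tm(3)[OF ic(2) cc(1)] tm(2)[OF cc(1) ic(2)] ts r3 ..
    show "dual_gens n G Gen_d * dual_gens n G Gen_c = q \<cdot>\<^sub>m (dual_gens n G Gen_c * dual_gens n G Gen_d)"
      unfolding dual tm(2)[OF cc(2) ic(2)] tm(3)[OF ic(2) cc(2)] ts r4 ..
    show "dual_gens n G Gen_b * dual_gens n G Gen_c = dual_gens n G Gen_c * dual_gens n G Gen_b"
      unfolding dual tm(1)[OF ic(1) ic(2)] tm(1)[OF ic(2) ic(1)] IJ ..
    show "dual_gens n G Gen_a ^\<^sub>m n = 0\<^sub>m m m"
      unfolding dual by (rule zero_pow[OF c(1) ic(1) IA]) (use gens_repD(7)[OF G] in \<open>simp add: defs\<close>)
    show "dual_gens n G Gen_d ^\<^sub>m n = 0\<^sub>m m m"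
      unfolding dual by (rule zero_pow[OF c(4) ic(2) JD]) (use gens_repD(10)[OF G] in \<open>simp add: defs\<close>)
    show "dual_gens n G Gen_b ^\<^sub>m n = 1\<^sub>m m" "dual_gens n G Gen_c ^\<^sub>m n = 1\<^sub>m m"
      unfolding dual using transpose_pow_mat[OF ic(1), of n] transpose_pow_mat[OF ic(2), of n] inv(3,6) by simp_all
    have tt: "transpose_mat (X + (1\<^sub>m m - Y)) = transpose_mat X + (1\<^sub>m m - transpose_mat Y)"
      if "X \<in> carrier_mat m m" "Y \<in> carrier_mat m m" for X Y :: "'k mat"
      using that by (intro eq_matI) auto
    show "dual_gens n G Gen_d * dual_gens n G Gen_a =
        q \<cdot>\<^sub>m (dual_gens n G Gen_a * dual_gens n G Gen_d) + (1\<^sub>m m - dual_gens n G Gen_b * dual_gens n G Gen_c)"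
      unfolding dual tm(4)[OF cc(2) cc(1)] tm(4)[OF cc(1) cc(2)] tm(1)[OF ic(1) ic(2)] ts r5
      by (rule tt) (simp_all add: mult_carrier_mat[OF cc(2) cc(1)] mult_carrier_mat[OF ic(2) ic(1)])
  qed
qed

section \<open>The adjunction between tensoring and internal homs\<close>

text \<open>Column k of the result is the linear map sending w to f(e_k (x) w), flattened row by
  row: the identification of Hom(P (x) W, S) with Hom(P, Hom(W, S)) on the level of
  matrices.\<close>

definition curry_mat :: "nat \<Rightarrow> nat \<Rightarrow> 'k mat \<Rightarrow> 'k mat" where
  "curry_mat p w f = mat (dim_row f * w) p (\<lambda>(x, k). f $$ (x div w, k * w + x mod w))"

definition uncurry_mat :: "nat \<Rightarrow> nat \<Rightarrow> 'k mat \<Rightarrow> 'k mat" where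
  "uncurry_mat s w F = mat s (dim_col F * w) (\<lambda>(i, y). F $$ (i * w + y mod w, y div w))"

lemma curry_mat_carrier: "f \<in> carrier_mat s (p * w) \<Longrightarrow> curry_mat p w f \<in> carrier_mat (s * w) p"
  by (auto simp: curry_mat_def)

lemma uncurry_mat_carrier: "F \<in> carrier_mat (s * w) p \<Longrightarrow> uncurry_mat s w F \<in> carrier_mat s (p * w)"
  by (auto simp: uncurry_mat_def)

lemma mult_add_less:
  assumes "(i::nat) < s" "j < w" shows "i * w + j < s * w"
proof -
  have "i * w + j < (i + 1) * w" using assms by simp
  also have "\<dots> \<le> s * w" using assms by (intro mult_le_mono1) auto
  finally show ?thesis .
qed

lemma uncurry_curry_mat:
  assumes f: "f \<in> carrier_mat s (p * w)"
  shows "uncurry_mat s w (curry_mat p w f) = f"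
proof (rule eq_matI)
  fix i y assume "i < dim_row f" "y < dim_col f"
  then have i: "i < s" and y: "y < p * w" using f by auto
  note d = div_mod_less[OF y]
  have "i * w + y mod w < s * w" by (rule mult_add_less[OF i d(2)])
  then show "uncurry_mat s w (curry_mat p w f) $$ (i, y) = f $$ (i, y)"
    using i y d f by (simp add: uncurry_mat_def curry_mat_def)
qed (use f in \<open>auto simp: uncurry_mat_def curry_mat_def\<close>)

lemma curry_uncurry_mat:
  assumes F: "F \<in> carrier_mat (s * w) p"
  shows "curry_mat p w (uncurry_mat s w F) = F"
proof (rule eq_matI)
  fix x k assume "x < dim_row F" "k < dim_col F"
  then have x: "x < s * w" and k: "k < p" using F by auto
  note d = div_mod_less[OF x]
  have "k * w + x mod w < p * w" by (rule mult_add_less[OF k d(2)])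
  then show "curry_mat p w (uncurry_mat s w F) $$ (x, k) = F $$ (x, k)"
    using x k d F by (simp add: uncurry_mat_def curry_mat_def)
qed (use F in \<open>auto simp: uncurry_mat_def curry_mat_def\<close>)

lemma curry_mat_inj:
  assumes "f \<in> carrier_mat s (p * w)" "g \<in> carrier_mat s (p * w)"
  shows "curry_mat p w f = curry_mat p w g \<longleftrightarrow> f = g"
  using uncurry_curry_mat[OF assms(1)] uncurry_curry_mat[OF assms(2)] by metis

lemma curry_mat_add:
  fixes f g :: "'k::field mat"
  assumes "f \<in> carrier_mat s (p * w)" "g \<in> carrier_mat s (p * w)"
  shows "curry_mat p w (f + g) = curry_mat p w f + curry_mat p w g"
proof (rule eq_matI)
  fix x k assume "x < dim_row (curry_mat p w f + curry_mat p w g)" "k < dim_col (curry_mat p w f + curry_mat p w g)"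
  then have x: "x < s * w" and k: "k < p" using assms by (auto simp: curry_mat_def)
  note d = div_mod_less[OF x]
  have "k * w + x mod w < p * w" by (rule mult_add_less[OF k d(2)])
  then show "curry_mat p w (f + g) $$ (x, k) = (curry_mat p w f + curry_mat p w g) $$ (x, k)"
    using x k d assms by (simp add: curry_mat_def)
qed (use assms in \<open>auto simp: curry_mat_def\<close>)

lemma curry_mat_mult_left:
  fixes f Z :: "'k::field mat"
  assumes f: "f \<in> carrier_mat s (p * w)" and Z: "Z \<in> carrier_mat t s"
  shows "curry_mat p w (Z * f) = kron_mat Z (1\<^sub>m w) * curry_mat p w f"
proof (rule eq_matI)
  note C = curry_mat_carrier[OF f]
  fix x k assume "x < dim_row (kron_mat Z (1\<^sub>m w) * curry_mat p w f)" "k < dim_col (kron_mat Z (1\<^sub>m w) * curry_mat p w f)"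
  then have x: "x < t * w" and k: "k < p" using C Z by auto
  note d = div_mod_less[OF x]
  have kw: "k * w + x mod w < p * w" by (rule mult_add_less[OF k d(2)])
  have "(kron_mat Z (1\<^sub>m w) * curry_mat p w f) $$ (x, k)
    = (\<Sum>y = 0..<s * w. kron_mat Z (1\<^sub>m w) $$ (x, y) * curry_mat p w f $$ (y, k))"
    using x k C Z by (simp add: scalar_prod_def)
  also have "\<dots> = (\<Sum>y = 0..<s * w. Z $$ (x div w, y div w) * (if x mod w = y mod w then 1 else 0) *
      f $$ (y div w, k * w + y mod w))"
    using x k Z f d by (intro sum.cong refl) (auto simp: kron_mat_index curry_mat_def div_mod_less)
  also have "\<dots> = (\<Sum>i = 0..<s. \<Sum>j = 0..<w. Z $$ (x div w, i) * (if x mod w = j then 1 else 0) *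
      f $$ (i, k * w + j))"
    by (rule sum_div_mod)
  also have "\<dots> = (\<Sum>i = 0..<s. \<Sum>j = 0..<w. if x mod w = j then Z $$ (x div w, i) * f $$ (i, k * w + j) else 0)"
    by (intro sum.cong refl) auto
  also have "\<dots> = (\<Sum>i = 0..<s. Z $$ (x div w, i) * f $$ (i, k * w + x mod w))"
    using d by (simp add: sum.delta')
  also have "\<dots> = curry_mat p w (Z * f) $$ (x, k)"
    using x k Z f d kw by (simp add: curry_mat_def scalar_prod_def)
  finally show "curry_mat p w (Z * f) $$ (x, k) = (kron_mat Z (1\<^sub>m w) * curry_mat p w f) $$ (x, k)" by simp
qed (use f Z in \<open>auto simp: curry_mat_def\<close>)

text \<open>Naturality in both tensor factors. A map on the second factor turns into its transpose
  on the dual, which is where the transposes in \<open>dual_gens\<close> come from.\<close>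

lemma curry_mat_mult_right:
  fixes f X Y :: "'k::field mat"
  assumes f: "f \<in> carrier_mat s (p * w)" and X: "X \<in> carrier_mat p p'" and Y: "Y \<in> carrier_mat w w'"
  shows "curry_mat p' w' (f * kron_mat X Y) = kron_mat (1\<^sub>m s) (transpose_mat Y) * curry_mat p w f * X"
proof (rule eq_matI)
  note C = curry_mat_carrier[OF f]
  have K: "kron_mat (1\<^sub>m s) (transpose_mat Y) \<in> carrier_mat (s * w') (s * w)"
    using Y by (intro kron_mat_carrier) auto
  have KC: "kron_mat (1\<^sub>m s) (transpose_mat Y) * curry_mat p w f \<in> carrier_mat (s * w') p"
    using K C by auto
  fix x k assume "x < dim_row (kron_mat (1\<^sub>m s) (transpose_mat Y) * curry_mat p w f * X)"
    "k < dim_col (kron_mat (1\<^sub>m s) (transpose_mat Y) * curry_mat p w f * X)"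
  then have x: "x < s * w'" and k: "k < p'" using Y X by auto
  note d = div_mod_less[OF x]
  have kw: "k * w' + x mod w' < p' * w'" by (rule mult_add_less[OF k d(2)])
  have gen: "(M * N) $$ (x, k) = (\<Sum>a = 0..<p. M $$ (x, a) * N $$ (a, k))"
    if "M \<in> carrier_mat (s * w') p" "N \<in> carrier_mat p p'" for M N :: "'k mat"
    using x k that by (simp add: scalar_prod_def)
  have e: "(kron_mat (1\<^sub>m s) (transpose_mat Y) * curry_mat p w f) $$ (x, a)
      = (\<Sum>b = 0..<w. f $$ (x div w', a * w + b) * Y $$ (b, x mod w'))" if a: "a < p" for a
  proof -
    have "(kron_mat (1\<^sub>m s) (transpose_mat Y) * curry_mat p w f) $$ (x, a)
      = (\<Sum>z = 0..<s * w. kron_mat (1\<^sub>m s) (transpose_mat Y) $$ (x, z) * curry_mat p w f $$ (z, a))"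
      using x a C K Y by (simp add: scalar_prod_def)
    also have "\<dots> = (\<Sum>z = 0..<s * w. (if x div w' = z div w then 1 else 0) * Y $$ (z mod w, x mod w') *
        f $$ (z div w, a * w + z mod w))"
      using x a Y f d by (intro sum.cong refl) (auto simp: kron_mat_index curry_mat_def div_mod_less)
    also have "\<dots> = (\<Sum>i = 0..<s. \<Sum>b = 0..<w. (if x div w' = i then 1 else 0) * Y $$ (b, x mod w') *
        f $$ (i, a * w + b))"
      by (rule sum_div_mod)
    also have "\<dots> = (\<Sum>i = 0..<s. if x div w' = i then (\<Sum>b = 0..<w. Y $$ (b, x mod w') * f $$ (i, a * w + b)) else 0)"
      by (intro sum.cong refl) auto
    also have "\<dots> = (\<Sum>b = 0..<w. Y $$ (b, x mod w') * f $$ (x div w', a * w + b))"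
      using d by (simp add: sum.delta')
    finally show ?thesis by (simp add: mult.commute)
  qed
  have "curry_mat p' w' (f * kron_mat X Y) $$ (x, k) = (f * kron_mat X Y) $$ (x div w', k * w' + x mod w')"
    using x k f d by (simp add: curry_mat_def)
  also have "\<dots> = (\<Sum>y = 0..<p * w. f $$ (x div w', (y div w) * w + y mod w) * (X $$ (y div w, k) * Y $$ (y mod w, x mod w')))"
    using kw d f X Y by (simp add: scalar_prod_def kron_mat_index)
  also have "\<dots> = (\<Sum>a = 0..<p. \<Sum>b = 0..<w. f $$ (x div w', a * w + b) * (X $$ (a, k) * Y $$ (b, x mod w')))"
    by (rule sum_div_mod)
  also have "\<dots> = (\<Sum>a = 0..<p. (\<Sum>b = 0..<w. f $$ (x div w', a * w + b) * Y $$ (b, x mod w')) * X $$ (a, k))"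
    by (simp add: sum_distrib_right sum_distrib_left algebra_simps)
  also have "\<dots> = (\<Sum>a = 0..<p. (kron_mat (1\<^sub>m s) (transpose_mat Y) * curry_mat p w f) $$ (x, a) * X $$ (a, k))"
    by (intro sum.cong refl) (simp add: e)
  also have "\<dots> = (kron_mat (1\<^sub>m s) (transpose_mat Y) * curry_mat p w f * X) $$ (x, k)"
    by (rule gen[OF KC X, symmetric])
  finally show "curry_mat p' w' (f * kron_mat X Y) $$ (x, k) =
    (kron_mat (1\<^sub>m s) (transpose_mat Y) * curry_mat p w f * X) $$ (x, k)" .
qed (use f X Y in \<open>auto simp: curry_mat_def\<close>)

text \<open>Serves \<open>a\<close> with its grouplike partner \<open>b\<close>, and
  \<open>d\<close> with \<open>c\<close>: the coproduct x (x) g + 1 (x) x on the left matches the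
  antipode value -x g^(-1) on the right, \<open>I\<close> being the inverse of g. Currying
  multiplies the wanted term by the transpose of \<open>B\<close>; cancelling that invertible factor
  gives the second equation.\<close>

lemma curry_mat_twisted:
  fixes f :: "'k::field mat"
  assumes f: "f \<in> carrier_mat s (p * w)" and As: "As \<in> carrier_mat s s" and Ap: "Ap \<in> carrier_mat p p"
    and B: "B \<in> carrier_mat w w" and I: "I \<in> carrier_mat w w" and Aw: "Aw \<in> carrier_mat w w"
    and inv: "B * I = 1\<^sub>m w" "I * B = 1\<^sub>m w"
  shows "f * (kron_mat Ap B + kron_mat (1\<^sub>m p) Aw) = As * f \<longleftrightarrow>
    curry_mat p w f * Ap = (kron_mat As (transpose_mat I) + kron_mat (1\<^sub>m s) (- transpose_mat (Aw * I))) * curry_mat p w f"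
proof -
  let ?F = "curry_mat p w f" and ?k = "\<lambda>Y. kron_mat (1\<^sub>m s) (transpose_mat Y)"
  note F = curry_mat_carrier[OF f]
  have kc: "?k Y \<in> carrier_mat (s * w) (s * w)" if "Y \<in> carrier_mat w w" for Y :: "'k mat"
    using that by (intro kron_mat_carrier) auto
  have kk: "?k Y * ?k Z = ?k (Z * Y)" if "Y \<in> carrier_mat w w" "Z \<in> carrier_mat w w" for Y Z :: "'k mat"
    using that kron_mat_mult[of "1\<^sub>m s" s s "transpose_mat Y" w w "1\<^sub>m s" s "transpose_mat Z" w]
      transpose_mult[OF that(2,1)] by simp
  have K1: "kron_mat Ap B \<in> carrier_mat (p * w) (p * w)" "kron_mat (1\<^sub>m p) Aw \<in> carrier_mat (p * w) (p * w)"
    using Ap B Aw by (auto intro: kron_mat_carrier)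
  have K2: "kron_mat As (1\<^sub>m w) \<in> carrier_mat (s * w) (s * w)" "kron_mat As (transpose_mat I) \<in> carrier_mat (s * w) (s * w)"
    using As I by (auto intro!: kron_mat_carrier)
  have kAs: "?k I * kron_mat As (1\<^sub>m w) = kron_mat As (transpose_mat I)"
    using kron_mat_mult[of "1\<^sub>m s" s s "transpose_mat I" w w As s "1\<^sub>m w" w] As I by simp
  have k1: "?k (1\<^sub>m w) = 1\<^sub>m (s * w)" by (simp add: kron_mat_one)
  have FA: "?F * Ap \<in> carrier_mat (s * w) p" using F Ap by auto
  have AwI: "Aw * I \<in> carrier_mat w w" using Aw I by auto
  have "f * (kron_mat Ap B + kron_mat (1\<^sub>m p) Aw) = As * f \<longleftrightarrow>
      curry_mat p w (f * kron_mat Ap B + f * kron_mat (1\<^sub>m p) Aw) = curry_mat p w (As * f)"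
    using mult_add_distrib_mat[OF f K1] f K1 As
    by (subst curry_mat_inj[of _ s]) (auto intro!: add_carrier_mat mult_carrier_mat[of _ s "p * w" _ "p * w"])
  also have "\<dots> \<longleftrightarrow> ?k B * ?F * Ap + ?k Aw * ?F = kron_mat As (1\<^sub>m w) * ?F"
  proof -
    have "curry_mat p w (f * kron_mat Ap B + f * kron_mat (1\<^sub>m p) Aw) = ?k B * ?F * Ap + ?k Aw * ?F * 1\<^sub>m p"
      using curry_mat_add[OF mult_carrier_mat[OF f K1(1)] mult_carrier_mat[OF f K1(2)]]
        curry_mat_mult_right[OF f Ap B] curry_mat_mult_right[OF f one_carrier_mat Aw] by simp
    moreover have "?k Aw * ?F * 1\<^sub>m p = ?k Aw * ?F"
      by (rule right_mult_one_mat[OF mult_carrier_mat[OF kc[OF Aw] F]])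
    ultimately show ?thesis using curry_mat_mult_left[OF f As] by simp
  qed
  also have "\<dots> \<longleftrightarrow> ?k I * (?k B * ?F * Ap + ?k Aw * ?F) = ?k I * (kron_mat As (1\<^sub>m w) * ?F)" (is "?l = ?r \<longleftrightarrow> _")
  proof
    assume h: "?k I * ?l = ?k I * ?r"
    have c: "?l \<in> carrier_mat (s * w) p" "?r \<in> carrier_mat (s * w) p"
      using kc[OF B] kc[OF Aw] F Ap K2 by (auto intro!: add_carrier_mat)
    have u: "?k B * (?k I * Z) = Z" if "Z \<in> carrier_mat (s * w) p" for Z
    proof -
      have "?k B * (?k I * Z) = ?k B * ?k I * Z" by (rule assoc_mult_mat[OF kc[OF B] kc[OF I] that, symmetric])
      also have "\<dots> = 1\<^sub>m (s * w) * Z" unfolding kk[OF B I] inv(2) k1 ..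
      finally show ?thesis by (simp only: left_mult_one_mat[OF that])
    qed
    have "?l = ?k B * (?k I * ?l)" using u[OF c(1)] by simp
    also have "\<dots> = ?k B * (?k I * ?r)" by (simp only: h)
    also have "\<dots> = ?r" by (rule u[OF c(2)])
    finally show "?l = ?r" .
  qed simp
  also have "?k I * (?k B * ?F * Ap + ?k Aw * ?F) = ?F * Ap + ?k (Aw * I) * ?F"
  proof -
    have "?k I * (?k B * ?F * Ap + ?k Aw * ?F) = ?k I * (?k B * ?F * Ap) + ?k I * (?k Aw * ?F)"
      by (rule mult_add_distrib_mat[OF kc[OF I] mult_carrier_mat[OF mult_carrier_mat[OF kc[OF B] F] Ap]
            mult_carrier_mat[OF kc[OF Aw] F]])
    also have "?k I * (?k Aw * ?F) = ?k (Aw * I) * ?F"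
      using assoc_mult_mat[OF kc[OF I] kc[OF Aw] F] kk[OF I Aw] by simp
    also have "?k I * (?k B * ?F * Ap) = ?k I * (?k B * (?F * Ap))"
      using assoc_mult_mat[OF kc[OF B] F Ap] by simp
    also have "\<dots> = ?F * Ap"
    proof -
      have "?k I * (?k B * (?F * Ap)) = ?k I * ?k B * (?F * Ap)" by (rule assoc_mult_mat[OF kc[OF I] kc[OF B] FA, symmetric])
      also have "\<dots> = 1\<^sub>m (s * w) * (?F * Ap)" unfolding kk[OF I B] inv(1) k1 ..
      finally show ?thesis by (simp only: left_mult_one_mat[OF FA])
    qed
    finally show ?thesis .
  qed
  also have "?k I * (kron_mat As (1\<^sub>m w) * ?F) = kron_mat As (transpose_mat I) * ?F"
    using assoc_mult_mat[OF kc[OF I] K2(1) F] kAs by simp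
  also have "?F * Ap + ?k (Aw * I) * ?F = kron_mat As (transpose_mat I) * ?F \<longleftrightarrow>
     ?F * Ap = kron_mat As (transpose_mat I) * ?F + - (?k (Aw * I) * ?F)"
  proof -
    have "(X + Y = Z) = (X = Z + - Y)" if "X \<in> carrier_mat i j" "Y \<in> carrier_mat i j" "Z \<in> carrier_mat i j"
      for X Y Z :: "'k mat" and i j
    proof
      assume "X + Y = Z"
      then show "X = Z + - Y" using that by (intro eq_matI) auto
    next
      assume "X = Z + - Y"
      then show "X + Y = Z" using that by (intro eq_matI) auto
    qed
    from this[OF FA mult_carrier_mat[OF kc[OF AwI] F] mult_carrier_mat[OF K2(2) F]] show ?thesis .
  qed
  also have "- (?k (Aw * I) * ?F) = - ?k (Aw * I) * ?F"
    by (rule uminus_mult_left_mat[symmetric]) (simp only: carrier_matD[OF kc[OF AwI]] carrier_matD[OF F])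
  also have "kron_mat As (transpose_mat I) * ?F + - ?k (Aw * I) * ?F =
      (kron_mat As (transpose_mat I) + kron_mat (1\<^sub>m s) (- transpose_mat (Aw * I))) * ?F"
    unfolding kron_mat_uminus_right
    by (rule add_mult_distrib_mat[OF K2(2) _ F, symmetric]) (use kc[OF AwI] in simp)
  finally show ?thesis .
qed

text \<open>The case \<open>Aw = 0\<close> of the previous lemma, in which the second summand of the
  coproduct disappears.\<close>

lemma curry_mat_twisted_grouplike:
  fixes f :: "'k::field mat"
  assumes f: "f \<in> carrier_mat s (p * w)" and As: "As \<in> carrier_mat s s" and Ap: "Ap \<in> carrier_mat p p"
    and B: "B \<in> carrier_mat w w" and I: "I \<in> carrier_mat w w"
    and inv: "B * I = 1\<^sub>m w" "I * B = 1\<^sub>m w"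
  shows "f * kron_mat Ap B = As * f \<longleftrightarrow> curry_mat p w f * Ap = kron_mat As (transpose_mat I) * curry_mat p w f"
proof -
  have 1: "kron_mat Ap B + kron_mat (1\<^sub>m p) (0\<^sub>m w w) = kron_mat Ap B"
    using Ap B by (simp add: kron_mat_zero right_add_zero_mat[OF kron_mat_carrier[OF Ap B]])
  have z: "- transpose_mat (0\<^sub>m w w * I) = (0\<^sub>m w w :: 'k mat)" using I by (intro eq_matI) auto
  have It: "transpose_mat I \<in> carrier_mat w w" using I by simp
  have 2: "kron_mat As (transpose_mat I) + kron_mat (1\<^sub>m s) (- transpose_mat (0\<^sub>m w w * I)) = kron_mat As (transpose_mat I)"
    unfolding z using As I by (simp add: kron_mat_zero right_add_zero_mat[OF kron_mat_carrier[OF As It]])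
  show ?thesis using curry_mat_twisted[OF f As Ap B I zero_carrier_mat inv] unfolding 1 2 .
qed

definition hm_dual :: "nat \<Rightarrow> 'k::field \<Rightarrow> 'k hmod \<Rightarrow> 'k hmod" where
  "hm_dual n q W = hm_of_gens (hm_dim W) (dual_gens n (act n q W))"

lemma hmod_dual:
  assumes "primitive_root_of_unity n q" "is_hmod n q W"
  shows "is_hmod n q (hm_dual n q W)" "act n q (hm_dual n q W) g = dual_gens n (act n q W) g"
    "hm_dim (hm_dual n q W) = hm_dim W"
  using hmod_of_gens[OF gens_rep_dual[OF assms(1) hmod_gens_rep[OF assms(2)]]]
  by (simp_all add: hm_dual_def)

lemma hom_carrier: "X \<in> hm_hom n q M N \<Longrightarrow> X \<in> carrier_mat (hm_dim N) (hm_dim M)"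
  by (simp add: hm_hom_def)

lemma hom_act:
  assumes "X \<in> hm_hom n q M N" shows "X * act n q M g = act n q N g * X"
  using assms by (auto simp: hm_hom_def act_def H_class_carrier)

text \<open>Generator by generator this is one of the two currying lemmas: the twisted one for
  \<open>a\<close> and \<open>d\<close>, the grouplike one for \<open>b\<close> and
  \<open>c\<close>.\<close>

lemma adjunction:
  fixes q :: "'k::field"
  assumes q: "primitive_root_of_unity n q" and P: "is_hmod n q P" and W: "is_hmod n q W" and S: "is_hmod n q S"
    and f: "f \<in> carrier_mat (hm_dim S) (hm_dim P * hm_dim W)"
  shows "f \<in> hm_hom n q (hm_tensor n q P W) S \<longleftrightarrow>
    curry_mat (hm_dim P) (hm_dim W) f \<in> hm_hom n q P (hm_tensor n q S (hm_dual n q W))"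
proof -
  let ?p = "hm_dim P" and ?w = "hm_dim W" and ?s = "hm_dim S" and ?F = "curry_mat (hm_dim P) (hm_dim W) f"
  note T = hmod_tensor[OF q P W] and D = hmod_dual[OF q W]
  note T' = hmod_tensor[OF q S D(1)]
  note c = hmod_eval(2)[OF P] hmod_eval(2)[OF W] hmod_eval(2)[OF S]
  have n: "0 < n" using q by (simp add: primitive_root_of_unity_def)
  note R = hmod_gens_rep[OF W]
  note ib = pow_inverse_mat[OF c(2) gens_repD(8)[OF R] n] and ic = pow_inverse_mat[OF c(2) gens_repD(9)[OF R] n]
  have i: "act n q W g ^\<^sub>m (n - 1) \<in> carrier_mat ?w ?w" for g using c(2) by (simp add: pow_carrier_mat)
  have "f * act n q (hm_tensor n q P W) g = act n q S g * f \<longleftrightarrow>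
      ?F * act n q P g = act n q (hm_tensor n q S (hm_dual n q W)) g * ?F" for g
  proof (cases g)
    case Gen_a
    show ?thesis unfolding Gen_a T(2) T'(2) tensor_gens.simps D dual_gens.simps
      by (rule curry_mat_twisted[OF f c(3) c(1) c(2) i c(2) ib(1,2)])
  next
    case Gen_b
    show ?thesis unfolding Gen_b T(2) T'(2) tensor_gens.simps D dual_gens.simps
      by (rule curry_mat_twisted_grouplike[OF f c(3) c(1) c(2) i ib(1,2)])
  next
    case Gen_c
    show ?thesis unfolding Gen_c T(2) T'(2) tensor_gens.simps D dual_gens.simps
      by (rule curry_mat_twisted_grouplike[OF f c(3) c(1) c(2) i ic(1,2)])
  next
    case Gen_d
    show ?thesis unfolding Gen_d T(2) T'(2) tensor_gens.simps D dual_gens.simps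
      by (rule curry_mat_twisted[OF f c(3) c(1) c(2) i c(2) ic(1,2)])
  qed
  then show ?thesis
    unfolding hom_iff[OF T(1) S] hom_iff[OF P T'(1)] T(3) T'(3) D(3) using f curry_mat_carrier[OF f] by auto
qed

lemma hom_comp:
  assumes "is_hmod n q M" "is_hmod n q N" "is_hmod n q K" "X \<in> hm_hom n q M N" "Y \<in> hm_hom n q N K"
  shows "Y * X \<in> hm_hom n q M K"
proof -
  have X: "X \<in> carrier_mat (hm_dim N) (hm_dim M)" and Y: "Y \<in> carrier_mat (hm_dim K) (hm_dim N)"
    using assms by (auto simp: hm_hom_def)
  note c = hmod_eval(2)[OF assms(1)] hmod_eval(2)[OF assms(2)] hmod_eval(2)[OF assms(3)]
  have "Y * X * act n q M g = act n q K g * (Y * X)" for g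
  proof -
    have "Y * X * act n q M g = Y * (act n q N g * X)"
      using assoc_mult_mat[OF Y X c(1)] hom_act[OF assms(4)] by simp
    also have "\<dots> = (act n q K g * Y) * X"
      using assoc_mult_mat[OF Y c(2) X] hom_act[OF assms(5)] by simp
    also have "\<dots> = act n q K g * (Y * X)" by (rule assoc_mult_mat[OF c(3) Y X])
    finally show ?thesis .
  qed
  then show ?thesis unfolding hom_iff[OF assms(1,3)] using X Y by auto
qed

lemma tensor_hom:
  fixes q :: "'k::field"
  assumes q: "primitive_root_of_unity n q"
    and M: "is_hmod n q M" and M': "is_hmod n q M'" and N: "is_hmod n q N" and N': "is_hmod n q N'"
    and X: "X \<in> hm_hom n q M M'" and Y: "Y \<in> hm_hom n q N N'"
  shows "kron_mat X Y \<in> hm_hom n q (hm_tensor n q M N) (hm_tensor n q M' N')"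
proof -
  note T = hmod_tensor[OF q M N] and T' = hmod_tensor[OF q M' N']
  note Xc = hom_carrier[OF X] and Yc = hom_carrier[OF Y]
  note c = hmod_eval(2)[OF M] hmod_eval(2)[OF N] hmod_eval(2)[OF M'] hmod_eval(2)[OF N']
  have K: "kron_mat X Y \<in> carrier_mat (hm_dim M' * hm_dim N') (hm_dim M * hm_dim N)"
    by (rule kron_mat_carrier[OF Xc Yc])
  have l: "kron_mat X Y * kron_mat A B = kron_mat (X * A) (Y * B)"
    if "A \<in> carrier_mat (hm_dim M) (hm_dim M)" "B \<in> carrier_mat (hm_dim N) (hm_dim N)" for A B
    by (rule kron_mat_mult[OF Xc Yc that])
  have r: "kron_mat A B * kron_mat X Y = kron_mat (A * X) (B * Y)"
    if "A \<in> carrier_mat (hm_dim M') (hm_dim M')" "B \<in> carrier_mat (hm_dim N') (hm_dim N')" for A B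
    by (rule kron_mat_mult[OF that Xc Yc])
  have l2: "kron_mat X Y * (kron_mat A B + kron_mat (1\<^sub>m (hm_dim M)) B') = kron_mat (X * A) (Y * B) + kron_mat X (Y * B')"
    if A: "A \<in> carrier_mat (hm_dim M) (hm_dim M)" and B: "B \<in> carrier_mat (hm_dim N) (hm_dim N)"
      and B': "B' \<in> carrier_mat (hm_dim N) (hm_dim N)" for A B B'
    using mult_add_distrib_mat[OF K kron_mat_carrier[OF A B] kron_mat_carrier[OF one_carrier_mat B']] l[OF A B]
      l[OF one_carrier_mat B'] Xc by simp
  have r2: "(kron_mat A B + kron_mat (1\<^sub>m (hm_dim M')) B') * kron_mat X Y = kron_mat (A * X) (B * Y) + kron_mat X (B' * Y)"
    if A: "A \<in> carrier_mat (hm_dim M') (hm_dim M')" and B: "B \<in> carrier_mat (hm_dim N') (hm_dim N')"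
      and B': "B' \<in> carrier_mat (hm_dim N') (hm_dim N')" for A B B'
    using add_mult_distrib_mat[OF kron_mat_carrier[OF A B] kron_mat_carrier[OF one_carrier_mat B'] K] r[OF A B]
      r[OF one_carrier_mat B'] Xc by simp
  note h = hom_act[OF X] hom_act[OF Y]
  have "kron_mat X Y * act n q (hm_tensor n q M N) g = act n q (hm_tensor n q M' N') g * kron_mat X Y" for g
    unfolding T(2) T'(2)
    by (cases g) (simp_all only: tensor_gens.simps l[OF c(1) c(2)] r[OF c(3) c(4)] l2[OF c(1) c(2) c(2)] r2[OF c(3) c(4) c(4)] h)
  then show ?thesis unfolding hom_iff[OF T(1) T'(1)] T(3) T'(3) using K by auto
qed

lemma hom_id: "is_hmod n q M \<Longrightarrow> 1\<^sub>m (hm_dim M) \<in> hm_hom n q M M"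
  unfolding hom_iff using hmod_eval(2)[of n q M] by (metis left_mult_one_mat one_carrier_mat right_mult_one_mat)

lemma pow_intertwine:
  fixes X :: "'k::field mat"
  assumes X: "X \<in> carrier_mat k m" and A: "A \<in> carrier_mat m m" and B: "B \<in> carrier_mat k k" and h: "X * A = B * X"
  shows "X * A ^\<^sub>m j = B ^\<^sub>m j * X"
proof (induction j)
  case 0
  then show ?case using X A B by simp
next
  case (Suc j)
  note p = pow_carrier_mat[OF A, of j] pow_carrier_mat[OF B, of j]
  have "X * A ^\<^sub>m Suc j = (X * A ^\<^sub>m j) * A" using assoc_mult_mat[OF X p(1) A] by simp
  also have "\<dots> = B ^\<^sub>m j * (X * A)" using assoc_mult_mat[OF p(2) X A] Suc by simp
  also have "\<dots> = B ^\<^sub>m Suc j * X" using assoc_mult_mat[OF p(2) B X] h by simp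
  finally show ?case .
qed

lemma dual_hom:
  fixes q :: "'k::field"
  assumes q: "primitive_root_of_unity n q" and M: "is_hmod n q M" and N: "is_hmod n q N"
    and X: "X \<in> hm_hom n q M N"
  shows "transpose_mat X \<in> hm_hom n q (hm_dual n q N) (hm_dual n q M)"
proof -
  let ?m = "hm_dim M" and ?k = "hm_dim N"
  note D = hmod_dual[OF q M] and D' = hmod_dual[OF q N]
  note Xc = hom_carrier[OF X] and c = hmod_eval(2)[OF M] hmod_eval(2)[OF N]
  note h = hom_act[OF X]
  have p: "act n q M g ^\<^sub>m j \<in> carrier_mat ?m ?m" "act n q N g ^\<^sub>m j \<in> carrier_mat ?k ?k" for g j
    by (rule pow_carrier_mat[OF c(1)], rule pow_carrier_mat[OF c(2)])
  have hp: "X * act n q M g ^\<^sub>m j = act n q N g ^\<^sub>m j * X" for g j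
    by (rule pow_intertwine[OF Xc c(1) c(2) h])
  have ha: "X * (act n q M g * act n q M g' ^\<^sub>m j) = act n q N g * act n q N g' ^\<^sub>m j * X" for g g' j
  proof -
    have "X * (act n q M g * act n q M g' ^\<^sub>m j) = act n q N g * X * act n q M g' ^\<^sub>m j"
      using assoc_mult_mat[OF Xc c(1) p(1)] h by simp
    also have "\<dots> = act n q N g * (act n q N g' ^\<^sub>m j * X)"
      using assoc_mult_mat[OF c(2) Xc p(1)] hp by simp
    also have "\<dots> = act n q N g * act n q N g' ^\<^sub>m j * X"
      using assoc_mult_mat[OF c(2) p(2) Xc] by simp
    finally show ?thesis .
  qed
  have t: "transpose_mat X * transpose_mat B = transpose_mat A * transpose_mat X"
    if "A \<in> carrier_mat ?m ?m" "B \<in> carrier_mat ?k ?k" "X * A = B * X" for A B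
    using transpose_mult[OF that(2) Xc] transpose_mult[OF Xc that(1)] that(3) by simp
  have t': "transpose_mat X * - transpose_mat B = - transpose_mat A * transpose_mat X"
    if "A \<in> carrier_mat ?m ?m" "B \<in> carrier_mat ?k ?k" "X * A = B * X" for A B
    using t[OF that] that(1,2) Xc by simp
  have "transpose_mat X * act n q (hm_dual n q N) g = act n q (hm_dual n q M) g * transpose_mat X" for g
    unfolding D(2) D'(2)
    by (cases g) (auto intro!: t t' hp ha p mult_carrier_mat[OF c(1) p(1)] mult_carrier_mat[OF c(2) p(2)]
        simp del: uminus_mult_left_mat uminus_mult_right_mat)
  then show ?thesis unfolding hom_iff[OF D'(1) D(1)] D(3) D'(3) using Xc by auto
qed

text \<open>The section is only linear. Unlike surjectivity itself it is visibly inherited by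
  Kronecker products and transposes.\<close>

lemma surj_right_inverse:
  fixes X :: "'k::field mat"
  assumes X: "X \<in> carrier_mat k m" and s: "\<And>w. w \<in> carrier_vec k \<Longrightarrow> \<exists>v\<in>carrier_vec m. X *\<^sub>v v = w"
  shows "\<exists>Y\<in>carrier_mat m k. X * Y = 1\<^sub>m k"
proof -
  have "\<forall>j. \<exists>v\<in>carrier_vec m. X *\<^sub>v v = unit_vec k j" using s by simp
  then obtain v where v: "\<And>j. v j \<in> carrier_vec m" "\<And>j. X *\<^sub>v v j = unit_vec k j" by metis
  define Y where "Y = mat m k (\<lambda>(i, j). v j $ i)"
  have Y: "Y \<in> carrier_mat m k" by (simp add: Y_def)
  have col: "col Y j = v j" if "j < k" for j
    using v(1)[of j] that by (auto simp: Y_def)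
  have "X * Y = 1\<^sub>m k"
  proof (rule eq_matI)
    fix i j assume "i < dim_row (1\<^sub>m k :: 'k mat)" "j < dim_col (1\<^sub>m k :: 'k mat)"
    then have i: "i < k" and j: "j < k" by auto
    have "(X * Y) $$ (i, j) = (X *\<^sub>v v j) $ i" using i j X Y col by simp
    then show "(X * Y) $$ (i, j) = (1\<^sub>m k :: 'k mat) $$ (i, j)" using v(2) i j by simp
  qed (use X Y in auto)
  then show ?thesis using Y by blast
qed

lemma right_inverse_surj:
  fixes X :: "'k::field mat"
  assumes "X \<in> carrier_mat k m" "Y \<in> carrier_mat m k" "X * Y = 1\<^sub>m k" "w \<in> carrier_vec k"
  shows "\<exists>v\<in>carrier_vec m. X *\<^sub>v v = w"
  using assoc_mult_mat_vec[OF assms(1,2,4)] assms by (intro bexI[of _ "Y *\<^sub>v w"]) auto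

section \<open>Projectivity of tensor products and extension of homomorphisms\<close>

lemma projective_lift:
  assumes "hm_projective n q P" "is_hmod n q M" "is_hmod n q N" "g \<in> hm_hom n q M N"
    and "Y \<in> carrier_mat (hm_dim M) (hm_dim N)" "g * Y = 1\<^sub>m (hm_dim N)" "f \<in> hm_hom n q P N"
  shows "\<exists>F\<in>hm_hom n q P M. g * F = f"
proof -
  have "hm_surj M N g"
    unfolding hm_surj_def using right_inverse_surj[OF hom_carrier[OF assms(4)] assms(5,6)] by blast
  then show ?thesis using assms unfolding hm_projective_def by blast
qed

text \<open>Homomorphisms from P (x) W to N correspond to those from P to N tensored with the dual
  of W, and tensoring with that dual keeps \<open>g\<close> surjective, as a linear section of
  \<open>g\<close> shows.\<close>

lemma projective_tensor:
  fixes q :: "'k::field"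
  assumes q: "primitive_root_of_unity n q" and Pp: "hm_projective n q P" and W: "is_hmod n q W"
  shows "hm_projective n q (hm_tensor n q P W)"
proof -
  have P: "is_hmod n q P" using Pp by (simp add: hm_projective_def)
  note T = hmod_tensor[OF q P W] and D = hmod_dual[OF q W]
  let ?p = "hm_dim P" and ?w = "hm_dim W"
  have "\<exists>f'\<in>hm_hom n q (hm_tensor n q P W) M. g * f' = f"
    if M: "is_hmod n q M" and N: "is_hmod n q N" and g: "g \<in> hm_hom n q M N" and s: "hm_surj M N g"
      and f: "f \<in> hm_hom n q (hm_tensor n q P W) N" for M N g f
  proof -
    note gc = hom_carrier[OF g]
    have fc: "f \<in> carrier_mat (hm_dim N) (?p * ?w)" using hom_carrier[OF f] T(3) by simp
    obtain Y where Y: "Y \<in> carrier_mat (hm_dim M) (hm_dim N)" "g * Y = 1\<^sub>m (hm_dim N)"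
      using surj_right_inverse[OF gc] s unfolding hm_surj_def by blast
    note TM = hmod_tensor[OF q M D(1)] and TN = hmod_tensor[OF q N D(1)]
    have h: "kron_mat g (1\<^sub>m ?w) \<in> hm_hom n q (hm_tensor n q M (hm_dual n q W)) (hm_tensor n q N (hm_dual n q W))"
      using tensor_hom[OF q M N D(1) D(1) g hom_id[OF D(1)]] D(3) by simp
    have i: "kron_mat g (1\<^sub>m ?w) * kron_mat Y (1\<^sub>m ?w) = 1\<^sub>m (hm_dim N * ?w)"
      using kron_mat_mult[OF gc one_carrier_mat Y(1) one_carrier_mat] Y(2) by (simp add: kron_mat_one)
    have "\<exists>F\<in>hm_hom n q P (hm_tensor n q M (hm_dual n q W)). kron_mat g (1\<^sub>m ?w) * F = curry_mat ?p ?w f"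
    proof (rule projective_lift[OF Pp TM(1) TN(1) h])
      show "kron_mat Y (1\<^sub>m ?w) \<in> carrier_mat (hm_dim (hm_tensor n q M (hm_dual n q W))) (hm_dim (hm_tensor n q N (hm_dual n q W)))"
        unfolding TM(3) TN(3) D(3) by (rule kron_mat_carrier[OF Y(1) one_carrier_mat])
      show "kron_mat g (1\<^sub>m ?w) * kron_mat Y (1\<^sub>m ?w) = 1\<^sub>m (hm_dim (hm_tensor n q N (hm_dual n q W)))"
        unfolding TN(3) D(3) by (rule i)
      show "curry_mat ?p ?w f \<in> hm_hom n q P (hm_tensor n q N (hm_dual n q W))"
        using adjunction[OF q P W N fc] f by blast
    qed
    then obtain F where F: "F \<in> hm_hom n q P (hm_tensor n q M (hm_dual n q W))"
      "kron_mat g (1\<^sub>m ?w) * F = curry_mat ?p ?w f" by blast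
    have Fc: "F \<in> carrier_mat (hm_dim M * ?w) ?p" using hom_carrier[OF F(1)] TM(3) D(3) by simp
    let ?f' = "uncurry_mat (hm_dim M) ?w F"
    note f'c = uncurry_mat_carrier[OF Fc]
    have "?f' \<in> hm_hom n q (hm_tensor n q P W) M"
      using adjunction[OF q P W M f'c] curry_uncurry_mat[OF Fc] F(1) by simp
    moreover have "curry_mat ?p ?w (g * ?f') = curry_mat ?p ?w f"
      using curry_mat_mult_left[OF f'c gc] curry_uncurry_mat[OF Fc] F(2) by simp
    then have "g * ?f' = f" using curry_mat_inj[OF mult_carrier_mat[OF gc f'c] fc] by simp
    ultimately show ?thesis by blast
  qed
  then show ?thesis unfolding hm_projective_def using T(1) by blast
qed

text \<open>Restriction along \<open>i\<close> is a surjective homomorphism from Hom(W, S) to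
  Hom(W1, S), and the curried \<open>f\<close> lifts along it because P is projective. Thus a
  homomorphism on the submodule P (x) W1 extends, whatever the target.\<close>

lemma hom_extension:
  fixes q :: "'k::field"
  assumes q: "primitive_root_of_unity n q" and Pp: "hm_projective n q P"
    and W: "is_hmod n q W" and W1: "is_hmod n q W1" and S: "is_hmod n q S"
    and i: "i \<in> hm_hom n q W1 W" and r: "r \<in> carrier_mat (hm_dim W1) (hm_dim W)" "r * i = 1\<^sub>m (hm_dim W1)"
    and f: "f \<in> hm_hom n q (hm_tensor n q P W1) S"
  shows "\<exists>f'\<in>hm_hom n q (hm_tensor n q P W) S. f' * kron_mat (1\<^sub>m (hm_dim P)) i = f"
proof -
  have P: "is_hmod n q P" using Pp by (simp add: hm_projective_def)
  note D = hmod_dual[OF q W]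
  note T1 = hmod_tensor[OF q P W1] and D1 = hmod_dual[OF q W1]
  note TS = hmod_tensor[OF q S D(1)] and TS1 = hmod_tensor[OF q S D1(1)]
  let ?p = "hm_dim P" and ?w = "hm_dim W" and ?w1 = "hm_dim W1" and ?s = "hm_dim S"
  note ic = hom_carrier[OF i]
  have fc: "f \<in> carrier_mat ?s (?p * ?w1)" using hom_carrier[OF f] T1(3) by simp
  let ?g = "kron_mat (1\<^sub>m ?s) (transpose_mat i)"
  have h: "?g \<in> hm_hom n q (hm_tensor n q S (hm_dual n q W)) (hm_tensor n q S (hm_dual n q W1))"
    by (rule tensor_hom[OF q S S D(1) D1(1) hom_id[OF S] dual_hom[OF q W1 W i]])
  have ir: "transpose_mat i * transpose_mat r = 1\<^sub>m ?w1"
    using transpose_mult[OF r(1) ic] r(2) by (metis transpose_one)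
  have "?g * kron_mat (1\<^sub>m ?s) (transpose_mat r) = 1\<^sub>m (?s * ?w1)"
    using kron_mat_mult[of "1\<^sub>m ?s" ?s ?s "transpose_mat i" ?w1 ?w "1\<^sub>m ?s" ?s "transpose_mat r" ?w1]
      ir r(1) ic by (simp add: kron_mat_one)
  then have "\<exists>F\<in>hm_hom n q P (hm_tensor n q S (hm_dual n q W)). ?g * F = curry_mat ?p ?w1 f"
  proof (intro projective_lift[OF Pp TS(1) TS1(1) h])
    show "kron_mat (1\<^sub>m ?s) (transpose_mat r) \<in> carrier_mat (hm_dim (hm_tensor n q S (hm_dual n q W))) (hm_dim (hm_tensor n q S (hm_dual n q W1)))"
      unfolding TS(3) TS1(3) D(3) D1(3) by (rule kron_mat_carrier) (use r in auto)
    show "curry_mat ?p ?w1 f \<in> hm_hom n q P (hm_tensor n q S (hm_dual n q W1))"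
      using adjunction[OF q P W1 S fc] f by blast
  qed (simp add: TS1(3) D1(3))
  then obtain F where F: "F \<in> hm_hom n q P (hm_tensor n q S (hm_dual n q W))" "?g * F = curry_mat ?p ?w1 f" by blast
  have Fc: "F \<in> carrier_mat (?s * ?w) ?p" using hom_carrier[OF F(1)] TS(3) D(3) by simp
  let ?f' = "uncurry_mat ?s ?w F"
  note f'c = uncurry_mat_carrier[OF Fc]
  have hom: "?f' \<in> hm_hom n q (hm_tensor n q P W) S"
    using adjunction[OF q P W S f'c] curry_uncurry_mat[OF Fc] F(1) by simp
  have K: "kron_mat (1\<^sub>m ?p) i \<in> carrier_mat (?p * ?w) (?p * ?w1)" by (rule kron_mat_carrier[OF one_carrier_mat ic])
  have gF: "?g * F \<in> carrier_mat (?s * ?w1) ?p" using F(2) curry_mat_carrier[OF fc] by simp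
  have "curry_mat ?p ?w1 (?f' * kron_mat (1\<^sub>m ?p) i) = ?g * F * 1\<^sub>m ?p"
    using curry_mat_mult_right[OF f'c one_carrier_mat ic] curry_uncurry_mat[OF Fc] by simp
  also have "\<dots> = curry_mat ?p ?w1 f" using F(2) right_mult_one_mat[OF gF] by simp
  finally have "?f' * kron_mat (1\<^sub>m ?p) i = f"
    using curry_mat_inj[OF mult_carrier_mat[OF f'c K] fc] by simp
  then show ?thesis using hom by blast
qed

section \<open>Tops of modules\<close>

text \<open>The zero module qualifies; where a quotient has to be nonzero, a vector with nonzero
  image is supplied.\<close>

definition hm_simple :: "nat \<Rightarrow> 'k::field \<Rightarrow> 'k hmod \<Rightarrow> bool" where
  "hm_simple n q S \<longleftrightarrow> is_hmod n q S \<and>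
     (\<forall>U. hm_submodule n q S U \<longrightarrow> (\<exists>u\<in>U. u \<noteq> 0\<^sub>v (hm_dim S)) \<longrightarrow> U = carrier_vec (hm_dim S))"

definition superfluous :: "nat \<Rightarrow> 'k::field \<Rightarrow> 'k hmod \<Rightarrow> 'k vec set \<Rightarrow> bool" where
  "superfluous n q P K \<longleftrightarrow> (\<forall>U. hm_submodule n q P U \<and>
     {u + v | u v. u \<in> U \<and> v \<in> K} = carrier_vec (hm_dim P) \<longrightarrow> U = carrier_vec (hm_dim P))"

text \<open>A projective cover without the demand that the source be projective. It covers three
  uses: Q(l,r) over V(l,r), the given \<open>P\<close>, and V(n,s) over itself.\<close>

definition essential_epi :: "nat \<Rightarrow> 'k::field \<Rightarrow> 'k hmod \<Rightarrow> 'k hmod \<Rightarrow> bool" where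
  "essential_epi n q P S \<longleftrightarrow> is_hmod n q P \<and>
     (\<exists>p\<in>hm_hom n q P S. hm_surj P S p \<and> superfluous n q P (hm_kernel P S p))"

text \<open>Surjectivity onto the product of the targets without forming a direct sum; indexing by a
  set allows one target to be exchanged at a time.\<close>

definition joint_surj :: "'k::field hmod \<Rightarrow> 'i set \<Rightarrow> ('i \<Rightarrow> 'k hmod) \<Rightarrow> ('i \<Rightarrow> 'k mat) \<Rightarrow> bool" where
  "joint_surj M I S f \<longleftrightarrow> (\<forall>y. (\<forall>i\<in>I. y i \<in> carrier_vec (hm_dim (S i))) \<longrightarrow>
     (\<exists>x\<in>carrier_vec (hm_dim M). \<forall>i\<in>I. f i *\<^sub>v x = y i))"

definition maps_onto :: "nat \<Rightarrow> 'k::field \<Rightarrow> 'k hmod \<Rightarrow> 'k hmod list \<Rightarrow> bool" where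
  "maps_onto n q M Ss \<longleftrightarrow> (\<exists>f. (\<forall>i<length Ss. f i \<in> hm_hom n q M (Ss ! i)) \<and>
     joint_surj M {..<length Ss} (\<lambda>i. Ss ! i) f)"

lemma joint_surjD:
  "joint_surj M I S f \<Longrightarrow> (\<And>i. i \<in> I \<Longrightarrow> y i \<in> carrier_vec (hm_dim (S i))) \<Longrightarrow>
   \<exists>x\<in>carrier_vec (hm_dim M). \<forall>i\<in>I. f i *\<^sub>v x = y i"
  by (simp add: joint_surj_def)

lemma vec_add_diff_cancel:
  fixes u v :: "'k::field vec"
  shows "u \<in> carrier_vec k \<Longrightarrow> v \<in> carrier_vec k \<Longrightarrow> u + (v - u) = v"
  by (intro eq_vecI) auto

lemma hmod_act_carrier:
  "is_hmod n q M \<Longrightarrow> h \<in> carrier (H_alg n q) \<Longrightarrow> hm_act M h \<in> carrier_mat (hm_dim M) (hm_dim M)"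
  by (auto simp: H_class_carrier hmod_eval(1))

lemma hom_act_any:
  "X \<in> hm_hom n q M N \<Longrightarrow> h \<in> carrier (H_alg n q) \<Longrightarrow> X * hm_act M h = hm_act N h * X"
  by (simp add: hm_hom_def)

lemma hom_act_vec:
  fixes M :: "'k::field hmod"
  assumes "is_hmod n q M" "is_hmod n q N" "X \<in> hm_hom n q M N" "h \<in> carrier (H_alg n q)" "v \<in> carrier_vec (hm_dim M)"
  shows "X *\<^sub>v (hm_act M h *\<^sub>v v) = hm_act N h *\<^sub>v (X *\<^sub>v v)"
proof -
  note X = hom_carrier[OF assms(3)] and c = hmod_act_carrier[OF assms(1,4)] hmod_act_carrier[OF assms(2,4)]
  have "X *\<^sub>v (hm_act M h *\<^sub>v v) = (X * hm_act M h) *\<^sub>v v"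
    by (rule assoc_mult_mat_vec[OF X c(1) assms(5), symmetric])
  also have "\<dots> = hm_act N h *\<^sub>v (X *\<^sub>v v)"
    unfolding hom_act_any[OF assms(3,4)] by (rule assoc_mult_mat_vec[OF c(2) X assms(5)])
  finally show ?thesis .
qed

definition common_kernel :: "'k::field hmod \<Rightarrow> 'i set \<Rightarrow> ('i \<Rightarrow> 'k hmod) \<Rightarrow> ('i \<Rightarrow> 'k mat) \<Rightarrow> 'k vec set" where
  "common_kernel M I S f = {x \<in> carrier_vec (hm_dim M). \<forall>i\<in>I. f i *\<^sub>v x = 0\<^sub>v (hm_dim (S i))}"

lemma common_kernel_submodule:
  fixes M :: "'k::field hmod"
  assumes M: "is_hmod n q M" and S: "\<And>i. i \<in> I \<Longrightarrow> is_hmod n q (S i)"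
    and f: "\<And>i. i \<in> I \<Longrightarrow> f i \<in> hm_hom n q M (S i)"
  shows "hm_submodule n q M (common_kernel M I S f)"
proof -
  have c: "f i \<in> carrier_mat (hm_dim (S i)) (hm_dim M)" if "i \<in> I" for i by (rule hom_carrier[OF f[OF that]])
  have z: "X *\<^sub>v 0\<^sub>v j = 0\<^sub>v k" if "X \<in> carrier_mat k j" for X :: "'k mat" and j k
    using that by (intro eq_vecI) auto
  show ?thesis
    unfolding hm_submodule_def common_kernel_def
  proof (safe, goal_cases)
    case (4 u v i)
    then show ?case using mult_add_distrib_mat_vec[OF c[of i], of u v] by simp
  next
    case (5 h u)
    then show ?case using hmod_act_carrier[OF M, of h] by auto
  next
    case (6 h u i)
    then show ?case using hom_act_vec[OF M S[of i] f[of i], of h u] z[OF hmod_act_carrier[OF S[of i], of h]] by simp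
  qed (use z[OF c] in auto)
qed

lemma image_submodule:
  fixes M :: "'k::field hmod"
  assumes M: "is_hmod n q M" and N: "is_hmod n q N" and F: "F \<in> hm_hom n q M N" and U: "hm_submodule n q M U"
  shows "hm_submodule n q N ((\<lambda>x. F *\<^sub>v x) ` U)"
proof -
  note Fc = hom_carrier[OF F]
  have u: "U \<subseteq> carrier_vec (hm_dim M)" "0\<^sub>v (hm_dim M) \<in> U" "\<And>x y. x \<in> U \<Longrightarrow> y \<in> U \<Longrightarrow> x + y \<in> U"
    "\<And>h x. h \<in> carrier (H_alg n q) \<Longrightarrow> x \<in> U \<Longrightarrow> hm_act M h *\<^sub>v x \<in> U"
    using U by (auto simp: hm_submodule_def)
  have z: "F *\<^sub>v 0\<^sub>v (hm_dim M) = 0\<^sub>v (hm_dim N)" using Fc by (intro eq_vecI) auto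
  show ?thesis
    unfolding hm_submodule_def
  proof (intro conjI ballI)
    show "(\<lambda>x. F *\<^sub>v x) ` U \<subseteq> carrier_vec (hm_dim N)" using u(1) Fc by auto
    show "0\<^sub>v (hm_dim N) \<in> (\<lambda>x. F *\<^sub>v x) ` U" using u(2) z by (metis imageI)
  next
    fix a b :: "'k vec" assume "a \<in> (\<lambda>x. F *\<^sub>v x) ` U" "b \<in> (\<lambda>x. F *\<^sub>v x) ` U"
    then obtain x y where xy: "x \<in> U" "y \<in> U" "a = F *\<^sub>v x" "b = F *\<^sub>v y" by blast
    then have "a + b = F *\<^sub>v (x + y)" using mult_add_distrib_mat_vec[OF Fc] u(1) by (metis subsetD)
    then show "a + b \<in> (\<lambda>x. F *\<^sub>v x) ` U" using u(3) xy by blast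
  next
    fix h and a :: "'k vec" assume h: "h \<in> carrier (H_alg n q)" and "a \<in> (\<lambda>x. F *\<^sub>v x) ` U"
    then obtain x where x: "x \<in> U" "a = F *\<^sub>v x" by blast
    then have "hm_act N h *\<^sub>v a = F *\<^sub>v (hm_act M h *\<^sub>v x)"
      using hom_act_vec[OF M N F h] u(1) by auto
    then show "hm_act N h *\<^sub>v a \<in> (\<lambda>x. F *\<^sub>v x) ` U" using u(4)[OF h x(1)] by blast
  qed
qed

section \<open>Joint surjectivity onto simple modules and onto their covers\<close>

lemma joint_surj_reindex:
  fixes M :: "'k::field hmod"
  assumes "joint_surj M I S f" "inj_on h J" "h ` J \<subseteq> I"
  shows "joint_surj M J (\<lambda>j. S (h j)) (\<lambda>j. f (h j))"
  unfolding joint_surj_def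
proof (intro allI impI)
  fix y :: "_ \<Rightarrow> 'k vec" assume y: "\<forall>j\<in>J. y j \<in> carrier_vec (hm_dim (S (h j)))"
  define y' where "y' i = (if i \<in> h ` J then y (inv_into J h i) else 0\<^sub>v (hm_dim (S i)))" for i
  have e: "y' (h j) = y j" if "j \<in> J" for j using that assms(2) by (simp add: y'_def)
  have "y' i \<in> carrier_vec (hm_dim (S i))" if "i \<in> I" for i
    using e y by (cases "i \<in> h ` J") (auto simp: y'_def)
  from joint_surjD[OF assms(1) this] obtain x where "x \<in> carrier_vec (hm_dim M)" "\<forall>i\<in>I. f i *\<^sub>v x = y' i" by blast
  then show "\<exists>x\<in>carrier_vec (hm_dim M). \<forall>j\<in>J. f (h j) *\<^sub>v x = y j" using e assms(3) by (metis image_subset_iff)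
qed

lemma maps_onto_perm:
  fixes M :: "'k::field hmod"
  assumes "maps_onto n q M Ss" "mset Ts = mset Ss"
  shows "maps_onto n q M Ts"
proof -
  obtain p where p: "p permutes {..<length Ss}" "permute_list p Ss = Ts"
    using mset_eq_permutation[OF assms(2)] by blast
  have l: "length Ts = length Ss" using p(2) by auto
  have nth: "Ts ! i = Ss ! p i" if "i < length Ss" for i using permute_list_nth[OF p(1) that] p(2) by simp
  have pi: "p i < length Ss" if "i < length Ss" for i using permutes_in_image[OF p(1), of i] that by simp
  obtain f where f: "\<And>i. i < length Ss \<Longrightarrow> f i \<in> hm_hom n q M (Ss ! i)" "joint_surj M {..<length Ss} (\<lambda>i. Ss ! i) f"
    using assms(1) by (auto simp: maps_onto_def)
  have "joint_surj M {..<length Ss} (\<lambda>j. Ss ! p j) (\<lambda>j. f (p j))"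
    by (rule joint_surj_reindex[OF f(2)]) (use pi permutes_inj_on[OF p(1)] in auto)
  then have "joint_surj M {..<length Ts} (\<lambda>j. Ts ! j) (\<lambda>j. f (p j))"
    unfolding joint_surj_def l by (simp add: nth)
  moreover have "\<forall>i<length Ts. f (p i) \<in> hm_hom n q M (Ts ! i)" using f(1) pi nth l by simp
  ultimately show ?thesis unfolding maps_onto_def by (intro exI[of _ "\<lambda>j. f (p j)"] conjI)
qed

lemma maps_onto_surj:
  fixes M :: "'k::field hmod"
  assumes M: "is_hmod n q M" and M': "is_hmod n q M'" and r: "r \<in> hm_hom n q M' M" and s: "hm_surj M' M r"
    and o: "maps_onto n q M Ss" and S: "\<And>S. S \<in> set Ss \<Longrightarrow> is_hmod n q S"
  shows "maps_onto n q M' Ss"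
proof -
  obtain f where f: "\<And>i. i < length Ss \<Longrightarrow> f i \<in> hm_hom n q M (Ss ! i)" "joint_surj M {..<length Ss} (\<lambda>i. Ss ! i) f"
    using o by (auto simp: maps_onto_def)
  have hom: "\<forall>i<length Ss. f i * r \<in> hm_hom n q M' (Ss ! i)"
    using hom_comp[OF M' M S r f(1)] by simp
  have "joint_surj M' {..<length Ss} (\<lambda>i. Ss ! i) (\<lambda>i. f i * r)"
    unfolding joint_surj_def
  proof (intro allI impI)
    fix y :: "_ \<Rightarrow> 'k vec" assume "\<forall>i\<in>{..<length Ss}. y i \<in> carrier_vec (hm_dim (Ss ! i))"
    then obtain x where x: "x \<in> carrier_vec (hm_dim M)" "\<forall>i\<in>{..<length Ss}. f i *\<^sub>v x = y i"
      using joint_surjD[OF f(2), of y] by blast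
    obtain x' where x': "x' \<in> carrier_vec (hm_dim M')" "r *\<^sub>v x' = x" using s x(1) unfolding hm_surj_def by blast
    have "\<forall>i\<in>{..<length Ss}. (f i * r) *\<^sub>v x' = y i"
      using assoc_mult_mat_vec[OF hom_carrier[OF f(1)] hom_carrier[OF r] x'(1)] x x' by simp
    then show "\<exists>x\<in>carrier_vec (hm_dim M'). \<forall>i\<in>{..<length Ss}. (f i * r) *\<^sub>v x = y i" using x'(1) by blast
  qed
  then show ?thesis using hom unfolding maps_onto_def by (intro exI[of _ "\<lambda>i. f i * r"] conjI)
qed

text \<open>The common kernel of the first K maps contains \<open>x K\<close>, which the next map
  does not kill. Its image there is a nonzero submodule of a simple module, hence everything, so the
  last value can be corrected without disturbing the earlier ones.\<close>

lemma joint_surj_triangular: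
  fixes M :: "'k::field hmod" and K :: nat
  assumes M: "is_hmod n q M"
    and S: "\<And>k. k < K \<Longrightarrow> hm_simple n q (S k)" and f: "\<And>k. k < K \<Longrightarrow> f k \<in> hm_hom n q M (S k)"
    and x: "\<And>k. k < K \<Longrightarrow> x k \<in> carrier_vec (hm_dim M)"
    and diag: "\<And>k. k < K \<Longrightarrow> f k *\<^sub>v x k \<noteq> 0\<^sub>v (hm_dim (S k))"
    and tri: "\<And>j k. j < k \<Longrightarrow> k < K \<Longrightarrow> f j *\<^sub>v x k = 0\<^sub>v (hm_dim (S j))"
  shows "joint_surj M {..<K} S f"
  using assms
proof (induction K)
  case 0
  show ?case unfolding joint_surj_def by (intro allI impI bexI[of _ "0\<^sub>v (hm_dim M)"]) auto
next
  case (Suc K)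
  have Sm: "is_hmod n q (S k)" if "k < Suc K" for k using Suc.prems(2)[OF that] by (simp add: hm_simple_def)
  let ?U = "common_kernel M {..<K} S f" and ?d = "hm_dim (S K)"
  note fK = Suc.prems(3)[of K, simplified]
  have "hm_submodule n q M ?U"
    by (rule common_kernel_submodule[OF M]) (use Sm Suc.prems in auto)
  note sub = image_submodule[OF M Sm[of K] fK this]
  have "x K \<in> ?U" using Suc.prems(4)[of K] Suc.prems(6)[of _ K] by (auto simp: common_kernel_def)
  then have ne: "\<exists>u\<in>(\<lambda>x. f K *\<^sub>v x) ` ?U. u \<noteq> 0\<^sub>v ?d" using Suc.prems(5)[of K] by blast
  have all: "(\<lambda>x. f K *\<^sub>v x) ` ?U = carrier_vec ?d"
    using Suc.prems(2)[of K] sub ne unfolding hm_simple_def by blast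
  show ?case
    unfolding joint_surj_def
  proof (intro allI impI)
    fix y :: "_ \<Rightarrow> 'k vec" assume y: "\<forall>i\<in>{..<Suc K}. y i \<in> carrier_vec (hm_dim (S i))"
    have "joint_surj M {..<K} S f" by (rule Suc.IH) (use Suc.prems in auto)
    then obtain x0 where x0: "x0 \<in> carrier_vec (hm_dim M)" "\<forall>i\<in>{..<K}. f i *\<^sub>v x0 = y i"
      using joint_surjD[of M "{..<K}" S f y] y by auto
    have yK: "y K \<in> carrier_vec ?d" using y by simp
    have fx0: "f K *\<^sub>v x0 \<in> carrier_vec ?d" using x0(1) hom_carrier[OF fK] by auto
    have "y K - f K *\<^sub>v x0 \<in> carrier_vec ?d" using yK fx0 by simp
    then obtain x1 where x1: "x1 \<in> ?U" "f K *\<^sub>v x1 = y K - f K *\<^sub>v x0" using all by (metis imageE)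
    have x1c: "x1 \<in> carrier_vec (hm_dim M)" using x1(1) by (simp add: common_kernel_def)
    have "f i *\<^sub>v (x0 + x1) = y i" if i: "i < Suc K" for i
    proof -
      have "f i *\<^sub>v (x0 + x1) = f i *\<^sub>v x0 + f i *\<^sub>v x1"
        by (rule mult_add_distrib_mat_vec[OF hom_carrier[OF Suc.prems(3)[OF i]] x0(1) x1c])
      also have "\<dots> = y i"
      proof (cases "i = K")
        case True
        have "f K *\<^sub>v x0 + (y K - f K *\<^sub>v x0) = y K" by (rule vec_add_diff_cancel[OF fx0 yK])
        then show ?thesis using True x1(2) by simp
      next
        case False
        then have "f i *\<^sub>v x0 = y i" "f i *\<^sub>v x1 = 0\<^sub>v (hm_dim (S i))" "y i \<in> carrier_vec (hm_dim (S i))"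
          using i x0 x1(1) y by (auto simp: common_kernel_def)
        then show ?thesis by simp
      qed
      finally show ?thesis .
    qed
    then show "\<exists>x\<in>carrier_vec (hm_dim M). \<forall>i\<in>{..<Suc K}. f i *\<^sub>v x = y i"
      using x0(1) x1c by (intro bexI[of _ "x0 + x1"]) auto
  qed
qed

lemma joint_surj_lift:
  fixes M :: "'k::field hmod"
  assumes M: "is_hmod n q M" and S: "\<And>i. i \<in> I \<Longrightarrow> is_hmod n q (S i)" and f: "\<And>i. i \<in> I \<Longrightarrow> f i \<in> hm_hom n q M (S i)"
    and js: "joint_surj M I S f" and j: "j \<in> I" and P: "is_hmod n q P"
    and p: "p \<in> hm_hom n q P (S j)" and sf: "superfluous n q P (hm_kernel P (S j) p)"
    and F: "F \<in> hm_hom n q M P" and pF: "p * F = f j"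
  shows "joint_surj M I (S(j := P)) (f(j := F))"
proof -
  let ?U = "common_kernel M (I - {j}) S f"
  note Fc = hom_carrier[OF F] and pc = hom_carrier[OF p]
  have "hm_submodule n q M ?U" by (rule common_kernel_submodule[OF M]) (use S f in auto)
  note sub = image_submodule[OF M P F this]
  have "{u + v | u v. u \<in> (\<lambda>x. F *\<^sub>v x) ` ?U \<and> v \<in> hm_kernel P (S j) p} = carrier_vec (hm_dim P)" (is "?L = _")
  proof (intro Set.equalityI subsetI)
    fix w assume "w \<in> ?L"
    then show "w \<in> carrier_vec (hm_dim P)" using Fc by (auto simp: hm_kernel_def common_kernel_def)
  next
    fix w :: "'k vec" assume w: "w \<in> carrier_vec (hm_dim P)"
    define y where "y i = (if i = j then p *\<^sub>v w else 0\<^sub>v (hm_dim (S i)))" for i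
    have "y i \<in> carrier_vec (hm_dim (S i))" if "i \<in> I" for i using pc w by (auto simp: y_def)
    from joint_surjD[OF js this] obtain x where x: "x \<in> carrier_vec (hm_dim M)" "\<forall>i\<in>I. f i *\<^sub>v x = y i" by blast
    have xU: "x \<in> ?U" using x by (auto simp: common_kernel_def y_def)
    have Fx: "F *\<^sub>v x \<in> carrier_vec (hm_dim P)" using Fc x(1) by auto
    have pFx: "p *\<^sub>v (F *\<^sub>v x) = p *\<^sub>v w"
      using assoc_mult_mat_vec[OF pc Fc x(1)] pF x(2) j by (simp add: y_def)
    have "p *\<^sub>v (w - F *\<^sub>v x) = p *\<^sub>v w - p *\<^sub>v (F *\<^sub>v x)"
      by (rule mult_minus_distrib_mat_vec[OF pc w Fx])
    then have "w - F *\<^sub>v x \<in> hm_kernel P (S j) p"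
      using w Fx pFx mult_mat_vec_carrier[OF pc w] by (simp add: hm_kernel_def)
    moreover have "w = F *\<^sub>v x + (w - F *\<^sub>v x)" by (rule vec_add_diff_cancel[OF Fx w, symmetric])
    ultimately show "w \<in> ?L" using xU by blast
  qed
  then have all: "(\<lambda>x. F *\<^sub>v x) ` ?U = carrier_vec (hm_dim P)"
    using sf sub unfolding superfluous_def by blast
  show ?thesis
    unfolding joint_surj_def
  proof (intro allI impI)
    fix y :: "_ \<Rightarrow> 'k vec" assume y: "\<forall>i\<in>I. y i \<in> carrier_vec (hm_dim ((S(j := P)) i))"
    define y' where "y' i = (if i = j then 0\<^sub>v (hm_dim (S j)) else y i)" for i
    have "y' i \<in> carrier_vec (hm_dim (S i))" if "i \<in> I" for i using y[rule_format, OF that] by (auto simp: y'_def)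
    from joint_surjD[OF js this] obtain x0 where x0: "x0 \<in> carrier_vec (hm_dim M)" "\<forall>i\<in>I. f i *\<^sub>v x0 = y' i" by blast
    have yj: "y j \<in> carrier_vec (hm_dim P)" using y j by auto
    have Fx0: "F *\<^sub>v x0 \<in> carrier_vec (hm_dim P)" using Fc x0(1) by auto
    have "y j - F *\<^sub>v x0 \<in> carrier_vec (hm_dim P)" using yj Fx0 by simp
    then obtain x1 where x1: "x1 \<in> ?U" "F *\<^sub>v x1 = y j - F *\<^sub>v x0" using all by (metis imageE)
    have x1c: "x1 \<in> carrier_vec (hm_dim M)" using x1(1) by (simp add: common_kernel_def)
    have "(f(j := F)) i *\<^sub>v (x0 + x1) = y i" if i: "i \<in> I" for i
    proof (cases "i = j")
      case True
      have "F *\<^sub>v x0 + (y j - F *\<^sub>v x0) = y j" by (rule vec_add_diff_cancel[OF Fx0 yj])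
      then show ?thesis using True x1(2) mult_add_distrib_mat_vec[OF Fc x0(1) x1c] by simp
    next
      case False
      then have "f i *\<^sub>v x0 = y i" "f i *\<^sub>v x1 = 0\<^sub>v (hm_dim (S i))" "y i \<in> carrier_vec (hm_dim (S i))"
        using i x0 x1(1) y by (auto simp: common_kernel_def y'_def)
      then show ?thesis using False mult_add_distrib_mat_vec[OF hom_carrier[OF f[OF i]] x0(1) x1c] by simp
    qed
    then show "\<exists>x\<in>carrier_vec (hm_dim M). \<forall>i\<in>I. (f(j := F)) i *\<^sub>v x = y i"
      using x0(1) x1c by (intro bexI[of _ "x0 + x1"]) auto
  qed
qed

text \<open>Every map is lifted through its cover by projectivity of \<open>M\<close>, one target
  after the other; \<open>?T k\<close> is the family of targets after k replacements.\<close>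

lemma maps_onto_covers:
  fixes M :: "'k::field hmod"
  assumes Mp: "hm_projective n q M" and o: "maps_onto n q M Ss"
    and S: "\<And>S. S \<in> set Ss \<Longrightarrow> is_hmod n q S"
    and l: "length Ps = length Ss" and e: "\<And>i. i < length Ss \<Longrightarrow> essential_epi n q (Ps ! i) (Ss ! i)"
  shows "maps_onto n q M Ps"
proof -
  have M: "is_hmod n q M" using Mp by (simp add: hm_projective_def)
  let ?T = "\<lambda>k i. if i < k then Ps ! i else Ss ! i" and ?N = "length Ss"
  have T: "is_hmod n q (?T k i)" if "i < ?N" for k i using e[OF that] S that by (auto simp: essential_epi_def)
  have "\<exists>f. (\<forall>i<?N. f i \<in> hm_hom n q M (?T k i)) \<and> joint_surj M {..<?N} (?T k) f" if "k \<le> ?N" for k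
    using that
  proof (induction k)
    case 0
    then show ?case using o by (simp add: maps_onto_def)
  next
    case (Suc k)
    then obtain f where f: "\<And>i. i < ?N \<Longrightarrow> f i \<in> hm_hom n q M (?T k i)" "joint_surj M {..<?N} (?T k) f" by auto
    have k: "k < ?N" using Suc.prems by simp
    have Tk: "?T k k = Ss ! k" by simp
    obtain p where p: "is_hmod n q (Ps ! k)" "p \<in> hm_hom n q (Ps ! k) (Ss ! k)" "hm_surj (Ps ! k) (Ss ! k) p"
      "superfluous n q (Ps ! k) (hm_kernel (Ps ! k) (Ss ! k) p)"
      using e[OF k] unfolding essential_epi_def by blast
    have Sk: "is_hmod n q (Ss ! k)" using S k by simp
    have fk: "f k \<in> hm_hom n q M (Ss ! k)" using f(1)[OF k] by simp
    obtain F where F: "F \<in> hm_hom n q M (Ps ! k)" "p * F = f k"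
      using Mp p(1-3) Sk fk unfolding hm_projective_def by blast
    have "joint_surj M {..<?N} ((?T k)(k := Ps ! k)) (f(k := F))"
      by (rule joint_surj_lift[OF M _ _ f(2) _ p(1) _ _ F(1)])
         (use T f(1) k p F(2) Tk in \<open>auto simp del: if_split\<close>)
    moreover have e: "(?T k)(k := Ps ! k) = ?T (Suc k)" by (auto simp: fun_eq_iff less_Suc_eq)
    ultimately have "joint_surj M {..<?N} (?T (Suc k)) (f(k := F))" by metis
    moreover have "\<forall>i<?N. (f(k := F)) i \<in> hm_hom n q M (?T (Suc k) i)"
      using f(1) F(1) by (auto simp: less_Suc_eq)
    ultimately show ?case by blast
  qed
  from this[of ?N] obtain f where f: "\<forall>i<?N. f i \<in> hm_hom n q M (?T ?N i)" "joint_surj M {..<?N} (?T ?N) f" by auto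
  then show ?thesis unfolding maps_onto_def l by (intro exI[of _ f]) (auto simp: joint_surj_def)
qed

text \<open>Maps on P (x) W1 extend to P (x) W by \<open>hom_extension\<close>, and maps on P (x) W2
  are pulled back to P (x) W. The latter vanish on P (x) W1, so the combined system is block
  triangular.\<close>

lemma maps_onto_extension:
  fixes q :: "'k::field"
  assumes q: "primitive_root_of_unity n q" and Pp: "hm_projective n q P"
    and W: "is_hmod n q W" and W1: "is_hmod n q W1" and W2: "is_hmod n q W2"
    and i: "i \<in> hm_hom n q W1 W" and r: "r \<in> carrier_mat (hm_dim W1) (hm_dim W)" "r * i = 1\<^sub>m (hm_dim W1)"
    and p: "p \<in> hm_hom n q W W2" and s: "s \<in> carrier_mat (hm_dim W) (hm_dim W2)" "p * s = 1\<^sub>m (hm_dim W2)"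
    and pi: "p * i = 0\<^sub>m (hm_dim W2) (hm_dim W1)"
    and o1: "maps_onto n q (hm_tensor n q P W1) L1" and o2: "maps_onto n q (hm_tensor n q P W2) L2"
    and S: "\<And>S. S \<in> set L1 \<union> set L2 \<Longrightarrow> is_hmod n q S"
  shows "maps_onto n q (hm_tensor n q P W) (L1 @ L2)"
proof -
  have P: "is_hmod n q P" using Pp by (simp add: hm_projective_def)
  note T = hmod_tensor[OF q P W] and T1 = hmod_tensor[OF q P W1] and T2 = hmod_tensor[OF q P W2]
  let ?d = "hm_dim P" and ?w = "hm_dim W" and ?w1 = "hm_dim W1" and ?w2 = "hm_dim W2"
  note ic = hom_carrier[OF i] and pc = hom_carrier[OF p]
  define I R Q E where IRQE: "I = kron_mat (1\<^sub>m ?d) i" "R = kron_mat (1\<^sub>m ?d) r" "Q = kron_mat (1\<^sub>m ?d) p" "E = kron_mat (1\<^sub>m ?d) s"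
  have c: "I \<in> carrier_mat (?d * ?w) (?d * ?w1)" "Q \<in> carrier_mat (?d * ?w2) (?d * ?w)" "E \<in> carrier_mat (?d * ?w) (?d * ?w2)"
    unfolding IRQE using kron_mat_carrier[OF one_carrier_mat ic] kron_mat_carrier[OF one_carrier_mat pc]
      kron_mat_carrier[OF one_carrier_mat s(1)] by auto
  have QE: "Q * E = 1\<^sub>m (?d * ?w2)" and QI: "Q * I = 0\<^sub>m (?d * ?w2) (?d * ?w1)"
    unfolding IRQE
    using kron_mat_mult[OF one_carrier_mat pc one_carrier_mat s(1), of ?d] s(2)
      kron_mat_mult[OF one_carrier_mat pc one_carrier_mat ic, of ?d] pi
    by (simp_all add: kron_mat_one kron_mat_zero)
  have Qh: "Q \<in> hm_hom n q (hm_tensor n q P W) (hm_tensor n q P W2)"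
    unfolding IRQE by (rule tensor_hom[OF q P P W W2 hom_id[OF P] p])
  obtain f where f: "\<And>k. k < length L1 \<Longrightarrow> f k \<in> hm_hom n q (hm_tensor n q P W1) (L1 ! k)"
    "joint_surj (hm_tensor n q P W1) {..<length L1} (\<lambda>k. L1 ! k) f"
    using o1 by (auto simp: maps_onto_def)
  obtain g where g: "\<And>k. k < length L2 \<Longrightarrow> g k \<in> hm_hom n q (hm_tensor n q P W2) (L2 ! k)"
    "joint_surj (hm_tensor n q P W2) {..<length L2} (\<lambda>k. L2 ! k) g"
    using o2 by (auto simp: maps_onto_def)
  have "\<exists>f'\<in>hm_hom n q (hm_tensor n q P W) (L1 ! k). f' * I = f k" if "k < length L1" for k
    unfolding IRQE by (rule hom_extension[OF q Pp W W1 _ i r f(1)[OF that]]) (use S that in auto)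
  then obtain f' where f': "\<And>k. k < length L1 \<Longrightarrow> f' k \<in> hm_hom n q (hm_tensor n q P W) (L1 ! k)"
    "\<And>k. k < length L1 \<Longrightarrow> f' k * I = f k" by metis
  define h where "h k = (if k < length L1 then f' k else g (k - length L1) * Q)" for k
  have hom: "\<forall>k<length (L1 @ L2). h k \<in> hm_hom n q (hm_tensor n q P W) ((L1 @ L2) ! k)"
  proof (intro allI impI)
    fix k assume k: "k < length (L1 @ L2)"
    show "h k \<in> hm_hom n q (hm_tensor n q P W) ((L1 @ L2) ! k)"
    proof (cases "k < length L1")
      case True
      then show ?thesis using f'(1) by (simp add: h_def nth_append)
    next
      case False
      then have k2: "k - length L1 < length L2" using k by simp
      have "L2 ! (k - length L1) \<in> set L2" using k2 by simp
      then show ?thesis using False hom_comp[OF T(1) T2(1) S Qh g(1)[OF k2]] by (simp add: h_def nth_append)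
    qed
  qed
  have "joint_surj (hm_tensor n q P W) {..<length (L1 @ L2)} (\<lambda>k. (L1 @ L2) ! k) h"
    unfolding joint_surj_def
  proof (intro allI impI)
    fix y :: "_ \<Rightarrow> 'k vec" assume y: "\<forall>k\<in>{..<length (L1 @ L2)}. y k \<in> carrier_vec (hm_dim ((L1 @ L2) ! k))"
    have y1: "y k \<in> carrier_vec (hm_dim (L1 ! k))" if "k < length L1" for k
      using y[rule_format, of k] that by (simp add: nth_append)
    have y2: "y (length L1 + k) \<in> carrier_vec (hm_dim (L2 ! k))" if "k < length L2" for k
      using y[rule_format, of "length L1 + k"] that by (simp add: nth_append)
    obtain z where z: "z \<in> carrier_vec (?d * ?w2)" "\<forall>k\<in>{..<length L2}. g k *\<^sub>v z = y (length L1 + k)"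
      using joint_surjD[OF g(2), of "\<lambda>k. y (length L1 + k)"] y2 T2(3) by auto
    \<comment> \<open>The values for \<open>L2\<close> are met first, through the linear section
      \<open>E\<close>. The correction for \<open>L1\<close> is taken from P (x) W1, which leaves
      them untouched because \<open>Q * I\<close> is zero.\<close>
    let ?x0 = "E *\<^sub>v z"
    have x0: "?x0 \<in> carrier_vec (?d * ?w)" using c z by auto
    have fx0: "f' k *\<^sub>v ?x0 \<in> carrier_vec (hm_dim (L1 ! k))" if "k < length L1" for k
      using hom_carrier[OF f'(1)[OF that]] x0 T(3) by auto
    obtain x1 where x1: "x1 \<in> carrier_vec (?d * ?w1)" "\<forall>k\<in>{..<length L1}. f k *\<^sub>v x1 = y k - f' k *\<^sub>v ?x0"
      using joint_surjD[OF f(2), of "\<lambda>k. y k - f' k *\<^sub>v ?x0"] y1 fx0 T1(3) by auto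
    have Ix1: "I *\<^sub>v x1 \<in> carrier_vec (?d * ?w)" using c x1 by auto
    have "h k *\<^sub>v (?x0 + I *\<^sub>v x1) = y k" if k: "k < length (L1 @ L2)" for k
    proof (cases "k < length L1")
      case True
      note f'c = hom_carrier[OF f'(1)[OF True], unfolded T(3)]
      have "f' k *\<^sub>v (?x0 + I *\<^sub>v x1) = f' k *\<^sub>v ?x0 + (f' k * I) *\<^sub>v x1"
        using mult_add_distrib_mat_vec[OF f'c x0 Ix1] assoc_mult_mat_vec[OF f'c c(1) x1(1)] by simp
      also have "\<dots> = f' k *\<^sub>v ?x0 + (y k - f' k *\<^sub>v ?x0)" using f'(2)[OF True] x1(2) True by simp
      also have "\<dots> = y k" by (rule vec_add_diff_cancel[OF fx0[OF True] y1[OF True]])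
      finally show ?thesis using True by (simp add: h_def)
    next
      case False
      then have k2: "k - length L1 < length L2" using k by simp
      note gc = hom_carrier[OF g(1)[OF k2], unfolded T2(3)]
      have "Q *\<^sub>v (?x0 + I *\<^sub>v x1) = (Q * E) *\<^sub>v z + (Q * I) *\<^sub>v x1"
        using mult_add_distrib_mat_vec[OF c(2) x0 Ix1] assoc_mult_mat_vec[OF c(2) c(3) z(1)]
          assoc_mult_mat_vec[OF c(2) c(1) x1(1)] by simp
      also have "\<dots> = z"
        unfolding QE QI using z(1) x1(1) by (intro eq_vecI) auto
      finally have "(g (k - length L1) * Q) *\<^sub>v (?x0 + I *\<^sub>v x1) = g (k - length L1) *\<^sub>v z"
        using assoc_mult_mat_vec[OF gc c(2), of "?x0 + I *\<^sub>v x1"] x0 Ix1 by simp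
      then show ?thesis using False k2 z(2) by (simp add: h_def)
    qed
    then show "\<exists>x\<in>carrier_vec (hm_dim (hm_tensor n q P W)). \<forall>k\<in>{..<length (L1 @ L2)}. h k *\<^sub>v x = y k"
      unfolding T(3) using x0 Ix1 by (intro bexI[of _ "?x0 + I *\<^sub>v x1"]) auto
  qed
  then show ?thesis using hom unfolding maps_onto_def by blast
qed

section \<open>Direct sums\<close>

fun stack_mat :: "nat \<Rightarrow> 'k::field mat list \<Rightarrow> 'k mat" where
  "stack_mat m [] = 0\<^sub>m 0 m"
| "stack_mat m (f # fs) = f @\<^sub>r stack_mat m fs"

lemma mat_eqI_vec:
  fixes A B :: "'k::field mat"
  assumes "A \<in> carrier_mat r c" "B \<in> carrier_mat r c" "\<And>v. v \<in> carrier_vec c \<Longrightarrow> A *\<^sub>v v = B *\<^sub>v v"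
  shows "A = B"
proof (rule eq_matI)
  fix i j assume "i < dim_row B" "j < dim_col B"
  then have i: "i < r" and j: "j < c" using assms(2) by auto
  have "X $$ (i, j) = (X *\<^sub>v unit_vec c j) $ i" if "X \<in> carrier_mat r c" for X :: "'k mat"
    using that i j by (simp add: scalar_prod_right_unit)
  then show "A $$ (i, j) = B $$ (i, j)" using assms(1,2) assms(3)[of "unit_vec c j"] by simp
qed (use assms in auto)

lemma stack_mat_carrier:
  "length fs = length Ps \<Longrightarrow> (\<And>i. i < length Ps \<Longrightarrow> fs ! i \<in> carrier_mat (hm_dim (Ps ! i)) m) \<Longrightarrow>
   stack_mat m fs \<in> carrier_mat (sum_list (map hm_dim Ps)) m"
proof (induction fs Ps rule: list_induct2)
  case (Cons f fs P Ps)
  have "fs ! i \<in> carrier_mat (hm_dim (Ps ! i)) m" if "i < length Ps" for i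
    using Cons.prems[of "Suc i"] that by simp
  then have "stack_mat m fs \<in> carrier_mat (sum_list (map hm_dim Ps)) m" by (rule Cons.IH)
  then show ?case using Cons.prems[of 0] by (simp add: carrier_append_rows)
qed simp

lemma dsum_act_carrier:
  assumes "\<And>P. P \<in> set Ps \<Longrightarrow> hm_act P h \<in> carrier_mat (hm_dim P) (hm_dim P)"
  shows "hm_act (hm_dsum Ps) h \<in> carrier_mat (sum_list (map hm_dim Ps)) (sum_list (map hm_dim Ps))"
proof -
  have "sum_list (map (\<lambda>P. dim_row (hm_act P h)) Ps) = sum_list (map hm_dim Ps)"
    "sum_list (map (\<lambda>P. dim_col (hm_act P h)) Ps) = sum_list (map hm_dim Ps)"
    by (auto intro!: arg_cong[where f = sum_list] dest!: assms)
  then show ?thesis by (intro carrier_matI) (simp_all add: hm_dsum_def dim_diag_block_mat o_def)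
qed

lemma stack_mat_intertwines:
  fixes A :: "'k::field mat"
  assumes "length fs = length Ps" "A \<in> carrier_mat m m"
    and "\<And>i. i < length Ps \<Longrightarrow> fs ! i \<in> carrier_mat (hm_dim (Ps ! i)) m"
    and "\<And>P. P \<in> set Ps \<Longrightarrow> hm_act P h \<in> carrier_mat (hm_dim P) (hm_dim P)"
    and "\<And>i. i < length Ps \<Longrightarrow> fs ! i * A = hm_act (Ps ! i) h * (fs ! i)"
    and v: "v \<in> carrier_vec m"
  shows "stack_mat m fs *\<^sub>v (A *\<^sub>v v) = hm_act (hm_dsum Ps) h *\<^sub>v (stack_mat m fs *\<^sub>v v)"
  using assms(1,3-5)
proof (induction fs Ps rule: list_induct2)
  case Nil
  then show ?case by (intro eq_vecI) (auto simp: hm_dsum_def)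
next
  case (Cons f fs P Ps)
  have fc: "f \<in> carrier_mat (hm_dim P) m" using Cons.prems(1)[of 0] by simp
  have fsc: "fs ! i \<in> carrier_mat (hm_dim (Ps ! i)) m" if "i < length Ps" for i
    using Cons.prems(1)[of "Suc i"] that by simp
  have hs: "fs ! i * A = hm_act (Ps ! i) h * (fs ! i)" if "i < length Ps" for i
    using Cons.prems(3)[of "Suc i"] that by simp
  have Pc: "hm_act P h \<in> carrier_mat (hm_dim P) (hm_dim P)" using Cons.prems(2) by simp
  have Psc: "hm_act P' h \<in> carrier_mat (hm_dim P') (hm_dim P')" if "P' \<in> set Ps" for P' using Cons.prems(2) that by simp
  note IH = Cons.IH[OF fsc Psc hs]
  note sc = stack_mat_carrier[OF Cons.hyps fsc]
  let ?D = "hm_act (hm_dsum Ps) h" and ?d = "sum_list (map hm_dim Ps)"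
  have D: "?D \<in> carrier_mat ?d ?d" by (rule dsum_act_carrier[OF Psc])
  have Av: "A *\<^sub>v v \<in> carrier_vec m" using assms(2) v by auto
  have fA: "f *\<^sub>v (A *\<^sub>v v) = hm_act P h *\<^sub>v (f *\<^sub>v v)"
    using assoc_mult_mat_vec[OF fc assms(2) v] assoc_mult_mat_vec[OF Pc fc v] Cons.prems(3)[of 0] by simp
  have e: "hm_act (hm_dsum (P # Ps)) h = four_block_mat (hm_act P h) (0\<^sub>m (hm_dim P) ?d) (0\<^sub>m ?d (hm_dim P)) ?D"
    using Pc D by (auto simp: hm_dsum_def Let_def)
  have fv: "f *\<^sub>v v \<in> carrier_vec (hm_dim P)" and sv: "stack_mat m fs *\<^sub>v v \<in> carrier_vec ?d" using fc sc v by auto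
  have "hm_act (hm_dsum (P # Ps)) h *\<^sub>v (stack_mat m (f # fs) *\<^sub>v v)
     = four_block_mat (hm_act P h) (0\<^sub>m (hm_dim P) ?d) (0\<^sub>m ?d (hm_dim P)) ?D *\<^sub>v (f *\<^sub>v v @\<^sub>v stack_mat m fs *\<^sub>v v)"
    unfolding e using mat_mult_append[OF fc sc v] by simp
  also have "\<dots> = hm_act P h *\<^sub>v (f *\<^sub>v v) @\<^sub>v ?D *\<^sub>v (stack_mat m fs *\<^sub>v v)"
    by (rule mult_mat_vec_split[OF Pc D fv sv])
  also have "\<dots> = stack_mat m (f # fs) *\<^sub>v (A *\<^sub>v v)"
    using mat_mult_append[OF fc sc Av] fA IH by simp
  finally show ?case by simp
qed

text \<open>Cuts a target vector into blocks, so that joint surjectivity becomes surjectivity of the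
  stacked matrix.\<close>

lemma stack_mat_preimage:
  fixes fs :: "'k::field mat list"
  shows "length fs = length Ps \<Longrightarrow> (\<And>i. i < length Ps \<Longrightarrow> fs ! i \<in> carrier_mat (hm_dim (Ps ! i)) m) \<Longrightarrow>
   w \<in> carrier_vec (sum_list (map hm_dim Ps)) \<Longrightarrow>
   \<exists>y. (\<forall>i<length Ps. y i \<in> carrier_vec (hm_dim (Ps ! i))) \<and>
     (\<forall>x\<in>carrier_vec m. (\<forall>i<length Ps. fs ! i *\<^sub>v x = y i) \<longrightarrow> stack_mat m fs *\<^sub>v x = w)"
proof (induction fs Ps arbitrary: w rule: list_induct2)
  case Nil
  then show ?case by (auto intro!: eq_vecI)
next
  case (Cons f fs P Ps)
  let ?d = "sum_list (map hm_dim Ps)"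
  have fc: "f \<in> carrier_mat (hm_dim P) m" using Cons.prems(1)[of 0] by simp
  have fsc: "fs ! i \<in> carrier_mat (hm_dim (Ps ! i)) m" if "i < length Ps" for i
    using Cons.prems(1)[of "Suc i"] that by simp
  note sc = stack_mat_carrier[OF Cons.hyps fsc]
  define w1 w2 where "w1 = vec_first w (hm_dim P)" "w2 = vec_last w ?d"
  have w: "w = w1 @\<^sub>v w2" using Cons.prems(2) by (simp add: w1_w2_def)
  have wc: "w1 \<in> carrier_vec (hm_dim P)" "w2 \<in> carrier_vec ?d" by (simp_all add: w1_w2_def)
  obtain y where y: "\<And>i. i<length Ps \<Longrightarrow> y i \<in> carrier_vec (hm_dim (Ps ! i))"
    "\<And>x. x\<in>carrier_vec m \<Longrightarrow> (\<forall>i<length Ps. fs ! i *\<^sub>v x = y i) \<Longrightarrow> stack_mat m fs *\<^sub>v x = w2"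
    using Cons.IH[OF fsc wc(2)] by blast
  show ?case
  proof (intro exI[of _ "case_nat w1 y"] conjI ballI impI allI)
    fix i assume "i < length (P # Ps)"
    then show "case_nat w1 y i \<in> carrier_vec (hm_dim ((P # Ps) ! i))"
      using wc y(1) by (cases i) auto
  next
    fix x :: "'k vec" assume x: "x \<in> carrier_vec m" and h: "\<forall>i<length (P # Ps). (f # fs) ! i *\<^sub>v x = case_nat w1 y i"
    have "f *\<^sub>v x = w1" using h[rule_format, of 0] by simp
    moreover have "stack_mat m fs *\<^sub>v x = w2"
    proof (rule y(2)[OF x], intro allI impI)
      fix i assume "i < length Ps"
      then show "fs ! i *\<^sub>v x = y i" using h[rule_format, of "Suc i"] by simp
    qed
    ultimately show "stack_mat m (f # fs) *\<^sub>v x = w" using mat_mult_append[OF fc sc x] w by simp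
  qed
qed

lemma maps_onto_dsum:
  fixes q :: "'k::field"
  assumes M: "is_hmod n q M" and o: "maps_onto n q M Ps" and P: "\<And>P. P \<in> set Ps \<Longrightarrow> is_hmod n q P"
  shows "\<exists>X\<in>hm_hom n q M (hm_dsum Ps). hm_surj M (hm_dsum Ps) X"
proof -
  obtain f where f: "\<And>i. i < length Ps \<Longrightarrow> f i \<in> hm_hom n q M (Ps ! i)" "joint_surj M {..<length Ps} (\<lambda>i. Ps ! i) f"
    using o by (auto simp: maps_onto_def)
  let ?fs = "map f [0..<length Ps]" and ?m = "hm_dim M"
  have l: "length ?fs = length Ps" by simp
  have c: "?fs ! i \<in> carrier_mat (hm_dim (Ps ! i)) ?m" if "i < length Ps" for i
    using hom_carrier[OF f(1)[OF that]] that by simp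
  have d: "hm_dim (hm_dsum Ps) = sum_list (map hm_dim Ps)" by (simp add: hm_dsum_def)
  let ?X = "stack_mat ?m ?fs"
  note X = stack_mat_carrier[OF l c]
  have "?X * hm_act M h = hm_act (hm_dsum Ps) h * ?X" if h: "h \<in> carrier (H_alg n q)" for h
  proof (rule mat_eqI_vec)
    have Pc: "hm_act P h \<in> carrier_mat (hm_dim P) (hm_dim P)" if "P \<in> set Ps" for P
      by (rule hmod_act_carrier[OF P[OF that] h])
    note Mc = hmod_act_carrier[OF M h] and D = dsum_act_carrier[of Ps h, OF Pc]
    show "?X * hm_act M h \<in> carrier_mat (sum_list (map hm_dim Ps)) ?m"
      "hm_act (hm_dsum Ps) h * ?X \<in> carrier_mat (sum_list (map hm_dim Ps)) ?m"
      using mult_carrier_mat[OF X Mc] mult_carrier_mat[OF D X] by auto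
    fix v :: "'k vec" assume v: "v \<in> carrier_vec ?m"
    have "?X *\<^sub>v (hm_act M h *\<^sub>v v) = hm_act (hm_dsum Ps) h *\<^sub>v (?X *\<^sub>v v)"
      by (rule stack_mat_intertwines[OF l Mc c Pc _ v]) (use hom_act_any[OF f(1) h] in auto)
    then show "(?X * hm_act M h) *\<^sub>v v = (hm_act (hm_dsum Ps) h * ?X) *\<^sub>v v"
      using assoc_mult_mat_vec[OF X Mc v] assoc_mult_mat_vec[OF D X v] by simp
  qed
  then have "?X \<in> hm_hom n q M (hm_dsum Ps)" using X by (simp add: hm_hom_def d)
  moreover have "hm_surj M (hm_dsum Ps) ?X"
    unfolding hm_surj_def d
  proof (intro ballI)
    fix w :: "'k vec" assume "w \<in> carrier_vec (sum_list (map hm_dim Ps))"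
    from stack_mat_preimage[OF l c this] obtain y where y: "\<And>i. i<length Ps \<Longrightarrow> y i \<in> carrier_vec (hm_dim (Ps ! i))"
      "\<And>x. x\<in>carrier_vec ?m \<Longrightarrow> (\<forall>i<length Ps. ?fs ! i *\<^sub>v x = y i) \<Longrightarrow> ?X *\<^sub>v x = w" by blast
    obtain x where "x \<in> carrier_vec ?m" "\<forall>i\<in>{..<length Ps}. f i *\<^sub>v x = y i"
      using joint_surjD[OF f(2), of y] y(1) by auto
    then show "\<exists>v\<in>carrier_vec ?m. ?X *\<^sub>v v = w" using y(2)[of x] by (intro bexI[of _ x]) auto
  qed
  ultimately show ?thesis by blast
qed

text \<open>If k exceeded m, padding with zeros to size k would give square matrices with product 1.
  The product in the other order would then also be 1, yet its (m, m) entry is 0.\<close>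

lemma right_inverse_dim_le:
  fixes X :: "'k::field mat"
  assumes X: "X \<in> carrier_mat k m" and Y: "Y \<in> carrier_mat m k" and XY: "X * Y = 1\<^sub>m k"
  shows "k \<le> m"
proof (rule ccontr)
  assume "\<not> k \<le> m"
  then have mk: "m < k" by simp
  define X' where "X' = mat k k (\<lambda>(i, j). if j < m then X $$ (i, j) else 0)"
  define Y' where "Y' = mat k k (\<lambda>(i, j). if i < m then Y $$ (i, j) else 0)"
  have c: "X' \<in> carrier_mat k k" "Y' \<in> carrier_mat k k" by (simp_all add: X'_def Y'_def)
  have "X' * Y' = 1\<^sub>m k"
  proof (rule eq_matI)
    fix i j assume "i < dim_row (1\<^sub>m k :: 'k mat)" "j < dim_col (1\<^sub>m k :: 'k mat)"
    then have i: "i < k" and j: "j < k" by auto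
    have "(X' * Y') $$ (i, j) = (\<Sum>a = 0..<k. X' $$ (i, a) * Y' $$ (a, j))"
      using i j c by (simp add: scalar_prod_def)
    also have "\<dots> = (\<Sum>a = 0..<m. X $$ (i, a) * Y $$ (a, j))"
      by (rule sum.mono_neutral_cong_right) (use i j mk in \<open>auto simp: X'_def Y'_def\<close>)
    also have "\<dots> = (X * Y) $$ (i, j)" using i j X Y by (simp add: scalar_prod_def)
    finally show "(X' * Y') $$ (i, j) = (1\<^sub>m k :: 'k mat) $$ (i, j)" using XY by simp
  qed (use c in auto)
  from mat_mult_left_right_inverse[OF c this] have "Y' * X' = 1\<^sub>m k" .
  moreover have "(Y' * X') $$ (m, m) = 0"
    using mk c by (simp add: scalar_prod_def) (simp add: Y'_def)
  ultimately show False using mk by simp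
qed

lemma surj_dim_le:
  assumes "X \<in> hm_hom n q M N" "hm_surj M N X"
  shows "hm_dim N \<le> hm_dim M"
  using surj_right_inverse[OF hom_carrier[OF assms(1)]] assms(2) right_inverse_dim_le[OF hom_carrier[OF assms(1)]]
  unfolding hm_surj_def by blast

text \<open>The target enters through square action matrices, the form in which a direct sum from
  \<open>hm_dsum\<close> is available. Equal dimensions make the right inverse two-sided, and
  conjugating shows that it intertwines.\<close>

lemma surj_hom_iso:
  fixes q :: "'k::field"
  assumes M: "is_hmod n q M" and Nc: "\<And>h. h \<in> carrier (H_alg n q) \<Longrightarrow> hm_act N h \<in> carrier_mat (hm_dim N) (hm_dim N)"
    and X: "X \<in> hm_hom n q M N" and s: "hm_surj M N X" and d: "hm_dim N = hm_dim M"
  shows "hm_iso n q M N"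
proof -
  let ?m = "hm_dim M"
  have Xc: "X \<in> carrier_mat ?m ?m" using hom_carrier[OF X] d by simp
  obtain Y where Y: "Y \<in> carrier_mat ?m ?m" "X * Y = 1\<^sub>m ?m"
    using surj_right_inverse[OF Xc] s d unfolding hm_surj_def by auto
  have YX: "Y * X = 1\<^sub>m ?m" by (rule mat_mult_left_right_inverse[OF Xc Y])
  have "Y * hm_act N h = hm_act M h * Y" if h: "h \<in> carrier (H_alg n q)" for h
  proof -
    let ?A = "hm_act M h" and ?B = "hm_act N h"
    have A: "?A \<in> carrier_mat ?m ?m" and B: "?B \<in> carrier_mat ?m ?m" using hmod_act_carrier[OF M h] Nc[OF h] d by auto
    have XA: "X * ?A = ?B * X" by (rule hom_act_any[OF X h])
    have "Y * ?B = Y * (?B * (X * Y))" using Y B by simp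
    also have "?B * (X * Y) = (X * ?A) * Y" using assoc_mult_mat[OF B Xc Y(1)] XA by simp
    also have "\<dots> = X * (?A * Y)" by (rule assoc_mult_mat[OF Xc A Y(1)])
    also have "Y * (X * (?A * Y)) = (Y * X) * (?A * Y)"
      by (rule assoc_mult_mat[OF Y(1) Xc mult_carrier_mat[OF A Y(1)], symmetric])
    also have "\<dots> = ?A * Y" unfolding YX by (rule left_mult_one_mat[OF mult_carrier_mat[OF A Y(1)]])
    finally show ?thesis .
  qed
  then have "Y \<in> hm_hom n q N M" using Y(1) d by (simp add: hm_hom_def)
  then show ?thesis unfolding hm_iso_def using X Y(2) YX d by auto
qed

text \<open>The first conclusion bounds the dimensions of the covers from above, as needed for
  \<open>hm_dim_P\<close>; the second turns the surjection into an isomorphism when the bound is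
  attained.\<close>

lemma dim_covers_le:
  fixes q :: "'k::field"
  assumes Mp: "hm_projective n q M" and o: "maps_onto n q M Ss"
    and S: "\<And>S. S \<in> set Ss \<Longrightarrow> is_hmod n q S"
    and l: "length Ps = length Ss" and e: "\<And>i. i < length Ss \<Longrightarrow> essential_epi n q (Ps ! i) (Ss ! i)"
  shows "sum_list (map hm_dim Ps) \<le> hm_dim M"
    and "sum_list (map hm_dim Ps) = hm_dim M \<Longrightarrow> hm_iso n q M (hm_dsum Ps)"
proof -
  have M: "is_hmod n q M" using Mp by (simp add: hm_projective_def)
  have P: "is_hmod n q P" if in_Ps: "P \<in> set Ps" for P
  proof -
    obtain i where "i < length Ss" "P = Ps ! i" using in_Ps[unfolded in_set_conv_nth] l by auto
    then show ?thesis using e by (auto simp: essential_epi_def)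
  qed
  obtain X where X: "X \<in> hm_hom n q M (hm_dsum Ps)" "hm_surj M (hm_dsum Ps) X"
    using maps_onto_dsum[OF M maps_onto_covers[OF Mp o S l e] P] by blast
  have d: "hm_dim (hm_dsum Ps) = sum_list (map hm_dim Ps)" by (simp add: hm_dsum_def)
  show "sum_list (map hm_dim Ps) \<le> hm_dim M" using surj_dim_le[OF X] d by simp
  assume "sum_list (map hm_dim Ps) = hm_dim M"
  then show "hm_iso n q M (hm_dsum Ps)"
    using dsum_act_carrier[of Ps, OF hmod_act_carrier[OF P]] d by (intro surj_hom_iso[OF M _ X]) auto
qed

section \<open>Roots of unity\<close>

locale primitive_root =
  fixes n :: nat and q :: "'k::field"
  assumes n_gt_2: "2 < n" and prim: "primitive_root_of_unity n q"
begin

lemma q_pow_n: "q ^ n = 1" and q_pow_neq_1: "0 < j \<Longrightarrow> j < n \<Longrightarrow> q ^ j \<noteq> 1"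
  using prim by (auto simp: primitive_root_of_unity_def)

lemma q_nz [simp]: "q \<noteq> 0"
  using q_pow_n n_gt_2 by (metis power_0_left not_less_zero one_neq_zero)

lemma q_neq_1 [simp]: "q \<noteq> 1"
  using q_pow_neq_1[of 1] n_gt_2 by auto

lemma powi_add: "q powi (i + j) = q powi i * q powi j"
  by (simp add: power_int_add)

lemma powi_diff: "q powi (i - j) = q powi i / q powi j"
  by (simp add: power_int_diff)

lemma powi_nz [simp]: "q powi i \<noteq> 0"
  by simp

lemma powi_mod: "q powi i = q ^ nat (i mod int n)"
proof -
  have "q powi i = q powi (int n * (i div int n) + i mod int n)" by simp
  also have "\<dots> = (q powi int n) powi (i div int n) * q powi (i mod int n)"
    by (simp only: powi_add power_int_mult)
  also have "\<dots> = q ^ nat (i mod int n)"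
    using n_gt_2 q_pow_n by (simp add: power_int_def)
  finally show ?thesis .
qed

lemma powi_cong: "i mod int n = j mod int n \<Longrightarrow> q powi i = q powi j"
  by (simp add: powi_mod)

lemma powi_eq_1_iff: "q powi i = 1 \<longleftrightarrow> i mod int n = 0"
proof
  assume "q powi i = 1"
  then have h: "q ^ nat (i mod int n) = 1" by (simp add: powi_mod)
  have "nat (i mod int n) < n" using n_gt_2 by (simp add: nat_less_iff)
  then have "\<not> 0 < nat (i mod int n)" using q_pow_neq_1 h by blast
  moreover have "0 \<le> i mod int n" using n_gt_2 by simp
  ultimately show "i mod int n = 0" by linarith
qed (simp add: powi_mod)

lemma powi_eq_iff: "q powi i = q powi j \<longleftrightarrow> i mod int n = j mod int n"
proof -
  have "q powi i = q powi j \<longleftrightarrow> q powi (i - j) = 1" by (simp add: powi_diff)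
  also have "\<dots> \<longleftrightarrow> (i - j) mod int n = 0" by (rule powi_eq_1_iff)
  also have "\<dots> \<longleftrightarrow> i mod int n = j mod int n" by (metis mod_eq_dvd_iff dvd_eq_mod_eq_0)
  finally show ?thesis .
qed

lemma q_int_Suc: "q_int q (Suc j) = q_int q j + q ^ j"
  by (simp add: q_int_def)

lemma q_int_0 [simp]: "q_int q 0 = 0"
  by (simp add: q_int_def)

lemma q_int_eq: "q_int q j * (1 - q) = 1 - q ^ j"
proof (induction j)
  case (Suc j)
  have "q_int q (Suc j) * (1 - q) = (1 - q ^ j) + q ^ j * (1 - q)"
    unfolding q_int_Suc distrib_right Suc ..
  then show ?case by (simp add: algebra_simps)
qed simp

lemma q_int_frac: "q_int q j = (1 - q ^ j) / (1 - q)"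
  using q_int_eq[of j] by (simp add: field_simps)

lemma q_int_nz: "0 < j \<Longrightarrow> j < n \<Longrightarrow> q_int q j \<noteq> 0"
  using q_pow_neq_1[of j] by (simp add: q_int_frac)

lemma q_int_n [simp]: "q_int q n = 0"
  by (simp add: q_int_frac q_pow_n)

text \<open>If n were zero in the field, the polynomial 1 + x + ... + x^(n-1) would vanish at 1 as
  well as at the other powers of q, giving n distinct roots in degree below n. Weight projections
  need to divide by n.\<close>

lemma of_nat_n_nz: "(of_nat n :: 'k) \<noteq> 0"
proof
  assume z: "(of_nat n :: 'k) = 0"
  define f :: "'k poly" where "f = (\<Sum>j<n. monom 1 j)"
  have ev: "poly f x = (\<Sum>j<n. x ^ j)" for x by (simp add: f_def poly_sum poly_monom)
  have "coeff f 0 = 1" using n_gt_2 by (simp add: f_def coeff_sum)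
  then have f0: "f \<noteq> 0" by auto
  have "degree f \<le> n - 1" unfolding f_def
    by (rule degree_sum_le) (use n_gt_2 in \<open>auto intro: order.trans[OF degree_monom_le]\<close>)
  moreover have "(\<lambda>i. q ^ i) ` {..<n} \<subseteq> {x. poly f x = 0}"
  proof clarsimp
    fix i assume i: "i < n"
    show "poly f (q ^ i) = 0"
    proof (cases "i = 0")
      case True
      then show ?thesis using z by (simp add: ev)
    next
      case False
      have "(1 - q ^ i) * (\<Sum>j<n. (q ^ i) ^ j) = 1 - (q ^ i) ^ n"
        by (simp add: one_diff_power_eq)
      also have "(q ^ i) ^ n = (q ^ n) ^ i" by (metis power_mult mult.commute)
      finally show ?thesis using q_pow_neq_1[of i] False i q_pow_n by (simp add: ev)
    qed
  qed
  moreover have "card ((\<lambda>i. q ^ i) ` {..<n}) = n"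
  proof -
    have "inj_on (\<lambda>i. q ^ i) {..<n}"
    proof (rule inj_onI)
      fix i j assume "i \<in> {..<n}" "j \<in> {..<n}" "q ^ i = q ^ j"
      then have "q powi int i = q powi int j" "i < n" "j < n" by auto
      then show "i = j" unfolding powi_eq_iff by simp
    qed
    then show ?thesis by (simp add: card_image)
  qed
  ultimately have "n \<le> n - 1"
    using card_mono[OF poly_roots_finite[OF f0], of "(\<lambda>i. q ^ i) ` {..<n}"] card_poly_roots_bound[OF f0] by linarith
  then show False using n_gt_2 by simp
qed

end

section \<open>Highest weight modules\<close>

text \<open>
  \<open>str_gens q L x y\<close> is spanned by a vector of weight \<open>(x, y)\<close> killed by \<open>d\<close>, and its first
  \<open>L\<close> translates under \<open>a\<close>. For \<open>x + y = 1 - l\<close> one gets $V(l,r)$ when \<open>L = l\<close> and a Verma module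
  when \<open>L = n\<close>.
\<close>

definition kap :: "'k::field \<Rightarrow> int \<Rightarrow> nat \<Rightarrow> 'k" where
  "kap q w j = q_int q j * (1 - q powi (w + int j - 1))"

fun str_gens :: "'k::field \<Rightarrow> nat \<Rightarrow> int \<Rightarrow> int \<Rightarrow> hgen \<Rightarrow> 'k mat" where
  "str_gens q L x y Gen_a = mat L L (\<lambda>(i, j). if i = j + 1 then 1 else 0)"
| "str_gens q L x y Gen_b = mat L L (\<lambda>(i, j). if i = j then q powi (x + int j) else 0)"
| "str_gens q L x y Gen_c = mat L L (\<lambda>(i, j). if i = j then q powi (y + int j) else 0)"
| "str_gens q L x y Gen_d = mat L L (\<lambda>(i, j). if j = i + 1 then kap q (x + y) j else 0)"

definition str_mod :: "'k::field \<Rightarrow> nat \<Rightarrow> int \<Rightarrow> int \<Rightarrow> 'k hmod" where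
  "str_mod q L x y = hm_of_gens L (str_gens q L x y)"

lemma V_eq_str_mod: "V q l r = str_mod q l r (1 - r - int l)"
proof -
  have "V_gen q l r g = str_gens q l r (1 - r - int l) g" for g
    by (cases g) (auto intro!: cong_mat simp: V_alpha_def kap_def algebra_simps)
  then have "V_gen q l r = str_gens q l r (1 - r - int l)" by (rule ext)
  then show ?thesis by (simp add: V_def str_mod_def)
qed

text \<open>Setting the vectors past the end to zero lets \<open>a\<close> act by the plain shift j
  to j + 1, with no case distinction at the boundary.\<close>

definition ub :: "nat \<Rightarrow> nat \<Rightarrow> 'k::field vec" where
  "ub L j = (if j < L then unit_vec L j else 0\<^sub>v L)"

lemma ub_carrier [simp]: "ub L j \<in> carrier_vec L"
  by (simp add: ub_def)

lemma ub_dim [simp]: "dim_vec (ub L j) = L"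
  by (simp add: ub_def)

lemma ub_index: "i < L \<Longrightarrow> ub L j $ i = (if i = j then 1 else 0)"
  by (auto simp: ub_def)

lemma ub_ge: "L \<le> j \<Longrightarrow> ub L j = 0\<^sub>v L"
  by (simp add: ub_def)

lemma mult_ub_index:
  assumes "A \<in> carrier_mat r L" "i < r"
  shows "(A *\<^sub>v ub L j) $ i = (if j < L then A $$ (i, j) else 0)"
  using assms by (auto simp: ub_def scalar_prod_right_unit)

lemma mat_eqI_ub:
  fixes A B :: "'k::field mat"
  assumes "A \<in> carrier_mat r L" "B \<in> carrier_mat r L" "\<And>j. j < L \<Longrightarrow> A *\<^sub>v ub L j = B *\<^sub>v ub L j"
  shows "A = B"
proof (rule eq_matI)
  fix i j assume "i < dim_row B" "j < dim_col B"
  then have i: "i < r" and j: "j < L" using assms(2) by auto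
  show "A $$ (i, j) = B $$ (i, j)"
    using mult_ub_index[OF assms(1) i, of j] mult_ub_index[OF assms(2) i, of j] assms(3)[OF j] j by simp
qed (use assms in auto)

lemma mult_mat_zero_vec: "A \<in> carrier_mat r c \<Longrightarrow> A *\<^sub>v 0\<^sub>v c = (0\<^sub>v r :: 'k::field vec)"
  by (intro eq_vecI) auto

lemma str_gens_carrier: "str_gens q L x y g \<in> carrier_mat L L"
  by (cases g) auto

lemma pow_mat_vec_Suc:
  fixes A :: "'k::field mat"
  assumes "A \<in> carrier_mat m m" "v \<in> carrier_vec m"
  shows "A ^\<^sub>m Suc k *\<^sub>v v = A *\<^sub>v (A ^\<^sub>m k *\<^sub>v v)" "A ^\<^sub>m Suc k *\<^sub>v v = A ^\<^sub>m k *\<^sub>v (A *\<^sub>v v)"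
proof -
  note p = pow_carrier_mat[OF assms(1), of k]
  show "A ^\<^sub>m Suc k *\<^sub>v v = A *\<^sub>v (A ^\<^sub>m k *\<^sub>v v)"
    unfolding pow_mat_Suc_left[OF assms(1)] by (rule assoc_mult_mat_vec[OF assms(1) p assms(2)])
  show "A ^\<^sub>m Suc k *\<^sub>v v = A ^\<^sub>m k *\<^sub>v (A *\<^sub>v v)"
    using assoc_mult_mat_vec[OF p assms] by simp
qed

lemma smult_mat_mult_vec:
  fixes A :: "'k::field mat"
  assumes "A \<in> carrier_mat r c" "v \<in> carrier_vec c"
  shows "(t \<cdot>\<^sub>m A) *\<^sub>v v = t \<cdot>\<^sub>v (A *\<^sub>v v)"
  using assms by (intro eq_vecI) auto

lemma gens_rep_vec:
  assumes G: "gens_rep n q m G" and v: "v \<in> carrier_vec m"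
  shows "G g *\<^sub>v v \<in> carrier_vec m"
    and "G Gen_b *\<^sub>v (G Gen_a *\<^sub>v v) = q \<cdot>\<^sub>v (G Gen_a *\<^sub>v (G Gen_b *\<^sub>v v))"
    and "G Gen_d *\<^sub>v (G Gen_b *\<^sub>v v) = q \<cdot>\<^sub>v (G Gen_b *\<^sub>v (G Gen_d *\<^sub>v v))"
    and "G Gen_c *\<^sub>v (G Gen_a *\<^sub>v v) = q \<cdot>\<^sub>v (G Gen_a *\<^sub>v (G Gen_c *\<^sub>v v))"
    and "G Gen_d *\<^sub>v (G Gen_c *\<^sub>v v) = q \<cdot>\<^sub>v (G Gen_c *\<^sub>v (G Gen_d *\<^sub>v v))"
    and "G Gen_b *\<^sub>v (G Gen_c *\<^sub>v v) = G Gen_c *\<^sub>v (G Gen_b *\<^sub>v v)"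
    and "G Gen_d *\<^sub>v (G Gen_a *\<^sub>v v) = q \<cdot>\<^sub>v (G Gen_a *\<^sub>v (G Gen_d *\<^sub>v v)) + (v - G Gen_b *\<^sub>v (G Gen_c *\<^sub>v v))"
proof -
  note c = gens_repD(1)[OF G]
  have a: "G g *\<^sub>v (G h *\<^sub>v v) = (G g * G h) *\<^sub>v v" for g h
    by (rule assoc_mult_mat_vec[OF c c v, symmetric])
  have s: "t \<cdot>\<^sub>v (G g *\<^sub>v (G h *\<^sub>v v)) = (t \<cdot>\<^sub>m (G g * G h)) *\<^sub>v v" for t g h
    unfolding a by (rule smult_mat_mult_vec[OF mult_carrier_mat[OF c c] v, symmetric])
  note cc = mult_carrier_mat[OF c c]
  show "G g *\<^sub>v v \<in> carrier_vec m" by (rule mult_mat_vec_carrier[OF c v])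
  show "G Gen_b *\<^sub>v (G Gen_a *\<^sub>v v) = q \<cdot>\<^sub>v (G Gen_a *\<^sub>v (G Gen_b *\<^sub>v v))"
    "G Gen_d *\<^sub>v (G Gen_b *\<^sub>v v) = q \<cdot>\<^sub>v (G Gen_b *\<^sub>v (G Gen_d *\<^sub>v v))"
    "G Gen_c *\<^sub>v (G Gen_a *\<^sub>v v) = q \<cdot>\<^sub>v (G Gen_a *\<^sub>v (G Gen_c *\<^sub>v v))"
    "G Gen_d *\<^sub>v (G Gen_c *\<^sub>v v) = q \<cdot>\<^sub>v (G Gen_c *\<^sub>v (G Gen_d *\<^sub>v v))"
    "G Gen_b *\<^sub>v (G Gen_c *\<^sub>v v) = G Gen_c *\<^sub>v (G Gen_b *\<^sub>v v)"
    unfolding s unfolding a gens_repD(2,3,4,5,6)[OF G] by (rule refl)+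
  have "G Gen_d *\<^sub>v (G Gen_a *\<^sub>v v) = (q \<cdot>\<^sub>m (G Gen_a * G Gen_d)) *\<^sub>v v + (1\<^sub>m m - G Gen_b * G Gen_c) *\<^sub>v v"
    unfolding a gens_repD(11)[OF G]
    by (rule add_mult_distrib_mat_vec[of _ m m, OF _ _ v]) (simp_all add: cc minus_carrier_mat[OF cc])
  also have "(1\<^sub>m m - G Gen_b * G Gen_c) *\<^sub>v v = v - (G Gen_b * G Gen_c) *\<^sub>v v"
    using minus_mult_distrib_mat_vec[OF one_carrier_mat cc v, of Gen_b Gen_c] v by simp
  finally show "G Gen_d *\<^sub>v (G Gen_a *\<^sub>v v) = q \<cdot>\<^sub>v (G Gen_a *\<^sub>v (G Gen_d *\<^sub>v v)) + (v - G Gen_b *\<^sub>v (G Gen_c *\<^sub>v v))"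
    unfolding a smult_mat_mult_vec[OF cc v] .
qed

lemma hom_ubI:
  assumes M: "is_hmod n q M" and N: "is_hmod n q N" and X: "X \<in> carrier_mat (hm_dim N) (hm_dim M)"
    and h: "\<And>g j. j < hm_dim M \<Longrightarrow> X *\<^sub>v (act n q M g *\<^sub>v ub (hm_dim M) j) = act n q N g *\<^sub>v (X *\<^sub>v ub (hm_dim M) j)"
  shows "X \<in> hm_hom n q M N"
proof -
  note c = hmod_eval(2)[OF M] hmod_eval(2)[OF N]
  have "X * act n q M g = act n q N g * X" for g
    by (rule mat_eqI_ub[OF mult_carrier_mat[OF X c(1)] mult_carrier_mat[OF c(2) X]])
       (simp only: assoc_mult_mat_vec[OF X c(1) ub_carrier] assoc_mult_mat_vec[OF c(2) X ub_carrier] h)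
  then show ?thesis unfolding hom_iff[OF M N] using X by blast
qed

definition cols_mat :: "nat \<Rightarrow> nat \<Rightarrow> (nat \<Rightarrow> 'k::field vec) \<Rightarrow> 'k mat" where
  "cols_mat k L w = mat k L (\<lambda>(i, j). w j $ i)"

lemma cols_mat_carrier [simp]: "cols_mat k L w \<in> carrier_mat k L"
  by (simp add: cols_mat_def)

lemma cols_mat_ub:
  assumes "\<And>j. w j \<in> carrier_vec k"
  shows "cols_mat k L w *\<^sub>v ub L j = (if j < L then w j else 0\<^sub>v k)"
proof (rule eq_vecI)
  fix i assume "i < dim_vec (if j < L then w j else 0\<^sub>v k)"
  then have "i < k" using assms[of j] by (auto split: if_splits)
  then show "(cols_mat k L w *\<^sub>v ub L j) $ i = (if j < L then w j else 0\<^sub>v k) $ i"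
    by (subst mult_ub_index[of _ k]) (auto simp: cols_mat_def)
qed (use assms[of j] in \<open>auto simp: cols_mat_def\<close>)

lemma smult_vec_zero: "(0::'k::field) \<cdot>\<^sub>v v = 0\<^sub>v (dim_vec v)" "t \<cdot>\<^sub>v 0\<^sub>v m = (0\<^sub>v m :: 'k vec)"
  by (auto intro!: eq_vecI)

lemma mult_smult_vec:
  "A \<in> carrier_mat r c \<Longrightarrow> v \<in> carrier_vec c \<Longrightarrow> A *\<^sub>v (t \<cdot>\<^sub>v v) = t \<cdot>\<^sub>v (A *\<^sub>v (v :: 'k::field vec))"
  by (rule mult_mat_vec)

context primitive_root
begin

lemma kap_0 [simp]: "kap q w 0 = 0"
  by (simp add: kap_def)

lemma kap_n [simp]: "kap q w n = 0"
  by (simp add: kap_def)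

lemma kap_eq_0_at: "(w + int l - 1) mod int n = 0 \<Longrightarrow> kap q w l = 0"
  by (simp add: kap_def powi_eq_1_iff[THEN iffD2])

lemma kap_nz: "0 < j \<Longrightarrow> j < n \<Longrightarrow> (w + int j - 1) mod int n \<noteq> 0 \<Longrightarrow> kap q w j \<noteq> 0"
  using q_int_nz[of j] powi_eq_1_iff[of "w + int j - 1"] by (auto simp: kap_def)

text \<open>\<open>kap q w j\<close> is the scalar by which \<open>d\<close> takes a^j v to a^(j-1)
  v when \<open>d\<close> kills v and v has weight (x, y) with x + y = w. The recursion is the
  relation da = q ad + (1 - bc), as bc acts on a^j v by q^(w + 2j).\<close>

lemma kap_Suc: "kap q w (Suc j) = q * kap q w j + (1 - q powi (w + 2 * int j))"
proof -
  have e: "q powi (w + int (Suc j) - 1) = q powi w * q ^ j" "q powi (w + int j - 1) = q powi w * q ^ j / q"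
    "q powi (w + 2 * int j) = q powi w * q ^ j * q ^ j"
  proof -
    have "w + int (Suc j) - 1 = w + int j" "w + 2 * int j = w + int j + int j" by simp_all
    then show "q powi (w + int (Suc j) - 1) = q powi w * q ^ j" "q powi (w + 2 * int j) = q powi w * q ^ j * q ^ j"
      by (simp_all only: powi_add power_int_of_nat)
    show "q powi (w + int j - 1) = q powi w * q ^ j / q"
      unfolding powi_diff[of "w + int j" 1] powi_add power_int_of_nat by simp
  qed
  have s: "q_int q (Suc j) = q_int q j + q ^ j" "q * q_int q j = q_int q j + q ^ j - 1"
    using q_int_eq[of j] by (auto simp: q_int_Suc algebra_simps)
  have "q * kap q w j = q * q_int q j - q_int q j * (q powi w * q ^ j)"
    unfolding kap_def e by (simp add: field_simps)
  then show ?thesis unfolding kap_def[of q w "Suc j"] e s by (simp add: algebra_simps)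
qed

text \<open>The hypothesis makes the formula for \<open>d\<close> correct at j = L, where
  \<open>ub L j\<close> is zero but, for L > 0, \<open>ub L (j - 1)\<close> is not. At j = 0 the
  truncated predecessor is harmless because \<open>kap q w 0\<close> is zero.\<close>

lemma str_act:
  assumes "kap q (x + y) L = 0"
  shows "str_gens q L x y Gen_a *\<^sub>v ub L j = ub L (Suc j)"
    and "str_gens q L x y Gen_b *\<^sub>v ub L j = q powi (x + int j) \<cdot>\<^sub>v ub L j"
    and "str_gens q L x y Gen_c *\<^sub>v ub L j = q powi (y + int j) \<cdot>\<^sub>v ub L j"
    and "str_gens q L x y Gen_d *\<^sub>v ub L j = kap q (x + y) j \<cdot>\<^sub>v ub L (j - 1)"
proof -
  note m = mult_ub_index[OF str_gens_carrier, of _ L q x y]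
  show "str_gens q L x y Gen_a *\<^sub>v ub L j = ub L (Suc j)"
  proof (rule eq_vecI)
    fix i assume "i < dim_vec (ub L (Suc j))"
    then have i: "i < L" by simp
    show "(str_gens q L x y Gen_a *\<^sub>v ub L j) $ i = (ub L (Suc j)) $ i"
      unfolding m[OF i] using i by (auto simp: ub_index)
  qed (simp add: carrier_matD[OF str_gens_carrier] del: str_gens.simps)
  show "str_gens q L x y Gen_b *\<^sub>v ub L j = q powi (x + int j) \<cdot>\<^sub>v ub L j"
  proof (rule eq_vecI)
    fix i assume "i < dim_vec (q powi (x + int j) \<cdot>\<^sub>v ub L j)"
    then have i: "i < L" by simp
    show "(str_gens q L x y Gen_b *\<^sub>v ub L j) $ i = (q powi (x + int j) \<cdot>\<^sub>v ub L j) $ i"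
      unfolding m[OF i] using i by (auto simp: ub_index)
  qed (simp add: carrier_matD[OF str_gens_carrier] del: str_gens.simps)
  show "str_gens q L x y Gen_c *\<^sub>v ub L j = q powi (y + int j) \<cdot>\<^sub>v ub L j"
  proof (rule eq_vecI)
    fix i assume "i < dim_vec (q powi (y + int j) \<cdot>\<^sub>v ub L j)"
    then have i: "i < L" by simp
    show "(str_gens q L x y Gen_c *\<^sub>v ub L j) $ i = (q powi (y + int j) \<cdot>\<^sub>v ub L j) $ i"
      unfolding m[OF i] using i by (auto simp: ub_index)
  qed (simp add: carrier_matD[OF str_gens_carrier] del: str_gens.simps)
  show "str_gens q L x y Gen_d *\<^sub>v ub L j = kap q (x + y) j \<cdot>\<^sub>v ub L (j - 1)"
  proof (rule eq_vecI)
    fix i assume i: "i < dim_vec (kap q (x + y) j \<cdot>\<^sub>v ub L (j - 1))"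
    then have iL: "i < L" by simp
    moreover have "kap q (x + y) j = 0" if "j \<ge> L" "i = j - 1"
    proof -
      have "j = L \<or> j = 0" using that iL by linarith
      then show ?thesis using assms by auto
    qed
    ultimately show "(str_gens q L x y Gen_d *\<^sub>v ub L j) $ i = (kap q (x + y) j \<cdot>\<^sub>v ub L (j - 1)) $ i"
      unfolding m[OF iL] by (cases "j = 0") (auto simp: ub_index)
  qed (simp add: carrier_matD[OF str_gens_carrier] del: str_gens.simps)
qed

lemma str_gens_pow_a: "kap q (x + y) L = 0 \<Longrightarrow> str_gens q L x y Gen_a ^\<^sub>m k *\<^sub>v ub L j = ub L (j + k)"
proof (induction k)
  case 0
  then show ?case using str_gens_carrier[of q L x y Gen_a] by simp
next
  case (Suc k)
  then show ?case by (simp add: pow_mat_vec_Suc(1)[OF str_gens_carrier ub_carrier] str_act(1) del: pow_mat.simps str_gens.simps)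
qed

lemma pow_mat_eigen:
  fixes A :: "'k mat"
  assumes A: "A \<in> carrier_mat m m" and v: "v \<in> carrier_vec m" and e: "A *\<^sub>v v = t \<cdot>\<^sub>v v"
  shows "A ^\<^sub>m k *\<^sub>v v = t ^ k \<cdot>\<^sub>v v"
proof (induction k)
  case 0
  then show ?case using A v by simp
next
  case (Suc k)
  show ?case unfolding pow_mat_vec_Suc(1)[OF A v] Suc mult_smult_vec[OF A v] e smult_smult_assoc
    by (simp add: mult.commute)
qed

lemma gens_rep_str:
  assumes k: "kap q (x + y) L = 0" and L: "L \<le> n"
  shows "gens_rep n q L (str_gens q L x y)"
proof -
  let ?G = "str_gens q L x y"
  note c = str_gens_carrier[of q L x y]
  note cc = mult_carrier_mat[OF c c]
  note s = str_act[OF k]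
  note ms = mult_smult_vec[OF c ub_carrier]
  have a: "(?G g * ?G h) *\<^sub>v ub L j = ?G g *\<^sub>v (?G h *\<^sub>v ub L j)" for g h j
    by (rule assoc_mult_mat_vec[OF c c ub_carrier])
  have sm: "(t \<cdot>\<^sub>m (?G g * ?G h)) *\<^sub>v ub L j = t \<cdot>\<^sub>v (?G g *\<^sub>v (?G h *\<^sub>v ub L j))" for t g h j
    unfolding a[symmetric] by (rule smult_mat_mult_vec[OF cc ub_carrier])
  note simps = a sm s ms smult_smult_assoc
  have pw: "q powi (z + (1 + int j)) = q * q powi (z + int j)" for z j
    by (simp add: powi_add)
  show ?thesis
  proof (rule gens_repI)
    show "?G g \<in> carrier_mat L L" for g by (rule c)
    show "?G Gen_b * ?G Gen_a = q \<cdot>\<^sub>m (?G Gen_a * ?G Gen_b)"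
      by (rule mat_eqI_ub[of _ L L]) (use cc in \<open>auto simp: simps pw simp del: str_gens.simps\<close>)
    show "?G Gen_c * ?G Gen_a = q \<cdot>\<^sub>m (?G Gen_a * ?G Gen_c)"
      by (rule mat_eqI_ub[of _ L L]) (use cc in \<open>auto simp: simps pw simp del: str_gens.simps\<close>)
    show "?G Gen_b * ?G Gen_c = ?G Gen_c * ?G Gen_b"
      by (rule mat_eqI_ub[of _ L L]) (use cc in \<open>auto simp: simps mult.commute simp del: str_gens.simps\<close>)
    have db: "q powi (z + int j) * kap q w j = q * (kap q w j * q powi (z + int (j - 1)))" for z j w
    proof (cases j)
      case (Suc i)
      then show ?thesis using pw[of z i] by simp
    qed simp
    show "?G Gen_d * ?G Gen_b = q \<cdot>\<^sub>m (?G Gen_b * ?G Gen_d)"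
      by (rule mat_eqI_ub[of _ L L]) (use cc in \<open>auto simp: simps db simp del: str_gens.simps\<close>)
    show "?G Gen_d * ?G Gen_c = q \<cdot>\<^sub>m (?G Gen_c * ?G Gen_d)"
      by (rule mat_eqI_ub[of _ L L]) (use cc in \<open>auto simp: simps db simp del: str_gens.simps\<close>)
    show "?G Gen_a ^\<^sub>m n = 0\<^sub>m L L"
      by (rule mat_eqI_ub[of _ L L, OF pow_carrier_mat[OF c]])
         (use L in \<open>auto simp: str_gens_pow_a[OF k] ub_ge intro!: eq_vecI simp del: str_gens.simps\<close>)
    have on: "(t ^ n) \<cdot>\<^sub>v ub L j = 1\<^sub>m L *\<^sub>v ub L j" if "t ^ n = 1" for t :: 'k and j
      using that by (intro eq_vecI) auto
    have pn: "(q powi z) ^ n = 1" for z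
    proof -
      have "(q powi z) ^ n = (q ^ n) powi z" by (metis power_int_mult power_int_of_nat mult.commute)
      then show ?thesis by (simp add: q_pow_n)
    qed
    show "?G Gen_b ^\<^sub>m n = 1\<^sub>m L"
      by (rule mat_eqI_ub[of _ L L, OF pow_carrier_mat[OF c]])
         (simp_all only: one_carrier_mat pow_mat_eigen[OF c ub_carrier s(2)] on[OF pn])
    show "?G Gen_c ^\<^sub>m n = 1\<^sub>m L"
      by (rule mat_eqI_ub[of _ L L, OF pow_carrier_mat[OF c]])
         (simp_all only: one_carrier_mat pow_mat_eigen[OF c ub_carrier s(3)] on[OF pn])
    \<comment> \<open>Each \<open>d\<close> lowers the index by one up to a scalar, or kills the
      vector at index 0. As all indices are below L and L is at most n, \<open>d^n\<close> is
      zero.\<close>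
    have dp: "\<exists>t. ?G Gen_d ^\<^sub>m i *\<^sub>v ub L j = (if i \<le> j then t \<cdot>\<^sub>v ub L (j - i) else 0\<^sub>v L)" for i j
    proof (induction i)
      case 0
      then show ?case using c[of Gen_d] by (intro exI[of _ 1]) simp
    next
      case (Suc i)
      then obtain t where t: "?G Gen_d ^\<^sub>m i *\<^sub>v ub L j = (if i \<le> j then t \<cdot>\<^sub>v ub L (j - i) else 0\<^sub>v L)" by blast
      have e: "?G Gen_d ^\<^sub>m Suc i *\<^sub>v ub L j = ?G Gen_d *\<^sub>v (if i \<le> j then t \<cdot>\<^sub>v ub L (j - i) else 0\<^sub>v L)"
        unfolding pow_mat_vec_Suc(1)[OF c ub_carrier] t ..
      consider "i < j" | "i = j" | "j < i" by linarith
      then show ?case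
      proof cases
        case 1
        then have "?G Gen_d ^\<^sub>m Suc i *\<^sub>v ub L j = (t * kap q (x + y) (j - i)) \<cdot>\<^sub>v ub L (j - Suc i)"
          unfolding e by (simp add: simps del: str_gens.simps)
        then show ?thesis using 1 by (intro exI[of _ "t * kap q (x + y) (j - i)"]) simp
      next
        case 2
        then have "?G Gen_d ^\<^sub>m Suc i *\<^sub>v ub L j = (t * 0) \<cdot>\<^sub>v ub L 0"
          unfolding e by (simp add: simps del: str_gens.simps)
        then show ?thesis using 2 by (simp add: smult_vec_zero)
      next
        case 3
        then show ?thesis unfolding e using mult_mat_zero_vec[OF c[of Gen_d]] by simp
      qed
    qed
    show "?G Gen_d ^\<^sub>m n = 0\<^sub>m L L"
    proof (rule mat_eqI_ub[of _ L L, OF pow_carrier_mat[OF c]])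
      fix j assume "j < L"
      then show "?G Gen_d ^\<^sub>m n *\<^sub>v ub L j = 0\<^sub>m L L *\<^sub>v ub L j"
        using dp[of n j] L by (auto intro!: eq_vecI)
    qed simp
    show "?G Gen_d * ?G Gen_a = q \<cdot>\<^sub>m (?G Gen_a * ?G Gen_d) + (1\<^sub>m L - ?G Gen_b * ?G Gen_c)"
    proof (rule mat_eqI_ub[of _ L L])
      fix j assume j: "j < L"
      have "(q \<cdot>\<^sub>m (?G Gen_a * ?G Gen_d) + (1\<^sub>m L - ?G Gen_b * ?G Gen_c)) *\<^sub>v ub L j =
        q \<cdot>\<^sub>v (?G Gen_a *\<^sub>v (?G Gen_d *\<^sub>v ub L j)) + (ub L j - ?G Gen_b *\<^sub>v (?G Gen_c *\<^sub>v ub L j))"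
      proof -
        have "(q \<cdot>\<^sub>m (?G Gen_a * ?G Gen_d) + (1\<^sub>m L - ?G Gen_b * ?G Gen_c)) *\<^sub>v ub L j =
          (q \<cdot>\<^sub>m (?G Gen_a * ?G Gen_d)) *\<^sub>v ub L j + (1\<^sub>m L - ?G Gen_b * ?G Gen_c) *\<^sub>v ub L j"
          by (rule add_mult_distrib_mat_vec[of _ L L, OF _ _ ub_carrier]) (simp_all add: cc minus_carrier_mat[OF cc] del: str_gens.simps)
        also have "(1\<^sub>m L - ?G Gen_b * ?G Gen_c) *\<^sub>v ub L j = ub L j - (?G Gen_b * ?G Gen_c) *\<^sub>v ub L j"
          using minus_mult_distrib_mat_vec[OF one_carrier_mat cc ub_carrier, of Gen_b Gen_c j] by (simp del: str_gens.simps)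
        finally show ?thesis unfolding sm a .
      qed
      also have "\<dots> = q \<cdot>\<^sub>v (kap q (x + y) j \<cdot>\<^sub>v ub L (Suc (j - 1))) + (ub L j - (q powi (y + int j) * q powi (x + int j)) \<cdot>\<^sub>v ub L j)"
        by (simp add: simps del: str_gens.simps)
      also have "kap q (x + y) j \<cdot>\<^sub>v ub L (Suc (j - 1)) = kap q (x + y) j \<cdot>\<^sub>v ub L j"
        by (cases j) (auto simp: smult_vec_zero)
      also have "q powi (y + int j) * q powi (x + int j) = q powi (x + y + 2 * int j)"
        by (simp add: mult_2 algebra_simps flip: powi_add)
      also have "q \<cdot>\<^sub>v (kap q (x + y) j \<cdot>\<^sub>v ub L j) + (ub L j - q powi (x + y + 2 * int j) \<cdot>\<^sub>v ub L j) = kap q (x + y) (Suc j) \<cdot>\<^sub>v ub L j"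
        unfolding kap_Suc by (intro eq_vecI) (auto simp: algebra_simps)
      also have "\<dots> = (?G Gen_d * ?G Gen_a) *\<^sub>v ub L j"
        by (simp add: simps del: str_gens.simps)
      finally show "(?G Gen_d * ?G Gen_a) *\<^sub>v ub L j =
        (q \<cdot>\<^sub>m (?G Gen_a * ?G Gen_d) + (1\<^sub>m L - ?G Gen_b * ?G Gen_c)) *\<^sub>v ub L j" by simp
    qed (simp_all add: cc add_carrier_mat minus_carrier_mat[OF cc] del: str_gens.simps)
  qed
qed

lemma str_hmod:
  assumes "kap q (x + y) L = 0" "L \<le> n"
  shows "is_hmod n q (str_mod q L x y)" "act n q (str_mod q L x y) g = str_gens q L x y g"
    "hm_dim (str_mod q L x y) = L"
  using hmod_of_gens[OF gens_rep_str[OF assms]] by (simp_all add: str_mod_def del: str_gens.simps)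

text \<open>The formulas of \<open>str_act\<close> hold for the \<open>a\<close>-orbit of any weight
  vector killed by \<open>d\<close>; this gives \<open>str_mod\<close> its universal
  property.\<close>

lemma highest_weight_orbit:
  assumes G: "gens_rep n q m G" and v: "v \<in> carrier_vec m" and dv: "G Gen_d *\<^sub>v v = 0\<^sub>v m"
    and bv: "G Gen_b *\<^sub>v v = q powi x \<cdot>\<^sub>v v" and cv: "G Gen_c *\<^sub>v v = q powi y \<cdot>\<^sub>v v"
  defines "w \<equiv> \<lambda>j. G Gen_a ^\<^sub>m j *\<^sub>v v"
  shows "w j \<in> carrier_vec m" "G Gen_a *\<^sub>v w j = w (Suc j)" "G Gen_b *\<^sub>v w j = q powi (x + int j) \<cdot>\<^sub>v w j"
    "G Gen_c *\<^sub>v w j = q powi (y + int j) \<cdot>\<^sub>v w j" "G Gen_d *\<^sub>v w j = kap q (x + y) j \<cdot>\<^sub>v w (j - 1)"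
    "w n = 0\<^sub>v m"
proof -
  note c = gens_repD(1)[OF G]
  show wc: "w j \<in> carrier_vec m" for j using pow_carrier_mat[OF c, of Gen_a j] v by (auto simp: w_def)
  show wS: "G Gen_a *\<^sub>v w j = w (Suc j)" for j unfolding w_def by (rule pow_mat_vec_Suc(1)[OF c v, symmetric])
  have w0: "w 0 = v" using c[of Gen_a] v by (simp add: w_def)
  have pw: "q powi (z + int (Suc j)) = q * q powi (z + int j)" for z j
    by (simp add: powi_add)
  note ms = mult_smult_vec[OF c wc]
  show wb: "G Gen_b *\<^sub>v w j = q powi (x + int j) \<cdot>\<^sub>v w j" for j
  proof (induction j)
    case (Suc j)
    have "G Gen_b *\<^sub>v w (Suc j) = q \<cdot>\<^sub>v (G Gen_a *\<^sub>v (G Gen_b *\<^sub>v w j))"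
      unfolding wS[symmetric] by (rule gens_rep_vec(2)[OF G wc])
    then show ?case unfolding Suc ms wS pw by (simp add: smult_smult_assoc)
  qed (simp add: w0 bv)
  show wcc: "G Gen_c *\<^sub>v w j = q powi (y + int j) \<cdot>\<^sub>v w j" for j
  proof (induction j)
    case (Suc j)
    have "G Gen_c *\<^sub>v w (Suc j) = q \<cdot>\<^sub>v (G Gen_a *\<^sub>v (G Gen_c *\<^sub>v w j))"
      unfolding wS[symmetric] by (rule gens_rep_vec(4)[OF G wc])
    then show ?case unfolding Suc ms wS pw by (simp add: smult_smult_assoc)
  qed (simp add: w0 cv)
  show "G Gen_d *\<^sub>v w j = kap q (x + y) j \<cdot>\<^sub>v w (j - 1)"
  proof (induction j)
    case 0
    then show ?case using v dv by (simp add: w0 smult_vec_zero)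
  next
    case (Suc j)
    \<comment> \<open>For j = 0 the truncated predecessor yields a wrong vector, but its coefficient
      is \<open>kap\<close> at 0, which vanishes.\<close>
    have e: "kap q (x + y) j \<cdot>\<^sub>v w (Suc (j - 1)) = kap q (x + y) j \<cdot>\<^sub>v w j"
      using wc[of j] wc[of "Suc 0"] by (cases j) (auto simp: smult_vec_zero)
    have p: "q powi (y + int j) * q powi (x + int j) = q powi (x + y + 2 * int j)"
      by (simp add: mult_2 algebra_simps flip: powi_add)
    have "G Gen_d *\<^sub>v w (Suc j) = q \<cdot>\<^sub>v (G Gen_a *\<^sub>v (G Gen_d *\<^sub>v w j)) + (w j - G Gen_b *\<^sub>v (G Gen_c *\<^sub>v w j))"
      unfolding wS[symmetric] by (rule gens_rep_vec(7)[OF G wc])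
    also have "\<dots> = q \<cdot>\<^sub>v (kap q (x + y) j \<cdot>\<^sub>v w j) + (w j - q powi (x + y + 2 * int j) \<cdot>\<^sub>v w j)"
      unfolding Suc wcc ms wb wS e smult_smult_assoc p ..
    also have "\<dots> = kap q (x + y) (Suc j) \<cdot>\<^sub>v w j"
      unfolding kap_Suc using wc[of j] by (intro eq_vecI) (auto simp: algebra_simps)
    finally show ?case by simp
  qed
  show "w n = 0\<^sub>v m" unfolding w_def gens_repD(7)[OF G] using v by (intro eq_vecI) auto
qed

lemma str_universal:
  assumes k: "kap q (x + y) L = 0" and L: "L \<le> n" and N: "is_hmod n q N" and v: "v \<in> carrier_vec (hm_dim N)"
    and dv: "act n q N Gen_d *\<^sub>v v = 0\<^sub>v (hm_dim N)"
    and bv: "act n q N Gen_b *\<^sub>v v = q powi x \<cdot>\<^sub>v v" and cv: "act n q N Gen_c *\<^sub>v v = q powi y \<cdot>\<^sub>v v"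
    and av: "act n q N Gen_a ^\<^sub>m L *\<^sub>v v = 0\<^sub>v (hm_dim N)"
  shows "\<exists>X\<in>hm_hom n q (str_mod q L x y) N. \<forall>j. X *\<^sub>v ub L j = act n q N Gen_a ^\<^sub>m j *\<^sub>v v"
proof -
  let ?w = "\<lambda>j. act n q N Gen_a ^\<^sub>m j *\<^sub>v v"
  note w = highest_weight_orbit[OF hmod_gens_rep[OF N] v dv bv cv]
  note S = str_hmod[OF k L]
  let ?X = "cols_mat (hm_dim N) L ?w"
  have "?w (L + i) = 0\<^sub>v (hm_dim N)" for i
  proof (induction i)
    case (Suc i)
    then show ?case using w(2)[of "L + i"] mult_mat_zero_vec[OF hmod_eval(2)[OF N]] by simp
  qed (simp add: av)
  then have wL: "?w j = 0\<^sub>v (hm_dim N)" if "L \<le> j" for j using that by (metis le_Suc_ex)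
  have X: "?X *\<^sub>v ub L j = ?w j" for j using cols_mat_ub[where w = ?w and L = L and j = j, OF w(1)] wL by auto
  have "?X \<in> hm_hom n q (str_mod q L x y) N"
  proof (rule hom_ubI[OF S(1) N])
    fix g j
    note ms = mult_smult_vec[OF cols_mat_carrier ub_carrier]
    show "?X *\<^sub>v (act n q (str_mod q L x y) g *\<^sub>v ub (hm_dim (str_mod q L x y)) j) =
        act n q N g *\<^sub>v (?X *\<^sub>v ub (hm_dim (str_mod q L x y)) j)"
      unfolding S(2,3) by (cases g) (simp_all only: str_act[OF k] ms X w)
  qed (simp add: S(3))
  then show ?thesis using X by blast
qed

end

declare str_gens.simps [simp del]

section \<open>Submodules in terms of generators and basis vectors\<close>

lemma submoduleD:
  assumes M: "is_hmod n q M" and U: "hm_submodule n q M U"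
  shows "U \<subseteq> carrier_vec (hm_dim M)" "0\<^sub>v (hm_dim M) \<in> U" "u \<in> U \<Longrightarrow> v \<in> U \<Longrightarrow> u + v \<in> U"
    "u \<in> U \<Longrightarrow> act n q M g *\<^sub>v u \<in> U" "u \<in> U \<Longrightarrow> t \<cdot>\<^sub>v u \<in> U"
proof -
  show sub: "U \<subseteq> carrier_vec (hm_dim M)" and "0\<^sub>v (hm_dim M) \<in> U" and "u \<in> U \<Longrightarrow> v \<in> U \<Longrightarrow> u + v \<in> U"
    using U by (auto simp: hm_submodule_def)
  have h: "hm_act M (H_class n q x) *\<^sub>v u \<in> U" if "u \<in> U" for x u
    using U that by (auto simp: hm_submodule_def H_class_carrier)
  show "u \<in> U \<Longrightarrow> act n q M g *\<^sub>v u \<in> U" unfolding act_def by (rule h)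
  assume u: "u \<in> U"
  then have uc: "u \<in> carrier_vec (hm_dim M)" using sub by auto
  have "hm_act M (H_class n q (scal t)) *\<^sub>v u = t \<cdot>\<^sub>v u"
    unfolding hmod_eval(1)[OF M] eval_free_scal smult_mat_mult_vec[OF one_carrier_mat uc] using uc by simp
  then show "t \<cdot>\<^sub>v u \<in> U" using h[OF u] by metis
qed

lemma submodule_pow:
  assumes M: "is_hmod n q M" and U: "hm_submodule n q M U" and u: "u \<in> U"
  shows "act n q M g ^\<^sub>m k *\<^sub>v u \<in> U"
proof -
  note c = hmod_eval(2)[OF M] and S = submoduleD[OF M U]
  have uc: "u \<in> carrier_vec (hm_dim M)" using S(1) u by auto
  show ?thesis
  proof (induction k)
    case 0
    have "act n q M g ^\<^sub>m 0 *\<^sub>v u = u" using c[of g] uc by simp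
    then show ?case using u by simp
  next
    case (Suc k)
    then show ?case unfolding pow_mat_vec_Suc(1)[OF c uc] by (rule S(4))
  qed
qed

lemma submodule_all:
  fixes M :: "'k::field hmod"
  assumes M: "is_hmod n q M" and U: "hm_submodule n q M U" and e: "\<And>j. j < hm_dim M \<Longrightarrow> ub (hm_dim M) j \<in> U"
  shows "U = carrier_vec (hm_dim M)"
proof
  let ?L = "hm_dim M"
  note S = submoduleD[OF M U]
  show "U \<subseteq> carrier_vec ?L" by (rule S(1))
  show "carrier_vec ?L \<subseteq> U"
  proof
    fix v :: "'k vec" assume v: "v \<in> carrier_vec ?L"
    have "vec ?L (\<lambda>i. if i < k then v $ i else 0) \<in> U" if "k \<le> ?L" for k
      using that
    proof (induction k)
      case 0
      have "vec ?L (\<lambda>i. if i < 0 then v $ i else 0) = 0\<^sub>v ?L" by (intro eq_vecI) auto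
      then show ?case using S(2) by simp
    next
      case (Suc k)
      have "vec ?L (\<lambda>i. if i < Suc k then v $ i else 0) = vec ?L (\<lambda>i. if i < k then v $ i else 0) + v $ k \<cdot>\<^sub>v ub ?L k"
        using Suc.prems by (intro eq_vecI) (auto simp: ub_index less_Suc_eq)
      then show ?case using S(3)[OF Suc.IH S(5)[OF e[of k]]] Suc.prems by simp
    qed
    moreover have "vec ?L (\<lambda>i. if i < ?L then v $ i else 0) = v" using v by (intro eq_vecI) auto
    ultimately show "v \<in> U" by (metis order_refl)
  qed
qed

section \<open>Weight projections\<close>

text \<open>If \<open>A^n = 1\<close> and \<open>t^n = 1\<close>, then for k = n this is n times the
  projection onto the eigenspace of \<open>A\<close> for 1/t. As a polynomial in \<open>A\<close> it
  preserves submodules and commutes with homomorphisms.\<close>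

fun avg_mat :: "nat \<Rightarrow> 'k::field mat \<Rightarrow> 'k \<Rightarrow> nat \<Rightarrow> 'k mat" where
  "avg_mat m A t 0 = 0\<^sub>m m m"
| "avg_mat m A t (Suc k) = avg_mat m A t k + t ^ k \<cdot>\<^sub>m A ^\<^sub>m k"

lemma avg_mat_carrier: "A \<in> carrier_mat m m \<Longrightarrow> avg_mat m A t k \<in> carrier_mat m m"
  by (induction k) (auto intro!: add_carrier_mat simp: pow_carrier_mat)

lemma avg_mat_vec_Suc:
  assumes A: "A \<in> carrier_mat m m" and v: "v \<in> carrier_vec m"
  shows "avg_mat m A t (Suc k) *\<^sub>v v = avg_mat m A t k *\<^sub>v v + t ^ k \<cdot>\<^sub>v (A ^\<^sub>m k *\<^sub>v v)"
  using add_mult_distrib_mat_vec[OF avg_mat_carrier[OF A] smult_carrier_mat[OF pow_carrier_mat[OF A]] v, of t k "t ^ k" k]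
    smult_mat_mult_vec[OF pow_carrier_mat[OF A] v] by simp

lemma avg_mat_vec_0: "v \<in> carrier_vec m \<Longrightarrow> avg_mat m A t 0 *\<^sub>v v = 0\<^sub>v m"
  by (intro eq_vecI) auto

lemma smult_add_rearrange:
  fixes a p v :: "'k::field vec"
  assumes "a \<in> carrier_vec m" "p \<in> carrier_vec m" "v \<in> carrier_vec m"
  shows "t \<cdot>\<^sub>v (a + s \<cdot>\<^sub>v p) + v = (t \<cdot>\<^sub>v a + v) + (t * s) \<cdot>\<^sub>v p"
  using assms by (intro eq_vecI) (auto simp: algebra_simps)

lemma vec_add_right_cancel:
  fixes a b v :: "'k::field vec"
  assumes "a \<in> carrier_vec m" "b \<in> carrier_vec m" "v \<in> carrier_vec m" "a + v = b + v"
  shows "a = b"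
proof (rule eq_vecI)
  fix i assume "i < dim_vec b"
  then have i: "i < m" using assms by auto
  have "a $ i + v $ i = (a + v) $ i" using i assms(1,3) by auto
  also have "\<dots> = (b + v) $ i" by (simp only: assms(4))
  also have "\<dots> = b $ i + v $ i" using i assms(2,3) by auto
  finally show "a $ i = b $ i" by simp
qed (use assms in auto)

text \<open>Telescoping of a geometric sum. For k = n the last term is \<open>v\<close> itself, and
  cancelling it gives the eigenvector equation of \<open>avg_mat_eigen\<close>.\<close>

lemma avg_mat_shift:
  assumes A: "A \<in> carrier_mat m m" and v: "v \<in> carrier_vec m"
  shows "t \<cdot>\<^sub>v (A *\<^sub>v (avg_mat m A t k *\<^sub>v v)) + v = avg_mat m A t k *\<^sub>v v + t ^ k \<cdot>\<^sub>v (A ^\<^sub>m k *\<^sub>v v)"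
proof (induction k)
  case 0
  then show ?case unfolding avg_mat_vec_0[OF v] using A v by (simp add: mult_mat_zero_vec[OF A] smult_vec_zero)
next
  case (Suc k)
  let ?a = "avg_mat m A t k *\<^sub>v v" and ?p = "A ^\<^sub>m k *\<^sub>v v"
  have a: "?a \<in> carrier_vec m" using mult_mat_vec_carrier[OF avg_mat_carrier[OF A] v] .
  have p: "?p \<in> carrier_vec m" by (rule mult_mat_vec_carrier[OF pow_carrier_mat[OF A] v])
  have Aa: "A *\<^sub>v ?a \<in> carrier_vec m" and Ap: "A *\<^sub>v ?p \<in> carrier_vec m"
    using mult_mat_vec_carrier[OF A] a p by auto
  have "A *\<^sub>v (avg_mat m A t (Suc k) *\<^sub>v v) = A *\<^sub>v ?a + t ^ k \<cdot>\<^sub>v (A *\<^sub>v ?p)"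
    unfolding avg_mat_vec_Suc[OF A v]
    using mult_add_distrib_mat_vec[OF A a, of "t ^ k \<cdot>\<^sub>v ?p"] mult_smult_vec[OF A p] p by simp
  then have "t \<cdot>\<^sub>v (A *\<^sub>v (avg_mat m A t (Suc k) *\<^sub>v v)) + v = (t \<cdot>\<^sub>v (A *\<^sub>v ?a) + v) + t ^ Suc k \<cdot>\<^sub>v (A *\<^sub>v ?p)"
    unfolding power_Suc by (simp only: smult_add_rearrange[OF Aa Ap v])
  then show ?case unfolding Suc avg_mat_vec_Suc[OF A v] pow_mat_vec_Suc(1)[OF A v] .
qed

lemma avg_mat_eigen:
  assumes A: "A \<in> carrier_mat m m" and v: "v \<in> carrier_vec m" and An: "A ^\<^sub>m n = 1\<^sub>m m" and tn: "t ^ n = 1"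
  shows "t \<cdot>\<^sub>v (A *\<^sub>v (avg_mat m A t n *\<^sub>v v)) = avg_mat m A t n *\<^sub>v v"
proof -
  let ?a = "avg_mat m A t n *\<^sub>v v"
  have a: "?a \<in> carrier_vec m" using mult_mat_vec_carrier[OF avg_mat_carrier[OF A] v] .
  have Aa: "A *\<^sub>v ?a \<in> carrier_vec m" using mult_mat_vec_carrier[OF A a] .
  have "t \<cdot>\<^sub>v (A *\<^sub>v ?a) + v = ?a + v" using avg_mat_shift[OF A v, of t n] An tn v by simp
  then show ?thesis by (rule vec_add_right_cancel[rotated -1]) (use a Aa v in simp_all)
qed

lemma avg_mat_intertwine:
  fixes A :: "'k::field mat"
  assumes X: "X \<in> carrier_mat k m" and A: "A \<in> carrier_mat m m" and B: "B \<in> carrier_mat k k" and h: "X * A = B * X"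
    and v: "v \<in> carrier_vec m"
  shows "X *\<^sub>v (avg_mat m A t j *\<^sub>v v) = avg_mat k B t j *\<^sub>v (X *\<^sub>v v)"
proof (induction j)
  case 0
  have Xv: "X *\<^sub>v v \<in> carrier_vec k" by (rule mult_mat_vec_carrier[OF X v])
  show ?case unfolding avg_mat_vec_0[OF v] avg_mat_vec_0[OF Xv] by (rule mult_mat_zero_vec[OF X])
next
  case (Suc j)
  have Xv: "X *\<^sub>v v \<in> carrier_vec k" by (rule mult_mat_vec_carrier[OF X v])
  have a: "avg_mat m A t j *\<^sub>v v \<in> carrier_vec m" using mult_mat_vec_carrier[OF avg_mat_carrier[OF A] v] .
  have p: "A ^\<^sub>m j *\<^sub>v v \<in> carrier_vec m" by (rule mult_mat_vec_carrier[OF pow_carrier_mat[OF A] v])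
  have tp: "t ^ j \<cdot>\<^sub>v (A ^\<^sub>m j *\<^sub>v v) \<in> carrier_vec m" using p by simp
  have "X *\<^sub>v (A ^\<^sub>m j *\<^sub>v v) = B ^\<^sub>m j *\<^sub>v (X *\<^sub>v v)"
    using assoc_mult_mat_vec[OF X pow_carrier_mat[OF A] v] assoc_mult_mat_vec[OF pow_carrier_mat[OF B] X v]
      pow_intertwine[OF X A B h] by metis
  then show ?case
    unfolding avg_mat_vec_Suc[OF A v] avg_mat_vec_Suc[OF B Xv] mult_add_distrib_mat_vec[OF X a tp] Suc
      mult_smult_vec[OF X p] by simp
qed

lemma avg_mat_on_eigen:
  assumes A: "A \<in> carrier_mat m m" and v: "v \<in> carrier_vec m"
    and Ak: "\<And>k. A ^\<^sub>m k *\<^sub>v v = s ^ k \<cdot>\<^sub>v v"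
  shows "avg_mat m A t k *\<^sub>v v = (\<Sum>i<k. (t * s) ^ i) \<cdot>\<^sub>v v"
proof (induction k)
  case 0
  then show ?case unfolding avg_mat_vec_0[OF v] using v by (simp add: smult_vec_zero)
next
  case (Suc k)
  show ?case unfolding avg_mat_vec_Suc[OF A v] Suc Ak
    using v by (intro eq_vecI) (auto simp: algebra_simps power_mult_distrib)
qed

lemma avg_mat_submodule:
  assumes M: "is_hmod n q M" and U: "hm_submodule n q M U" and u: "u \<in> U"
  shows "avg_mat (hm_dim M) (act n q M g) t k *\<^sub>v u \<in> U"
proof -
  note S = submoduleD[OF M U]
  have uc: "u \<in> carrier_vec (hm_dim M)" using S(1) u by auto
  show ?thesis
  proof (induction k)
    case 0
    show ?case unfolding avg_mat_vec_0[OF uc] by (rule S(2))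
  next
    case (Suc k)
    show ?case unfolding avg_mat_vec_Suc[OF hmod_eval(2)[OF M] uc]
      by (rule S(3)[OF Suc S(5)[OF submodule_pow[OF M U u]]])
  qed
qed

context primitive_root
begin

text \<open>The projection onto the vectors of weight (x, y) for \<open>b\<close> and
  \<open>c\<close>. It turns an arbitrary preimage of a weight vector into a weight vector, and it
  splits weight components off inside a submodule.\<close>

definition wt_proj :: "'k hmod \<Rightarrow> int \<Rightarrow> int \<Rightarrow> 'k vec \<Rightarrow> 'k vec" where
  "wt_proj M x y v = (inverse (of_nat n) * inverse (of_nat n)) \<cdot>\<^sub>v
     (avg_mat (hm_dim M) (act n q M Gen_c) (q powi (- y)) n *\<^sub>v (avg_mat (hm_dim M) (act n q M Gen_b) (q powi (- x)) n *\<^sub>v v))"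

lemma powi_pow_n: "(q powi z) ^ n = 1"
proof -
  have "(q powi z) ^ n = (q ^ n) powi z" by (metis power_int_mult power_int_of_nat mult.commute)
  then show ?thesis by (simp add: q_pow_n)
qed

lemma wt_proj_carrier:
  assumes M: "is_hmod n q M" and v: "v \<in> carrier_vec (hm_dim M)"
  shows "wt_proj M x y v \<in> carrier_vec (hm_dim M)"
  unfolding wt_proj_def smult_carrier_vec
  by (rule mult_mat_vec_carrier[OF avg_mat_carrier[OF hmod_eval(2)[OF M]] mult_mat_vec_carrier[OF avg_mat_carrier[OF hmod_eval(2)[OF M]] v]])

lemma wt_proj_weight:
  assumes M: "is_hmod n q M" and v: "v \<in> carrier_vec (hm_dim M)"
  shows "act n q M Gen_b *\<^sub>v wt_proj M x y v = q powi x \<cdot>\<^sub>v wt_proj M x y v"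
    and "act n q M Gen_c *\<^sub>v wt_proj M x y v = q powi y \<cdot>\<^sub>v wt_proj M x y v"
proof -
  let ?m = "hm_dim M" and ?B = "act n q M Gen_b" and ?C = "act n q M Gen_c"
  note c = hmod_eval(2)[OF M] and R = hmod_gens_rep[OF M]
  let ?b = "avg_mat ?m ?B (q powi (- x)) n" and ?c = "avg_mat ?m ?C (q powi (- y)) n"
  note ac = avg_mat_carrier[OF c]
  have bv: "?b *\<^sub>v v \<in> carrier_vec ?m" by (rule mult_mat_vec_carrier[OF ac v])
  have cbv: "?c *\<^sub>v (?b *\<^sub>v v) \<in> carrier_vec ?m" by (rule mult_mat_vec_carrier[OF ac bv])
  have inv: "q powi z * q powi (- z) = 1" for z by (simp add: power_int_minus)
  have e: "A *\<^sub>v u = q powi z \<cdot>\<^sub>v u" if "A \<in> carrier_mat ?m ?m" "u \<in> carrier_vec ?m" "q powi (- z) \<cdot>\<^sub>v (A *\<^sub>v u) = u" for A u z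
  proof -
    have "q powi z \<cdot>\<^sub>v u = (q powi z * q powi (- z)) \<cdot>\<^sub>v (A *\<^sub>v u)"
      using that(3) by (metis smult_smult_assoc)
    then show ?thesis unfolding inv by simp
  qed
  have 1: "?B *\<^sub>v (?b *\<^sub>v v) = q powi x \<cdot>\<^sub>v (?b *\<^sub>v v)"
    by (rule e[OF c bv avg_mat_eigen[OF c v gens_repD(8)[OF R] powi_pow_n]])
  have 2: "?C *\<^sub>v (?c *\<^sub>v (?b *\<^sub>v v)) = q powi y \<cdot>\<^sub>v (?c *\<^sub>v (?b *\<^sub>v v))"
    by (rule e[OF c cbv avg_mat_eigen[OF c bv gens_repD(9)[OF R] powi_pow_n]])
  have "?B *\<^sub>v (?c *\<^sub>v (?b *\<^sub>v v)) = ?c *\<^sub>v (?B *\<^sub>v (?b *\<^sub>v v))"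
    by (rule avg_mat_intertwine[OF c c c gens_repD(6)[OF R] bv])
  also have "\<dots> = q powi x \<cdot>\<^sub>v (?c *\<^sub>v (?b *\<^sub>v v))" unfolding 1 by (rule mult_smult_vec[OF ac bv])
  finally have 3: "?B *\<^sub>v (?c *\<^sub>v (?b *\<^sub>v v)) = q powi x \<cdot>\<^sub>v (?c *\<^sub>v (?b *\<^sub>v v))" .
  show "?B *\<^sub>v wt_proj M x y v = q powi x \<cdot>\<^sub>v wt_proj M x y v" "?C *\<^sub>v wt_proj M x y v = q powi y \<cdot>\<^sub>v wt_proj M x y v"
    unfolding wt_proj_def mult_smult_vec[OF c cbv] 2 3 smult_smult_assoc by (simp_all only: mult.commute)
qed

lemma wt_proj_submodule:
  assumes M: "is_hmod n q M" and U: "hm_submodule n q M U" and u: "u \<in> U"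
  shows "wt_proj M x y u \<in> U"
  unfolding wt_proj_def by (rule submoduleD(5)[OF M U avg_mat_submodule[OF M U avg_mat_submodule[OF M U u]]])

lemma wt_proj_hom:
  assumes M: "is_hmod n q M" and N: "is_hmod n q N" and X: "X \<in> hm_hom n q M N" and v: "v \<in> carrier_vec (hm_dim M)"
  shows "X *\<^sub>v wt_proj M x y v = wt_proj N x y (X *\<^sub>v v)"
proof -
  note c = hmod_eval(2)[OF M] and c' = hmod_eval(2)[OF N] and Xc = hom_carrier[OF X]
  have bv: "avg_mat (hm_dim M) (act n q M Gen_b) t n *\<^sub>v v \<in> carrier_vec (hm_dim M)" for t
    by (rule mult_mat_vec_carrier[OF avg_mat_carrier[OF c] v])
  have cbv: "avg_mat (hm_dim M) (act n q M Gen_c) s n *\<^sub>v (avg_mat (hm_dim M) (act n q M Gen_b) t n *\<^sub>v v) \<in> carrier_vec (hm_dim M)" for s t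
    by (rule mult_mat_vec_carrier[OF avg_mat_carrier[OF c] bv])
  show ?thesis
    unfolding wt_proj_def mult_smult_vec[OF Xc cbv] avg_mat_intertwine[OF Xc c c' hom_act[OF X] bv]
      avg_mat_intertwine[OF Xc c c' hom_act[OF X] v] ..
qed

text \<open>The last hypothesis says that coinciding weights for \<open>b\<close> force coinciding
  weights for \<open>c\<close>, so that the weight for \<open>b\<close> alone decides the
  value.\<close>

lemma wt_proj_eigen:
  assumes M: "is_hmod n q M" and v: "v \<in> carrier_vec (hm_dim M)"
    and b: "act n q M Gen_b *\<^sub>v v = q powi x' \<cdot>\<^sub>v v" and c: "act n q M Gen_c *\<^sub>v v = q powi y' \<cdot>\<^sub>v v"
    and x: "x' mod int n = x mod int n \<Longrightarrow> y' mod int n = y mod int n"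
  shows "wt_proj M x y v = (if x' mod int n = x mod int n then v else 0\<^sub>v (hm_dim M))"
proof -
  note cc = hmod_eval(2)[OF M]
  have g: "(\<Sum>i<n. (q powi (- z) * q powi z') ^ i) = (if z' mod int n = z mod int n then of_nat n else 0)" for z z'
  proof -
    have e: "q powi (- z) * q powi z' = q powi (z' - z)" by (simp add: power_int_minus power_int_diff field_simps)
    show ?thesis
    proof (cases "z' mod int n = z mod int n")
      case True
      then have "q powi (z' - z) = 1" using powi_eq_iff[of z' z] by (simp add: powi_diff)
      then show ?thesis using True e by simp
    next
      case False
      then have "q powi (z' - z) \<noteq> 1" using powi_eq_iff[of z' z] by (simp add: powi_diff)
      moreover have "(1 - q powi (z' - z)) * (\<Sum>i<n. (q powi (z' - z)) ^ i) = 0"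
        using powi_pow_n[of "z' - z"] by (simp add: one_diff_power_eq[symmetric])
      ultimately show ?thesis using False unfolding e by simp
    qed
  qed
  note pe = pow_mat_eigen[OF cc v]
  have "avg_mat (hm_dim M) (act n q M Gen_b) (q powi (- x)) n *\<^sub>v v = (if x' mod int n = x mod int n then of_nat n else 0) \<cdot>\<^sub>v v"
    unfolding avg_mat_on_eigen[OF cc v pe[OF b]] g ..
  moreover have "avg_mat (hm_dim M) (act n q M Gen_c) (q powi (- y)) n *\<^sub>v v = (if y' mod int n = y mod int n then of_nat n else 0) \<cdot>\<^sub>v v"
    unfolding avg_mat_on_eigen[OF cc v pe[OF c]] g ..
  ultimately have "wt_proj M x y v = ((inverse (of_nat n) * inverse (of_nat n)) * ((if x' mod int n = x mod int n then of_nat n else 0) * (if y' mod int n = y mod int n then of_nat n else 0))) \<cdot>\<^sub>v v"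
    unfolding wt_proj_def by (simp only: mult_smult_vec[OF avg_mat_carrier[OF cc] v] smult_smult_assoc)
  moreover have "inverse (of_nat n) * inverse (of_nat n) * (of_nat n * of_nat n) = (1 :: 'k)"
    using of_nat_n_nz by (simp add: field_simps)
  ultimately show ?thesis using x v by (auto simp: smult_vec_zero)
qed

lemma weight_shift:
  assumes G: "gens_rep n q m G" and v: "v \<in> carrier_vec m"
    and bv: "G Gen_b *\<^sub>v v = q powi x \<cdot>\<^sub>v v" and cv: "G Gen_c *\<^sub>v v = q powi y \<cdot>\<^sub>v v"
  shows "G Gen_b *\<^sub>v (G Gen_a ^\<^sub>m k *\<^sub>v v) = q powi (x + int k) \<cdot>\<^sub>v (G Gen_a ^\<^sub>m k *\<^sub>v v)"
    and "G Gen_c *\<^sub>v (G Gen_a ^\<^sub>m k *\<^sub>v v) = q powi (y + int k) \<cdot>\<^sub>v (G Gen_a ^\<^sub>m k *\<^sub>v v)"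
    and "G Gen_b *\<^sub>v (G Gen_d ^\<^sub>m k *\<^sub>v v) = q powi (x - int k) \<cdot>\<^sub>v (G Gen_d ^\<^sub>m k *\<^sub>v v)"
    and "G Gen_c *\<^sub>v (G Gen_d ^\<^sub>m k *\<^sub>v v) = q powi (y - int k) \<cdot>\<^sub>v (G Gen_d ^\<^sub>m k *\<^sub>v v)"
proof -
  note c = gens_repD(1)[OF G]
  have p: "G g ^\<^sub>m k *\<^sub>v v \<in> carrier_vec m" for g k by (rule mult_mat_vec_carrier[OF pow_carrier_mat[OF c] v])
  have z: "G g ^\<^sub>m 0 *\<^sub>v v = v" for g using c[of g] v by simp
  note S = pow_mat_vec_Suc(1)[OF c v] and ms = mult_smult_vec[OF c p]
  have pw: "q powi (z + int (Suc j)) = q * q powi (z + int j)" for z j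
    by (simp add: powi_add)
  have pm: "q * q powi (z - int (Suc j)) = q powi (z - int j)" for z j
    by (simp add: powi_diff powi_add)
  have dv: "u = inverse q \<cdot>\<^sub>v w" if "w = q \<cdot>\<^sub>v u" for u w :: "'k vec"
    using that by (simp add: smult_smult_assoc)
  have pm': "inverse q * q powi (z - int j) = q powi (z - int (Suc j))" for z j
    using pm[of z j] q_nz by (simp add: field_simps)
  show "G Gen_b *\<^sub>v (G Gen_a ^\<^sub>m k *\<^sub>v v) = q powi (x + int k) \<cdot>\<^sub>v (G Gen_a ^\<^sub>m k *\<^sub>v v)"
  proof (induction k)
    case (Suc k)
    show ?case unfolding S gens_rep_vec(2)[OF G p] Suc ms smult_smult_assoc pw ..
  qed (simp add: z bv del: pow_mat.simps)
  show "G Gen_c *\<^sub>v (G Gen_a ^\<^sub>m k *\<^sub>v v) = q powi (y + int k) \<cdot>\<^sub>v (G Gen_a ^\<^sub>m k *\<^sub>v v)"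
  proof (induction k)
    case (Suc k)
    show ?case unfolding S gens_rep_vec(4)[OF G p] Suc ms smult_smult_assoc pw ..
  qed (simp add: z cv del: pow_mat.simps)
  show "G Gen_b *\<^sub>v (G Gen_d ^\<^sub>m k *\<^sub>v v) = q powi (x - int k) \<cdot>\<^sub>v (G Gen_d ^\<^sub>m k *\<^sub>v v)"
  proof (induction k)
    case (Suc k)
    show ?case unfolding S dv[OF gens_rep_vec(3)[OF G p]] Suc ms smult_smult_assoc pm' ..
  qed (simp add: z bv del: pow_mat.simps)
  show "G Gen_c *\<^sub>v (G Gen_d ^\<^sub>m k *\<^sub>v v) = q powi (y - int k) \<cdot>\<^sub>v (G Gen_d ^\<^sub>m k *\<^sub>v v)"
  proof (induction k)
    case (Suc k)
    show ?case unfolding S dv[OF gens_rep_vec(5)[OF G p]] Suc ms smult_smult_assoc pm' ..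
  qed (simp add: z cv del: pow_mat.simps)
qed

lemma highest_weight_orbit_d:
  assumes G: "gens_rep n q m G" and v: "v \<in> carrier_vec m" and dv: "G Gen_d *\<^sub>v v = 0\<^sub>v m"
    and bv: "G Gen_b *\<^sub>v v = q powi x \<cdot>\<^sub>v v" and cv: "G Gen_c *\<^sub>v v = q powi y \<cdot>\<^sub>v v"
  shows "G Gen_d ^\<^sub>m k *\<^sub>v (G Gen_a ^\<^sub>m (k + j) *\<^sub>v v) = (\<Prod>i=j+1..j+k. kap q (x + y) i) \<cdot>\<^sub>v (G Gen_a ^\<^sub>m j *\<^sub>v v)"
proof (induction k)
  case 0
  show ?case using gens_repD(1)[OF G, of Gen_d] highest_weight_orbit(1)[OF G v dv bv cv, of j] by simp
next
  case (Suc k)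
  note w = highest_weight_orbit[OF G v dv bv cv] and c = gens_repD(1)[OF G]
  have "G Gen_d ^\<^sub>m Suc k *\<^sub>v (G Gen_a ^\<^sub>m (Suc k + j) *\<^sub>v v) = G Gen_d ^\<^sub>m k *\<^sub>v (kap q (x + y) (Suc k + j) \<cdot>\<^sub>v (G Gen_a ^\<^sub>m (k + j) *\<^sub>v v))"
    unfolding pow_mat_vec_Suc(2)[OF c w(1)] w(5) by simp
  also have "\<dots> = kap q (x + y) (Suc k + j) \<cdot>\<^sub>v ((\<Prod>i=j+1..j+k. kap q (x + y) i) \<cdot>\<^sub>v (G Gen_a ^\<^sub>m j *\<^sub>v v))"
    unfolding mult_smult_vec[OF pow_carrier_mat[OF c] w(1)] Suc ..
  also have "\<dots> = (\<Prod>i=j+1..j+Suc k. kap q (x + y) i) \<cdot>\<^sub>v (G Gen_a ^\<^sub>m j *\<^sub>v v)"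
    unfolding smult_smult_assoc by (simp add: prod.nat_ivl_Suc' add.commute mult.commute)
  finally show ?case .
qed

section \<open>Simple and projective highest weight modules\<close>

lemma kap_V: "kap q (r + (1 - r - int l)) l = 0"
  by (rule kap_eq_0_at) simp

lemma kap_V_nz: "0 < j \<Longrightarrow> j < l \<Longrightarrow> l \<le> n \<Longrightarrow> kap q (r + (1 - r - int l)) j \<noteq> 0"
proof (rule kap_nz)
  assume j: "0 < j" "j < l" "l \<le> n"
  show "j < n" using j by simp
  show "(r + (1 - r - int l) + int j - 1) mod int n \<noteq> 0"
  proof
    assume "(r + (1 - r - int l) + int j - 1) mod int n = 0"
    then have "int n dvd int j - int l" by (simp add: mod_eq_0_iff_dvd)
    then have "int n dvd int l - int j" by (simp add: dvd_diff_commute)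
    then have "int n \<le> int l - int j" using j by (intro zdvd_imp_le) auto
    then show False using j by simp
  qed
qed

lemma V_hmod:
  assumes "l \<le> n"
  shows "is_hmod n q (V q l r)" "hm_dim (V q l r) = l" "act n q (V q l r) g = str_gens q l r (1 - r - int l) g"
  unfolding V_eq_str_mod using str_hmod[OF kap_V assms] by simp_all

lemma V_act:
  assumes l: "l \<le> n"
  shows "act n q (V q l r) Gen_a *\<^sub>v ub l j = ub l (Suc j)"
    and "act n q (V q l r) Gen_b *\<^sub>v ub l j = q powi (r + int j) \<cdot>\<^sub>v ub l j"
    and "act n q (V q l r) Gen_c *\<^sub>v ub l j = q powi (1 - r - int l + int j) \<cdot>\<^sub>v ub l j"
    and "act n q (V q l r) Gen_d *\<^sub>v ub l j = kap q (1 - int l) j \<cdot>\<^sub>v ub l (j - 1)"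
  unfolding V_hmod(3)[OF l] using str_act[OF kap_V] by simp_all

text \<open>For a vector of the submodule, look at its last nonzero coordinate. Each
  \<open>d\<close> lowers that position by one, because the scalars \<open>kap\<close> involved do
  not vanish; at position 0 a multiple of the generator is left, and \<open>a\<close> recovers the
  whole basis.\<close>

lemma V_simple:
  assumes l: "l \<le> n"
  shows "hm_simple n q (V q l r)"
proof -
  note M = V_hmod[OF l, of r] and A = V_act[OF l, of r]
  have "U = carrier_vec l" if U: "hm_submodule n q (V q l r) U" and ne: "\<exists>u\<in>U. u \<noteq> 0\<^sub>v l" for U
  proof -
    note S = submoduleD[OF M(1) U, unfolded M(2)]
    have c: "act n q (V q l r) g \<in> carrier_mat l l" for g using hmod_eval(2)[OF M(1)] M(2) by simp
    have bot: "j < l \<Longrightarrow> u \<in> U \<Longrightarrow> u $ j \<noteq> 0 \<Longrightarrow> (\<forall>i. j < i \<longrightarrow> i < l \<longrightarrow> u $ i = 0) \<Longrightarrow> ub l 0 \<in> U" for u j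
    proof (induction j arbitrary: u)
      case 0
      have uc: "u \<in> carrier_vec l" using S(1) 0 by auto
      have "inverse (u $ 0) \<cdot>\<^sub>v u = ub l 0"
        using 0 uc by (intro eq_vecI) (auto simp: ub_index)
      then show ?case using S(5)[OF 0(2)] by metis
    next
      case (Suc j)
      let ?D = "act n q (V q l r) Gen_d"
      have uc: "u \<in> carrier_vec l" using S(1) Suc.prems by auto
      have De: "(?D *\<^sub>v u) $ i = (if Suc i < l then kap q (1 - int l) (Suc i) * u $ Suc i else 0)" if i: "i < l" for i
      proof -
        have "(?D *\<^sub>v u) $ i = (\<Sum>k = 0..<l. ?D $$ (i, k) * u $ k)"
          using i uc c[of Gen_d] by (simp add: scalar_prod_def)
        also have "\<dots> = (\<Sum>k = 0..<l. if k = Suc i then kap q (1 - int l) k * u $ k else 0)"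
        proof (intro sum.cong refl)
          fix k assume k: "k \<in> {0..<l}"
          have "?D $$ (i, k) = (?D *\<^sub>v ub l k) $ i" using mult_ub_index[OF c i] k by simp
          also have "\<dots> = (if k = Suc i then kap q (1 - int l) k else 0)"
            unfolding A(4) using i k by (cases k) (auto simp: ub_index)
          finally show "?D $$ (i, k) * u $ k = (if k = Suc i then kap q (1 - int l) k * u $ k else 0)" by simp
        qed
        also have "\<dots> = (if Suc i < l then kap q (1 - int l) (Suc i) * u $ Suc i else 0)" by (auto simp: sum.delta)
        finally show ?thesis .
      qed
      have nz: "kap q (1 - int l) (Suc j) \<noteq> 0" using kap_V_nz[of "Suc j" l 0] Suc.prems l by simp
      show ?case
      proof (rule Suc.IH[of "?D *\<^sub>v u"])
        show "?D *\<^sub>v u \<in> U" by (rule S(4)[OF Suc.prems(2)])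
      qed (use Suc.prems nz De in auto)
    qed
    obtain u where u: "u \<in> U" "u \<noteq> 0\<^sub>v l" using ne by blast
    have uc: "u \<in> carrier_vec l" using S(1) u by auto
    let ?J = "{i. i < l \<and> u $ i \<noteq> 0}"
    have "?J \<noteq> {}"
    proof
      assume "?J = {}"
      then have "u = 0\<^sub>v l" using uc by (intro eq_vecI) auto
      then show False using u(2) by simp
    qed
    define m where "m = Max ?J"
    have fin: "finite ?J" by simp
    have m: "m \<in> ?J" unfolding m_def using \<open>?J \<noteq> {}\<close> fin by (rule Max_in[rotated])
    have tl: "\<forall>i. m < i \<longrightarrow> i < l \<longrightarrow> u $ i = 0"
    proof (intro allI impI)
      fix i assume i: "m < i" "i < l"
      show "u $ i = 0"
      proof (rule ccontr)
        assume "u $ i \<noteq> 0"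
        then have "i \<in> ?J" using i by simp
        then have "i \<le> m" unfolding m_def by (rule Max_ge[OF fin])
        then show False using i by simp
      qed
    qed
    have b0: "ub l 0 \<in> U" by (rule bot[OF _ u(1) _ tl]) (use m in simp_all)
    have "ub l j \<in> U" for j
    proof (induction j)
      case (Suc j)
      then show ?case using S(4)[of "ub l j" Gen_a] A(1)[of j] by metis
    qed (rule b0)
    then show ?thesis using submodule_all[OF M(1) U] M(2) by simp
  qed
  then show ?thesis unfolding hm_simple_def using M by simp
qed

text \<open>A preimage of the generator need not be killed by \<open>d\<close>. Taking its weight
  component u and then d^(n-1) a^(n-1) u repairs this, since d^n = 0. The image changes only by the
  factor \<open>?K\<close>, a product of the scalars \<open>kap\<close> strictly inside a string of
  length n, none of which vanishes.\<close>

lemma V_n_projective: "hm_projective n q (V q n r)"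
proof -
  note M0 = V_hmod[OF order_refl, of r]
  let ?x = r and ?y = "1 - r - int n"
  have "\<exists>F\<in>hm_hom n q (V q n r) M. g * F = f"
    if M: "is_hmod n q M" and N: "is_hmod n q N" and g: "g \<in> hm_hom n q M N" and s: "hm_surj M N g"
      and f: "f \<in> hm_hom n q (V q n r) N" for M N g f
  proof -
    let ?mM = "hm_dim M" and ?mN = "hm_dim N"
    note cM = hmod_eval(2)[OF M] and cN = hmod_eval(2)[OF N] and RM = hmod_gens_rep[OF M] and RN = hmod_gens_rep[OF N]
    note gc = hom_carrier[OF g] and fc = hom_carrier[OF f, unfolded M0(2)]
    have c0: "act n q (V q n r) h \<in> carrier_mat n n" for h using hmod_eval(2)[OF M0(1)] M0(2) by simp
    have fh: "f *\<^sub>v (act n q (V q n r) h *\<^sub>v ub n j) = act n q N h *\<^sub>v (f *\<^sub>v ub n j)" for h j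
      using assoc_mult_mat_vec[OF fc c0 ub_carrier] assoc_mult_mat_vec[OF cN fc ub_carrier] hom_act[OF f] by metis
    let ?v = "f *\<^sub>v ub n 0"
    have v: "?v \<in> carrier_vec ?mN" by (rule mult_mat_vec_carrier[OF fc ub_carrier])
    have vb: "act n q N Gen_b *\<^sub>v ?v = q powi ?x \<cdot>\<^sub>v ?v" "act n q N Gen_c *\<^sub>v ?v = q powi ?y \<cdot>\<^sub>v ?v"
      unfolding fh[symmetric] V_act(2,3)[OF order_refl] mult_smult_vec[OF fc ub_carrier] by simp_all
    have vd: "act n q N Gen_d *\<^sub>v ?v = 0\<^sub>v ?mN"
      unfolding fh[symmetric] V_act(4)[OF order_refl] mult_smult_vec[OF fc ub_carrier] using fc by (simp add: smult_vec_zero)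
    let ?K = "\<Prod>i=0+1..0+(n-1). kap q (?x + ?y) i"
    have "kap q (?x + ?y) i \<noteq> 0" if "i \<in> {0+1..0+(n-1)}" for i
      by (rule kap_V_nz) (use that n_gt_2 in auto)
    then have K: "?K \<noteq> 0" unfolding prod_zero_iff[OF finite_atLeastAtMost] by blast
    have DA: "act n q N Gen_d ^\<^sub>m (n - 1) *\<^sub>v (act n q N Gen_a ^\<^sub>m (n - 1) *\<^sub>v ?v) = ?K \<cdot>\<^sub>v ?v"
      using highest_weight_orbit_d[OF RN v vd vb, of "n - 1" 0] cN[of Gen_a] v by simp
    obtain u0 where u0: "u0 \<in> carrier_vec ?mM" "g *\<^sub>v u0 = ?v" using s v unfolding hm_surj_def by blast
    \<comment> \<open>Projecting keeps the image, because \<open>?v\<close> already has this weight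
      and homomorphisms commute with the projection.\<close>
    let ?u = "wt_proj M ?x ?y u0"
    note uc = wt_proj_carrier[OF M u0(1), of ?x ?y] and ub = wt_proj_weight[OF M u0(1), of ?x ?y]
    have gu: "g *\<^sub>v ?u = ?v"
      unfolding wt_proj_hom[OF M N g u0(1)] u0(2) using wt_proj_eigen[OF N v vb, of ?x ?y] by simp
    let ?Ap = "act n q M Gen_a ^\<^sub>m (n - 1)" and ?Dp = "act n q M Gen_d ^\<^sub>m (n - 1)"
    have pc: "act n q M h ^\<^sub>m k \<in> carrier_mat ?mM ?mM" "act n q N h ^\<^sub>m k \<in> carrier_mat ?mN ?mN" for h k
      by (rule pow_carrier_mat[OF cM], rule pow_carrier_mat[OF cN])
    have gp: "g *\<^sub>v (act n q M h ^\<^sub>m k *\<^sub>v z) = act n q N h ^\<^sub>m k *\<^sub>v (g *\<^sub>v z)" if "z \<in> carrier_vec ?mM" for h k z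
      using assoc_mult_mat_vec[OF gc pc(1) that] assoc_mult_mat_vec[OF pc(2) gc that] pow_intertwine[OF gc cM cN hom_act[OF g]] by metis
    have Au: "?Ap *\<^sub>v ?u \<in> carrier_vec ?mM" by (rule mult_mat_vec_carrier[OF pc(1) uc])
    define z where "z = ?Dp *\<^sub>v (?Ap *\<^sub>v ?u)"
    have z: "z \<in> carrier_vec ?mM" unfolding z_def by (rule mult_mat_vec_carrier[OF pc(1) Au])
    have zb: "act n q M Gen_b *\<^sub>v z = q powi ?x \<cdot>\<^sub>v z" "act n q M Gen_c *\<^sub>v z = q powi ?y \<cdot>\<^sub>v z"
      unfolding z_def weight_shift(3,4)[OF RM Au weight_shift(1,2)[OF RM uc ub]] by simp_all
    have "act n q M Gen_d *\<^sub>v z = act n q M Gen_d ^\<^sub>m Suc (n - 1) *\<^sub>v (?Ap *\<^sub>v ?u)"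
      unfolding z_def by (rule pow_mat_vec_Suc(1)[OF cM Au, symmetric])
    also have "\<dots> = 0\<^sub>v ?mM"
    proof -
      have "Suc (n - 1) = n" using n_gt_2 by simp
      then show ?thesis unfolding gens_repD(10)[OF RM, symmetric] using gens_repD(10)[OF RM] Au by (intro eq_vecI) auto
    qed
    finally have zd: "act n q M Gen_d *\<^sub>v z = 0\<^sub>v ?mM" .
    have gz: "g *\<^sub>v z = ?K \<cdot>\<^sub>v ?v" unfolding z_def gp[OF Au] gp[OF uc] gu DA ..
    let ?w = "inverse ?K \<cdot>\<^sub>v z"
    have w: "?w \<in> carrier_vec ?mM" using z by simp
    have wb: "act n q M Gen_b *\<^sub>v ?w = q powi ?x \<cdot>\<^sub>v ?w" "act n q M Gen_c *\<^sub>v ?w = q powi ?y \<cdot>\<^sub>v ?w"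
      unfolding mult_smult_vec[OF cM z] zb smult_smult_assoc by (simp_all only: mult.commute)
    have wd: "act n q M Gen_d *\<^sub>v ?w = 0\<^sub>v ?mM" unfolding mult_smult_vec[OF cM z] zd by (simp add: smult_vec_zero)
    have gw: "g *\<^sub>v ?w = ?v" unfolding mult_smult_vec[OF gc z] gz smult_smult_assoc using K by simp
    have wa: "act n q M Gen_a ^\<^sub>m n *\<^sub>v ?w = 0\<^sub>v ?mM" unfolding gens_repD(7)[OF RM] using w by (intro eq_vecI) auto
    obtain F where F: "F \<in> hm_hom n q (str_mod q n ?x ?y) M" "\<And>j. F *\<^sub>v ub n j = act n q M Gen_a ^\<^sub>m j *\<^sub>v ?w"
      using str_universal[OF kap_V order_refl M w wd wb wa] by blast
    have Fh: "F \<in> hm_hom n q (V q n r) M" using F(1) by (simp add: V_eq_str_mod)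
    note Fc = hom_carrier[OF Fh, unfolded M0(2)]
    have "g * F = f"
    proof (rule mat_eqI_ub[OF mult_carrier_mat[OF gc Fc] fc])
      fix j
      have "ub n j = act n q (V q n r) Gen_a ^\<^sub>m j *\<^sub>v ub n 0" unfolding V_hmod(3)[OF order_refl] str_gens_pow_a[OF kap_V] by simp
      then have "f *\<^sub>v ub n j = (f * act n q (V q n r) Gen_a ^\<^sub>m j) *\<^sub>v ub n 0"
        using assoc_mult_mat_vec[OF fc pow_carrier_mat[OF c0] ub_carrier] by metis
      also have "\<dots> = act n q N Gen_a ^\<^sub>m j *\<^sub>v ?v"
        unfolding pow_intertwine[OF fc c0 cN hom_act[OF f]] by (rule assoc_mult_mat_vec[OF pc(2) fc ub_carrier])
      also have "\<dots> = (g * F) *\<^sub>v ub n j"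
        unfolding assoc_mult_mat_vec[OF gc Fc ub_carrier] F(2) gp[OF w] gw ..
      finally show "(g * F) *\<^sub>v ub n j = f *\<^sub>v ub n j" by simp
    qed
    then show ?thesis using Fh by blast
  qed
  then show ?thesis unfolding hm_projective_def using M0(1) by blast
qed

end

section \<open>Short exact sequences\<close>

text \<open>Injectivity and surjectivity are recorded by linear one-sided inverses, the form in
  which they pass to tensor products with P.\<close>

definition short_exact :: "nat \<Rightarrow> 'k::field \<Rightarrow> 'k hmod \<Rightarrow> 'k hmod \<Rightarrow> 'k hmod \<Rightarrow> bool" where
  "short_exact n q W1 W W2 \<longleftrightarrow> is_hmod n q W1 \<and> is_hmod n q W \<and> is_hmod n q W2 \<and>
     (\<exists>i\<in>hm_hom n q W1 W. \<exists>p\<in>hm_hom n q W W2.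
       (\<exists>r\<in>carrier_mat (hm_dim W1) (hm_dim W). r * i = 1\<^sub>m (hm_dim W1)) \<and>
       (\<exists>s\<in>carrier_mat (hm_dim W) (hm_dim W2). p * s = 1\<^sub>m (hm_dim W2)) \<and>
       p * i = 0\<^sub>m (hm_dim W2) (hm_dim W1))"

lemma short_exactI:
  assumes "is_hmod n q W1" "is_hmod n q W" "is_hmod n q W2" "i \<in> hm_hom n q W1 W" "p \<in> hm_hom n q W W2"
    and "hm_dim W1 = a" "hm_dim W = b" "hm_dim W2 = c" "r \<in> carrier_mat a b" "s \<in> carrier_mat b c"
    and "r * i = 1\<^sub>m a" "p * s = 1\<^sub>m c" "p * i = 0\<^sub>m c a"
  shows "short_exact n q W1 W W2"
  unfolding short_exact_def using assms by blast

lemma maps_onto_exact: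
  fixes q :: "'k::field"
  assumes "primitive_root_of_unity n q" "hm_projective n q P" "short_exact n q W1 W W2"
    and "maps_onto n q (hm_tensor n q P W1) L1" "maps_onto n q (hm_tensor n q P W2) L2"
    and "\<And>S. S \<in> set L1 \<union> set L2 \<Longrightarrow> is_hmod n q S"
  shows "maps_onto n q (hm_tensor n q P W) (L1 @ L2)"
  using assms(3) maps_onto_extension[OF assms(1,2) _ _ _ _ _ _ _ _ _ _ assms(4,5,6)]
  unfolding short_exact_def by blast

context primitive_root
begin

lemma kap_cong: "w mod int n = w' mod int n \<Longrightarrow> kap q w j = kap q w' j"
proof -
  assume "w mod int n = w' mod int n"
  then have h: "(w + int j - 1) mod int n = (w' + int j - 1) mod int n"
    by (intro mod_diff_cong mod_add_cong refl)
  show ?thesis unfolding kap_def powi_cong[OF h] ..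
qed

lemma str_mod_cong:
  assumes x: "x mod int n = x' mod int n" and y: "y mod int n = y' mod int n"
  shows "str_mod q L x y = str_mod q L x' y'"
proof -
  have xy: "(x + y) mod int n = (x' + y') mod int n" using x y by (metis mod_add_eq)
  have p: "q powi (x + int j) = q powi (x' + int j)" "q powi (y + int j) = q powi (y' + int j)" for j
    using x y by (auto intro!: powi_cong mod_add_cong)
  have "str_gens q L x y g = str_gens q L x' y' g" for g
    by (cases g) (auto simp: str_gens.simps p kap_cong[OF xy] intro!: cong_mat)
  then show ?thesis unfolding str_mod_def by (metis ext)
qed

lemma V_cong: "r mod int n = r' mod int n \<Longrightarrow> V q l r = V q l r'"
  unfolding V_eq_str_mod
  by (rule str_mod_cong) (auto intro: mod_diff_cong)

text \<open>Vanishing of \<open>kap\<close> at L makes the L-th translate of the generator a highest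
  weight vector: it generates the submodule, and cutting the string there gives the quotient. The
  three hypotheses on \<open>kap\<close> are what makes each of the three strings a module.\<close>

lemma str_exact:
  assumes k: "kap q (x + y) L = 0" and k': "kap q (x + int L + (y + int L)) L' = 0" and kk: "kap q (x + y) (L + L') = 0"
    and n: "L + L' \<le> n"
  shows "short_exact n q (str_mod q L' (x + int L) (y + int L)) (str_mod q (L + L') x y) (str_mod q L x y)"
proof -
  let ?W1 = "str_mod q L' (x + int L) (y + int L)" and ?W = "str_mod q (L + L') x y" and ?W2 = "str_mod q L x y"
  have l: "L \<le> n" "L' \<le> n" using n by auto
  note M1 = str_hmod[OF k' l(2)] and M = str_hmod[OF kk n] and M2 = str_hmod[OF k l(1)]
  have "\<exists>X\<in>hm_hom n q ?W1 ?W. \<forall>j. X *\<^sub>v ub L' j = act n q ?W Gen_a ^\<^sub>m j *\<^sub>v ub (L + L') L"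
    by (rule str_universal[OF k' l(2) M(1)])
       (simp_all add: M(2,3) str_act[OF kk] str_gens_pow_a[OF kk] k smult_vec_zero ub_ge)
  then obtain i where i: "i \<in> hm_hom n q ?W1 ?W" "\<And>j. i *\<^sub>v ub L' j = ub (L + L') (L + j)"
    by (auto simp: M(2) str_gens_pow_a[OF kk])
  have "\<exists>X\<in>hm_hom n q ?W ?W2. \<forall>j. X *\<^sub>v ub (L + L') j = act n q ?W2 Gen_a ^\<^sub>m j *\<^sub>v ub L 0"
    by (rule str_universal[OF kk n M2(1)])
       (simp_all add: M2(2,3) str_act[OF k] str_gens_pow_a[OF k] smult_vec_zero ub_ge)
  then obtain p where p: "p \<in> hm_hom n q ?W ?W2" "\<And>j. p *\<^sub>v ub (L + L') j = ub L j"
    by (auto simp: M2(2) str_gens_pow_a[OF k])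
  note ic = hom_carrier[OF i(1), unfolded M1(3) M(3)] and pc = hom_carrier[OF p(1), unfolded M2(3) M(3)]
  let ?r = "cols_mat L' (L + L') (\<lambda>j. if j < L then 0\<^sub>v L' else ub L' (j - L))"
  let ?s = "cols_mat (L + L') L (\<lambda>j. ub (L + L') j)"
  have r: "?r *\<^sub>v ub (L + L') j = (if j < L + L' then if j < L then 0\<^sub>v L' else ub L' (j - L) else 0\<^sub>v L')" for j
    by (rule cols_mat_ub) auto
  have s: "?s *\<^sub>v ub L j = (if j < L then ub (L + L') j else 0\<^sub>v (L + L'))" for j
    by (rule cols_mat_ub) auto
  have "?r * i = 1\<^sub>m L'"
    by (rule mat_eqI_ub[OF mult_carrier_mat[OF cols_mat_carrier ic] one_carrier_mat])
       (simp add: assoc_mult_mat_vec[OF cols_mat_carrier ic ub_carrier] i(2) r)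
  moreover have "p * ?s = 1\<^sub>m L"
    by (rule mat_eqI_ub[OF mult_carrier_mat[OF pc cols_mat_carrier] one_carrier_mat])
       (simp add: assoc_mult_mat_vec[OF pc cols_mat_carrier ub_carrier] p(2) s)
  moreover have "p * i = 0\<^sub>m L L'"
  proof (rule mat_eqI_ub[OF mult_carrier_mat[OF pc ic] zero_carrier_mat])
    fix j
    have "0\<^sub>m L L' *\<^sub>v ub L' j = (0\<^sub>v L :: 'k vec)" by (intro eq_vecI) auto
    then show "(p * i) *\<^sub>v ub L' j = 0\<^sub>m L L' *\<^sub>v ub L' j"
      by (simp add: assoc_mult_mat_vec[OF pc ic ub_carrier] i(2) p(2) ub_ge)
  qed
  ultimately show ?thesis
    by (rule short_exactI[OF M1(1) M(1) M2(1) i(1) p(1) M1(3) M(3) M2(3) cols_mat_carrier cols_mat_carrier])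
qed

definition verma :: "nat \<Rightarrow> int \<Rightarrow> 'k hmod" where
  "verma l r = str_mod q n r (1 - r - int l)"

text \<open>For x + y = 1 - l the scalars \<open>kap\<close> vanish at l, so the string of length n
  breaks there; the weight of the lower piece matches that of V(n-l, r+l) modulo n.\<close>

lemma verma_exact:
  assumes l: "l \<le> n"
  shows "short_exact n q (V q (n - l) (r + int l)) (verma l r) (V q l r)"
proof -
  have k': "kap q (r + int l + (1 - r - int l + int l)) (n - l) = 0"
    by (rule kap_eq_0_at) (use l in \<open>simp add: of_nat_diff\<close>)
  have n: "l + (n - l) = n" using l by simp
  have "short_exact n q (str_mod q (n - l) (r + int l) (1 - r - int l + int l)) (str_mod q n r (1 - r - int l)) (str_mod q l r (1 - r - int l))"
    by (rule str_exact[OF kap_V k', unfolded n]) simp_all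
  moreover have "str_mod q (n - l) (r + int l) (1 - r - int l + int l) = V q (n - l) (r + int l)"
    unfolding V_eq_str_mod
  proof (rule str_mod_cong)
    have "1 - r - int l + int l = (1 - (r + int l) - int (n - l)) + int n" using l by simp
    then show "(1 - r - int l + int l) mod int n = (1 - (r + int l) - int (n - l)) mod int n" by (metis mod_add_self2)
  qed simp
  ultimately show ?thesis by (simp add: V_eq_str_mod verma_def)
qed

end

section \<open>Extensions of Verma modules\<close>

context primitive_root
begin

text \<open>
  The self-extension \<open>Q l r\<close> of Verma modules has basis \<open>ey j\<close>, \<open>ez j\<close> with \<open>j < n\<close>. The vectors
  \<open>ez j\<close> span the Verma module of $V(n-l,r+l)$, the quotient by them is the Verma module of $V(l,r)$,
  and \<open>d\<close> sends the generator \<open>ey 0\<close> to \<open>ez (n - l - 1)\<close>.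
\<close>

definition ey :: "nat \<Rightarrow> 'k vec" where
  "ey j = (if j < n then ub (2 * n) j else 0\<^sub>v (2 * n))"

definition ez :: "nat \<Rightarrow> 'k vec" where
  "ez j = (if j < n then ub (2 * n) (n + j) else 0\<^sub>v (2 * n))"

definition two_cols :: "nat \<Rightarrow> (nat \<Rightarrow> 'k vec) \<Rightarrow> (nat \<Rightarrow> 'k vec) \<Rightarrow> 'k mat" where
  "two_cols k Y Z = cols_mat k (2 * n) (\<lambda>j. if j < n then Y j else Z (j - n))"

text \<open>The factor q^j in the action of \<open>d\<close> on \<open>ey j\<close> is forced: it
  arises from moving \<open>d\<close> past a^j by the relation da = q ad + (1 - bc).\<close>

fun Q_gens :: "nat \<Rightarrow> int \<Rightarrow> hgen \<Rightarrow> 'k mat" where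
  "Q_gens l r Gen_a = two_cols (2 * n) (\<lambda>j. ey (Suc j)) (\<lambda>j. ez (Suc j))"
| "Q_gens l r Gen_b = two_cols (2 * n) (\<lambda>j. q powi (r + int j) \<cdot>\<^sub>v ey j) (\<lambda>j. q powi (r + int l + int j) \<cdot>\<^sub>v ez j)"
| "Q_gens l r Gen_c = two_cols (2 * n) (\<lambda>j. q powi (1 - r - int l + int j) \<cdot>\<^sub>v ey j) (\<lambda>j. q powi (1 - r + int j) \<cdot>\<^sub>v ez j)"
| "Q_gens l r Gen_d = two_cols (2 * n) (\<lambda>j. kap q (1 - int l) j \<cdot>\<^sub>v ey (j - 1) + q ^ j \<cdot>\<^sub>v ez (n - l - 1 + j))
     (\<lambda>j. kap q (1 + int l) j \<cdot>\<^sub>v ez (j - 1))"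

definition Q :: "nat \<Rightarrow> int \<Rightarrow> 'k hmod" where
  "Q l r = hm_of_gens (2 * n) (Q_gens l r)"

lemma ey_carrier [simp]: "ey j \<in> carrier_vec (2 * n)" and ez_carrier [simp]: "ez j \<in> carrier_vec (2 * n)"
  by (simp_all add: ey_def ez_def)

lemma eyz_dim [simp]: "dim_vec (ey j) = 2 * n" "dim_vec (ez j) = 2 * n"
  by (simp_all add: ey_def ez_def)

lemma eyz_ge: "n \<le> j \<Longrightarrow> ey j = 0\<^sub>v (2 * n)" "n \<le> j \<Longrightarrow> ez j = 0\<^sub>v (2 * n)"
  by (simp_all add: ey_def ez_def)

lemma ub_eyz: "j < 2 * n \<Longrightarrow> ub (2 * n) j = (if j < n then ey j else ez (j - n))"
  by (auto simp: ey_def ez_def)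

lemma two_cols_carrier [simp]: "two_cols k Y Z \<in> carrier_mat k (2 * n)"
  by (simp add: two_cols_def)

lemma two_cols_vec:
  assumes c: "\<And>j. Y j \<in> carrier_vec k" "\<And>j. Z j \<in> carrier_vec k"
    and z: "\<And>j. n \<le> j \<Longrightarrow> Y j = 0\<^sub>v k" "\<And>j. n \<le> j \<Longrightarrow> Z j = 0\<^sub>v k"
  shows "two_cols k Y Z *\<^sub>v ey j = Y j" "two_cols k Y Z *\<^sub>v ez j = Z j"
proof -
  have u: "two_cols k Y Z *\<^sub>v ub (2 * n) i = (if i < 2 * n then if i < n then Y i else Z (i - n) else 0\<^sub>v k)" for i
    unfolding two_cols_def by (rule cols_mat_ub) (use c in auto)
  have z0: "two_cols k Y Z *\<^sub>v 0\<^sub>v (2 * n) = 0\<^sub>v k" by (rule mult_mat_zero_vec[OF two_cols_carrier])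
  show "two_cols k Y Z *\<^sub>v ey j = Y j" unfolding ey_def using u[of j] z0 z by auto
  show "two_cols k Y Z *\<^sub>v ez j = Z j" unfolding ez_def using u[of "n + j"] z0 z by auto
qed

lemma mat_eqI_eyz:
  fixes A B :: "'k mat"
  assumes "A \<in> carrier_mat m (2 * n)" "B \<in> carrier_mat m (2 * n)"
    and "\<And>j. A *\<^sub>v ey j = B *\<^sub>v ey j" "\<And>j. A *\<^sub>v ez j = B *\<^sub>v ez j"
  shows "A = B"
  by (rule mat_eqI_ub[OF assms(1,2)]) (use assms(3,4) in \<open>simp add: ub_eyz\<close>)

lemma kap_1_minus: "kap q (1 - int l) l = 0"
  by (rule kap_eq_0_at) simp

lemma kap_1_plus: "l \<le> n \<Longrightarrow> kap q (1 + int l) (n - l) = 0"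
  by (rule kap_eq_0_at) (simp add: of_nat_diff)

lemma Q_gens_carrier: "Q_gens l r g \<in> carrier_mat (2 * n) (2 * n)"
  by (cases g) simp_all

lemma Q_act:
  assumes l: "0 < l" "l < n"
  shows "Q_gens l r Gen_a *\<^sub>v ey j = ey (Suc j)" "Q_gens l r Gen_a *\<^sub>v ez j = ez (Suc j)"
    and "Q_gens l r Gen_b *\<^sub>v ey j = q powi (r + int j) \<cdot>\<^sub>v ey j"
    and "Q_gens l r Gen_b *\<^sub>v ez j = q powi (r + int l + int j) \<cdot>\<^sub>v ez j"
    and "Q_gens l r Gen_c *\<^sub>v ey j = q powi (1 - r - int l + int j) \<cdot>\<^sub>v ey j"
    and "Q_gens l r Gen_c *\<^sub>v ez j = q powi (1 - r + int j) \<cdot>\<^sub>v ez j"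
    and "Q_gens l r Gen_d *\<^sub>v ey j = kap q (1 - int l) j \<cdot>\<^sub>v ey (j - 1) + q ^ j \<cdot>\<^sub>v ez (n - l - 1 + j)"
    and "Q_gens l r Gen_d *\<^sub>v ez j = kap q (1 + int l) j \<cdot>\<^sub>v ez (j - 1)"
proof -
  have kz: "kap q w j \<cdot>\<^sub>v ey (j - 1) = 0\<^sub>v (2 * n)" "kap q w j \<cdot>\<^sub>v ez (j - 1) = 0\<^sub>v (2 * n)" if "n \<le> j" for w j
    using that eyz_ge[of "j - 1"] by (cases "j = n"; simp add: smult_vec_zero)+
  show "Q_gens l r Gen_a *\<^sub>v ey j = ey (Suc j)" "Q_gens l r Gen_a *\<^sub>v ez j = ez (Suc j)"
    unfolding Q_gens.simps by (rule two_cols_vec; simp add: eyz_ge)+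
  show "Q_gens l r Gen_b *\<^sub>v ey j = q powi (r + int j) \<cdot>\<^sub>v ey j"
    "Q_gens l r Gen_b *\<^sub>v ez j = q powi (r + int l + int j) \<cdot>\<^sub>v ez j"
    unfolding Q_gens.simps by (rule two_cols_vec; simp add: eyz_ge smult_vec_zero)+
  show "Q_gens l r Gen_c *\<^sub>v ey j = q powi (1 - r - int l + int j) \<cdot>\<^sub>v ey j"
    "Q_gens l r Gen_c *\<^sub>v ez j = q powi (1 - r + int j) \<cdot>\<^sub>v ez j"
    unfolding Q_gens.simps by (rule two_cols_vec; simp add: eyz_ge smult_vec_zero)+
  have nl: "n \<le> n - l - 1 + j" if "n \<le> j" for j using that l by simp
  show "Q_gens l r Gen_d *\<^sub>v ey j = kap q (1 - int l) j \<cdot>\<^sub>v ey (j - 1) + q ^ j \<cdot>\<^sub>v ez (n - l - 1 + j)"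
    "Q_gens l r Gen_d *\<^sub>v ez j = kap q (1 + int l) j \<cdot>\<^sub>v ez (j - 1)"
    unfolding Q_gens.simps
    by (rule two_cols_vec; simp add: kz[simplified] eyz_ge nl[simplified] smult_vec_zero)+
qed

declare Q_gens.simps [simp del]

text \<open>Aimed at k + 1 = n, where the two coefficients become 1 and 0, so that
  \<open>d^n\<close> commutes with \<open>a\<close>. The matrix \<open>B\<close> stands for bc,
  which \<open>d\<close> crosses at the cost of q^2.\<close>

lemma d_pow_a:
  fixes A :: "'k mat"
  assumes c: "A \<in> carrier_mat m m" "B \<in> carrier_mat m m" "D \<in> carrier_mat m m"
    and da: "\<And>v. v \<in> carrier_vec m \<Longrightarrow> D *\<^sub>v (A *\<^sub>v v) = q \<cdot>\<^sub>v (A *\<^sub>v (D *\<^sub>v v)) + (v - B *\<^sub>v v)"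
    and db: "\<And>v. v \<in> carrier_vec m \<Longrightarrow> D *\<^sub>v (B *\<^sub>v v) = (q * q) \<cdot>\<^sub>v (B *\<^sub>v (D *\<^sub>v v))"
    and v: "v \<in> carrier_vec m"
  shows "D ^\<^sub>m Suc k *\<^sub>v (A *\<^sub>v v) = q ^ Suc k \<cdot>\<^sub>v (A *\<^sub>v (D ^\<^sub>m Suc k *\<^sub>v v)) +
     q_int q (Suc k) \<cdot>\<^sub>v (D ^\<^sub>m k *\<^sub>v v - q ^ k \<cdot>\<^sub>v (B *\<^sub>v (D ^\<^sub>m k *\<^sub>v v)))"
proof (induction k)
  case 0
  have "D ^\<^sub>m Suc 0 = D" "D ^\<^sub>m 0 *\<^sub>v v = v" using c v by simp_all
  then show ?case using da[OF v] by (simp add: q_int_def)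
next
  case (Suc k)
  let ?p = "D ^\<^sub>m k *\<^sub>v v"
  have p: "?p \<in> carrier_vec m" by (rule mult_mat_vec_carrier[OF pow_carrier_mat[OF c(3)] v])
  have Av: "A *\<^sub>v v \<in> carrier_vec m" by (rule mult_mat_vec_carrier[OF c(1) v])
  note S = pow_mat_vec_Suc(1)[OF c(3)]
  define u where "u = D *\<^sub>v ?p"
  have u: "u \<in> carrier_vec m" unfolding u_def by (rule mult_mat_vec_carrier[OF c(3) p])
  have Au: "A *\<^sub>v u \<in> carrier_vec m" "B *\<^sub>v ?p \<in> carrier_vec m" "B *\<^sub>v u \<in> carrier_vec m" "D *\<^sub>v u \<in> carrier_vec m" "A *\<^sub>v (D *\<^sub>v u) \<in> carrier_vec m"
    using mult_mat_vec_carrier[OF c(1) u] mult_mat_vec_carrier[OF c(2) p] mult_mat_vec_carrier[OF c(2) u] mult_mat_vec_carrier[OF c(3) u]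
      mult_mat_vec_carrier[OF c(1) mult_mat_vec_carrier[OF c(3) u]] by auto
  have pS: "D ^\<^sub>m Suc k *\<^sub>v v = u" unfolding S[OF v] u_def ..
  have pSS: "D ^\<^sub>m Suc (Suc k) *\<^sub>v v = D *\<^sub>v u" unfolding S[OF v, of "Suc k"] pS ..
  have IH: "D ^\<^sub>m Suc k *\<^sub>v (A *\<^sub>v v) = q ^ Suc k \<cdot>\<^sub>v (A *\<^sub>v u) + q_int q (Suc k) \<cdot>\<^sub>v (?p - q ^ k \<cdot>\<^sub>v (B *\<^sub>v ?p))"
    using Suc unfolding pS .
  have "D ^\<^sub>m Suc (Suc k) *\<^sub>v (A *\<^sub>v v) = D *\<^sub>v (q ^ Suc k \<cdot>\<^sub>v (A *\<^sub>v u) + q_int q (Suc k) \<cdot>\<^sub>v (?p - q ^ k \<cdot>\<^sub>v (B *\<^sub>v ?p)))"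
    unfolding S[OF Av, of "Suc k"] IH ..
  also have "\<dots> = q ^ Suc k \<cdot>\<^sub>v (D *\<^sub>v (A *\<^sub>v u)) + q_int q (Suc k) \<cdot>\<^sub>v (u - q ^ k \<cdot>\<^sub>v (D *\<^sub>v (B *\<^sub>v ?p)))"
  proof -
    have 1: "q ^ Suc k \<cdot>\<^sub>v (A *\<^sub>v u) \<in> carrier_vec m" "q ^ k \<cdot>\<^sub>v (B *\<^sub>v ?p) \<in> carrier_vec m" "?p - q ^ k \<cdot>\<^sub>v (B *\<^sub>v ?p) \<in> carrier_vec m"
      using Au p by simp_all
    then have 2: "q_int q (Suc k) \<cdot>\<^sub>v (?p - q ^ k \<cdot>\<^sub>v (B *\<^sub>v ?p)) \<in> carrier_vec m" by simp
    show ?thesis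
      unfolding mult_add_distrib_mat_vec[OF c(3) 1(1) 2] mult_smult_vec[OF c(3) Au(1)] mult_smult_vec[OF c(3) 1(3)]
        mult_minus_distrib_mat_vec[OF c(3) p 1(2)] mult_smult_vec[OF c(3) Au(2)] u_def[symmetric] ..
  qed
  also have "\<dots> = q ^ Suc k \<cdot>\<^sub>v (q \<cdot>\<^sub>v (A *\<^sub>v (D *\<^sub>v u)) + (u - B *\<^sub>v u)) + q_int q (Suc k) \<cdot>\<^sub>v (u - q ^ k \<cdot>\<^sub>v ((q * q) \<cdot>\<^sub>v (B *\<^sub>v u)))"
    unfolding da[OF u] db[OF p] u_def[symmetric] ..
  also have "\<dots> = q ^ Suc (Suc k) \<cdot>\<^sub>v (A *\<^sub>v (D *\<^sub>v u)) + q_int q (Suc (Suc k)) \<cdot>\<^sub>v (u - q ^ Suc k \<cdot>\<^sub>v (B *\<^sub>v u))"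
  proof -
    have gen: "s \<cdot>\<^sub>v (q \<cdot>\<^sub>v w + (u' - b)) + i \<cdot>\<^sub>v (u' - t \<cdot>\<^sub>v ((q * q) \<cdot>\<^sub>v b)) = (q * s) \<cdot>\<^sub>v w + (i + s) \<cdot>\<^sub>v (u' - (q * t) \<cdot>\<^sub>v b)"
      if cc: "w \<in> carrier_vec m" "u' \<in> carrier_vec m" "b \<in> carrier_vec m" and i: "i + s = 1 + q * i" and s: "s = q * t" for w u' b :: "'k vec" and s i t
    proof (rule eq_vecI)
      fix j assume "j < dim_vec ((q * s) \<cdot>\<^sub>v w + (i + s) \<cdot>\<^sub>v (u' - (q * t) \<cdot>\<^sub>v b))"
      then have j: "j < m" using cc by auto
      have "s + i * (t * (q * q)) = (i + s) * (q * t)"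
        unfolding i using s by (simp add: algebra_simps)
      then have "(s + i * (t * (q * q))) * b $ j = (i + s) * (q * t) * b $ j" by simp
      then show "(s \<cdot>\<^sub>v (q \<cdot>\<^sub>v w + (u' - b)) + i \<cdot>\<^sub>v (u' - t \<cdot>\<^sub>v ((q * q) \<cdot>\<^sub>v b))) $ j = ((q * s) \<cdot>\<^sub>v w + (i + s) \<cdot>\<^sub>v (u' - (q * t) \<cdot>\<^sub>v b)) $ j"
        using j cc by (simp add: algebra_simps)
    qed (use cc in auto)
    have "q_int q (Suc k) + q ^ Suc k = 1 + q * q_int q (Suc k)"
      using q_int_eq[of "Suc k"] by (simp add: algebra_simps)
    from gen[OF Au(5) u Au(3) this, of "q ^ k"] show ?thesis by (simp add: q_int_Suc[of "Suc k"])
  qed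
  finally show ?case unfolding pSS pS .
qed

text \<open>The delicate relation is \<open>d^n = 0\<close> on the vectors \<open>ey j\<close>. It
  is checked on \<open>ey 0\<close> and carried to the others by \<open>a\<close>, with which
  \<open>d^n\<close> commutes by \<open>d_pow_a\<close>.\<close>

lemma gens_rep_Q:
  assumes l: "0 < l" "l < n"
  shows "gens_rep n q (2 * n) (Q_gens l r)"
proof -
  let ?G = "Q_gens l r"
  note c = Q_gens_carrier[of l r]
  note cc = mult_carrier_mat[OF c c]
  note s = Q_act[OF l]
  note ms = mult_smult_vec[OF c ey_carrier] mult_smult_vec[OF c ez_carrier]
  have sc: "t \<cdot>\<^sub>v ey j \<in> carrier_vec (2 * n)" "t \<cdot>\<^sub>v ez j \<in> carrier_vec (2 * n)" for t j by simp_all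
  have ma: "?G g *\<^sub>v (t \<cdot>\<^sub>v ey i + t' \<cdot>\<^sub>v ez j) = t \<cdot>\<^sub>v (?G g *\<^sub>v ey i) + t' \<cdot>\<^sub>v (?G g *\<^sub>v ez j)" for g t t' i j
    unfolding mult_add_distrib_mat_vec[OF c sc] ms ..
  have a: "(?G g * ?G h) *\<^sub>v ey j = ?G g *\<^sub>v (?G h *\<^sub>v ey j)" "(?G g * ?G h) *\<^sub>v ez j = ?G g *\<^sub>v (?G h *\<^sub>v ez j)" for g h j
    by (rule assoc_mult_mat_vec[OF c c ey_carrier], rule assoc_mult_mat_vec[OF c c ez_carrier])
  have sm: "(t \<cdot>\<^sub>m (?G g * ?G h)) *\<^sub>v ey j = t \<cdot>\<^sub>v (?G g *\<^sub>v (?G h *\<^sub>v ey j))"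
    "(t \<cdot>\<^sub>m (?G g * ?G h)) *\<^sub>v ez j = t \<cdot>\<^sub>v (?G g *\<^sub>v (?G h *\<^sub>v ez j))" for t g h j
    unfolding a[symmetric] by (rule smult_mat_mult_vec[OF cc ey_carrier], rule smult_mat_mult_vec[OF cc ez_carrier])
  note simps = a sm s ms ma smult_smult_assoc
  have sad: "t \<cdot>\<^sub>v (x + y) = t \<cdot>\<^sub>v x + t \<cdot>\<^sub>v y" if "x \<in> carrier_vec (2 * n)" "y \<in> carrier_vec (2 * n)" for t and x y :: "'k vec"
    by (rule smult_add_distrib_vec[OF that])
  have pw: "q powi (z + (1 + int j)) = q * q powi (z + int j)" for z j
    by (simp add: powi_add)
  have db: "q powi (z + int j) * kap q w j = q * (kap q w j * q powi (z + int (j - 1)))" for z j w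
  proof (cases j)
    case (Suc i)
    then show ?thesis using pw[of z i] by simp
  qed simp
  \<comment> \<open>The vector \<open>ez (n - l - 1)\<close> has exponent r + n - 1 for
    \<open>b\<close>, one less than that of \<open>ey 0\<close> modulo n, as an image of
    \<open>ey 0\<close> under \<open>d\<close> must.\<close>
  have shift: "q powi (x + int (n - l - 1 + j)) * q = q powi (x - int l + int j)" for x j
  proof -
    have "q powi (x + int (n - l - 1 + j)) * q = q powi (x + int (n - l - 1 + j) + 1)" by (simp add: powi_add)
    also have "x + int (n - l - 1 + j) + 1 = x - int l + int j + int n" using l by (simp add: of_nat_diff)
    also have "q powi \<dots> = q powi (x - int l + int j)" by (rule powi_cong) simp
    finally show ?thesis .
  qed
  have sh1: "q powi (r + int j) * q ^ j = q * (q ^ j * q powi (r + int l + int (n - l - 1 + j)))" for j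
    using shift[of "r + int l" j] by (simp add: mult.commute mult.left_commute)
  have sh2: "q powi (1 - r - int l + int j) * q ^ j = q * (q ^ j * q powi (1 - r + int (n - l - 1 + j)))" for j
    using shift[of "1 - r" j] by (simp add: mult.commute mult.left_commute)
  have da1: "?G Gen_d *\<^sub>v (?G Gen_a *\<^sub>v ey j) = q \<cdot>\<^sub>v (?G Gen_a *\<^sub>v (?G Gen_d *\<^sub>v ey j)) + (ey j - ?G Gen_b *\<^sub>v (?G Gen_c *\<^sub>v ey j))" for j
  proof -
    have e: "kap q (1 - int l) j \<cdot>\<^sub>v ey (Suc (j - 1)) = kap q (1 - int l) j \<cdot>\<^sub>v ey j" by (cases j) (auto simp: smult_vec_zero)
    have p: "q powi (1 - r - int l + int j) * q powi (r + int j) = q powi (1 - int l + 2 * int j)"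
      by (simp add: mult_2 algebra_simps flip: powi_add)
    have z: "n - l - 1 + Suc j = Suc (n - l - 1 + j)" by simp
    have "q \<cdot>\<^sub>v (?G Gen_a *\<^sub>v (?G Gen_d *\<^sub>v ey j)) + (ey j - ?G Gen_b *\<^sub>v (?G Gen_c *\<^sub>v ey j))
      = q \<cdot>\<^sub>v (kap q (1 - int l) j \<cdot>\<^sub>v ey j + q ^ j \<cdot>\<^sub>v ez (n - l - 1 + Suc j)) + (ey j - q powi (1 - int l + 2 * int j) \<cdot>\<^sub>v ey j)"
      unfolding s ma ms e smult_smult_assoc p z ..
    also have "\<dots> = kap q (1 - int l) (Suc j) \<cdot>\<^sub>v ey j + q ^ Suc j \<cdot>\<^sub>v ez (n - l - 1 + Suc j)"
      unfolding kap_Suc by (intro eq_vecI) (auto simp: algebra_simps)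
    finally show ?thesis unfolding s by simp
  qed
  have da2: "?G Gen_d *\<^sub>v (?G Gen_a *\<^sub>v ez j) = q \<cdot>\<^sub>v (?G Gen_a *\<^sub>v (?G Gen_d *\<^sub>v ez j)) + (ez j - ?G Gen_b *\<^sub>v (?G Gen_c *\<^sub>v ez j))" for j
  proof -
    have e: "kap q (1 + int l) j \<cdot>\<^sub>v ez (Suc (j - 1)) = kap q (1 + int l) j \<cdot>\<^sub>v ez j" by (cases j) (auto simp: smult_vec_zero)
    have p: "q powi (1 - r + int j) * q powi (r + int l + int j) = q powi (1 + int l + 2 * int j)"
      by (simp add: mult_2 algebra_simps flip: powi_add)
    have "q \<cdot>\<^sub>v (?G Gen_a *\<^sub>v (?G Gen_d *\<^sub>v ez j)) + (ez j - ?G Gen_b *\<^sub>v (?G Gen_c *\<^sub>v ez j))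
      = q \<cdot>\<^sub>v (kap q (1 + int l) j \<cdot>\<^sub>v ez j) + (ez j - q powi (1 + int l + 2 * int j) \<cdot>\<^sub>v ez j)"
      unfolding s ms e smult_smult_assoc p ..
    also have "\<dots> = kap q (1 + int l) (Suc j) \<cdot>\<^sub>v ez j"
      unfolding kap_Suc by (intro eq_vecI) (auto simp: algebra_simps)
    finally show ?thesis unfolding s by simp
  qed
  have DA: "?G Gen_d * ?G Gen_a = q \<cdot>\<^sub>m (?G Gen_a * ?G Gen_d) + (1\<^sub>m (2 * n) - ?G Gen_b * ?G Gen_c)"
  proof -
    have e: "(q \<cdot>\<^sub>m (?G Gen_a * ?G Gen_d) + (1\<^sub>m (2 * n) - ?G Gen_b * ?G Gen_c)) *\<^sub>v u =
        (q \<cdot>\<^sub>m (?G Gen_a * ?G Gen_d)) *\<^sub>v u + (u - (?G Gen_b * ?G Gen_c) *\<^sub>v u)" if u: "u \<in> carrier_vec (2 * n)" for u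
      using add_mult_distrib_mat_vec[OF smult_carrier_mat[OF cc] minus_carrier_mat[OF cc] u, of q Gen_a Gen_d "1\<^sub>m (2 * n)" Gen_b Gen_c]
        minus_mult_distrib_mat_vec[OF one_carrier_mat cc u, of Gen_b Gen_c] u by simp
    show ?thesis
    proof (rule mat_eqI_eyz[OF cc])
      show "(?G Gen_d * ?G Gen_a) *\<^sub>v ey j = (q \<cdot>\<^sub>m (?G Gen_a * ?G Gen_d) + (1\<^sub>m (2 * n) - ?G Gen_b * ?G Gen_c)) *\<^sub>v ey j" for j
        unfolding e[OF ey_carrier] sm a by (rule da1)
      show "(?G Gen_d * ?G Gen_a) *\<^sub>v ez j = (q \<cdot>\<^sub>m (?G Gen_a * ?G Gen_d) + (1\<^sub>m (2 * n) - ?G Gen_b * ?G Gen_c)) *\<^sub>v ez j" for j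
        unfolding e[OF ez_carrier] sm a by (rule da2)
    qed (simp add: cc add_carrier_mat minus_carrier_mat[OF cc])
  qed
  have DB: "?G Gen_d * ?G Gen_b = q \<cdot>\<^sub>m (?G Gen_b * ?G Gen_d)"
    by (rule mat_eqI_eyz[of _ "2 * n"]) (simp_all add: cc simps db sad sh1)
  have DC: "?G Gen_d * ?G Gen_c = q \<cdot>\<^sub>m (?G Gen_c * ?G Gen_d)"
    by (rule mat_eqI_eyz[of _ "2 * n"]) (simp_all add: cc simps db sad sh2)
  have ap: "?G Gen_a ^\<^sub>m k *\<^sub>v ey j = ey (j + k)" "?G Gen_a ^\<^sub>m k *\<^sub>v ez j = ez (j + k)" for k j
  proof (induction k)
    case 0
    { case 1 then show ?case using c[of Gen_a] by simp }
    { case 2 then show ?case using c[of Gen_a] by simp }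
  next
    case (Suc k)
    { case 1 then show ?case unfolding pow_mat_vec_Suc(1)[OF c ey_carrier] Suc s by simp }
    { case 2 then show ?case unfolding pow_mat_vec_Suc(1)[OF c ez_carrier] Suc s by simp }
  qed
  have z: "(0\<^sub>m (2 * n) (2 * n) :: 'k mat) *\<^sub>v u = 0\<^sub>v (2 * n)" if "u \<in> carrier_vec (2 * n)" for u
    using that by (intro eq_vecI) auto
  have dz: "?G Gen_d ^\<^sub>m k *\<^sub>v ez j = 0\<^sub>v (2 * n)" if "j < k" for j k
    using that
  proof (induction k arbitrary: j)
    case (Suc k)
    show ?case
    proof (cases j)
      case 0
      then show ?thesis unfolding pow_mat_vec_Suc(2)[OF c ez_carrier] s using mult_mat_zero_vec[OF pow_carrier_mat[OF c]] by (simp add: smult_vec_zero)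
    next
      case (Suc i)
      then have "?G Gen_d ^\<^sub>m k *\<^sub>v ez (j - 1) = 0\<^sub>v (2 * n)" using Suc.IH[of i] \<open>j < Suc k\<close> by simp
      then show ?thesis unfolding pow_mat_vec_Suc(2)[OF c ez_carrier] s mult_smult_vec[OF pow_carrier_mat[OF c] ez_carrier] by (simp add: smult_vec_zero)
    qed
  qed simp
  \<comment> \<open>The first \<open>d\<close> leads to \<open>ez (n - l - 1)\<close>, and n - l
    further ones kill that vector. Since l > 0, the remaining n - 1 are enough.\<close>
  have dy0: "?G Gen_d ^\<^sub>m n *\<^sub>v ey 0 = 0\<^sub>v (2 * n)"
  proof -
    have n1: "n = Suc (n - 1)" using l by simp
    have "?G Gen_d ^\<^sub>m Suc (n - 1) *\<^sub>v ey 0 = ?G Gen_d ^\<^sub>m (n - 1) *\<^sub>v ez (n - l - 1)"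
      unfolding pow_mat_vec_Suc(2)[OF c ey_carrier] s by (simp add: smult_vec_zero)
    also have "\<dots> = 0\<^sub>v (2 * n)" by (rule dz) (use l in simp)
    finally show ?thesis using n1 by simp
  qed
  let ?E = "?G Gen_b * ?G Gen_c"
  have da: "?G Gen_d *\<^sub>v (?G Gen_a *\<^sub>v v) = q \<cdot>\<^sub>v (?G Gen_a *\<^sub>v (?G Gen_d *\<^sub>v v)) + (v - ?E *\<^sub>v v)" if v: "v \<in> carrier_vec (2 * n)" for v
  proof -
    have "(?G Gen_d * ?G Gen_a) *\<^sub>v v = (q \<cdot>\<^sub>m (?G Gen_a * ?G Gen_d)) *\<^sub>v v + (v - ?E *\<^sub>v v)"
      unfolding DA
      using add_mult_distrib_mat_vec[OF smult_carrier_mat[OF cc] minus_carrier_mat[OF cc] v, of q Gen_a Gen_d "1\<^sub>m (2 * n)" Gen_b Gen_c]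
        minus_mult_distrib_mat_vec[OF one_carrier_mat cc v, of Gen_b Gen_c] v by simp
    then show ?thesis unfolding smult_mat_mult_vec[OF cc v] assoc_mult_mat_vec[OF c c v] .
  qed
  have dE: "?G Gen_d *\<^sub>v (?E *\<^sub>v v) = (q * q) \<cdot>\<^sub>v (?E *\<^sub>v (?G Gen_d *\<^sub>v v))" if v: "v \<in> carrier_vec (2 * n)" for v
  proof -
    have Cv: "?G g *\<^sub>v v \<in> carrier_vec (2 * n)" for g by (rule mult_mat_vec_carrier[OF c v])
    have CCv: "?G g *\<^sub>v (?G h *\<^sub>v v) \<in> carrier_vec (2 * n)" for g h by (rule mult_mat_vec_carrier[OF c Cv])
    have 1: "?G Gen_d *\<^sub>v (?G Gen_b *\<^sub>v w) = q \<cdot>\<^sub>v (?G Gen_b *\<^sub>v (?G Gen_d *\<^sub>v w))"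
      "?G Gen_d *\<^sub>v (?G Gen_c *\<^sub>v w) = q \<cdot>\<^sub>v (?G Gen_c *\<^sub>v (?G Gen_d *\<^sub>v w))" if w: "w \<in> carrier_vec (2 * n)" for w
      using arg_cong[OF DB, of "\<lambda>X. X *\<^sub>v w"] arg_cong[OF DC, of "\<lambda>X. X *\<^sub>v w"]
      unfolding smult_mat_mult_vec[OF cc w] assoc_mult_mat_vec[OF c c w] .
    show ?thesis
      unfolding assoc_mult_mat_vec[OF c c v] assoc_mult_mat_vec[OF c c Cv] 1(1)[OF Cv] 1(2)[OF v] mult_smult_vec[OF c CCv] smult_smult_assoc ..
  qed
  have dn: "?G Gen_d ^\<^sub>m n *\<^sub>v (?G Gen_a *\<^sub>v v) = ?G Gen_a *\<^sub>v (?G Gen_d ^\<^sub>m n *\<^sub>v v)" if v: "v \<in> carrier_vec (2 * n)" for v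
  proof -
    obtain k where k: "n = Suc k" using l by (cases n) auto
    have pv: "?G Gen_d ^\<^sub>m k *\<^sub>v v \<in> carrier_vec (2 * n)" for k by (rule mult_mat_vec_carrier[OF pow_carrier_mat[OF c] v])
    have Ev: "?E *\<^sub>v (?G Gen_d ^\<^sub>m k *\<^sub>v v) \<in> carrier_vec (2 * n)" for k by (rule mult_mat_vec_carrier[OF cc pv])
    have Apv: "?G Gen_a *\<^sub>v (?G Gen_d ^\<^sub>m k *\<^sub>v v) \<in> carrier_vec (2 * n)" for k by (rule mult_mat_vec_carrier[OF c pv])
    have zz: "0 \<cdot>\<^sub>v (x - t \<cdot>\<^sub>v y) = 0\<^sub>v (2 * n)" "1 \<cdot>\<^sub>v x + 0\<^sub>v (2 * n) = x" if "x \<in> carrier_vec (2 * n)" "y \<in> carrier_vec (2 * n)" for x y :: "'k vec" and t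
      using that by (auto intro!: eq_vecI)
    have q1: "q ^ Suc k = 1" "q_int q (Suc k) = 0" using k q_pow_n q_int_n by simp_all
    have "?G Gen_d ^\<^sub>m Suc k *\<^sub>v (?G Gen_a *\<^sub>v v) = q ^ Suc k \<cdot>\<^sub>v (?G Gen_a *\<^sub>v (?G Gen_d ^\<^sub>m Suc k *\<^sub>v v)) +
        q_int q (Suc k) \<cdot>\<^sub>v (?G Gen_d ^\<^sub>m k *\<^sub>v v - q ^ k \<cdot>\<^sub>v (?E *\<^sub>v (?G Gen_d ^\<^sub>m k *\<^sub>v v)))"
      by (rule d_pow_a[OF c cc c da dE v])
    also have "\<dots> = 1 \<cdot>\<^sub>v (?G Gen_a *\<^sub>v (?G Gen_d ^\<^sub>m Suc k *\<^sub>v v)) + 0\<^sub>v (2 * n)"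
      unfolding q1 zz(1)[OF pv Ev] ..
    also have "\<dots> = ?G Gen_a *\<^sub>v (?G Gen_d ^\<^sub>m Suc k *\<^sub>v v)" by (rule zz(2)[OF Apv Apv])
    finally have "?G Gen_d ^\<^sub>m Suc k *\<^sub>v (?G Gen_a *\<^sub>v v) = ?G Gen_a *\<^sub>v (?G Gen_d ^\<^sub>m Suc k *\<^sub>v v)" .
    then show ?thesis using k by simp
  qed
  have dy: "?G Gen_d ^\<^sub>m n *\<^sub>v ey j = 0\<^sub>v (2 * n)" for j
  proof (induction j)
    case (Suc j)
    show ?case unfolding s(1)[of r j, symmetric] dn[OF ey_carrier] Suc by (rule mult_mat_zero_vec[OF c])
  qed (rule dy0)
  have on: "t \<cdot>\<^sub>v ey j = 1\<^sub>m (2 * n) *\<^sub>v ey j" "t \<cdot>\<^sub>v ez j = 1\<^sub>m (2 * n) *\<^sub>v ez j" if "t = 1" for t j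
    using that by (auto intro!: eq_vecI)
  show ?thesis
  proof (rule gens_repI)
    show "?G g \<in> carrier_mat (2 * n) (2 * n)" for g by (rule c)
    show "?G Gen_b * ?G Gen_a = q \<cdot>\<^sub>m (?G Gen_a * ?G Gen_b)"
      by (rule mat_eqI_eyz[of _ "2 * n"]) (simp_all add: cc simps pw)
    have e: "2 + (int j - int l - r) = 1 - r - int l + (1 + int j)" "2 + (int j - r) = 1 - r + (1 + int j)" for j
      by simp_all
    show "?G Gen_c * ?G Gen_a = q \<cdot>\<^sub>m (?G Gen_a * ?G Gen_c)"
      by (rule mat_eqI_eyz[of _ "2 * n"]) (simp_all add: cc simps, simp_all only: e pw)
    show "?G Gen_b * ?G Gen_c = ?G Gen_c * ?G Gen_b"
      by (rule mat_eqI_eyz[OF cc cc]; unfold a s ms smult_smult_assoc; simp only: mult.commute)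
    show "?G Gen_a ^\<^sub>m n = 0\<^sub>m (2 * n) (2 * n)"
      by (rule mat_eqI_eyz[OF pow_carrier_mat[OF c] zero_carrier_mat]) (simp_all add: ap eyz_ge z)
    show "?G Gen_b ^\<^sub>m n = 1\<^sub>m (2 * n)"
      by (rule mat_eqI_eyz[OF pow_carrier_mat[OF c] one_carrier_mat])
         (simp_all only: pow_mat_eigen[OF c ey_carrier s(3)] pow_mat_eigen[OF c ez_carrier s(4)] on[OF powi_pow_n])
    show "?G Gen_c ^\<^sub>m n = 1\<^sub>m (2 * n)"
      by (rule mat_eqI_eyz[OF pow_carrier_mat[OF c] one_carrier_mat])
         (simp_all only: pow_mat_eigen[OF c ey_carrier s(5)] pow_mat_eigen[OF c ez_carrier s(6)] on[OF powi_pow_n])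
    show "?G Gen_d ^\<^sub>m n = 0\<^sub>m (2 * n) (2 * n)"
    proof (rule mat_eqI_eyz[OF pow_carrier_mat[OF c] zero_carrier_mat])
      fix j
      show "?G Gen_d ^\<^sub>m n *\<^sub>v ey j = 0\<^sub>m (2 * n) (2 * n) *\<^sub>v ey j" by (simp add: dy z)
      show "?G Gen_d ^\<^sub>m n *\<^sub>v ez j = 0\<^sub>m (2 * n) (2 * n) *\<^sub>v ez j"
        using dz[of j n] mult_mat_zero_vec[OF pow_carrier_mat[OF c]] by (cases "j < n") (simp_all add: z eyz_ge)
    qed
  qed (rule DA DB DC)+
qed

section \<open>Homomorphisms out of Q(l,r) and its simple quotient\<close>

lemma Q_hmod:
  assumes "0 < l" "l < n"
  shows "is_hmod n q (Q l r)" "act n q (Q l r) g = Q_gens l r g" "hm_dim (Q l r) = 2 * n"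
  using hmod_of_gens[OF gens_rep_Q[OF assms]] by (simp_all add: Q_def)

text \<open>The images of the basis are given as sequences over all j that vanish from n on,
  matching \<open>ey\<close> and \<open>ez\<close>, so that the conditions carry no boundary
  cases.\<close>

lemma Q_hom:
  assumes l: "0 < l" "l < n" and N: "is_hmod n q N"
    and c: "\<And>j. Y j \<in> carrier_vec (hm_dim N)" "\<And>j. Z j \<in> carrier_vec (hm_dim N)"
    and z: "\<And>j. n \<le> j \<Longrightarrow> Y j = 0\<^sub>v (hm_dim N)" "\<And>j. n \<le> j \<Longrightarrow> Z j = 0\<^sub>v (hm_dim N)"
    and a: "\<And>j. act n q N Gen_a *\<^sub>v Y j = Y (Suc j)" "\<And>j. act n q N Gen_a *\<^sub>v Z j = Z (Suc j)"
    and b: "\<And>j. act n q N Gen_b *\<^sub>v Y j = q powi (r + int j) \<cdot>\<^sub>v Y j"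
      "\<And>j. act n q N Gen_b *\<^sub>v Z j = q powi (r + int l + int j) \<cdot>\<^sub>v Z j"
    and cc: "\<And>j. act n q N Gen_c *\<^sub>v Y j = q powi (1 - r - int l + int j) \<cdot>\<^sub>v Y j"
      "\<And>j. act n q N Gen_c *\<^sub>v Z j = q powi (1 - r + int j) \<cdot>\<^sub>v Z j"
    and d: "\<And>j. act n q N Gen_d *\<^sub>v Y j = kap q (1 - int l) j \<cdot>\<^sub>v Y (j - 1) + q ^ j \<cdot>\<^sub>v Z (n - l - 1 + j)"
      "\<And>j. act n q N Gen_d *\<^sub>v Z j = kap q (1 + int l) j \<cdot>\<^sub>v Z (j - 1)"
  shows "\<exists>X\<in>hm_hom n q (Q l r) N. \<forall>j. X *\<^sub>v ey j = Y j \<and> X *\<^sub>v ez j = Z j"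
proof -
  note M = Q_hmod[OF l, of r]
  let ?X = "two_cols (hm_dim N) Y Z"
  note X = two_cols_vec[of Y "hm_dim N" Z, OF c z]
  note ms = mult_smult_vec[OF two_cols_carrier ey_carrier, of "hm_dim N" Y Z] mult_smult_vec[OF two_cols_carrier ez_carrier, of "hm_dim N" Y Z]
  have sc: "t \<cdot>\<^sub>v ey j \<in> carrier_vec (2 * n)" "t \<cdot>\<^sub>v ez j \<in> carrier_vec (2 * n)" for t j by simp_all
  have ma: "?X *\<^sub>v (t \<cdot>\<^sub>v ey i + t' \<cdot>\<^sub>v ez j) = t \<cdot>\<^sub>v (?X *\<^sub>v ey i) + t' \<cdot>\<^sub>v (?X *\<^sub>v ez j)" for t t' i j
    unfolding mult_add_distrib_mat_vec[OF two_cols_carrier sc] ms ..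
  have "?X *\<^sub>v (Q_gens l r g *\<^sub>v ey j) = act n q N g *\<^sub>v (?X *\<^sub>v ey j) \<and> ?X *\<^sub>v (Q_gens l r g *\<^sub>v ez j) = act n q N g *\<^sub>v (?X *\<^sub>v ez j)" for g j
    by (cases g) (simp_all only: Q_act[OF l] ms ma X a b cc d)
  then have "?X \<in> hm_hom n q (Q l r) N"
    by (intro hom_ubI[OF M(1) N]) (simp_all add: M(2,3) ub_eyz)
  then show ?thesis using X by blast
qed

lemma Q_hom_highest:
  assumes l: "0 < l" "l < n" and N: "is_hmod n q N" and v: "v \<in> carrier_vec (hm_dim N)"
    and dv: "act n q N Gen_d *\<^sub>v v = 0\<^sub>v (hm_dim N)"
    and bv: "act n q N Gen_b *\<^sub>v v = q powi r \<cdot>\<^sub>v v" and cv: "act n q N Gen_c *\<^sub>v v = q powi (1 - r - int l) \<cdot>\<^sub>v v"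
  shows "\<exists>X\<in>hm_hom n q (Q l r) N. \<forall>j. X *\<^sub>v ey j = act n q N Gen_a ^\<^sub>m j *\<^sub>v v \<and> X *\<^sub>v ez j = 0\<^sub>v (hm_dim N)"
proof -
  let ?w = "\<lambda>j. act n q N Gen_a ^\<^sub>m j *\<^sub>v v"
  note w = highest_weight_orbit[OF hmod_gens_rep[OF N] v dv bv cv]
  note mz = mult_mat_zero_vec[OF hmod_eval(2)[OF N]]
  have "?w (n + i) = 0\<^sub>v (hm_dim N)" for i
  proof (induction i)
    case (Suc i)
    then show ?case using w(2)[of "n + i"] mz by simp
  qed (simp add: w(6))
  then have wn: "?w j = 0\<^sub>v (hm_dim N)" if "n \<le> j" for j using that by (metis le_Suc_ex)
  have e: "r + (1 - r - int l) = 1 - int l" by simp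
  show ?thesis
    by (rule Q_hom[OF l N w(1) _ wn _ w(2) _ w(3) _ w(4)]) (use mz w(1) in \<open>simp_all add: smult_vec_zero w(5) e\<close>)
qed

lemma verma_hmod:
  "is_hmod n q (verma l r)" "act n q (verma l r) g = str_gens q n r (1 - r - int l) g" "hm_dim (verma l r) = n"
  unfolding verma_def using str_hmod[OF kap_n order_refl] by simp_all

lemma Q_exact:
  assumes l: "0 < l" "l < n"
  shows "short_exact n q (verma (n - l) (r + int l)) (Q l r) (verma l r)"
proof -
  note M = Q_hmod[OF l, of r] and W2 = verma_hmod[of l r]
  let ?W1 = "str_mod q n (r + int l) (1 - r)"
  have e1: "verma (n - l) (r + int l) = ?W1"
    unfolding verma_def
  proof (rule str_mod_cong)
    have "1 - r = (1 - (r + int l) - int (n - l)) + int n" using l by (simp add: of_nat_diff)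
    then show "(1 - (r + int l) - int (n - l)) mod int n = (1 - r) mod int n" by (metis mod_add_self2)
  qed simp
  note W1 = str_hmod[OF kap_n order_refl, of "r + int l" "1 - r"]
  have ap: "Q_gens l r Gen_a ^\<^sub>m k *\<^sub>v ez 0 = ez k" for k
  proof (induction k)
    case 0
    then show ?case using Q_gens_carrier[of l r Gen_a] by simp
  next
    case (Suc k)
    then show ?case by (simp add: pow_mat_vec_Suc(1)[OF Q_gens_carrier ez_carrier] Q_act[OF l] del: pow_mat.simps)
  qed
  have "\<exists>X\<in>hm_hom n q ?W1 (Q l r). \<forall>j. X *\<^sub>v ub n j = act n q (Q l r) Gen_a ^\<^sub>m j *\<^sub>v ez 0"
    by (rule str_universal[OF kap_n order_refl M(1)])
       (simp_all add: M(2,3) Q_act[OF l] ap eyz_ge smult_vec_zero)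
  then obtain i where i: "i \<in> hm_hom n q ?W1 (Q l r)" "\<And>j. i *\<^sub>v ub n j = ez j" by (auto simp: M(2) ap)
  have "\<exists>X\<in>hm_hom n q (Q l r) (verma l r). \<forall>j. X *\<^sub>v ey j = act n q (verma l r) Gen_a ^\<^sub>m j *\<^sub>v ub n 0 \<and> X *\<^sub>v ez j = 0\<^sub>v (hm_dim (verma l r))"
    by (rule Q_hom_highest[OF l W2(1)]) (simp_all add: W2(2,3) str_act[OF kap_n] smult_vec_zero)
  then obtain p where p: "p \<in> hm_hom n q (Q l r) (verma l r)" "\<And>j. p *\<^sub>v ey j = ub n j" "\<And>j. p *\<^sub>v ez j = 0\<^sub>v n"
    by (auto simp: W2(2,3) str_gens_pow_a[OF kap_n])
  note ic = hom_carrier[OF i(1), unfolded W1(3) M(3)] and pc = hom_carrier[OF p(1), unfolded W2(3) M(3)]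
  let ?r = "two_cols n (\<lambda>j. 0\<^sub>v n) (\<lambda>j. ub n j)" and ?s = "cols_mat (2 * n) n ey"
  have r: "?r *\<^sub>v ez j = ub n j" for j by (rule two_cols_vec(2)) (auto simp: ub_ge)
  have s: "?s *\<^sub>v ub n j = (if j < n then ey j else 0\<^sub>v (2 * n))" for j by (rule cols_mat_ub) simp
  have "?r * i = 1\<^sub>m n"
    by (rule mat_eqI_ub[OF mult_carrier_mat[OF two_cols_carrier ic] one_carrier_mat])
       (simp add: assoc_mult_mat_vec[OF two_cols_carrier ic ub_carrier] i(2) r)
  moreover have "p * ?s = 1\<^sub>m n"
    by (rule mat_eqI_ub[OF mult_carrier_mat[OF pc cols_mat_carrier] one_carrier_mat])
       (simp add: assoc_mult_mat_vec[OF pc cols_mat_carrier ub_carrier] p(2) s)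
  moreover have "p * i = 0\<^sub>m n n"
  proof (rule mat_eqI_ub[OF mult_carrier_mat[OF pc ic] zero_carrier_mat])
    fix j
    have "0\<^sub>m n n *\<^sub>v ub n j = (0\<^sub>v n :: 'k vec)" by (intro eq_vecI) auto
    then show "(p * i) *\<^sub>v ub n j = 0\<^sub>m n n *\<^sub>v ub n j"
      by (simp add: assoc_mult_mat_vec[OF pc ic ub_carrier] i(2) p(3))
  qed
  ultimately show ?thesis
    unfolding e1 by (rule short_exactI[OF W1(1) M(1) W2(1) i(1) p(1) W1(3) M(3) W2(3) two_cols_carrier cols_mat_carrier])
qed

text \<open>A submodule U that together with the kernel fills Q(l,r) contains some u with first
  coordinate 1. Its weight component is \<open>ey 0\<close> plus a multiple of
  \<open>ez (n - l)\<close>; applying \<open>d\<close> leaves \<open>ez (n - l - 1)\<close>, from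
  which \<open>d\<close> and \<open>a\<close> produce all \<open>ez j\<close>. Subtracting gives
  \<open>ey 0\<close>, hence everything.\<close>

lemma Q_essential:
  assumes l: "0 < l" "l < n"
  shows "essential_epi n q (Q l r) (V q l r)"
proof -
  note M = Q_hmod[OF l, of r] and W = V_hmod[OF less_imp_le[OF l(2)], of r]
  let ?x = r and ?y = "1 - r - int l"
  have "\<exists>X\<in>hm_hom n q (Q l r) (V q l r). \<forall>j. X *\<^sub>v ey j = act n q (V q l r) Gen_a ^\<^sub>m j *\<^sub>v ub l 0 \<and> X *\<^sub>v ez j = 0\<^sub>v (hm_dim (V q l r))"
    by (rule Q_hom_highest[OF l W(1)]) (simp_all add: W(2,3) str_act[OF kap_V] smult_vec_zero)
  then obtain p where p: "p \<in> hm_hom n q (Q l r) (V q l r)" "\<And>j. p *\<^sub>v ey j = ub l j" "\<And>j. p *\<^sub>v ez j = 0\<^sub>v l"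
    by (auto simp: W(2,3) str_gens_pow_a[OF kap_V])
  note pc = hom_carrier[OF p(1), unfolded W(2) M(3)]
  let ?s = "cols_mat (2 * n) l ey"
  have s: "?s *\<^sub>v ub l j = (if j < l then ey j else 0\<^sub>v (2 * n))" for j by (rule cols_mat_ub) simp
  have ps: "p * ?s = 1\<^sub>m l"
    by (rule mat_eqI_ub[OF mult_carrier_mat[OF pc cols_mat_carrier] one_carrier_mat])
       (simp add: assoc_mult_mat_vec[OF pc cols_mat_carrier ub_carrier] p(2) s)
  have surj: "hm_surj (Q l r) (V q l r) p"
    unfolding hm_surj_def W(2) M(3) using right_inverse_surj[OF pc cols_mat_carrier ps] by blast
  have "U = carrier_vec (2 * n)"
    if U: "hm_submodule n q (Q l r) U" and UK: "{u + v | u v. u \<in> U \<and> v \<in> hm_kernel (Q l r) (V q l r) p} = carrier_vec (2 * n)" for U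
  proof -
    note S = submoduleD[OF M(1) U, unfolded M(2,3)]
    have "ey 0 \<in> {u + v | u v. u \<in> U \<and> v \<in> hm_kernel (Q l r) (V q l r) p}" unfolding UK by simp
    then obtain u v where uv: "ey 0 = u + v" "u \<in> U" "v \<in> carrier_vec (2 * n)" "p *\<^sub>v v = 0\<^sub>v l"
      unfolding hm_kernel_def W(2) M(3) by blast
    have uc: "u \<in> carrier_vec (2 * n)" using S(1) uv(2) by auto
    have pu: "p *\<^sub>v u = ub l 0"
    proof -
      have "p *\<^sub>v ey 0 = p *\<^sub>v u + p *\<^sub>v v" unfolding uv(1) by (rule mult_add_distrib_mat_vec[OF pc uc uv(3)])
      then show ?thesis using uv(4) p(2)[of 0] mult_mat_vec_carrier[OF pc uc] by simp
    qed
    have u0: "u $ 0 = 1"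
    proof -
      have "(p *\<^sub>v u) $ 0 = (\<Sum>k = 0..<2 * n. p $$ (0, k) * u $ k)" using pc uc l by (simp add: scalar_prod_def)
      also have "\<dots> = (\<Sum>k = 0..<2 * n. if k = 0 then u $ k else 0)"
      proof (intro sum.cong refl)
        fix k assume k: "k \<in> {0..<2 * n}"
        have "p $$ (0, k) = (p *\<^sub>v ub (2 * n) k) $ 0" using mult_ub_index[OF pc l(1)] k by simp
        also have "\<dots> = (if k = 0 then 1 else 0)" using k l p(2,3) by (auto simp: ub_eyz ub_index)
        finally show "p $$ (0, k) * u $ k = (if k = 0 then u $ k else 0)" by simp
      qed
      also have "\<dots> = u $ 0" using l by (simp add: sum.delta)
      finally show ?thesis using pu l by (simp add: ub_index)
    qed
    let ?e = "\<lambda>v. wt_proj (Q l r) ?x ?y v"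
    have jm: "(r + int j) mod int n = r mod int n \<longleftrightarrow> j = 0" if "j < n" for j
    proof
      assume "(r + int j) mod int n = r mod int n"
      then have "int n dvd int j" by (metis add_diff_cancel_left' mod_eq_dvd_iff)
      then show "j = 0" using that by (metis nat_dvd_not_less neq0_conv of_nat_dvd_iff)
    qed simp
    have ey_e: "?e (ey j) = (if j = 0 then ey j else 0\<^sub>v (2 * n))" if j: "j < n" for j
      using wt_proj_eigen[OF M(1), of "ey j" "r + int j" "1 - r - int l + int j" ?x ?y] jm[OF j]
      by (simp add: M(2,3) Q_act[OF l])
    \<comment> \<open>Modulo n the only other basis vector with the weight of \<open>ey 0\<close> is
      \<open>ez (n - l)\<close>, and its weight for \<open>c\<close> agrees too.\<close>
    have ez_e: "?e (ez j) = (if j = n - l then ez j else 0\<^sub>v (2 * n))" if j: "j < n" for j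
    proof -
      have e: "(r + int l + int j) mod int n = r mod int n \<longleftrightarrow> j = n - l"
      proof
        assume "(r + int l + int j) mod int n = r mod int n"
        then have "int n dvd int (l + j)" by (metis add.assoc add_diff_cancel_left' mod_eq_dvd_iff of_nat_add)
        then have "n dvd l + j" by (simp only: of_nat_dvd_iff)
        then obtain t where t: "l + j = n * t" by (auto simp: dvd_def)
        then have "t = 1" using l j by (cases t; cases "t - 1") auto
        then show "j = n - l" using t by simp
      next
        assume "j = n - l"
        then have e: "r + int l + int j = r + int n" using l by (simp add: of_nat_diff)
        show "(r + int l + int j) mod int n = r mod int n" unfolding e by simp
      qed
      have "(1 - r + int j) mod int n = (1 - r - int l) mod int n" if "j = n - l"
      proof -
        have e: "1 - r + int j = 1 - r - int l + int n" using that l by (simp add: of_nat_diff)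
        show ?thesis unfolding e by simp
      qed
      then show ?thesis
        using wt_proj_eigen[OF M(1), of "ez j" "r + int l + int j" "1 - r + int j" ?x ?y] e
        by (simp add: M(2,3) Q_act[OF l])
    qed
    \<comment> \<open>The projection is written as a single matrix so that its value on
      \<open>u\<close> can be computed from its values on basis vectors.\<close>
    obtain E where E: "E \<in> carrier_mat (2 * n) (2 * n)" "\<And>v. v \<in> carrier_vec (2 * n) \<Longrightarrow> ?e v = E *\<^sub>v v"
    proof
      let ?b = "avg_mat (2 * n) (Q_gens l r Gen_b) (q powi (- ?x)) n" and ?c = "avg_mat (2 * n) (Q_gens l r Gen_c) (q powi (- ?y)) n"
      let ?t = "inverse (of_nat n) * inverse (of_nat n) :: 'k"
      note ac = avg_mat_carrier[OF Q_gens_carrier]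
      show "?t \<cdot>\<^sub>m (?c * ?b) \<in> carrier_mat (2 * n) (2 * n)" by (rule smult_carrier_mat[OF mult_carrier_mat[OF ac ac]])
      fix v :: "'k vec" assume v: "v \<in> carrier_vec (2 * n)"
      show "?e v = (?t \<cdot>\<^sub>m (?c * ?b)) *\<^sub>v v"
        unfolding wt_proj_def M(2,3) smult_mat_mult_vec[OF mult_carrier_mat[OF ac ac] v] assoc_mult_mat_vec[OF ac ac v] ..
    qed
    have Eub: "E *\<^sub>v ub (2 * n) k = (if k = 0 \<or> k = 2 * n - l then ub (2 * n) k else 0\<^sub>v (2 * n))" if k: "k < 2 * n" for k
    proof -
      have "E *\<^sub>v ub (2 * n) k = ?e (ub (2 * n) k)" using E(2) by simp
      also have "\<dots> = (if k = 0 \<or> k = 2 * n - l then ub (2 * n) k else 0\<^sub>v (2 * n))"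
      proof (cases "k < n")
        case True
        then have "k \<noteq> 2 * n - l" using l by linarith
        then show ?thesis using ey_e[OF True] True k by (simp add: ub_eyz)
      next
        case False
        then have "k - n < n" "k \<noteq> 0" "k - n = n - l \<longleftrightarrow> k = 2 * n - l" using k l by auto
        then show ?thesis using ez_e[of "k - n"] False k by (simp add: ub_eyz)
      qed
      finally show ?thesis .
    qed
    let ?k = "u $ (2 * n - l)"
    have Eu: "E *\<^sub>v u = ey 0 + ?k \<cdot>\<^sub>v ez (n - l)"
    proof (rule eq_vecI)
      fix i assume "i < dim_vec (ey 0 + ?k \<cdot>\<^sub>v ez (n - l))"
      then have i: "i < 2 * n" by simp
      have "(E *\<^sub>v u) $ i = (\<Sum>k = 0..<2 * n. E $$ (i, k) * u $ k)" using E(1) uc i by (simp add: scalar_prod_def)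
      also have "\<dots> = (\<Sum>k = 0..<2 * n. if k = i then (if i = 0 \<or> i = 2 * n - l then u $ i else 0) else 0)"
      proof (intro sum.cong refl)
        fix k assume k: "k \<in> {0..<2 * n}"
        have "E $$ (i, k) = (E *\<^sub>v ub (2 * n) k) $ i" using mult_ub_index[OF E(1) i] k by simp
        then show "E $$ (i, k) * u $ k = (if k = i then (if i = 0 \<or> i = 2 * n - l then u $ i else 0) else 0)"
          using k i Eub[of k] by (auto simp: ub_index)
      qed
      also have "\<dots> = (if i = 0 \<or> i = 2 * n - l then u $ i else 0)" using i by (simp add: sum.delta')
      also have "\<dots> = (ey 0 + ?k \<cdot>\<^sub>v ez (n - l)) $ i"
      proof -
        have nl: "n + (n - l) = 2 * n - l" using l by simp
        have ye: "ey 0 = ub (2 * n) 0" "ez (n - l) = ub (2 * n) (2 * n - l)" using l nl by (auto simp: ey_def ez_def)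
        show ?thesis unfolding ye using i u0 l by (auto simp: ub_index)
      qed
      finally show "(E *\<^sub>v u) $ i = (ey 0 + ?k \<cdot>\<^sub>v ez (n - l)) $ i" .
    qed (use E(1) in simp)
    have EuU: "ey 0 + ?k \<cdot>\<^sub>v ez (n - l) \<in> U"
      using wt_proj_submodule[OF M(1) U uv(2), of ?x ?y] E(2)[OF uc] Eu by simp
    \<comment> \<open>The extra summand is harmless: \<open>ez (n - l)\<close> is killed by
      \<open>d\<close>, being a highest weight vector of the lower Verma module.\<close>
    have "Q_gens l r Gen_d *\<^sub>v (ey 0 + ?k \<cdot>\<^sub>v ez (n - l)) = ez (n - l - 1)"
    proof -
      have kc: "?k \<cdot>\<^sub>v ez (n - l) \<in> carrier_vec (2 * n)" by simp
      show ?thesis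
        unfolding mult_add_distrib_mat_vec[OF Q_gens_carrier ey_carrier kc] mult_smult_vec[OF Q_gens_carrier ez_carrier] Q_act[OF l]
          kap_1_plus[OF less_imp_le[OF l(2)]]
        by (simp add: smult_vec_zero)
    qed
    then have z1: "ez (n - l - 1) \<in> U" using S(4)[OF EuU, of Gen_d] by simp
    have "ez (n - l - 1 - i) \<in> U" if "i \<le> n - l - 1" for i
      using that
    proof (induction i)
      case 0
      then show ?case using z1 by simp
    next
      case (Suc i)
      let ?j = "n - l - 1 - i"
      have j: "0 < ?j" "?j < n - l" using Suc.prems l by auto
      have nz: "kap q (1 + int l) ?j \<noteq> 0"
      proof (rule kap_nz)
        show "(1 + int l + int ?j - 1) mod int n \<noteq> 0"
        proof
          assume "(1 + int l + int ?j - 1) mod int n = 0"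
          then have "int n dvd int (l + ?j)" by (simp add: mod_eq_0_iff_dvd)
          then have "n dvd l + ?j" by (simp only: of_nat_dvd_iff)
          then have "n \<le> l + ?j" using j by (intro dvd_imp_le) auto
          then show False using j l by linarith
        qed
      qed (use j l in auto)
      have "inverse (kap q (1 + int l) ?j) \<cdot>\<^sub>v (Q_gens l r Gen_d *\<^sub>v ez ?j) = ez (?j - 1)"
        unfolding Q_act[OF l] smult_smult_assoc using nz by simp
      moreover have "inverse (kap q (1 + int l) ?j) \<cdot>\<^sub>v (Q_gens l r Gen_d *\<^sub>v ez ?j) \<in> U"
        by (rule S(5)[OF S(4)[OF Suc.IH]]) (use Suc.prems in simp)
      ultimately show ?case by simp
    qed
    from this[of "n - l - 1"] have z0: "ez 0 \<in> U" by simp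
    have zj: "ez j \<in> U" for j
    proof (induction j)
      case (Suc j)
      then show ?case using S(4)[of "ez j" Gen_a] Q_act(2)[OF l, of r j] by metis
    qed (rule z0)
    have "ey 0 = (ey 0 + ?k \<cdot>\<^sub>v ez (n - l)) + (- ?k) \<cdot>\<^sub>v ez (n - l)" by (intro eq_vecI) auto
    then have y0: "ey 0 \<in> U" using S(3)[OF EuU S(5)[OF zj]] by metis
    have yj: "ey j \<in> U" for j
    proof (induction j)
      case (Suc j)
      then show ?case using S(4)[of "ey j" Gen_a] Q_act(1)[OF l, of r j] by metis
    qed (rule y0)
    show ?thesis
      using submodule_all[OF M(1) U] yj zj unfolding M(3) by (simp add: ub_eyz)
  qed
  then show ?thesis
    unfolding essential_epi_def superfluous_def M(3) using M(1) p(1) surj by blast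
qed

end

section \<open>Homomorphisms into internal homs of simple modules\<close>

text \<open>Row-major flattening, compatible with \<open>kron_mat\<close>: it identifies S tensored
  with the dual of W with the space of matrices from W to S.\<close>

definition vec_of_mat :: "nat \<Rightarrow> nat \<Rightarrow> 'k::field mat \<Rightarrow> 'k vec" where
  "vec_of_mat s w X = vec (s * w) (\<lambda>k. X $$ (k div w, k mod w))"

lemma vec_of_mat_carrier [simp]: "vec_of_mat s w X \<in> carrier_vec (s * w)"
  by (simp add: vec_of_mat_def)

lemma vec_of_mat_smult:
  "X \<in> carrier_mat s w \<Longrightarrow> vec_of_mat s w (t \<cdot>\<^sub>m X) = t \<cdot>\<^sub>v vec_of_mat s w X"
  by (intro eq_vecI) (auto simp: vec_of_mat_def div_mod_less)

lemma vec_of_mat_diff: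
  assumes "X \<in> carrier_mat s w" "Y \<in> carrier_mat s w"
  shows "vec_of_mat s w X + - vec_of_mat s w Y = vec_of_mat s w (X - Y)"
  using assms by (intro eq_vecI) (auto simp: vec_of_mat_def div_mod_less)

lemma vec_of_mat_zero: "vec_of_mat s w (0\<^sub>m s w) = 0\<^sub>v (s * w)"
  by (intro eq_vecI) (auto simp: vec_of_mat_def div_mod_less)

text \<open>This allows S tensored with the dual of W to be treated as Hom(W, S): the first factor
  multiplies on the left, the transposed second factor on the right.\<close>

lemma kron_vec_of_mat:
  fixes X :: "'k::field mat"
  assumes Z: "Z \<in> carrier_mat s' s" and X: "X \<in> carrier_mat s w" and Y: "Y \<in> carrier_mat w w'"
  shows "kron_mat Z (transpose_mat Y) *\<^sub>v vec_of_mat s w X = vec_of_mat s' w' (Z * X * Y)"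
proof (rule eq_vecI)
  have K: "kron_mat Z (transpose_mat Y) \<in> carrier_mat (s' * w') (s * w)"
    using Z Y by (intro kron_mat_carrier) auto
  have ZX: "Z * X \<in> carrier_mat s' w" using Z X by auto
  have gen: "(M * N) $$ (x, k) = (\<Sum>a = 0..<c. M $$ (x, a) * N $$ (a, k))"
    if "M \<in> carrier_mat r c" "N \<in> carrier_mat c e" "x < r" "k < e" for M N :: "'k mat" and r c e x k
    using that by (simp add: scalar_prod_def)
  have genv: "(M *\<^sub>v v) $ x = (\<Sum>a = 0..<c. M $$ (x, a) * v $ a)"
    if "M \<in> carrier_mat r c" "v \<in> carrier_vec c" "x < r" for M :: "'k mat" and v r c x
    using that by (simp add: scalar_prod_def)
  fix i assume "i < dim_vec (vec_of_mat s' w' (Z * X * Y))"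
  then have i: "i < s' * w'" by (simp add: vec_of_mat_def)
  note d = div_mod_less[OF i]
  have "(kron_mat Z (transpose_mat Y) *\<^sub>v vec_of_mat s w X) $ i
      = (\<Sum>k = 0..<s * w. kron_mat Z (transpose_mat Y) $$ (i, k) * vec_of_mat s w X $ k)"
    by (rule genv[OF K vec_of_mat_carrier i])
  also have "\<dots> = (\<Sum>k = 0..<s * w. Z $$ (i div w', k div w) * Y $$ (k mod w, i mod w') * X $$ (k div w, k mod w))"
    using i d Z Y by (intro sum.cong refl) (auto simp: kron_mat_index vec_of_mat_def div_mod_less)
  also have "\<dots> = (\<Sum>a = 0..<s. \<Sum>b = 0..<w. Z $$ (i div w', a) * Y $$ (b, i mod w') * X $$ (a, b))"
    by (rule sum_div_mod)
  also have "\<dots> = (\<Sum>b = 0..<w. \<Sum>a = 0..<s. Z $$ (i div w', a) * Y $$ (b, i mod w') * X $$ (a, b))"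
    by (rule sum.swap)
  also have "\<dots> = (\<Sum>b = 0..<w. (Z * X) $$ (i div w', b) * Y $$ (b, i mod w'))"
    using gen[OF Z X d(1)] by (intro sum.cong refl) (simp add: sum_distrib_right sum_distrib_left ac_simps)
  also have "\<dots> = (Z * X * Y) $$ (i div w', i mod w')"
    by (rule gen[OF ZX Y d, symmetric])
  also have "\<dots> = vec_of_mat s' w' (Z * X * Y) $ i" using i by (simp add: vec_of_mat_def)
  finally show "(kron_mat Z (transpose_mat Y) *\<^sub>v vec_of_mat s w X) $ i = vec_of_mat s' w' (Z * X * Y) $ i" .
qed (use Z Y in \<open>simp add: vec_of_mat_def\<close>)

lemma kron_twisted_vec_of_mat:
  fixes X :: "'k::field mat"
  assumes A: "A \<in> carrier_mat s s" and A': "A' \<in> carrier_mat w w" and I: "I \<in> carrier_mat w w" and X: "X \<in> carrier_mat s w"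
  shows "(kron_mat A (transpose_mat I) + kron_mat (1\<^sub>m s) (- transpose_mat (A' * I))) *\<^sub>v vec_of_mat s w X
    = vec_of_mat s w ((A * X - X * A') * I)"
proof -
  have AI: "A' * I \<in> carrier_mat w w" using A' I by auto
  have K: "kron_mat A (transpose_mat I) \<in> carrier_mat (s * w) (s * w)"
    "kron_mat (1\<^sub>m s) (transpose_mat (A' * I)) \<in> carrier_mat (s * w) (s * w)"
    using A I AI by (auto intro!: kron_mat_carrier)
  have um: "(- M) *\<^sub>v v = - (M *\<^sub>v v)" if "M \<in> carrier_mat a b" "v \<in> carrier_vec b" for M :: "'k mat" and a b v
    using that by (intro uminus_mult_mat_vec) simp
  have "(kron_mat A (transpose_mat I) + kron_mat (1\<^sub>m s) (- transpose_mat (A' * I))) *\<^sub>v vec_of_mat s w X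
    = kron_mat A (transpose_mat I) *\<^sub>v vec_of_mat s w X + (- kron_mat (1\<^sub>m s) (transpose_mat (A' * I))) *\<^sub>v vec_of_mat s w X"
    unfolding kron_mat_uminus_right
    by (rule add_mult_distrib_mat_vec[OF K(1) _ vec_of_mat_carrier]) (use K(2) in simp)
  also have "\<dots> = vec_of_mat s w (A * X * I) + - vec_of_mat s w (1\<^sub>m s * X * (A' * I))"
    unfolding um[OF K(2) vec_of_mat_carrier] kron_vec_of_mat[OF A X I] kron_vec_of_mat[OF one_carrier_mat X AI] ..
  also have "\<dots> = vec_of_mat s w (A * X * I - 1\<^sub>m s * X * (A' * I))"
    by (rule vec_of_mat_diff) (use A X I AI in auto)
  also have "1\<^sub>m s * X * (A' * I) = X * A' * I"
    using assoc_mult_mat[OF X A' I] X by simp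
  also have "A * X * I - X * A' * I = (A * X - X * A') * I"
    by (rule minus_mult_distrib_mat[symmetric, of _ s w]) (use A X A' I in auto)
  finally show ?thesis .
qed

context primitive_root
begin

section \<open>Weight vectors in internal homs between simple modules\<close>

abbreviation internal_hom :: "'k hmod \<Rightarrow> 'k hmod \<Rightarrow> 'k hmod" where
  "internal_hom W S \<equiv> hm_tensor n q S (hm_dual n q W)"

lemma internal_hom_hmod:
  assumes "is_hmod n q W" "is_hmod n q S"
  shows "is_hmod n q (internal_hom W S)" "hm_dim (internal_hom W S) = hm_dim S * hm_dim W"
  using hmod_tensor[OF prim assms(2) hmod_dual(1)[OF prim assms(1)]] hmod_dual(3)[OF prim assms(1)] by simp_all

lemma internal_hom_act:
  assumes W: "is_hmod n q W" and S: "is_hmod n q S" and X: "X \<in> carrier_mat (hm_dim S) (hm_dim W)"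
  defines "\<phi> \<equiv> vec_of_mat (hm_dim S) (hm_dim W)"
  shows "act n q (internal_hom W S) Gen_a *\<^sub>v \<phi> X = \<phi> ((act n q S Gen_a * X - X * act n q W Gen_a) * act n q W Gen_b ^\<^sub>m (n - 1))"
    and "act n q (internal_hom W S) Gen_d *\<^sub>v \<phi> X = \<phi> ((act n q S Gen_d * X - X * act n q W Gen_d) * act n q W Gen_c ^\<^sub>m (n - 1))"
    and "act n q S Gen_b * X = t \<cdot>\<^sub>m (X * act n q W Gen_b) \<Longrightarrow> act n q (internal_hom W S) Gen_b *\<^sub>v \<phi> X = t \<cdot>\<^sub>v \<phi> X"
    and "act n q S Gen_c * X = t \<cdot>\<^sub>m (X * act n q W Gen_c) \<Longrightarrow> act n q (internal_hom W S) Gen_c *\<^sub>v \<phi> X = t \<cdot>\<^sub>v \<phi> X"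
proof -
  note D = hmod_dual[OF prim W]
  note T = hmod_tensor[OF prim S D(1)]
  note cS = hmod_eval(2)[OF S] and cW = hmod_eval(2)[OF W] and R = hmod_gens_rep[OF W]
  note p = pow_carrier_mat[OF cW, of _ "n - 1"]
  have n: "0 < n" using n_gt_2 by simp
  show "act n q (internal_hom W S) Gen_a *\<^sub>v \<phi> X = \<phi> ((act n q S Gen_a * X - X * act n q W Gen_a) * act n q W Gen_b ^\<^sub>m (n - 1))"
    "act n q (internal_hom W S) Gen_d *\<^sub>v \<phi> X = \<phi> ((act n q S Gen_d * X - X * act n q W Gen_d) * act n q W Gen_c ^\<^sub>m (n - 1))"
    unfolding T(2) tensor_gens.simps D(2) dual_gens.simps \<phi>_def by (rule kron_twisted_vec_of_mat[OF cS cW p X])+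
  have gl: "vec_of_mat (hm_dim S) (hm_dim W) (act n q S g * X * act n q W g ^\<^sub>m (n - 1)) = t \<cdot>\<^sub>v vec_of_mat (hm_dim S) (hm_dim W) X"
    if h: "act n q S g * X = t \<cdot>\<^sub>m (X * act n q W g)" and i: "act n q W g * act n q W g ^\<^sub>m (n - 1) = 1\<^sub>m (hm_dim W)" for g
  proof -
    have "act n q S g * X * act n q W g ^\<^sub>m (n - 1) = t \<cdot>\<^sub>m (X * act n q W g * act n q W g ^\<^sub>m (n - 1))"
      unfolding h by (rule mult_smult_assoc_mat[OF mult_carrier_mat[OF X cW] p])
    also have "X * act n q W g * act n q W g ^\<^sub>m (n - 1) = X"
      using assoc_mult_mat[OF X cW[of g] p[of g]] i X by simp
    finally show ?thesis using vec_of_mat_smult[OF X] by simp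
  qed
  show "act n q S Gen_b * X = t \<cdot>\<^sub>m (X * act n q W Gen_b) \<Longrightarrow> act n q (internal_hom W S) Gen_b *\<^sub>v \<phi> X = t \<cdot>\<^sub>v \<phi> X"
    unfolding T(2) tensor_gens.simps D(2) dual_gens.simps \<phi>_def kron_vec_of_mat[OF cS X p]
    by (rule gl[OF _ pow_inverse_mat(1)[OF cW gens_repD(8)[OF R] n]])
  show "act n q S Gen_c * X = t \<cdot>\<^sub>m (X * act n q W Gen_c) \<Longrightarrow> act n q (internal_hom W S) Gen_c *\<^sub>v \<phi> X = t \<cdot>\<^sub>v \<phi> X"
    unfolding T(2) tensor_gens.simps D(2) dual_gens.simps \<phi>_def kron_vec_of_mat[OF cS X p]
    by (rule gl[OF _ pow_inverse_mat(1)[OF cW gens_repD(9)[OF R] n]])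
qed

text \<open>Translates a homomorphism into Hom(W, S) back into values on basis tensors, the form in
  which triangularity is checked.\<close>

lemma uncurry_hom:
  assumes P: "is_hmod n q P" and W: "is_hmod n q W" and S: "is_hmod n q S"
    and F: "F \<in> hm_hom n q P (internal_hom W S)"
  shows "\<exists>f\<in>hm_hom n q (hm_tensor n q P W) S. \<forall>k<hm_dim P. \<forall>j<hm_dim W. \<forall>X\<in>carrier_mat (hm_dim S) (hm_dim W).
    F *\<^sub>v ub (hm_dim P) k = vec_of_mat (hm_dim S) (hm_dim W) X \<longrightarrow>
    f *\<^sub>v ub (hm_dim P * hm_dim W) (k * hm_dim W + j) = X *\<^sub>v ub (hm_dim W) j"
proof -
  let ?p = "hm_dim P" and ?w = "hm_dim W" and ?s = "hm_dim S"
  have Fc: "F \<in> carrier_mat (?s * ?w) ?p" using hom_carrier[OF F] internal_hom_hmod(2)[OF W S] by simp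
  let ?f = "uncurry_mat ?s ?w F"
  note fc = uncurry_mat_carrier[OF Fc]
  have f: "?f \<in> hm_hom n q (hm_tensor n q P W) S"
    using adjunction[OF prim P W S fc] curry_uncurry_mat[OF Fc] F by simp
  have "?f *\<^sub>v ub (?p * ?w) (k * ?w + j) = X *\<^sub>v ub ?w j"
    if k: "k < ?p" and j: "j < ?w" and X: "X \<in> carrier_mat ?s ?w" and e: "F *\<^sub>v ub ?p k = vec_of_mat ?s ?w X" for k j X
  proof (rule eq_vecI)
    fix i assume "i < dim_vec (X *\<^sub>v ub ?w j)"
    then have i: "i < ?s" using X by simp
    have kj: "k * ?w + j < ?p * ?w" by (rule mult_add_less[OF k j])
    have ij: "i * ?w + j < ?s * ?w" by (rule mult_add_less[OF i j])
    have "(?f *\<^sub>v ub (?p * ?w) (k * ?w + j)) $ i = ?f $$ (i, k * ?w + j)"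
      using mult_ub_index[OF fc i] kj by simp
    also have "\<dots> = F $$ (i * ?w + j, k)"
      using i kj j Fc by (simp add: uncurry_mat_def)
    also have "\<dots> = (F *\<^sub>v ub ?p k) $ (i * ?w + j)"
      using mult_ub_index[OF Fc ij] k by simp
    also have "\<dots> = X $$ (i, j)" unfolding e using ij j by (simp add: vec_of_mat_def)
    also have "\<dots> = (X *\<^sub>v ub ?w j) $ i" using mult_ub_index[OF X i] j by simp
    finally show "(?f *\<^sub>v ub (?p * ?w) (k * ?w + j)) $ i = (X *\<^sub>v ub ?w j) $ i" .
  qed (use fc X in simp)
  then show ?thesis using f by blast
qed

text \<open>The matrix kills the basis vectors before i and sends the j-th one to a multiple of the
  (j - i)-th. Commuting with \<open>d\<close> forces the ratios of consecutive factors, and m <= p +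
  i keeps the denominators nonzero. The congruence for p is the condition on the weights of
  \<open>c\<close>.\<close>

lemma highest_matrix:
  fixes r s :: int
  assumes m: "m \<le> n" and i: "i < m" and p: "p \<le> n" and mp: "m \<le> p + i"
    and c: "(int p - (int l + int m - 1 - 2 * int i)) mod int n = 0"
  defines "W \<equiv> V q m s" and "S \<equiv> V q p (r + s + int i)"
  shows "\<exists>X\<in>carrier_mat p m. act n q S Gen_d * X = X * act n q W Gen_d \<and>
    act n q S Gen_b * X = q powi r \<cdot>\<^sub>m (X * act n q W Gen_b) \<and>
    act n q S Gen_c * X = q powi (1 - r - int l) \<cdot>\<^sub>m (X * act n q W Gen_c) \<and>
    (\<forall>j<i. X *\<^sub>v ub m j = 0\<^sub>v p) \<and> X *\<^sub>v ub m i = ub p 0"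
proof -
  define f where "f j = (\<Prod>k=i+1..j. kap q (1 - int m) k / kap q (1 - int p) (k - i))" for j
  define w where "w j = (if j < i then 0\<^sub>v p else f j \<cdot>\<^sub>v ub p (j - i))" for j
  let ?X = "cols_mat p m w"
  have X: "?X *\<^sub>v ub m j = w j" if "j < m" for j using cols_mat_ub[of w p m j] that by (simp add: w_def)
  have wc: "w j \<in> carrier_vec p" for j by (simp add: w_def)
  note WM = V_hmod[OF m, of s, folded W_def] and SM = V_hmod[OF p, of "r + s + int i", folded S_def]
  note WA = V_act[OF m, of s, folded W_def] and SA = V_act[OF p, of "r + s + int i", folded S_def]
  note cW = hmod_eval(2)[OF WM(1), unfolded WM(2)] and cS = hmod_eval(2)[OF SM(1), unfolded SM(2)]
  note Xc = cols_mat_carrier[of p m w]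
  note l1 = assoc_mult_mat_vec[OF cS Xc ub_carrier] and l2 = assoc_mult_mat_vec[OF Xc cW ub_carrier]
  note sw = mult_smult_vec[OF cS ub_carrier] and sX = mult_smult_vec[OF Xc ub_carrier]
  have fi: "f i = 1" by (simp add: f_def)
  have fS: "f j * kap q (1 - int p) (j - i) = kap q (1 - int m) j * f (j - 1)" if ij: "i < j" "j < m" for j
  proof -
    have nz: "kap q (1 - int p) (j - i) \<noteq> 0" using kap_V_nz[of "j - i" p 0] ij mp p by simp
    obtain j' where j': "j = Suc j'" using ij(1) by (cases j) auto
    have "f j = f j' * (kap q (1 - int m) j / kap q (1 - int p) (j - i))"
      unfolding f_def j' using ij j' by (subst prod.nat_ivl_Suc') (auto simp: mult.commute)
    then show ?thesis using nz j' by simp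
  qed
  have "act n q S Gen_d * ?X = ?X * act n q W Gen_d"
  proof (rule mat_eqI_ub[OF mult_carrier_mat[OF cS Xc] mult_carrier_mat[OF Xc cW]])
    fix j assume j: "j < m"
    have r: "?X *\<^sub>v (act n q W Gen_d *\<^sub>v ub m j) = kap q (1 - int m) j \<cdot>\<^sub>v w (j - 1)"
      unfolding WA sX using X[of "j - 1"] j by simp
    consider "j < i" | "j = i" | "i < j" by linarith
    then have "act n q S Gen_d *\<^sub>v w j = kap q (1 - int m) j \<cdot>\<^sub>v w (j - 1)"
    proof cases
      case 1
      then show ?thesis by (simp add: w_def mult_mat_zero_vec[OF cS] smult_vec_zero less_imp_diff_less)
    next
      case 2
      have "kap q (1 - int m) i \<cdot>\<^sub>v w (i - 1) = 0\<^sub>v p"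
        using wc[of "i - 1"] by (cases i) (auto simp: w_def smult_vec_zero)
      then show ?thesis using 2 by (simp add: w_def sw SA smult_vec_zero)
    next
      case 3
      then have e: "w j = f j \<cdot>\<^sub>v ub p (j - i)" "w (j - 1) = f (j - 1) \<cdot>\<^sub>v ub p (j - i - 1)" by (auto simp: w_def)
      show ?thesis unfolding e sw SA smult_smult_assoc fS[OF 3 j] ..
    qed
    then show "(act n q S Gen_d * ?X) *\<^sub>v ub m j = (?X * act n q W Gen_d) *\<^sub>v ub m j"
      unfolding l1 l2 r X[OF j] .
  qed
  moreover have "act n q S Gen_b * ?X = q powi r \<cdot>\<^sub>m (?X * act n q W Gen_b)"
  proof (rule mat_eqI_ub[OF mult_carrier_mat[OF cS Xc] smult_carrier_mat[OF mult_carrier_mat[OF Xc cW]]])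
    fix j assume j: "j < m"
    have "q powi (r + s + int i + int (j - i)) = q powi r * q powi (s + int j)" if "\<not> j < i"
      using that by (simp add: of_nat_diff powi_add[symmetric] algebra_simps)
    then have "act n q S Gen_b *\<^sub>v w j = (q powi r * q powi (s + int j)) \<cdot>\<^sub>v w j"
      by (cases "j < i") (auto simp: w_def mult_mat_zero_vec[OF cS] smult_vec_zero sw SA smult_smult_assoc mult.commute)
    then show "(act n q S Gen_b * ?X) *\<^sub>v ub m j = (q powi r \<cdot>\<^sub>m (?X * act n q W Gen_b)) *\<^sub>v ub m j"
      unfolding smult_mat_mult_vec[OF mult_carrier_mat[OF Xc cW] ub_carrier] l1 l2 WA sX X[OF j] smult_smult_assoc .
  qed
  moreover have "act n q S Gen_c * ?X = q powi (1 - r - int l) \<cdot>\<^sub>m (?X * act n q W Gen_c)"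
  proof (rule mat_eqI_ub[OF mult_carrier_mat[OF cS Xc] smult_carrier_mat[OF mult_carrier_mat[OF Xc cW]]])
    fix j assume j: "j < m"
    have "q powi (1 - (r + s + int i) - int p + int (j - i)) = q powi (1 - r - int l) * q powi (1 - s - int m + int j)" if "\<not> j < i"
      unfolding powi_add[symmetric]
    proof (rule powi_cong)
      have "1 - r - int l + (1 - s - int m + int j) = (1 - (r + s + int i) - int p + int (j - i)) + (int p - (int l + int m - 1 - 2 * int i))"
        using that by (simp add: of_nat_diff)
      then show "(1 - (r + s + int i) - int p + int (j - i)) mod int n = (1 - r - int l + (1 - s - int m + int j)) mod int n"
        using c by (metis add.right_neutral mod_add_right_eq)
    qed
    then have "act n q S Gen_c *\<^sub>v w j = (q powi (1 - r - int l) * q powi (1 - s - int m + int j)) \<cdot>\<^sub>v w j"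
      by (cases "j < i") (auto simp: w_def mult_mat_zero_vec[OF cS] smult_vec_zero sw SA smult_smult_assoc mult.commute)
    then show "(act n q S Gen_c * ?X) *\<^sub>v ub m j = (q powi (1 - r - int l) \<cdot>\<^sub>m (?X * act n q W Gen_c)) *\<^sub>v ub m j"
      unfolding smult_mat_mult_vec[OF mult_carrier_mat[OF Xc cW] ub_carrier] l1 l2 WA sX X[OF j] smult_smult_assoc .
  qed
  moreover have "\<forall>j<i. ?X *\<^sub>v ub m j = 0\<^sub>v p" using X i by (simp add: w_def)
  moreover have "?X *\<^sub>v ub m i = ub p 0" using X[OF i] fi by (simp add: w_def)
  ultimately show ?thesis using Xc by blast
qed

text \<open>A pure shift of basis vectors commutes with \<open>a\<close>, vectors pushed past the
  end being zero. The shift n + l - 1 - i is dictated by the weight (r + l - 1, -r), that of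
  \<open>ey (l - 1)\<close>; then m - 1 - i is the last column whose image stays inside V(p,
  r+s+i).\<close>

lemma lowest_matrix:
  fixes r s :: int
  assumes m: "m \<le> n" and i: "l \<le> i" "i < m" and p: "p \<le> n" "int p = int n + int l + int m - 1 - 2 * int i" and l: "0 < l"
  defines "W \<equiv> V q m s" and "S \<equiv> V q p (r + s + int i)"
  shows "\<exists>X\<in>carrier_mat p m. act n q S Gen_a * X = X * act n q W Gen_a \<and>
    act n q S Gen_b * X = q powi (r + int l - 1) \<cdot>\<^sub>m (X * act n q W Gen_b) \<and>
    act n q S Gen_c * X = q powi (- r) \<cdot>\<^sub>m (X * act n q W Gen_c) \<and>
    (\<forall>j. m - 1 - i < j \<longrightarrow> X *\<^sub>v ub m j = 0\<^sub>v p) \<and> X *\<^sub>v ub m (m - 1 - i) \<noteq> 0\<^sub>v p"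
proof -
  define w where "w j = (ub p (n + l - 1 - i + j) :: 'k vec)" for j
  let ?X = "cols_mat p m w"
  have wm: "w j = 0\<^sub>v p" if "m - 1 - i < j" for j
    unfolding w_def by (rule ub_ge) (use that p i m l in linarith)
  have X: "?X *\<^sub>v ub m j = w j" for j using cols_mat_ub[of w p m j] wm[of j] i by (auto simp: w_def)
  note WM = V_hmod[OF m, of s, folded W_def] and SM = V_hmod[OF p(1), of "r + s + int i", folded S_def]
  note WA = V_act[OF m, of s, folded W_def] and SA = V_act[OF p(1), of "r + s + int i", folded S_def]
  note cW = hmod_eval(2)[OF WM(1), unfolded WM(2)] and cS = hmod_eval(2)[OF SM(1), unfolded SM(2)]
  note Xc = cols_mat_carrier[of p m w]
  note l1 = assoc_mult_mat_vec[OF cS Xc ub_carrier] and l2 = assoc_mult_mat_vec[OF Xc cW ub_carrier]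
  note sX = mult_smult_vec[OF Xc ub_carrier]
  have ni: "i \<le> n + l - 1" using i m l by linarith
  have "act n q S Gen_a * ?X = ?X * act n q W Gen_a"
    by (rule mat_eqI_ub[OF mult_carrier_mat[OF cS Xc] mult_carrier_mat[OF Xc cW]])
       (simp only: l1 l2 WA X w_def SA add_Suc_right)
  moreover have "act n q S Gen_b * ?X = q powi (r + int l - 1) \<cdot>\<^sub>m (?X * act n q W Gen_b)"
  proof (rule mat_eqI_ub[OF mult_carrier_mat[OF cS Xc] smult_carrier_mat[OF mult_carrier_mat[OF Xc cW]]])
    fix j
    have "q powi (r + s + int i + int (n + l - 1 - i + j)) = q powi (r + int l - 1) * q powi (s + int j)"
      unfolding powi_add[symmetric]
    proof (rule powi_cong)
      have e: "r + s + int i + int (n + l - 1 - i + j) = r + int l - 1 + (s + int j) + int n"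
        using ni l by (simp add: of_nat_diff)
      show "(r + s + int i + int (n + l - 1 - i + j)) mod int n = (r + int l - 1 + (s + int j)) mod int n"
        unfolding e by simp
    qed
    then have "act n q S Gen_b *\<^sub>v w j = (q powi (r + int l - 1) * q powi (s + int j)) \<cdot>\<^sub>v w j"
      unfolding w_def SA by simp
    then show "(act n q S Gen_b * ?X) *\<^sub>v ub m j = (q powi (r + int l - 1) \<cdot>\<^sub>m (?X * act n q W Gen_b)) *\<^sub>v ub m j"
      unfolding smult_mat_mult_vec[OF mult_carrier_mat[OF Xc cW] ub_carrier] l1 l2 WA sX X smult_smult_assoc .
  qed
  moreover have "act n q S Gen_c * ?X = q powi (- r) \<cdot>\<^sub>m (?X * act n q W Gen_c)"
  proof (rule mat_eqI_ub[OF mult_carrier_mat[OF cS Xc] smult_carrier_mat[OF mult_carrier_mat[OF Xc cW]]])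
    fix j
    have "1 - (r + s + int i) - int p + int (n + l - 1 - i + j) = - r + (1 - s - int m + int j)"
      using ni l p(2) by (simp add: of_nat_diff)
    then have "q powi (1 - (r + s + int i) - int p + int (n + l - 1 - i + j)) = q powi (- r) * q powi (1 - s - int m + int j)"
      by (simp only: powi_add)
    then have "act n q S Gen_c *\<^sub>v w j = (q powi (- r) * q powi (1 - s - int m + int j)) \<cdot>\<^sub>v w j"
      unfolding w_def SA by simp
    then show "(act n q S Gen_c * ?X) *\<^sub>v ub m j = (q powi (- r) \<cdot>\<^sub>m (?X * act n q W Gen_c)) *\<^sub>v ub m j"
      unfolding smult_mat_mult_vec[OF mult_carrier_mat[OF Xc cW] ub_carrier] l1 l2 WA sX X smult_smult_assoc .
  qed
  moreover have "\<forall>j. m - 1 - i < j \<longrightarrow> ?X *\<^sub>v ub m j = 0\<^sub>v p" using X wm by simp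
  moreover have "?X *\<^sub>v ub m (m - 1 - i) \<noteq> 0\<^sub>v p"
  proof -
    have lt: "n + l - 1 - i + (m - 1 - i) < p" using p(2) i m l ni by linarith
    have "ub p (n + l - 1 - i + (m - 1 - i)) $ (n + l - 1 - i + (m - 1 - i)) = (1 :: 'k)" using lt by (simp add: ub_index)
    moreover have "(0\<^sub>v p :: 'k vec) $ (n + l - 1 - i + (m - 1 - i)) = 0" using lt by simp
    ultimately show ?thesis unfolding X w_def by (metis zero_neq_one)
  qed
  ultimately show ?thesis using Xc by blast
qed

text \<open>\<open>d\<close> sends a matrix Y to (d Y - Y d) c^(-1). The term Y d moves the last
  nonzero column one place to the right, with a factor \<open>kap\<close> that does not vanish
  inside V(m,s), whereas d Y reaches no new column.\<close>

lemma lowest_matrix_iterate: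
  fixes s t :: int
  assumes m: "m \<le> n" and p: "p \<le> n"
  defines "W \<equiv> V q m s" and "S \<equiv> V q p t"
  assumes X: "X \<in> carrier_mat p m" "\<forall>j. J < j \<longrightarrow> X *\<^sub>v ub m j = 0\<^sub>v p" "X *\<^sub>v ub m J \<noteq> 0\<^sub>v p"
  shows "J + k < m \<Longrightarrow> \<exists>Y\<in>carrier_mat p m. act n q (internal_hom W S) Gen_d ^\<^sub>m k *\<^sub>v vec_of_mat p m X = vec_of_mat p m Y \<and>
    (\<forall>j. J + k < j \<longrightarrow> Y *\<^sub>v ub m j = 0\<^sub>v p) \<and> Y *\<^sub>v ub m (J + k) \<noteq> 0\<^sub>v p"
proof (induction k)
  case 0
  note WM = V_hmod[OF m, of s, folded W_def] and SM = V_hmod[OF p, of t, folded S_def]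
  note N = internal_hom_hmod[OF WM(1) SM(1), unfolded WM(2) SM(2)]
  have "act n q (internal_hom W S) Gen_d ^\<^sub>m 0 *\<^sub>v vec_of_mat p m X = vec_of_mat p m X"
    using hmod_eval(2)[OF N(1), of Gen_d] N(2) by simp
  then show ?case using X by auto
next
  case (Suc k)
  note WM = V_hmod[OF m, of s, folded W_def] and SM = V_hmod[OF p, of t, folded S_def]
  note WA = V_act[OF m, of s, folded W_def]
  note cW = hmod_eval(2)[OF WM(1), unfolded WM(2)] and cS = hmod_eval(2)[OF SM(1), unfolded SM(2)]
  note N = internal_hom_hmod[OF WM(1) SM(1), unfolded WM(2) SM(2)]
  obtain Y where Y: "Y \<in> carrier_mat p m" "act n q (internal_hom W S) Gen_d ^\<^sub>m k *\<^sub>v vec_of_mat p m X = vec_of_mat p m Y"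
    "\<And>j. J + k < j \<Longrightarrow> Y *\<^sub>v ub m j = 0\<^sub>v p" "Y *\<^sub>v ub m (J + k) \<noteq> 0\<^sub>v p"
    using Suc by auto
  let ?D = "act n q S Gen_d" and ?D' = "act n q W Gen_d" and ?I = "act n q W Gen_c ^\<^sub>m (n - 1)"
  let ?Z = "(?D * Y - Y * ?D') * ?I"
  note Ic = pow_carrier_mat[OF cW, of Gen_c "n - 1"]
  have c: "?D * Y \<in> carrier_mat p m" "Y * ?D' \<in> carrier_mat p m" using mult_carrier_mat[OF cS Y(1)] mult_carrier_mat[OF Y(1) cW] by auto
  have DY: "?D * Y - Y * ?D' \<in> carrier_mat p m" by (rule minus_carrier_mat[OF c(2)])
  have Z: "?Z \<in> carrier_mat p m" by (rule mult_carrier_mat[OF DY Ic])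
  have e1: "act n q (internal_hom W S) Gen_d ^\<^sub>m Suc k *\<^sub>v vec_of_mat p m X = vec_of_mat p m ?Z"
    unfolding pow_mat_vec_Suc(1)[OF hmod_eval(2)[OF N(1), unfolded N(2)] vec_of_mat_carrier] Y(2)
    using internal_hom_act(2)[OF WM(1) SM(1), unfolded WM(2) SM(2), OF Y(1)] .
  have Zj: "?Z *\<^sub>v ub m j = (q powi (1 - s - int m + int j)) ^ (n - 1) \<cdot>\<^sub>v (?D *\<^sub>v (Y *\<^sub>v ub m j) - kap q (1 - int m) j \<cdot>\<^sub>v (Y *\<^sub>v ub m (j - 1)))" for j
    unfolding assoc_mult_mat_vec[OF DY Ic ub_carrier] pow_mat_eigen[OF cW ub_carrier WA(3)] mult_smult_vec[OF DY ub_carrier]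
      minus_mult_distrib_mat_vec[OF c ub_carrier] assoc_mult_mat_vec[OF cS Y(1) ub_carrier] assoc_mult_mat_vec[OF Y(1) cW ub_carrier]
      WA(4) mult_smult_vec[OF Y(1) ub_carrier] ..
  have "?Z *\<^sub>v ub m j = 0\<^sub>v p" if "J + Suc k < j" for j
  proof -
    have y: "Y *\<^sub>v ub m j = 0\<^sub>v p" "Y *\<^sub>v ub m (j - 1) = 0\<^sub>v p" using Y(3)[of j] Y(3)[of "j - 1"] that by simp_all
    show ?thesis unfolding Zj y mult_mat_zero_vec[OF cS] by (simp add: smult_vec_zero)
  qed
  moreover have "?Z *\<^sub>v ub m (J + Suc k) \<noteq> 0\<^sub>v p"
  proof
    assume z: "?Z *\<^sub>v ub m (J + Suc k) = 0\<^sub>v p"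
    let ?t = "(q powi (1 - s - int m + int (J + Suc k))) ^ (n - 1)" and ?\<kappa> = "kap q (1 - int m) (J + Suc k)"
    have y: "Y *\<^sub>v ub m (J + Suc k) = 0\<^sub>v p" using Y(3)[of "J + Suc k"] by simp
    have "?Z *\<^sub>v ub m (J + Suc k) = ?t \<cdot>\<^sub>v (0\<^sub>v p - ?\<kappa> \<cdot>\<^sub>v (Y *\<^sub>v ub m (J + k)))"
      unfolding Zj y mult_mat_zero_vec[OF cS] by simp
    then have e: "?t \<cdot>\<^sub>v (0\<^sub>v p - ?\<kappa> \<cdot>\<^sub>v (Y *\<^sub>v ub m (J + k))) = 0\<^sub>v p" using z by simp
    have nz: "?t \<noteq> 0" "?\<kappa> \<noteq> 0" using kap_V_nz[of "J + Suc k" m 0] Suc.prems m by simp_all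
    have yc: "Y *\<^sub>v ub m (J + k) \<in> carrier_vec p" by (rule mult_mat_vec_carrier[OF Y(1) ub_carrier])
    have gen: "y = 0\<^sub>v p" if y: "y \<in> carrier_vec p" and h: "t \<cdot>\<^sub>v (0\<^sub>v p - k \<cdot>\<^sub>v y) = 0\<^sub>v p" and nz: "t \<noteq> 0" "k \<noteq> 0" for y :: "'k vec" and t k
    proof (rule eq_vecI)
      fix i assume i: "i < dim_vec (0\<^sub>v p :: 'k vec)"
      have "(t \<cdot>\<^sub>v (0\<^sub>v p - k \<cdot>\<^sub>v y)) $ i = (0\<^sub>v p :: 'k vec) $ i" by (simp only: h)
      then have "t * (0 - k * y $ i) = 0" using i y by simp
      then show "y $ i = (0\<^sub>v p :: 'k vec) $ i" using nz i by simp
    qed (use y in simp)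
    show False using gen[OF yc e nz] Y(4) by simp
  qed
  ultimately show ?case using Z e1 by blast
qed

section \<open>Lowest weight vectors and the homomorphisms out of Q(l,r) that they define\<close>

lemma kap_frac: "kap q w j = (1 - q ^ j) * (1 - q powi (w + int j - 1)) / (1 - q)"
  by (simp add: kap_def q_int_frac)

text \<open>Modulo n in the exponents, the two factors 1 - q^j and 1 - q^(j - l) trade
  places.\<close>

lemma kap_reflect:
  assumes "j \<le> l" "l \<le> n"
  shows "kap q (1 + int l) (n - l + j) = kap q (1 - int l) j"
proof -
  have 1: "q ^ (n - l + j) = q powi (1 - int l + int j - 1)"
  proof -
    have e: "int (n - l + j) = (1 - int l + int j - 1) + int n" using assms by (simp add: of_nat_diff)
    have "q ^ (n - l + j) = q powi int (n - l + j)" by (simp only: power_int_of_nat)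
    also have "\<dots> = q powi (1 - int l + int j - 1)" by (rule powi_cong) (unfold e, simp)
    finally show ?thesis .
  qed
  have 2: "q powi (1 + int l + int (n - l + j) - 1) = q ^ j"
  proof -
    have e: "1 + int l + int (n - l + j) - 1 = int j + int n" using assms by (simp add: of_nat_diff)
    have "q powi (1 + int l + int (n - l + j) - 1) = q powi int j" by (rule powi_cong) (unfold e, simp)
    then show ?thesis by simp
  qed
  show ?thesis unfolding kap_frac 1 2 by simp
qed

text \<open>The relation for da, applied to the k-th vector of the orbit, determines
  \<open>a\<close> on the next one because q is invertible. The scalars that result are those of the
  lower Verma module in Q(l,r), read backwards from n.\<close>

lemma lowest_weight_orbit:
  assumes G: "gens_rep n q m G" and v: "v \<in> carrier_vec m" and av: "G Gen_a *\<^sub>v v = 0\<^sub>v m"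
    and bv: "G Gen_b *\<^sub>v v = q powi x \<cdot>\<^sub>v v" and cv: "G Gen_c *\<^sub>v v = q powi y \<cdot>\<^sub>v v"
    and xy: "(x + y) mod int n = (int l - 1) mod int n"
  defines "w \<equiv> \<lambda>j. G Gen_d ^\<^sub>m j *\<^sub>v v"
  shows "k \<le> n \<Longrightarrow> G Gen_a *\<^sub>v w k = kap q (1 + int l) (n - k) \<cdot>\<^sub>v w (k - 1)"
proof (induction k)
  case 0
  have "w 0 = v" using gens_repD(1)[OF G, of Gen_d] v by (simp add: w_def)
  then show ?case using av v by (simp add: smult_vec_zero)
next
  case (Suc k)
  note c = gens_repD(1)[OF G]
  have wc: "w j \<in> carrier_vec m" for j unfolding w_def by (rule mult_mat_vec_carrier[OF pow_carrier_mat[OF c] v])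
  have wS: "G Gen_d *\<^sub>v w j = w (Suc j)" for j unfolding w_def by (rule pow_mat_vec_Suc(1)[OF c v, symmetric])
  have wb: "G Gen_b *\<^sub>v w j = q powi (x - int j) \<cdot>\<^sub>v w j" "G Gen_c *\<^sub>v w j = q powi (y - int j) \<cdot>\<^sub>v w j" for j
    unfolding w_def using weight_shift(3,4)[OF G v bv cv] by auto
  note ms = mult_smult_vec[OF c wc]
  have k: "k < n" using Suc.prems by simp
  have IH: "G Gen_a *\<^sub>v w k = kap q (1 + int l) (n - k) \<cdot>\<^sub>v w (k - 1)" using Suc by simp
  have e: "kap q (1 + int l) (n - k) \<cdot>\<^sub>v w (Suc (k - 1)) = kap q (1 + int l) (n - k) \<cdot>\<^sub>v w k"
    using wc[of k] wc[of 1] by (cases k) (auto simp: smult_vec_zero)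
  have p: "q powi (y - int k) * q powi (x - int k) = q powi (1 + int l + 2 * int (n - Suc k))"
    unfolding powi_add[symmetric]
  proof (rule powi_cong)
    have e: "1 + int l + 2 * int (n - Suc k) = (int l - 1) + (- 2 * int k) + int n + int n" using k by (simp add: of_nat_diff)
    have "(y - int k + (x - int k)) mod int n = ((x + y) + (- 2 * int k)) mod int n" by (simp add: algebra_simps)
    also have "\<dots> = ((int l - 1) + (- 2 * int k)) mod int n" using xy by (metis mod_add_left_eq)
    also have "\<dots> = (1 + int l + 2 * int (n - Suc k)) mod int n" unfolding e by (simp only: mod_add_self2)
    finally show "(y - int k + (x - int k)) mod int n = (1 + int l + 2 * int (n - Suc k)) mod int n" .
  qed
  have r: "kap q (1 + int l) (n - k) = q * kap q (1 + int l) (n - Suc k) + (1 - q powi (1 + int l + 2 * int (n - Suc k)))"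
    using kap_Suc[of "1 + int l" "n - Suc k"] k by (simp add: Suc_diff_Suc)
  have u: "G Gen_a *\<^sub>v w (Suc k) \<in> carrier_vec m" by (rule mult_mat_vec_carrier[OF c wc])
  have "kap q (1 + int l) (n - k) \<cdot>\<^sub>v w k = G Gen_d *\<^sub>v (G Gen_a *\<^sub>v w k)" unfolding IH ms wS e ..
  also have "\<dots> = q \<cdot>\<^sub>v (G Gen_a *\<^sub>v w (Suc k)) + (w k - q powi (1 + int l + 2 * int (n - Suc k)) \<cdot>\<^sub>v w k)"
    unfolding gens_rep_vec(7)[OF G wc] wS wb ms smult_smult_assoc p ..
  finally have h: "kap q (1 + int l) (n - k) \<cdot>\<^sub>v w k = q \<cdot>\<^sub>v (G Gen_a *\<^sub>v w (Suc k)) + (w k - q powi (1 + int l + 2 * int (n - Suc k)) \<cdot>\<^sub>v w k)" .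
  have gen: "u = a \<cdot>\<^sub>v z" if cc: "u \<in> carrier_vec m" "z \<in> carrier_vec m" and h: "b \<cdot>\<^sub>v z = q \<cdot>\<^sub>v u + (z - e \<cdot>\<^sub>v z)" and b: "b = q * a + (1 - e)" for u z :: "'k vec" and a b e
  proof (rule eq_vecI)
    fix i assume "i < dim_vec (a \<cdot>\<^sub>v z)"
    then have i: "i < m" using cc by simp
    have "(b \<cdot>\<^sub>v z) $ i = (q \<cdot>\<^sub>v u + (z - e \<cdot>\<^sub>v z)) $ i" by (simp only: h)
    then have "b * z $ i = q * u $ i + (z $ i - e * z $ i)" using i cc by simp
    then have "q * u $ i = q * (a * z $ i)" unfolding b by (simp add: algebra_simps)
    then show "u $ i = (a \<cdot>\<^sub>v z) $ i" using i cc by simp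
  qed (use cc in simp)
  show ?case using gen[OF u wc h r] by simp
qed

text \<open>
  The homomorphism sends \<open>ez j\<close> to a multiple of $d^{n-1-j} v$ and \<open>ey j\<close> to a multiple of $d^{l-1-j} v$; the
  factors are forced by how \<open>a\<close> acts on the orbit of \<open>v\<close> under \<open>d\<close>.
\<close>

lemma Q_hom_lowest:
  assumes l: "0 < l" "l < n" and N: "is_hmod n q N" and v: "v \<in> carrier_vec (hm_dim N)"
    and av: "act n q N Gen_a *\<^sub>v v = 0\<^sub>v (hm_dim N)"
    and bv: "act n q N Gen_b *\<^sub>v v = q powi (r + int l - 1) \<cdot>\<^sub>v v" and cv: "act n q N Gen_c *\<^sub>v v = q powi (- r) \<cdot>\<^sub>v v"
  shows "\<exists>X\<in>hm_hom n q (Q l r) N. \<exists>\<kappa>. \<kappa> \<noteq> 0 \<and> X *\<^sub>v ez (n - l - 1) = \<kappa> \<cdot>\<^sub>v (act n q N Gen_d ^\<^sub>m l *\<^sub>v v)"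
proof -
  let ?G = "act n q N" and ?m = "hm_dim N"
  note G = hmod_gens_rep[OF N] and c = hmod_eval(2)[OF N]
  define w where "w j = ?G Gen_d ^\<^sub>m j *\<^sub>v v" for j
  have wc: "w j \<in> carrier_vec ?m" for j unfolding w_def by (rule mult_mat_vec_carrier[OF pow_carrier_mat[OF c] v])
  have wS: "?G Gen_d *\<^sub>v w j = w (Suc j)" for j unfolding w_def by (rule pow_mat_vec_Suc(1)[OF c v, symmetric])
  have wb: "?G Gen_b *\<^sub>v w j = q powi (r + int l - 1 - int j) \<cdot>\<^sub>v w j" "?G Gen_c *\<^sub>v w j = q powi (- r - int j) \<cdot>\<^sub>v w j" for j
    unfolding w_def using weight_shift(3,4)[OF G v bv cv] by auto
  have wa: "?G Gen_a *\<^sub>v w k = kap q (1 + int l) (n - k) \<cdot>\<^sub>v w (k - 1)" if "k \<le> n" for k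
    unfolding w_def by (rule lowest_weight_orbit[OF G v av bv cv _ that]) simp
  have wn: "w n = 0\<^sub>v ?m" unfolding w_def gens_repD(10)[OF G] using v by (intro eq_vecI) auto
  note ms = mult_smult_vec[OF c wc] and mz = mult_mat_zero_vec[OF c]
  define cz where "cz j = (\<Prod>i<j. kap q (1 + int l) (Suc i))" for j
  \<comment> \<open>The constant factor \<open>cz (n - l - 1)\<close> makes the image of
    \<open>ey 0\<close> under \<open>d\<close> agree with the image of
    \<open>ez (n - l - 1)\<close>.\<close>
  define cy where "cy j = cz (n - l - 1) * (\<Prod>i<j. kap q (1 - int l) (Suc i))" for j
  define Y where "Y j = (if j < l then cy j \<cdot>\<^sub>v w (l - 1 - j) else 0\<^sub>v ?m)" for j
  define Z where "Z j = (if j < n then cz j \<cdot>\<^sub>v w (n - 1 - j) else 0\<^sub>v ?m)" for j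
  \<comment> \<open>The factor with i = n - l - 1 is \<open>kap q (1 + int l) (n - l)\<close>, which
    vanishes; so \<open>ez j\<close> is sent to 0 from j = n - l on.\<close>
  have cz0: "cz j = 0" if "n - l \<le> j" for j
  proof -
    have "n - l - 1 \<in> {..<j}" using that l by auto
    moreover have "Suc (n - l - 1) = n - l" using l by simp
    then have "kap q (1 + int l) (Suc (n - l - 1)) = 0" using kap_1_plus[of l] l by (simp only:)
    ultimately show ?thesis unfolding cz_def by (meson finite_lessThan prod_zero)
  qed
  have Z0: "Z j = 0\<^sub>v ?m" if "n - l \<le> j" for j using cz0[OF that] wc[of "n - 1 - j"] by (simp add: Z_def smult_vec_zero)
  have czS: "cz (Suc j) = cz j * kap q (1 + int l) (Suc j)" "cy (Suc j) = cy j * kap q (1 - int l) (Suc j)" for j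
    by (simp_all add: cz_def cy_def mult.assoc)
  have "\<exists>X\<in>hm_hom n q (Q l r) N. \<forall>j. X *\<^sub>v ey j = Y j \<and> X *\<^sub>v ez j = Z j"
  proof (rule Q_hom[OF l N])
    fix j
    show "Y j \<in> carrier_vec ?m" "Z j \<in> carrier_vec ?m" using wc by (simp_all add: Y_def Z_def)
    show "?G Gen_a *\<^sub>v Z j = Z (Suc j)"
    proof (cases "Suc j < n")
      case True
      have z: "Z j = cz j \<cdot>\<^sub>v w (n - 1 - j)" "Z (Suc j) = cz (Suc j) \<cdot>\<^sub>v w (n - 1 - Suc j)" using True by (auto simp: Z_def)
      have "n - (n - 1 - j) = Suc j" "n - 1 - j - 1 = n - 1 - Suc j" using True by auto
      then show ?thesis unfolding z ms czS using wa[of "n - 1 - j"] by (simp add: smult_smult_assoc)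
    next
      case False
      have "w 0 = v" using c[of Gen_d] v by (simp add: w_def)
      then have "?G Gen_a *\<^sub>v w 0 = 0\<^sub>v ?m" using av by simp
      then show ?thesis using False by (auto simp: Z_def ms mz smult_vec_zero)
    qed
    show "?G Gen_a *\<^sub>v Y j = Y (Suc j)"
    proof (cases "Suc j < l")
      case True
      have y: "Y j = cy j \<cdot>\<^sub>v w (l - 1 - j)" "Y (Suc j) = cy (Suc j) \<cdot>\<^sub>v w (l - 1 - Suc j)" using True by (auto simp: Y_def)
      have "n - (l - 1 - j) = n - l + Suc j" "l - 1 - j - 1 = l - 1 - Suc j" using True l by auto
      moreover have "kap q (1 + int l) (n - l + Suc j) = kap q (1 - int l) (Suc j)" by (rule kap_reflect) (use True l in auto)
      ultimately show ?thesis unfolding y ms czS using wa[of "l - 1 - j"] l by (simp add: smult_smult_assoc)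
    next
      case False
      have "w 0 = v" using c[of Gen_d] v by (simp add: w_def)
      then have "?G Gen_a *\<^sub>v w 0 = 0\<^sub>v ?m" using av by simp
      then show ?thesis using False by (auto simp: Y_def ms mz smult_vec_zero)
    qed
    have bZ: "q powi (r + int l - 1 - int (n - 1 - j)) = q powi (r + int l + int j)" "q powi (- r - int (n - 1 - j)) = q powi (1 - r + int j)" if "j < n"
    proof -
      have e: "r + int l + int j = r + int l - 1 - int (n - 1 - j) + int n" "1 - r + int j = - r - int (n - 1 - j) + int n"
        using that by (simp_all add: of_nat_diff)
      show "q powi (r + int l - 1 - int (n - 1 - j)) = q powi (r + int l + int j)" by (rule powi_cong) (unfold e, simp)
      show "q powi (- r - int (n - 1 - j)) = q powi (1 - r + int j)" by (rule powi_cong) (unfold e, simp)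
    qed
    have bY: "r + int l - 1 - int (l - 1 - j) = r + int j" "- r - int (l - 1 - j) = 1 - r - int l + int j" if "j < l"
      using that by (simp_all add: of_nat_diff)
    show "?G Gen_b *\<^sub>v Y j = q powi (r + int j) \<cdot>\<^sub>v Y j"
      by (cases "j < l") (simp_all only: Y_def ms wb bY mz smult_vec_zero smult_smult_assoc mult.commute if_True if_False)
    show "?G Gen_c *\<^sub>v Y j = q powi (1 - r - int l + int j) \<cdot>\<^sub>v Y j"
      by (cases "j < l") (simp_all only: Y_def ms wb bY mz smult_vec_zero smult_smult_assoc mult.commute if_True if_False)
    show "?G Gen_b *\<^sub>v Z j = q powi (r + int l + int j) \<cdot>\<^sub>v Z j"
      by (cases "j < n") (simp_all only: Z_def ms wb bZ mz smult_vec_zero smult_smult_assoc mult.commute if_True if_False)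
    show "?G Gen_c *\<^sub>v Z j = q powi (1 - r + int j) \<cdot>\<^sub>v Z j"
      by (cases "j < n") (simp_all only: Z_def ms wb bZ mz smult_vec_zero smult_smult_assoc mult.commute if_True if_False)
    show "?G Gen_d *\<^sub>v Z j = kap q (1 + int l) j \<cdot>\<^sub>v Z (j - 1)"
    proof (cases j)
      case 0
      have "Suc (n - 1) = n" using l by simp
      then have "?G Gen_d *\<^sub>v w (n - 1) = 0\<^sub>v ?m" using wS[of "n - 1"] wn by simp
      then show ?thesis using 0 l wc[of "n - 1"] by (simp add: Z_def ms smult_vec_zero)
    next
      case (Suc i)
      show ?thesis
      proof (cases "j < n")
        case True
        then have z: "Z j = cz (Suc i) \<cdot>\<^sub>v w (n - 1 - j)" "Z (j - 1) = cz i \<cdot>\<^sub>v w (n - 1 - i)" "Suc (n - 1 - j) = n - 1 - i"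
          using Suc by (auto simp: Z_def)
        show ?thesis unfolding z(1,2) ms wS z(3) czS using Suc by (simp add: smult_smult_assoc mult.commute)
      next
        case False
        then have "Z j = 0\<^sub>v ?m" "Z (j - 1) = 0\<^sub>v ?m" using Z0[of j] Z0[of "j - 1"] l by auto
        then show ?thesis by (simp add: mz smult_vec_zero)
      qed
    qed
    show "?G Gen_d *\<^sub>v Y j = kap q (1 - int l) j \<cdot>\<^sub>v Y (j - 1) + q ^ j \<cdot>\<^sub>v Z (n - l - 1 + j)"
    proof (cases j)
      case 0
      have z: "Z (n - l - 1) = cz (n - l - 1) \<cdot>\<^sub>v w l" using l by (simp add: Z_def)
      have "Y 0 = cz (n - l - 1) \<cdot>\<^sub>v w (l - 1)" using l by (simp add: Y_def cy_def)
      moreover have "?G Gen_d *\<^sub>v w (l - 1) = w l" using wS[of "l - 1"] l by simp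
      ultimately show ?thesis using 0 z wc[of l] wc[of "l - 1"] by (simp add: ms smult_vec_zero)
    next
      case (Suc i)
      have z: "Z (n - l - 1 + j) = 0\<^sub>v ?m" by (rule Z0) (use Suc in simp)
      have Yc: "Y i \<in> carrier_vec ?m" using wc by (simp add: Y_def)
      consider "j < l" | "j = l" | "l < j" by linarith
      then have "?G Gen_d *\<^sub>v Y j = kap q (1 - int l) j \<cdot>\<^sub>v Y i"
      proof cases
        case 1
        then have y: "Y j = cy (Suc i) \<cdot>\<^sub>v w (l - 1 - j)" "Y i = cy i \<cdot>\<^sub>v w (l - 1 - i)" "Suc (l - 1 - j) = l - 1 - i"
          using Suc by (auto simp: Y_def)
        show ?thesis unfolding y(1,2) ms wS y(3) czS using Suc by (simp add: smult_smult_assoc mult.commute)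
      next
        case 2
        then have "Y j = 0\<^sub>v ?m" by (simp add: Y_def)
        then show ?thesis using 2 kap_1_minus[of l] Yc by (simp add: mz smult_vec_zero)
      next
        case 3
        then have "Y j = 0\<^sub>v ?m" "Y i = 0\<^sub>v ?m" using Suc by (auto simp: Y_def)
        then show ?thesis by (simp add: mz smult_vec_zero)
      qed
      then show ?thesis unfolding z using Suc Yc by (simp add: smult_vec_zero)
    qed
  qed (use l in \<open>auto simp: Y_def Z_def\<close>)
  then obtain X where X: "X \<in> hm_hom n q (Q l r) N" "\<And>j. X *\<^sub>v ez j = Z j" by blast
  have "cz (n - l - 1) \<noteq> 0"
    unfolding cz_def prod_zero_iff[OF finite_lessThan]
  proof clarsimp
    fix i assume i: "i < n - Suc l" and z: "kap q (1 + int l) (Suc i) = 0"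
    have "kap q (1 + int l) (Suc i) \<noteq> 0"
    proof (rule kap_nz)
      show "(1 + int l + int (Suc i) - 1) mod int n \<noteq> 0"
      proof
        assume "(1 + int l + int (Suc i) - 1) mod int n = 0"
        then have "int n dvd int (l + Suc i)" by (simp add: mod_eq_0_iff_dvd)
        then have "n dvd l + Suc i" by (simp only: of_nat_dvd_iff)
        then have "n \<le> l + Suc i" by (intro dvd_imp_le) auto
        then show False using i by linarith
      qed
    qed (use i in auto)
    then show False using z by simp
  qed
  moreover have "X *\<^sub>v ez (n - l - 1) = cz (n - l - 1) \<cdot>\<^sub>v (?G Gen_d ^\<^sub>m l *\<^sub>v v)"
    unfolding X(2) using l by (simp add: Z_def w_def)
  ultimately show ?thesis using X(1) by blast
qed

end

section \<open>Tops of tensor products with simple modules\<close>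

lemma ub_nz: "j < L \<Longrightarrow> (ub L j :: 'k::field vec) \<noteq> 0\<^sub>v L"
proof
  assume j: "j < L" and "(ub L j :: 'k vec) = 0\<^sub>v L"
  then have "(ub L j :: 'k vec) $ j = 0\<^sub>v L $ j" by simp
  then show False using j by (simp add: ub_index)
qed

lemma maps_onto_triangular:
  fixes M :: "'k::field hmod" and S :: "'i \<Rightarrow> 'k hmod"
  assumes M: "is_hmod n q M"
    and S: "\<And>i. i \<in> set is \<Longrightarrow> hm_simple n q (S i)" and f: "\<And>i. i \<in> set is \<Longrightarrow> f i \<in> hm_hom n q M (S i)"
    and x: "\<And>i. i \<in> set is \<Longrightarrow> x i \<in> carrier_vec (hm_dim M)"
    and diag: "\<And>i. i \<in> set is \<Longrightarrow> f i *\<^sub>v x i \<noteq> 0\<^sub>v (hm_dim (S i))"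
    and tri: "sorted_wrt (\<lambda>i j. f i *\<^sub>v x j = 0\<^sub>v (hm_dim (S i))) is"
  shows "maps_onto n q M (map S is)"
  unfolding maps_onto_def length_map
proof (intro exI[of _ "\<lambda>k. f (is ! k)"] conjI allI impI)
  show "joint_surj M {..<length is} (\<lambda>k. map S is ! k) (\<lambda>k. f (is ! k))"
  proof (rule joint_surj_triangular[OF M, where x = "\<lambda>k. x (is ! k)"])
    fix j k assume "j < k" "k < length is"
    then show "f (is ! j) *\<^sub>v x (is ! k) = 0\<^sub>v (hm_dim (map S is ! j))"
      using sorted_wrt_nth_less[OF tri] by simp
  qed (use S f x diag in simp_all)
qed (use f in simp)

context primitive_root
begin

lemma internal_hom_highest:
  fixes r s :: int
  assumes m: "m \<le> n" and i: "i < m" and p: "p \<le> n" and mp: "m \<le> p + i"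
    and c: "(int p - (int l + int m - 1 - 2 * int i)) mod int n = 0"
  defines "N \<equiv> internal_hom (V q m s) (V q p (r + s + int i))"
  shows "\<exists>X\<in>carrier_mat p m. act n q N Gen_d *\<^sub>v vec_of_mat p m X = 0\<^sub>v (hm_dim N) \<and>
    act n q N Gen_b *\<^sub>v vec_of_mat p m X = q powi r \<cdot>\<^sub>v vec_of_mat p m X \<and>
    act n q N Gen_c *\<^sub>v vec_of_mat p m X = q powi (1 - r - int l) \<cdot>\<^sub>v vec_of_mat p m X \<and>
    (\<forall>j<i. X *\<^sub>v ub m j = 0\<^sub>v p) \<and> X *\<^sub>v ub m i = ub p 0"
proof -
  obtain X where X: "X \<in> carrier_mat p m"
    and d: "act n q (V q p (r + s + int i)) Gen_d * X = X * act n q (V q m s) Gen_d"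
    and b: "act n q (V q p (r + s + int i)) Gen_b * X = q powi r \<cdot>\<^sub>m (X * act n q (V q m s) Gen_b)"
    and cc: "act n q (V q p (r + s + int i)) Gen_c * X = q powi (1 - r - int l) \<cdot>\<^sub>m (X * act n q (V q m s) Gen_c)"
    and e: "\<forall>j<i. X *\<^sub>v ub m j = 0\<^sub>v p" "X *\<^sub>v ub m i = ub p 0"
    using highest_matrix[OF m i p mp c, of r s] by (elim bexE conjE) (rule that)
  note WM = V_hmod[OF m, of s] and SM = V_hmod[OF p, of "r + s + int i"]
  note cW = hmod_eval(2)[OF WM(1), unfolded WM(2)]
  note N = internal_hom_hmod[OF WM(1) SM(1), unfolded WM(2) SM(2), folded N_def]
  note ia = internal_hom_act[OF WM(1) SM(1), unfolded WM(2) SM(2), folded N_def, OF X]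
  have "act n q N Gen_d *\<^sub>v vec_of_mat p m X = 0\<^sub>v (hm_dim N)"
    unfolding ia(2) d minus_r_inv_mat[OF mult_carrier_mat[OF X cW]] left_mult_zero_mat[OF pow_carrier_mat[OF cW]] vec_of_mat_zero N(2) ..
  then show ?thesis using X e ia(3)[OF b] ia(4)[OF cc] by blast
qed

text \<open>Indices below m belong to the tensors of \<open>ey 0\<close> with the basis of V(m,s).
  The last clause, vanishing on all tensors with some \<open>ez k\<close>, makes these maps
  triangular against those of \<open>Q_tensor_lowest\<close>.\<close>

lemma Q_tensor_highest:
  fixes r s :: int
  assumes l: "0 < l" "l < n" and m: "m \<le> n" and i: "i < m" and p: "p \<le> n" and mp: "m \<le> p + i"
    and c: "(int p - (int l + int m - 1 - 2 * int i)) mod int n = 0"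
  shows "\<exists>f\<in>hm_hom n q (hm_tensor n q (Q l r) (V q m s)) (V q p (r + s + int i)).
    (\<forall>j<i. f *\<^sub>v ub (2 * n * m) j = 0\<^sub>v p) \<and> f *\<^sub>v ub (2 * n * m) i \<noteq> 0\<^sub>v p \<and>
    (\<forall>k<n. \<forall>j<m. f *\<^sub>v ub (2 * n * m) ((n + k) * m + j) = 0\<^sub>v p)"
proof -
  note WM = V_hmod[OF m, of s] and SM = V_hmod[OF p, of "r + s + int i"] and QM = Q_hmod[OF l, of r]
  note N = internal_hom_hmod[OF WM(1) SM(1), unfolded WM(2) SM(2)]
  let ?N = "internal_hom (V q m s) (V q p (r + s + int i))"
  obtain X where X: "X \<in> carrier_mat p m" and dX: "act n q ?N Gen_d *\<^sub>v vec_of_mat p m X = 0\<^sub>v (hm_dim ?N)"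
    and bX: "act n q ?N Gen_b *\<^sub>v vec_of_mat p m X = q powi r \<cdot>\<^sub>v vec_of_mat p m X"
    and cX: "act n q ?N Gen_c *\<^sub>v vec_of_mat p m X = q powi (1 - r - int l) \<cdot>\<^sub>v vec_of_mat p m X"
    and e: "\<forall>j<i. X *\<^sub>v ub m j = 0\<^sub>v p" "X *\<^sub>v ub m i = ub p 0"
    using internal_hom_highest[OF m i p mp c, of r s] by (elim bexE conjE) (rule that)
  have vc: "vec_of_mat p m X \<in> carrier_vec (hm_dim ?N)" unfolding N(2) by simp
  obtain F where F: "F \<in> hm_hom n q (Q l r) ?N"
    and FX: "\<And>j. F *\<^sub>v ey j = act n q ?N Gen_a ^\<^sub>m j *\<^sub>v vec_of_mat p m X" "\<And>j. F *\<^sub>v ez j = 0\<^sub>v (hm_dim ?N)"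
    using Q_hom_highest[OF l N(1) vc dX bX cX] by blast
  obtain f where f: "f \<in> hm_hom n q (hm_tensor n q (Q l r) (V q m s)) (V q p (r + s + int i))"
    and fX: "\<And>k j X. k < 2 * n \<Longrightarrow> j < m \<Longrightarrow> X \<in> carrier_mat p m \<Longrightarrow> F *\<^sub>v ub (2 * n) k = vec_of_mat p m X \<Longrightarrow>
      f *\<^sub>v ub (2 * n * m) (k * m + j) = X *\<^sub>v ub m j"
    using uncurry_hom[OF QM(1) WM(1) SM(1) F] unfolding WM(2) SM(2) QM(3) by blast
  have n: "0 < n" using n_gt_2 by simp
  have "F *\<^sub>v ub (2 * n) 0 = vec_of_mat p m X"
    using n FX(1)[of 0] hmod_eval(2)[OF N(1), of Gen_a] N(2) by (simp add: ub_eyz)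
  then have g: "f *\<^sub>v ub (2 * n * m) j = X *\<^sub>v ub m j" if "j < m" for j using fX[of 0 j X] that n X by simp
  have "f *\<^sub>v ub (2 * n * m) ((n + k) * m + j) = 0\<^sub>v p" if "k < n" "j < m" for k j
  proof -
    have "F *\<^sub>v ub (2 * n) (n + k) = vec_of_mat p m (0\<^sub>m p m)"
      using that FX(2)[of k] N(2) by (simp add: ub_eyz vec_of_mat_zero)
    then have "f *\<^sub>v ub (2 * n * m) ((n + k) * m + j) = 0\<^sub>m p m *\<^sub>v ub m j" by (intro fX) (use that in auto)
    then show ?thesis by (auto intro!: eq_vecI)
  qed
  moreover have "p \<noteq> 0" using mp i by simp
  ultimately show ?thesis using f g e i by (intro bexI[of _ f]) (auto simp: ub_nz)
qed

text \<open>The analogue with the Verma module V(n,r) in place of Q(l,r); the congruence for p is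
  the one with l = n.\<close>

lemma V_n_tensor_highest:
  fixes r s :: int
  assumes m: "m \<le> n" and i: "i < m" and p: "p \<le> n" and mp: "m \<le> p + i"
    and c: "(int p - (int n + int m - 1 - 2 * int i)) mod int n = 0"
  shows "\<exists>f\<in>hm_hom n q (hm_tensor n q (V q n r) (V q m s)) (V q p (r + s + int i)).
    (\<forall>j<i. f *\<^sub>v ub (n * m) j = 0\<^sub>v p) \<and> f *\<^sub>v ub (n * m) i \<noteq> 0\<^sub>v p"
proof -
  note WM = V_hmod[OF m, of s] and SM = V_hmod[OF p, of "r + s + int i"] and QM = V_hmod[OF le_refl, of r]
  note N = internal_hom_hmod[OF WM(1) SM(1), unfolded WM(2) SM(2)]
  let ?N = "internal_hom (V q m s) (V q p (r + s + int i))"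
  obtain X where X: "X \<in> carrier_mat p m" and dX: "act n q ?N Gen_d *\<^sub>v vec_of_mat p m X = 0\<^sub>v (hm_dim ?N)"
    and bX: "act n q ?N Gen_b *\<^sub>v vec_of_mat p m X = q powi r \<cdot>\<^sub>v vec_of_mat p m X"
    and cX: "act n q ?N Gen_c *\<^sub>v vec_of_mat p m X = q powi (1 - r - int n) \<cdot>\<^sub>v vec_of_mat p m X"
    and e: "\<forall>j<i. X *\<^sub>v ub m j = 0\<^sub>v p" "X *\<^sub>v ub m i = ub p 0"
    using internal_hom_highest[OF m i p mp c, of r s] by (elim bexE conjE) (rule that)
  have vc: "vec_of_mat p m X \<in> carrier_vec (hm_dim ?N)" unfolding N(2) by simp
  have an: "act n q ?N Gen_a ^\<^sub>m n *\<^sub>v vec_of_mat p m X = 0\<^sub>v (hm_dim ?N)"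
    unfolding gens_repD(7)[OF hmod_gens_rep[OF N(1)]] using vc by (intro eq_vecI) auto
  obtain F where F: "F \<in> hm_hom n q (V q n r) ?N"
    and FX: "\<And>j. F *\<^sub>v ub n j = act n q ?N Gen_a ^\<^sub>m j *\<^sub>v vec_of_mat p m X"
    using str_universal[OF kap_V le_refl N(1) vc dX bX cX an] unfolding V_eq_str_mod[of q n r] by blast
  obtain f where f: "f \<in> hm_hom n q (hm_tensor n q (V q n r) (V q m s)) (V q p (r + s + int i))"
    and fX: "\<And>k j X. k < n \<Longrightarrow> j < m \<Longrightarrow> X \<in> carrier_mat p m \<Longrightarrow> F *\<^sub>v ub n k = vec_of_mat p m X \<Longrightarrow>
      f *\<^sub>v ub (n * m) (k * m + j) = X *\<^sub>v ub m j"
    using uncurry_hom[OF QM(1) WM(1) SM(1) F] unfolding WM(2) SM(2) QM(2) by blast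
  have n: "0 < n" using n_gt_2 by simp
  have "F *\<^sub>v ub n 0 = vec_of_mat p m X"
    using FX[of 0] hmod_eval(2)[OF N(1), of Gen_a] N(2) by simp
  then have g: "f *\<^sub>v ub (n * m) j = X *\<^sub>v ub m j" if "j < m" for j using fX[of 0 j X] that n X by simp
  moreover have "p \<noteq> 0" using mp i by simp
  ultimately show ?thesis using f g e i by (intro bexI[of _ f]) (auto simp: ub_nz)
qed

text \<open>Such a map is detected on the tensors of \<open>ez (n - l - 1)\<close> with the basis of
  V(m,s): that vector goes to a nonzero multiple of d^l X, whose last nonzero column has moved from
  m - 1 - i to l + m - 1 - i.\<close>

lemma Q_tensor_lowest:
  fixes r s :: int
  assumes l: "0 < l" "l < n" and m: "m \<le> n" and i: "l \<le> i" "i < m"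
    and p: "p \<le> n" "int p = int n + int l + int m - 1 - 2 * int i"
  shows "\<exists>f\<in>hm_hom n q (hm_tensor n q (Q l r) (V q m s)) (V q p (r + s + int i)).
    (\<forall>j<m. l + m - 1 - i < j \<longrightarrow> f *\<^sub>v ub (2 * n * m) ((n + (n - l - 1)) * m + j) = 0\<^sub>v p) \<and>
    f *\<^sub>v ub (2 * n * m) ((n + (n - l - 1)) * m + (l + m - 1 - i)) \<noteq> 0\<^sub>v p"
proof -
  note WM = V_hmod[OF m, of s] and SM = V_hmod[OF p(1), of "r + s + int i"] and QM = Q_hmod[OF l, of r]
  note cW = hmod_eval(2)[OF WM(1), unfolded WM(2)]
  note N = internal_hom_hmod[OF WM(1) SM(1), unfolded WM(2) SM(2)]
  let ?N = "internal_hom (V q m s) (V q p (r + s + int i))"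
  obtain X where X: "X \<in> carrier_mat p m"
    and a: "act n q (V q p (r + s + int i)) Gen_a * X = X * act n q (V q m s) Gen_a"
    and b: "act n q (V q p (r + s + int i)) Gen_b * X = q powi (r + int l - 1) \<cdot>\<^sub>m (X * act n q (V q m s) Gen_b)"
    and c: "act n q (V q p (r + s + int i)) Gen_c * X = q powi (- r) \<cdot>\<^sub>m (X * act n q (V q m s) Gen_c)"
    and e: "\<forall>j. m - 1 - i < j \<longrightarrow> X *\<^sub>v ub m j = 0\<^sub>v p" "X *\<^sub>v ub m (m - 1 - i) \<noteq> 0\<^sub>v p"
    using lowest_matrix[OF m i p l(1), of r s] by (elim bexE conjE) (rule that)
  note ia = internal_hom_act[OF WM(1) SM(1), unfolded WM(2) SM(2), OF X]
  have aX: "act n q ?N Gen_a *\<^sub>v vec_of_mat p m X = 0\<^sub>v (hm_dim ?N)"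
    unfolding ia(1) a minus_r_inv_mat[OF mult_carrier_mat[OF X cW]] left_mult_zero_mat[OF pow_carrier_mat[OF cW]] vec_of_mat_zero N(2) ..
  have vc: "vec_of_mat p m X \<in> carrier_vec (hm_dim ?N)" unfolding N(2) by simp
  have J: "m - 1 - i + l = l + m - 1 - i" "m - 1 - i + l < m" using i by simp_all
  obtain Y where Y: "Y \<in> carrier_mat p m" "act n q ?N Gen_d ^\<^sub>m l *\<^sub>v vec_of_mat p m X = vec_of_mat p m Y"
    "\<forall>j. l + m - 1 - i < j \<longrightarrow> Y *\<^sub>v ub m j = 0\<^sub>v p" "Y *\<^sub>v ub m (l + m - 1 - i) \<noteq> 0\<^sub>v p"
    using lowest_matrix_iterate[OF m p(1) X e J(2)] unfolding J(1) by blast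
  obtain F \<kappa> where F: "F \<in> hm_hom n q (Q l r) ?N" and \<kappa>: "\<kappa> \<noteq> 0"
    and FX: "F *\<^sub>v ez (n - l - 1) = \<kappa> \<cdot>\<^sub>v vec_of_mat p m Y"
    using Q_hom_lowest[OF l N(1) vc aX ia(3)[OF b] ia(4)[OF c]] unfolding Y(2) by blast
  obtain f where f: "f \<in> hm_hom n q (hm_tensor n q (Q l r) (V q m s)) (V q p (r + s + int i))"
    and fX: "\<And>k j X. k < 2 * n \<Longrightarrow> j < m \<Longrightarrow> X \<in> carrier_mat p m \<Longrightarrow> F *\<^sub>v ub (2 * n) k = vec_of_mat p m X \<Longrightarrow>
      f *\<^sub>v ub (2 * n * m) (k * m + j) = X *\<^sub>v ub m j"
    using uncurry_hom[OF QM(1) WM(1) SM(1) F] unfolding WM(2) SM(2) QM(3) by blast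
  have k: "n + (n - l - 1) < 2 * n" using l by simp
  have "F *\<^sub>v ub (2 * n) (n + (n - l - 1)) = vec_of_mat p m (\<kappa> \<cdot>\<^sub>m Y)"
    using FX unfolding ub_eyz[OF k] by (simp add: vec_of_mat_smult[OF Y(1)])
  note g0 = fX[OF k _ smult_carrier_mat[OF Y(1)] this]
  have g: "f *\<^sub>v ub (2 * n * m) ((n + (n - l - 1)) * m + j) = \<kappa> \<cdot>\<^sub>v (Y *\<^sub>v ub m j)" if "j < m" for j
    unfolding g0[OF that] by (rule smult_mat_mult_vec[OF Y(1) ub_carrier])
  have nz: "\<kappa> \<cdot>\<^sub>v y \<noteq> 0\<^sub>v p" if "y \<in> carrier_vec p" "y \<noteq> 0\<^sub>v p" for y
  proof
    assume "\<kappa> \<cdot>\<^sub>v y = 0\<^sub>v p"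
    then have "inverse \<kappa> \<cdot>\<^sub>v (\<kappa> \<cdot>\<^sub>v y) = 0\<^sub>v p" by (simp add: smult_vec_zero)
    then show False using that \<kappa> by (simp add: smult_smult_assoc)
  qed
  have "f *\<^sub>v ub (2 * n * m) ((n + (n - l - 1)) * m + j) = 0\<^sub>v p" if "j < m" "l + m - 1 - i < j" for j
    unfolding g[OF that(1)] using Y(3) that by (simp add: smult_vec_zero)
  moreover have "f *\<^sub>v ub (2 * n * m) ((n + (n - l - 1)) * m + (l + m - 1 - i)) \<noteq> 0\<^sub>v p"
    unfolding g[OF J(2)[unfolded J(1)]] by (rule nz[OF mult_mat_vec_carrier[OF Y(1) ub_carrier] Y(4)])
  ultimately show ?thesis using f by (intro bexI[of _ f] conjI allI impI)
qed

text \<open>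
  A pair \<open>(p, t)\<close> stands for the simple module \<open>V(p, t)\<close>. The quotients in \<open>hw_low\<close> and \<open>hw_high\<close> come from
  vectors killed by \<open>d\<close>; the second copy of \<open>hw_high\<close> in \<open>Q_tensor_tops\<close> comes from vectors killed by \<open>a\<close>.
\<close>

definition hw_low :: "nat \<Rightarrow> nat \<Rightarrow> int \<Rightarrow> (nat \<times> int) list" where
  "hw_low l m t = map (\<lambda>i. (l + m - 1 - 2 * i, t + int i)) [0..<l]"

definition hw_high :: "nat \<Rightarrow> nat \<Rightarrow> int \<Rightarrow> (nat \<times> int) list" where
  "hw_high l m t = map (\<lambda>i. (n + l + m - 1 - 2 * i, t + int i)) [(l + m) div 2..<m]"

text \<open>The quotients are separated by test vectors, with indices from 0: \<open>ey 0\<close>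
  tensored with the i-th basis vector for the map \<open>g i\<close> coming from a vector killed by
  \<open>d\<close>, and \<open>z i\<close>, which is \<open>ez (n - l - 1)\<close> tensored with the
  basis vector l + m - 1 - i, for the map \<open>h i\<close> coming from a vector killed by
  \<open>a\<close>.\<close>

lemma Q_tensor_tops:
  fixes r s :: int
  assumes l: "0 < l" "l \<le> m" and m: "m < n" "l + m \<le> n"
  shows "maps_onto n q (hm_tensor n q (Q l r) (V q m s))
    (map (case_prod (V q)) (hw_low l m (r + s) @ hw_high l m (r + s) @ hw_high l m (r + s)))"
proof -
  \<comment> \<open>The bound i >= (l + m) div 2 is equivalent to n + l + m - 1 - 2i <= n, so that
    V(p,t) with this p is among the simple modules.\<close>
  define c where "c = (l + m) div 2"
  define pd where "pd i = (if i < l then l + m - 1 - 2 * i else n + l + m - 1 - 2 * i)" for i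
  define S where "S i = V q (pd i) (r + s + int i)" for i
  let ?M = "hm_tensor n q (Q l r) (V q m s)"
  have ln: "l < n" "m \<le> n" using l m by auto
  have lc: "l \<le> c" "c \<le> m" using l by (auto simp: c_def)
  note QM = Q_hmod[OF l(1) ln(1), of r] and WM = V_hmod[OF ln(2), of s]
  note TM = hmod_tensor[OF prim QM(1) WM(1), unfolded QM(3) WM(2)]
  have pd: "pd i \<le> n" "m \<le> pd i + i" "(int (pd i) - (int l + int m - 1 - 2 * int i)) mod int n = 0" "i < m"
    if i: "i \<in> {0..<l} \<union> {c..<m}" for i
  proof -
    consider "i < l" | "c \<le> i" "i < m" "l \<le> i" using i lc by force
    then have "pd i \<le> n \<and> m \<le> pd i + i \<and> (int (pd i) - (int l + int m - 1 - 2 * int i)) mod int n = 0 \<and> i < m"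
    proof cases
      case 1
      then have "int (pd i) = int l + int m - 1 - 2 * int i" using l by (simp add: pd_def of_nat_diff)
      then show ?thesis using 1 l m by (auto simp: pd_def)
    next
      case 2
      then have e: "int (pd i) = int n + int l + int m - 1 - 2 * int i" using m by (simp add: pd_def of_nat_diff)
      have "l + m \<le> 2 * i + 1" using 2 unfolding c_def by linarith
      then have "pd i \<le> n" "m \<le> pd i + i" using e 2 m by linarith+
      then show ?thesis using e 2 by simp
    qed
    then show "pd i \<le> n" "m \<le> pd i + i" "(int (pd i) - (int l + int m - 1 - 2 * int i)) mod int n = 0" "i < m" by auto
  qed
  have Sd: "hm_dim (S i) = pd i" "hm_simple n q (S i)" if "i \<in> {0..<l} \<union> {c..<m}" for i
    unfolding S_def using V_hmod(2)[OF pd(1)[OF that]] V_simple[OF pd(1)[OF that]] by auto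
  have "\<forall>i\<in>{0..<l} \<union> {c..<m}. \<exists>f. f \<in> hm_hom n q ?M (S i) \<and>
    (\<forall>j<i. f *\<^sub>v ub (2 * n * m) j = 0\<^sub>v (pd i)) \<and> f *\<^sub>v ub (2 * n * m) i \<noteq> 0\<^sub>v (pd i) \<and>
    (\<forall>k<n. \<forall>j<m. f *\<^sub>v ub (2 * n * m) ((n + k) * m + j) = 0\<^sub>v (pd i))"
  proof
    fix i assume i: "i \<in> {0..<l} \<union> {c..<m}"
    show "\<exists>f. f \<in> hm_hom n q ?M (S i) \<and>
      (\<forall>j<i. f *\<^sub>v ub (2 * n * m) j = 0\<^sub>v (pd i)) \<and> f *\<^sub>v ub (2 * n * m) i \<noteq> 0\<^sub>v (pd i) \<and>
      (\<forall>k<n. \<forall>j<m. f *\<^sub>v ub (2 * n * m) ((n + k) * m + j) = 0\<^sub>v (pd i))"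
      using Q_tensor_highest[OF l(1) ln pd(4)[OF i] pd(1-3)[OF i], of r s] unfolding S_def by blast
  qed
  from bchoice[OF this] obtain g where g: "\<And>i. i \<in> {0..<l} \<union> {c..<m} \<Longrightarrow> g i \<in> hm_hom n q ?M (S i)"
    "\<And>i j. i \<in> {0..<l} \<union> {c..<m} \<Longrightarrow> j < i \<Longrightarrow> g i *\<^sub>v ub (2 * n * m) j = 0\<^sub>v (pd i)"
    "\<And>i. i \<in> {0..<l} \<union> {c..<m} \<Longrightarrow> g i *\<^sub>v ub (2 * n * m) i \<noteq> 0\<^sub>v (pd i)"
    "\<And>i k j. i \<in> {0..<l} \<union> {c..<m} \<Longrightarrow> k < n \<Longrightarrow> j < m \<Longrightarrow> g i *\<^sub>v ub (2 * n * m) ((n + k) * m + j) = 0\<^sub>v (pd i)"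
    by blast
  define z where "z i = (n + (n - l - 1)) * m + (l + m - 1 - i)" for i
  have "\<forall>i\<in>{c..<m}. \<exists>f. f \<in> hm_hom n q ?M (S i) \<and>
    (\<forall>j<m. l + m - 1 - i < j \<longrightarrow> f *\<^sub>v ub (2 * n * m) ((n + (n - l - 1)) * m + j) = 0\<^sub>v (pd i)) \<and> f *\<^sub>v ub (2 * n * m) (z i) \<noteq> 0\<^sub>v (pd i)"
  proof
    fix i assume i: "i \<in> {c..<m}"
    then have h: "l \<le> i" "i < m" "i \<in> {0..<l} \<union> {c..<m}" using lc by auto
    have "int (pd i) = int n + int l + int m - 1 - 2 * int i" using h m by (simp add: pd_def of_nat_diff)
    from Q_tensor_lowest[OF l(1) ln h(1,2) pd(1)[OF h(3)] this, of r s]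
    show "\<exists>f. f \<in> hm_hom n q ?M (S i) \<and>
      (\<forall>j<m. l + m - 1 - i < j \<longrightarrow> f *\<^sub>v ub (2 * n * m) ((n + (n - l - 1)) * m + j) = 0\<^sub>v (pd i)) \<and> f *\<^sub>v ub (2 * n * m) (z i) \<noteq> 0\<^sub>v (pd i)"
      unfolding S_def z_def by blast
  qed
  from bchoice[OF this] obtain h where h: "\<And>i. i \<in> {c..<m} \<Longrightarrow> h i \<in> hm_hom n q ?M (S i)"
    "\<And>i j. i \<in> {c..<m} \<Longrightarrow> j < m \<Longrightarrow> l + m - 1 - i < j \<Longrightarrow> h i *\<^sub>v ub (2 * n * m) ((n + (n - l - 1)) * m + j) = 0\<^sub>v (pd i)"
    "\<And>i. i \<in> {c..<m} \<Longrightarrow> h i *\<^sub>v ub (2 * n * m) (z i) \<noteq> 0\<^sub>v (pd i)"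
    by blast
  let ?G = "[0..<l] @ [c..<m]" and ?H = "[c..<m]"
  \<comment> \<open>A map must kill the test vectors that come later. \<open>g i\<close> and
    \<open>h i\<close> kill those of smaller index, so both lists descend; every \<open>g\<close>
    kills every \<open>z\<close>, whereas \<open>h\<close> is not controlled on the test vectors of
    \<open>g\<close>, so the \<open>g\<close> come first.\<close>
  let ?L = "map Inl (rev ?G) @ map Inr (rev ?H) :: (nat + nat) list"
  have "maps_onto n q ?M (map (case_sum S S) ?L)"
  proof (rule maps_onto_triangular[OF TM(1), where f = "case_sum g h" and x = "case_sum (ub (2 * n * m)) (\<lambda>i. ub (2 * n * m) (z i))"])
    fix i assume "i \<in> set ?L"
    then consider k where "i = Inl k" "k \<in> {0..<l} \<union> {c..<m}" | k where "i = Inr k" "k \<in> {c..<m}" by auto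
    then have "hm_simple n q (case_sum S S i) \<and> case_sum g h i \<in> hm_hom n q ?M (case_sum S S i) \<and>
      case_sum (ub (2 * n * m)) (\<lambda>i. ub (2 * n * m) (z i)) i \<in> carrier_vec (hm_dim ?M) \<and>
      case_sum g h i *\<^sub>v case_sum (ub (2 * n * m)) (\<lambda>i. ub (2 * n * m) (z i)) i \<noteq> 0\<^sub>v (hm_dim (case_sum S S i))"
      by cases (use Sd g(1,3) h(1,3) TM(3) in auto)
    then show "hm_simple n q (case_sum S S i)" "case_sum g h i \<in> hm_hom n q ?M (case_sum S S i)"
      "case_sum (ub (2 * n * m)) (\<lambda>i. ub (2 * n * m) (z i)) i \<in> carrier_vec (hm_dim ?M)"
      "case_sum g h i *\<^sub>v case_sum (ub (2 * n * m)) (\<lambda>i. ub (2 * n * m) (z i)) i \<noteq> 0\<^sub>v (hm_dim (case_sum S S i))"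
      by auto
  next
    let ?R = "\<lambda>i j. case_sum g h i *\<^sub>v case_sum (ub (2 * n * m)) (\<lambda>i. ub (2 * n * m) (z i)) j = 0\<^sub>v (hm_dim (case_sum S S i))"
    have "sorted_wrt (<) ?G" using lc by (auto simp: sorted_wrt_append)
    then have 1: "sorted_wrt (\<lambda>i j. ?R (Inl j) (Inl i)) ?G"
      by (rule sorted_wrt_mono_rel[rotated]) (use g(2) Sd(1) in auto)
    have "sorted_wrt (<) ?H" by simp
    then have 2: "sorted_wrt (\<lambda>i j. ?R (Inr j) (Inr i)) ?H"
    proof (rule sorted_wrt_mono_rel[rotated])
      fix i j assume ij: "i \<in> set ?H" "j \<in> set ?H" "i < j"
      have "h j *\<^sub>v ub (2 * n * m) (z i) = 0\<^sub>v (pd j)"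
        unfolding z_def by (rule h(2)) (use ij lc l in auto)
      then show "?R (Inr j) (Inr i)" using ij Sd(1) by simp
    qed
    have 3: "?R (Inl i) (Inr j)" if "i \<in> set ?G" "j \<in> set ?H" for i j
    proof -
      have "g i *\<^sub>v ub (2 * n * m) (z j) = 0\<^sub>v (pd i)"
        unfolding z_def by (rule g(4)) (use that lc l ln in auto)
      then show ?thesis using that Sd(1) by simp
    qed
    show "sorted_wrt ?R ?L"
      unfolding sorted_wrt_append[of _ "map Inl (rev ?G)"] sorted_wrt_map sorted_wrt_rev using 1 2 3 by auto
  qed
  moreover have "mset (map (case_prod (V q)) (hw_low l m (r + s) @ hw_high l m (r + s) @ hw_high l m (r + s))) = mset (map (case_sum S S) ?L)"
  proof -
    have 1: "map (case_prod (V q)) (hw_low l m (r + s)) = map S [0..<l]"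
      unfolding hw_low_def map_map by (rule map_cong) (auto simp: S_def pd_def)
    have 2: "map (case_prod (V q)) (hw_high l m (r + s)) = map S [c..<m]"
      unfolding hw_high_def map_map c_def[symmetric] by (rule map_cong) (use lc in \<open>auto simp: S_def pd_def\<close>)
    have 3: "map (case_sum S S) ?L = map S (rev ?G) @ map S (rev ?H)" by (simp add: o_def)
    show ?thesis unfolding 3 unfolding map_append 1 2 by (simp add: ac_simps)
  qed
  ultimately show ?thesis by (rule maps_onto_perm)
qed

text \<open>Vectors killed by \<open>d\<close> alone are used here, giving each quotient once. Since
  n counts as 0 modulo n, the list is that of l = 0, where the low part is empty.\<close>

lemma V_n_tensor_tops:
  fixes r s :: int
  assumes m: "m \<le> n"
  shows "maps_onto n q (hm_tensor n q (V q n r) (V q m s)) (map (case_prod (V q)) (hw_high 0 m (r + s)))"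
proof -
  define c where "c = m div 2"
  define pd where "pd i = n + m - 1 - 2 * i" for i
  define S where "S i = V q (pd i) (r + s + int i)" for i
  let ?M = "hm_tensor n q (V q n r) (V q m s)"
  note QM = V_hmod[OF le_refl, of r] and WM = V_hmod[OF m, of s]
  note TM = hmod_tensor[OF prim QM(1) WM(1), unfolded QM(2) WM(2)]
  have pd: "pd i \<le> n" "m \<le> pd i + i" "(int (pd i) - (int n + int m - 1 - 2 * int i)) mod int n = 0" "i < m"
    if i: "i \<in> {c..<m}" for i
  proof -
    have e: "int (pd i) = int n + int m - 1 - 2 * int i" using i m by (simp add: pd_def of_nat_diff)
    have "m \<le> 2 * i + 1" using i unfolding c_def by auto
    then show "pd i \<le> n" "m \<le> pd i + i" "i < m" using i m by (auto simp: pd_def)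
    show "(int (pd i) - (int n + int m - 1 - 2 * int i)) mod int n = 0" unfolding e by simp
  qed
  have Sd: "hm_dim (S i) = pd i" "hm_simple n q (S i)" if "i \<in> {c..<m}" for i
    unfolding S_def using V_hmod(2)[OF pd(1)[OF that]] V_simple[OF pd(1)[OF that]] by auto
  have "\<forall>i\<in>{c..<m}. \<exists>f. f \<in> hm_hom n q ?M (S i) \<and>
    (\<forall>j<i. f *\<^sub>v ub (n * m) j = 0\<^sub>v (pd i)) \<and> f *\<^sub>v ub (n * m) i \<noteq> 0\<^sub>v (pd i)"
  proof
    fix i assume i: "i \<in> {c..<m}"
    show "\<exists>f. f \<in> hm_hom n q ?M (S i) \<and>
      (\<forall>j<i. f *\<^sub>v ub (n * m) j = 0\<^sub>v (pd i)) \<and> f *\<^sub>v ub (n * m) i \<noteq> 0\<^sub>v (pd i)"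
      using V_n_tensor_highest[OF m pd(4)[OF i] pd(1-3)[OF i], of r s] unfolding S_def by blast
  qed
  from bchoice[OF this] obtain g where g: "\<And>i. i \<in> {c..<m} \<Longrightarrow> g i \<in> hm_hom n q ?M (S i)"
    "\<And>i j. i \<in> {c..<m} \<Longrightarrow> j < i \<Longrightarrow> g i *\<^sub>v ub (n * m) j = 0\<^sub>v (pd i)"
    "\<And>i. i \<in> {c..<m} \<Longrightarrow> g i *\<^sub>v ub (n * m) i \<noteq> 0\<^sub>v (pd i)"
    by blast
  have "maps_onto n q ?M (map S (rev [c..<m]))"
  proof (rule maps_onto_triangular[OF TM(1), where f = g and x = "ub (n * m)"])
    have "sorted_wrt (<) [c..<m]" by simp
    then have "sorted_wrt (\<lambda>i j. g j *\<^sub>v ub (n * m) i = 0\<^sub>v (hm_dim (S j))) [c..<m]"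
      by (rule sorted_wrt_mono_rel[rotated]) (use g(2) Sd(1) in auto)
    then show "sorted_wrt (\<lambda>i j. g i *\<^sub>v ub (n * m) j = 0\<^sub>v (hm_dim (S i))) (rev [c..<m])" by (simp add: sorted_wrt_rev)
  qed (use g Sd TM(3) in auto)
  moreover have "map (case_prod (V q)) (hw_high 0 m (r + s)) = map S [c..<m]"
    unfolding hw_high_def map_map by (rule map_cong) (auto simp: S_def pd_def c_def)
  then have "mset (map (case_prod (V q)) (hw_high 0 m (r + s))) = mset (map S (rev [c..<m]))" by simp
  ultimately show ?thesis by (rule maps_onto_perm)
qed

end

section \<open>Tensor products of projective covers\<close>

lemma tensor_surj:
  fixes q :: "'k::field"
  assumes q: "primitive_root_of_unity n q"
    and M: "is_hmod n q M" and M': "is_hmod n q M'" and N: "is_hmod n q N" and N': "is_hmod n q N'"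
    and X: "X \<in> hm_hom n q M M'" "hm_surj M M' X" and Y: "Y \<in> hm_hom n q N N'" "hm_surj N N' Y"
  shows "hm_surj (hm_tensor n q M N) (hm_tensor n q M' N') (kron_mat X Y)"
proof -
  note Xc = hom_carrier[OF X(1)] and Yc = hom_carrier[OF Y(1)]
  obtain X' where X': "X' \<in> carrier_mat (hm_dim M) (hm_dim M')" "X * X' = 1\<^sub>m (hm_dim M')"
    using surj_right_inverse[OF Xc] X(2) unfolding hm_surj_def by blast
  obtain Y' where Y': "Y' \<in> carrier_mat (hm_dim N) (hm_dim N')" "Y * Y' = 1\<^sub>m (hm_dim N')"
    using surj_right_inverse[OF Yc] Y(2) unfolding hm_surj_def by blast
  have "kron_mat X Y * kron_mat X' Y' = 1\<^sub>m (hm_dim M' * hm_dim N')"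
    unfolding kron_mat_mult[OF Xc Yc X'(1) Y'(1)] X'(2) Y'(2) by (rule kron_mat_one)
  note r = right_inverse_surj[OF kron_mat_carrier[OF Xc Yc] kron_mat_carrier[OF X'(1) Y'(1)] this]
  show ?thesis unfolding hm_surj_def hmod_tensor(3)[OF q M N] hmod_tensor(3)[OF q M' N'] using r by blast
qed

lemma surj_id: "hm_surj M M (1\<^sub>m (hm_dim M) :: 'k::field mat)"
  unfolding hm_surj_def by auto

text \<open>Projectivity lifts P -> S to P -> E, and the lift is onto because E -> S is essential:
  the case of a single target in \<open>maps_onto_covers\<close>.\<close>

lemma projective_onto_essential:
  fixes q :: "'k::field"
  assumes P: "hm_projective n q P" and p: "p \<in> hm_hom n q P S" "hm_surj P S p"
    and S: "is_hmod n q S" and E: "essential_epi n q E S"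
  shows "\<exists>X\<in>hm_hom n q P E. hm_surj P E X"
proof -
  have "maps_onto n q P [S]"
    unfolding maps_onto_def
  proof (intro exI[of _ "\<lambda>_. p"] conjI)
    show "joint_surj P {..<length [S]} (\<lambda>i. [S] ! i) (\<lambda>_. p)"
      using p(2) by (simp add: joint_surj_def hm_surj_def lessThan_Suc)
  qed (use p(1) in simp)
  then have "maps_onto n q P [E]" by (rule maps_onto_covers[OF P]) (use S E in auto)
  then obtain f where f: "f 0 \<in> hm_hom n q P E" and j: "joint_surj P {..<length [E]} (\<lambda>i. [E] ! i) f"
    unfolding maps_onto_def by auto
  have "hm_surj P E (f 0)"
    unfolding hm_surj_def
  proof
    fix w :: "'k vec" assume "w \<in> carrier_vec (hm_dim E)"
    then show "\<exists>v\<in>carrier_vec (hm_dim P). f 0 *\<^sub>v v = w" using joint_surjD[OF j, of "\<lambda>_. w"] by auto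
  qed
  then show ?thesis using f by blast
qed

lemma essential_epi_cover:
  assumes "hm_projective_cover n q P S"
  shows "essential_epi n q P S"
  using assms unfolding hm_projective_cover_def essential_epi_def superfluous_def hm_projective_def by blast

text \<open>Needed for V(n,s), which serves as its own cover.\<close>

lemma essential_epi_id:
  fixes M :: "'k::field hmod"
  assumes M: "is_hmod n q M"
  shows "essential_epi n q M M"
proof -
  have k: "hm_kernel M M (1\<^sub>m (hm_dim M)) = {0\<^sub>v (hm_dim M)}"
    unfolding hm_kernel_def by auto
  have "superfluous n q M {0\<^sub>v (hm_dim M)}"
    unfolding superfluous_def
  proof (intro allI impI, elim conjE)
    fix U :: "'k vec set" assume U: "hm_submodule n q M U" and e: "{u + v |u v. u \<in> U \<and> v \<in> {0\<^sub>v (hm_dim M)}} = carrier_vec (hm_dim M)"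
    have c: "U \<subseteq> carrier_vec (hm_dim M)" using U by (simp add: hm_submodule_def)
    have "carrier_vec (hm_dim M) \<subseteq> U" unfolding e[symmetric] using c by force
    then show "U = carrier_vec (hm_dim M)" using c by blast
  qed
  then show ?thesis unfolding essential_epi_def using M hom_id[OF M] surj_id[of M] k by metis
qed

text \<open>Converts lower bounds for all covers and an upper bound for their total dimension into
  the exact dimension of one of them.\<close>

lemma sum_list_eq_imp_eq:
  fixes f g :: "'a \<Rightarrow> nat"
  assumes "\<And>x. x \<in> set xs \<Longrightarrow> g x \<le> f x" and "sum_list (map f xs) \<le> sum_list (map g xs)" and "x \<in> set xs"
  shows "f x = g x"
proof -
  have "sum_list (map f (remove1 x xs)) \<ge> sum_list (map g (remove1 x xs))"
    by (rule sum_list_mono) (use assms(1) in \<open>auto dest: notin_set_remove1\<close>)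
  moreover have "sum_list (map f xs) = f x + sum_list (map f (remove1 x xs))" "sum_list (map g xs) = g x + sum_list (map g (remove1 x xs))"
    using assms(3) by (rule sum_list_map_remove1)+
  ultimately show ?thesis using assms(1)[OF assms(3)] assms(2) by linarith
qed

context primitive_root
begin

definition P_dim :: "nat \<Rightarrow> nat" where
  "P_dim p = (if p < n then 2 * n else n)"

lemma hw_range:
  assumes "(p, t') \<in> set (hw_low l m t @ hw_high l m t)" "l \<le> m" "m \<le> n" "l + m \<le> n"
  shows "1 \<le> p" "p \<le> n"
proof -
  consider i where "i < l" "p = l + m - 1 - 2 * i" | i where "(l + m) div 2 \<le> i" "i < m" "p = n + l + m - 1 - 2 * i"
    using assms(1) unfolding hw_low_def hw_high_def by auto
  then have "1 \<le> p \<and> p \<le> n"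
  proof cases
    case 1
    then show ?thesis using assms(2-4) by arith
  next
    case 2
    have "l + m \<le> 2 * i + 1" using 2(1) by linarith
    then show ?thesis using 2 assms(2-4) by arith
  qed
  then show "1 \<le> p" "p \<le> n" by auto
qed

lemma P_dim_hw_low:
  assumes "l \<le> m" "l + m \<le> n"
  shows "sum_list (map (\<lambda>x. P_dim (fst x)) (hw_low l m t)) = 2 * n * l"
proof -
  have "map (\<lambda>x. P_dim (fst x)) (hw_low l m t) = map (\<lambda>_. 2 * n) [0..<l]"
    unfolding hw_low_def map_map by (rule map_cong) (use assms in \<open>auto simp: P_dim_def\<close>)
  then show ?thesis by (simp add: sum_list_triv)
qed

text \<open>Each entry has p < n and contributes 2n, except that for odd l + m the first entry has p
  = n and contributes n. With this the two parities give the same formula.\<close>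

lemma P_dim_hw_high:
  assumes l: "l \<le> m" and m: "m \<le> n"
  shows "sum_list (map (\<lambda>x. P_dim (fst x)) (hw_high l m t)) = n * (m - l)"
proof -
  define c where "c = (l + m) div 2"
  have tail: "map (\<lambda>i. P_dim (n + l + m - 1 - 2 * i)) [k..<m] = map (\<lambda>_. 2 * n) [k..<m]" if "l + m \<le> 2 * k" for k
    by (rule map_cong) (use that m in \<open>auto simp: P_dim_def\<close>)
  have e: "map (\<lambda>x. P_dim (fst x)) (hw_high l m t) = map (\<lambda>i. P_dim (n + l + m - 1 - 2 * i)) [c..<m]"
    unfolding hw_high_def map_map c_def by (rule map_cong) auto
  show ?thesis
  proof (cases "even (l + m)")
    case True
    then have c: "2 * c = l + m" by (simp add: c_def)
    then have "l + m \<le> 2 * c" by simp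
    then have "sum_list (map (\<lambda>x. P_dim (fst x)) (hw_high l m t)) = (m - c) * (2 * n)"
      unfolding e by (subst tail) (simp_all add: sum_list_triv)
    also have "\<dots> = n * (2 * (m - c))" by (simp only: mult.commute mult.left_commute)
    also have "2 * (m - c) = m - l" using c l by linarith
    finally show ?thesis .
  next
    case False
    then have c: "2 * c + 1 = l + m" unfolding c_def by presburger
    then have cm: "c < m" using l by linarith
    have d: "P_dim (n + l + m - 1 - 2 * c) = n" using c by (simp add: P_dim_def)
    have "l + m \<le> 2 * Suc c" using c by simp
    then have "sum_list (map (\<lambda>x. P_dim (fst x)) (hw_high l m t)) = n + (m - Suc c) * (2 * n)"
      unfolding e upt_conv_Cons[OF cm] list.map sum_list.Cons d by (subst tail) (simp_all add: sum_list_triv)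
    also have "\<dots> = n * (1 + 2 * (m - Suc c))" by (simp add: algebra_simps)
    also have "1 + 2 * (m - Suc c) = m - l" using c cm by linarith
    finally show ?thesis .
  qed
qed

end

section \<open>The given covers: dimensions, tensor products and their decomposition\<close>

locale projective_covers = primitive_root n q
  for n :: nat and q :: "'k::field" +
  fixes P :: "nat \<Rightarrow> int \<Rightarrow> 'k hmod"
  assumes P_cover: "1 \<le> m \<Longrightarrow> m < n \<Longrightarrow> hm_projective_cover n q (P m s) (V q m s)"
    and P_top: "P n s = V q n s"
begin

lemma P_essential:
  assumes "1 \<le> m" "m \<le> n"
  shows "essential_epi n q (P m s) (V q m s)"
proof (cases "m < n")
  case True
  then show ?thesis using P_cover assms essential_epi_cover by blast
next
  case False
  then show ?thesis using assms P_top essential_epi_id[OF V_hmod(1)[OF le_refl]] by simp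
qed

lemma P_projective:
  assumes "1 \<le> m" "m < n"
  shows "hm_projective n q (P m s)" "is_hmod n q (P m s)"
  using P_cover[OF assms] by (auto simp: hm_projective_cover_def hm_projective_def)

lemma P_onto_Q:
  assumes m: "1 \<le> m" "m < n"
  shows "\<exists>X\<in>hm_hom n q (P m s) (Q m s). hm_surj (P m s) (Q m s) X"
proof -
  obtain p where p: "p \<in> hm_hom n q (P m s) (V q m s)" "hm_surj (P m s) (V q m s) p"
    using P_cover[OF m] unfolding hm_projective_cover_def by blast
  show ?thesis
    by (rule projective_onto_essential[OF P_projective(1)[OF m] p V_hmod(1) Q_essential]) (use m in auto)
qed

lemma hm_dim_P_ge:
  assumes m: "1 \<le> m" "m \<le> n"
  shows "P_dim m \<le> hm_dim (P m s)"
proof (cases "m < n")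
  case True
  obtain X where X: "X \<in> hm_hom n q (P m s) (Q m s)" "hm_surj (P m s) (Q m s) X" using P_onto_Q[OF m(1) True] by blast
  show ?thesis using surj_dim_le[OF X] Q_hmod(3)[of m s] m True by (simp add: P_dim_def)
next
  case False
  then show ?thesis using m P_top V_hmod(2)[of n s] by (simp add: P_dim_def)
qed

text \<open>
  The lower bound is sharp because \<open>V(n, r) \<otimes> V(n + 1 - m, s)\<close> is projective of dimension exactly the sum of the
  lower bounds over its known tops, one of which is \<open>V(m, t)\<close>.
\<close>

lemma hm_dim_P:
  assumes m: "1 \<le> m" "m \<le> n"
  shows "hm_dim (P m t) = P_dim m"
proof -
  \<comment> \<open>For this k the last top in \<open>hw_high 0 k r\<close>, at i = k - 1, has first
    entry n + 1 - k = m; below, \<open>r\<close> is chosen so that its second entry is t.\<close>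
  define k where "k = n + 1 - m"
  have k: "0 < k" "k \<le> n" using m by (auto simp: k_def)
  define r where "r = t - int (k - 1)"
  let ?M = "hm_tensor n q (V q n r) (V q k 0)" and ?L = "hw_high 0 k r"
  note T = hmod_tensor[OF prim V_hmod(1)[OF le_refl, of r] V_hmod(1)[OF k(2), of 0]]
  have R: "1 \<le> p \<and> p \<le> n" if "(p, t') \<in> set ?L" for p t' using hw_range[of p t' 0 k r] that k by auto
  have "sum_list (map hm_dim (map (case_prod P) ?L)) \<le> hm_dim ?M"
  proof (rule dim_covers_le(1))
    show "hm_projective n q ?M" by (rule projective_tensor[OF prim V_n_projective V_hmod(1)[OF k(2)]])
    show "maps_onto n q ?M (map (case_prod (V q)) ?L)" using V_n_tensor_tops[OF k(2), of r 0] by simp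
    show "is_hmod n q S" if "S \<in> set (map (case_prod (V q)) ?L)" for S using that R V_hmod(1) by auto
    fix i assume "i < length (map (case_prod (V q)) ?L)"
    then have i: "i < length ?L" by simp
    obtain p t' where pt: "?L ! i = (p, t')" by (cases "?L ! i")
    have "(p, t') \<in> set ?L" using i pt by (metis nth_mem)
    then show "essential_epi n q (map (case_prod P) ?L ! i) (map (case_prod (V q)) ?L ! i)" using i pt P_essential R by simp
  qed simp
  also have "\<dots> = sum_list (map (\<lambda>x. P_dim (fst x)) ?L)"
    using T(3) P_dim_hw_high[of 0 k r] k V_hmod(2) by simp
  finally have le: "sum_list (map (\<lambda>x. hm_dim (case_prod P x)) ?L) \<le> sum_list (map (\<lambda>x. P_dim (fst x)) ?L)"
    by (simp add: o_def)
  have mem: "(m, t) \<in> set ?L"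
  proof -
    have "k - 1 \<in> set [(0 + k) div 2..<k]" using k by auto
    moreover have "(n + 0 + k - 1 - 2 * (k - 1), r + int (k - 1)) = (m, t)" using m by (auto simp: k_def r_def)
    ultimately show ?thesis unfolding hw_high_def by (metis (no_types, lifting) image_eqI list.set_map)
  qed
  have ge: "P_dim (fst x) \<le> hm_dim (case_prod P x)" if "x \<in> set ?L" for x
  proof -
    obtain p t' where x: "x = (p, t')" by (cases x)
    then show ?thesis using R[of p t'] hm_dim_P_ge[of p t'] that by simp
  qed
  show ?thesis using sum_list_eq_imp_eq[OF ge le mem] by simp
qed

text \<open>Index pairs of the simple quotients found in \<open>Q_tensor_tops\<close>, with t in the
  role of r + s.\<close>

definition tops :: "nat \<Rightarrow> nat \<Rightarrow> int \<Rightarrow> (nat \<times> int) list" where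
  "tops l m t = hw_low l m t @ hw_high l m t @ hw_high l m t"

lemma tops_hmod:
  assumes "l \<le> m" "m < n" "l + m \<le> n" "S \<in> set (map (case_prod (V q)) (tops l m t))"
  shows "is_hmod n q S"
proof -
  obtain p t' where "(p, t') \<in> set (tops l m t)" "S = V q p t'" using assms(4) by auto
  then show ?thesis using hw_range[of p t' l m t] V_hmod(1) assms by (auto simp: tops_def)
qed

lemma P_tensor_V_tops:
  assumes l: "0 < l" "l \<le> m" and m: "m < n" "l + m \<le> n"
  shows "maps_onto n q (hm_tensor n q (P l r) (V q m s)) (map (case_prod (V q)) (tops l m (r + s)))"
proof -
  have ln: "1 \<le> l" "l < n" "m \<le> n" using l m by auto
  note PM = P_projective(2)[OF ln(1,2), of r] and QM = Q_hmod(1)[OF l(1) ln(2), of r] and WM = V_hmod(1)[OF ln(3), of s]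
  obtain X where X: "X \<in> hm_hom n q (P l r) (Q l r)" "hm_surj (P l r) (Q l r) X" using P_onto_Q[OF ln(1,2)] by blast
  note r = tensor_hom[OF prim PM QM WM WM X(1) hom_id[OF WM]] tensor_surj[OF prim PM QM WM WM X hom_id[OF WM] surj_id]
  show ?thesis
    by (rule maps_onto_surj[OF hmod_tensor(1)[OF prim QM WM] hmod_tensor(1)[OF prim PM WM] r
          Q_tensor_tops[OF l m, of r s, folded tops_def]]) (rule tops_hmod[OF l(2) m])
qed

lemma map_V_cong:
  assumes "t mod int n = t' mod int n"
  shows "map (case_prod (V q)) (tops l m t) = map (case_prod (V q)) (tops l m t')"
proof -
  have "V q p (t + int i) = V q p (t' + int i)" for p i by (rule V_cong) (metis assms mod_add_left_eq)
  then show ?thesis unfolding tops_def hw_low_def hw_high_def by simp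
qed

lemma P_tensor_P_tops:
  fixes r r' :: int
  assumes l: "0 < l" "l \<le> l'" and l': "l' < n" "l + l' \<le> n"
  defines "t \<equiv> r + r'"
  shows "maps_onto n q (hm_tensor n q (P l r) (P l' r'))
    (map (case_prod (V q)) ((tops l l' t @ tops l (n - l') (t + int l')) @ (tops l (n - l') (t + int l') @ tops l l' t)))"
proof -
  have ln: "1 \<le> l" "l < n" "1 \<le> l'" "0 < l'" "l' \<le> n" using l l' by auto
  \<comment> \<open>Under the exchange of l' with n - l' the conditions l <= l' and l + l' <= n
    trade places, so \<open>P_tensor_V_tops\<close> applies to both kinds of simple factor.\<close>
  have m: "l \<le> n - l'" "n - l' < n" "l + (n - l') \<le> n" "n - (n - l') = l'" "n - l' \<le> n" using l l' by auto
  note Pl = P_projective[OF ln(1,2), of r] and Pl' = P_projective(2)[OF ln(3) l'(1), of r'] and QM = Q_hmod(1)[OF ln(4) l'(1), of r']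
  let ?V = "\<lambda>l' t. map (case_prod (V q)) (tops l l' t)"
  have hm: "is_hmod n q S" if "S \<in> set (?V l' u) \<union> set (?V (n - l') v)" for S u v
    using that tops_hmod[OF l(2) l', of S u] tops_hmod[OF m(1-3), of S v] by blast
  have 1: "maps_onto n q (hm_tensor n q (P l r) (verma l' r')) (?V (n - l') (t + int l') @ ?V l' t)"
  proof (rule maps_onto_exact[OF prim Pl(1) verma_exact[OF ln(5)]])
    show "maps_onto n q (hm_tensor n q (P l r) (V q (n - l') (r' + int l'))) (?V (n - l') (t + int l'))"
      using P_tensor_V_tops[OF l(1) m(1-3), of r "r' + int l'"] by (simp add: t_def add.assoc)
    show "maps_onto n q (hm_tensor n q (P l r) (V q l' r')) (?V l' t)"
      unfolding t_def by (rule P_tensor_V_tops[OF l l'])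
  qed (use hm in blast)
  have 2: "maps_onto n q (hm_tensor n q (P l r) (verma (n - l') (r' + int l'))) (?V l' t @ ?V (n - l') (t + int l'))"
  proof (rule maps_onto_exact[OF prim Pl(1) verma_exact[OF m(5)], unfolded m(4)])
    \<comment> \<open>The simple submodule of the second Verma module has second index r' + n, which
      V identifies with r'.\<close>
    have "?V l' (r + (r' + int l' + int (n - l'))) = ?V l' t"
      by (rule map_V_cong) (use l' in \<open>simp add: t_def of_nat_diff add.assoc[symmetric]\<close>)
    then show "maps_onto n q (hm_tensor n q (P l r) (V q l' (r' + int l' + int (n - l')))) (?V l' t)"
      using P_tensor_V_tops[OF l l', of r "r' + int l' + int (n - l')"] by simp
    show "maps_onto n q (hm_tensor n q (P l r) (V q (n - l') (r' + int l'))) (?V (n - l') (t + int l'))"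
      using P_tensor_V_tops[OF l(1) m(1-3), of r "r' + int l'"] by (simp add: t_def add.assoc)
  qed (use hm in blast)
  have 3: "maps_onto n q (hm_tensor n q (P l r) (Q l' r'))
    ((?V l' t @ ?V (n - l') (t + int l')) @ (?V (n - l') (t + int l') @ ?V l' t))"
    by (rule maps_onto_exact[OF prim Pl(1) Q_exact[OF ln(4) l'(1)] 2 1]) (unfold set_append, use hm in blast)
  obtain X where X: "X \<in> hm_hom n q (P l' r') (Q l' r')" "hm_surj (P l' r') (Q l' r') X" using P_onto_Q[OF ln(3) l'(1)] by blast
  note r = tensor_hom[OF prim Pl(2) Pl(2) Pl' QM hom_id[OF Pl(2)] X(1)] tensor_surj[OF prim Pl(2) Pl(2) Pl' QM hom_id[OF Pl(2)] surj_id X]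
  show ?thesis unfolding map_append
    by (rule maps_onto_surj[OF hmod_tensor(1)[OF prim Pl(2) QM] hmod_tensor(1)[OF prim Pl(2) Pl'] r 3]) (unfold set_append, use hm in blast)
qed

text \<open>
  The weights in \<open>T\<close> may differ from those of the known tops by multiples of \<open>n\<close>, which \<open>V\<close> ignores but \<open>P\<close> need not.
\<close>

lemma P_tensor_P_iso:
  assumes l: "0 < l" "l \<le> l'" and l': "l' < n" "l + l' \<le> n"
    and T: "mset (map (case_prod (V q)) T) = mset (map (case_prod (V q))
      (tops l l' (r + r') @ tops l (n - l') (r + r' + int l') @ tops l (n - l') (r + r' + int l') @ tops l l' (r + r')))"
    and T1: "mset (map fst T) = mset (map fst
      (tops l l' (r + r') @ tops l (n - l') (r + r' + int l') @ tops l (n - l') (r + r' + int l') @ tops l l' (r + r')))"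
  shows "hm_iso n q (hm_tensor n q (P l r) (P l' r')) (hm_dsum (map (case_prod P) T))"
proof -
  let ?L = "tops l l' (r + r') @ tops l (n - l') (r + r' + int l') @ tops l (n - l') (r + r' + int l') @ tops l l' (r + r')"
  let ?M = "hm_tensor n q (P l r) (P l' r')"
  have ln: "1 \<le> l" "l < n" "1 \<le> l'" using l l' by auto
  have m: "l \<le> n - l'" "n - l' < n" "l + (n - l') \<le> n" using l l' by auto
  note Pl = P_projective[OF ln(1,2), of r] and Pl' = P_projective(2)[OF ln(3) l'(1), of r']
  have R0: "1 \<le> p \<and> p \<le> n" if p: "p \<in> set (map fst ?L)" for p
  proof -
    obtain x where x: "x \<in> set ?L" "p = fst x" using p unfolding set_map by blast
    obtain t' where "x = (p, t')" using x(2) by (cases x) simp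
    with x(1) have "(p, t') \<in> set ?L" by (simp only:)
    then show ?thesis
      using hw_range[of p t' l l' "r + r'"] hw_range[of p t' l "n - l'" "r + r' + int l'"] l l' m by (auto simp: tops_def)
  qed
  have R: "1 \<le> p \<and> p \<le> n" if "(p, t') \<in> set T" for p t'
  proof -
    have "p \<in> set (map fst T)" using image_eqI[OF _ that, of p fst] by simp
    then show ?thesis unfolding mset_eq_setD[OF T1] by (rule R0)
  qed
  have o: "maps_onto n q ?M (map (case_prod (V q)) T)"
    by (rule maps_onto_perm[OF P_tensor_P_tops[OF l l']]) (use T in simp)
  \<comment> \<open>The covers of the known tops of P(l,r) (x) V(k,s) add up to 2nk, the full
    dimension of that tensor product; no quotient has been missed.\<close>
  have d: "sum_list (map (\<lambda>x. P_dim (fst x)) (tops l k t)) = 2 * n * k" if "l \<le> k" "k < n" "l + k \<le> n" for k t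
  proof -
    have "sum_list (map (\<lambda>x. P_dim (fst x)) (tops l k t)) = 2 * n * l + 2 * (n * (k - l))"
      unfolding tops_def using P_dim_hw_low[of l k t] P_dim_hw_high[of l k t] that by simp
    also have "\<dots> = 2 * n * (l + (k - l))" by (simp add: algebra_simps)
    finally show ?thesis using that by simp
  qed
  have dT: "map hm_dim (map (case_prod P) T) = map P_dim (map fst T)"
    unfolding map_map by (rule map_cong[OF refl]) (use R hm_dim_P in auto)
  have "sum_list (map hm_dim (map (case_prod P) T)) = sum_list (map P_dim (map fst ?L))"
    unfolding dT sum_mset_sum_list[symmetric] mset_map[of P_dim] T1 ..
  also have "\<dots> = 2 * (2 * n * l' + 2 * n * (n - l'))"
    using d[OF l(2) l'] d[OF m] by (simp add: o_def)
  also have "\<dots> = 2 * (2 * n * (l' + (n - l')))" by (simp only: distrib_left)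
  also have "\<dots> = hm_dim ?M"
    using hmod_tensor(3)[OF prim Pl(2) Pl'] hm_dim_P[of l r] hm_dim_P[of l' r'] ln l' by (simp add: P_dim_def)
  finally have dim: "sum_list (map hm_dim (map (case_prod P) T)) = hm_dim ?M" .
  show ?thesis
  proof (rule dim_covers_le(2)[OF projective_tensor[OF prim Pl(1) Pl'] o _ _ _ dim])
    show "is_hmod n q S" if "S \<in> set (map (case_prod (V q)) T)" for S using that R V_hmod(1) by auto
    fix i assume "i < length (map (case_prod (V q)) T)"
    then have i: "i < length T" by simp
    obtain p t' where pt: "T ! i = (p, t')" by (cases "T ! i")
    have "(p, t') \<in> set T" using i pt by (metis nth_mem)
    then show "essential_epi n q (map (case_prod P) T ! i) (map (case_prod (V q)) T ! i)" using i pt P_essential R by simp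
  qed simp
qed

end

section \<open>Nested direct sums\<close>

text \<open>An equality, not just an isomorphism: forming block diagonal matrices is strictly
  associative.\<close>

lemma hm_dsum_nested: "hm_dsum (map hm_dsum Lss) = hm_dsum (concat Lss)"
proof -
  have "diag_block_mat (map (\<lambda>Ms. diag_block_mat (map f Ms)) Lss) = diag_block_mat (map f (concat Lss))"
    for f :: "'a hmod \<Rightarrow> 'a::field mat"
    by (induction Lss) (simp_all add: diag_block_mat_append Let_def)
  moreover have "sum_list (map (\<lambda>Ms. sum_list (map hm_dim Ms)) Lss) = sum_list (map hm_dim (concat Lss))"
    by (induction Lss) simp_all
  ultimately show ?thesis by (simp add: hm_dsum_def o_def)
qed

lemma hm_dsum_append: "hm_dsum As \<oplus>\<^sub>H hm_dsum Bs = hm_dsum (As @ Bs)"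
  using hm_dsum_nested[of "[As, Bs]"] by simp

lemma hm_sum_copies:
  "hm_sum i j (\<lambda>x. hm_copies s (F x)) = hm_dsum (concat (map (\<lambda>x. replicate s (F x)) [i..j]))"
  unfolding hm_sum_def hm_copies_def by (simp add: hm_dsum_nested[symmetric] o_def)

lemma mset_concat_replicate:
  "mset (concat (map (\<lambda>x. replicate s (f x)) xs)) = repeat_mset s (mset (map f xs))"
  by (induction xs) (simp_all add: repeat_mset_distrib_add_mset)

lemma upto_eq_map: "[i..j] = map (\<lambda>k. i + int k) [0..<nat (j - i + 1)]"
  by (rule nth_equalityI) (auto simp: nth_upto)

lemma c_half_eq: "c_half t = (t + 1) div 2"
  unfolding c_half_def by (metis floor_divide_of_int_eq of_int_1 of_int_add of_int_numeral)

theorem proposition4p5: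
  fixes q :: "'k::alg_closed_field" and n l l' :: nat and r r' :: int
    and P :: "nat \<Rightarrow> int \<Rightarrow> 'k hmod"
  assumes "n > 2" and "primitive_root_of_unity n q"
    and P_cover: "\<And>m s. 1 \<le> m \<Longrightarrow> m < n \<Longrightarrow> hm_projective_cover n q (P m s) (V q m s)"
    and P_top: "\<And>s. P n s = V q n s"
    and "1 \<le> l" and "l \<le> l'" and "l' < n" and "l + l' \<le> n"
  shows "hm_iso n q (hm_tensor n q (P l r) (P l' r'))
     (hm_sum 0 (int l - 1)
        (\<lambda>i. hm_copies 2 (P (nat (int l + int l' - 1 - 2 * i)) (r + r' + i)))
      \<oplus>\<^sub>H hm_sum (int l') (int l' + int l - 1)
        (\<lambda>i. hm_copies 2 (P (nat (int n + int l + int l' - 1 - 2 * i)) (r + r' + i)))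
      \<oplus>\<^sub>H hm_sum (c_half (int l' + int l - 1)) (int l' - 1)
        (\<lambda>i. hm_copies 4 (P (nat (int n + int l + int l' - 1 - 2 * i)) (r + r' + i)))
      \<oplus>\<^sub>H hm_sum 1 (c_half (int n - int l - int l'))
        (\<lambda>i. hm_copies 4 (P (nat (int l + int l' - 1 + 2 * i)) (r + r' - i))))"
proof -
  interpret projective_covers n q P
    using assms by unfold_locales auto
  define t where "t = r + r'"
  define FA where "FA i = (nat (int l + int l' - 1 - 2 * i), t + i)" for i
  define FB where "FB i = (nat (int n + int l + int l' - 1 - 2 * i), t + i)" for i
  define FD where "FD i = (nat (int l + int l' - 1 + 2 * i), t - i)" for i
  let ?c = "c_half (int l' + int l - 1)" and ?e = "c_half (int n - int l - int l')"
  define T where "T = concat (map (\<lambda>i. replicate 2 (FA i)) [0..int l - 1]) @ concat (map (\<lambda>i. replicate 2 (FB i)) [int l'..int l' + int l - 1])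
    @ concat (map (\<lambda>i. replicate 4 (FB i)) [?c..int l' - 1]) @ concat (map (\<lambda>i. replicate 4 (FD i)) [1..?e])"
  have A: "map FA [0..int l - 1] = hw_low l l' t"
    unfolding upto_eq_map hw_low_def map_map using assms by (simp add: FA_def nat_eq_iff)
  have B: "map FB [int l'..int l' + int l - 1] = hw_low l (n - l') (t + int l')"
  proof -
    have "nat (int n + int l + int l' - 1 - 2 * (int l' + int k)) = l + (n - l') - 1 - 2 * k" for k
    proof -
      have "int n + int l + int l' - 1 - 2 * (int l' + int k) = int (n + l + l') - int (1 + 2 * l' + 2 * k)" by simp
      then have "nat (int n + int l + int l' - 1 - 2 * (int l' + int k)) = n + l + l' - (1 + 2 * l' + 2 * k)"
        by (simp only: nat_minus_as_int)
      then show ?thesis using assms(7) by simp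
    qed
    then have "FB (int l' + int k) = (l + (n - l') - 1 - 2 * k, t + int l' + int k)" for k
      unfolding FB_def by (simp only: add.assoc)
    moreover have "nat (int l' + int l - 1 - int l' + 1) = l" by simp
    ultimately show ?thesis unfolding upto_eq_map hw_low_def map_map o_def by (simp only:)
  qed
  have c: "?c = int ((l + l') div 2)" unfolding c_half_eq by (simp add: zdiv_int add.commute)
  have C: "map FB [?c..int l' - 1] = hw_high l l' t"
  proof (rule nth_equalityI)
    show "length (map FB [?c..int l' - 1]) = length (hw_high l l' t)" unfolding c hw_high_def by simp
    fix i assume "i < length (map FB [?c..int l' - 1])"
    then have i: "?c + int i \<le> int l' - 1" by simp
    then show "map FB [?c..int l' - 1] ! i = hw_high l l' t ! i"
      using assms unfolding hw_high_def c by (auto simp: nth_upto FB_def nat_eq_iff)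
  qed
  \<comment> \<open>The number of entries of \<open>hw_high l (n - l')\<close>. It equals (n - l -
    l' + 1) div 2, the upper limit of the last sum in the statement.\<close>
  define K where "K = n - l' - (l + (n - l')) div 2"
  \<comment> \<open>The last sum runs through this list backwards: its index 1 + i corresponds to n
    - l' - 1 - i here, and the second entries differ by n. Hence the reversal, and a comparison of
    the modules V in place of the index pairs.\<close>
  define H where "H = rev (hw_high l (n - l') (t + int l'))"
  define Ds where "Ds = map FD [1..?e]"
  have e: "?e = int K" unfolding c_half_eq K_def using assms by linarith
  have len: "length Ds = K" "length H = K" unfolding Ds_def H_def e by (simp_all add: hw_high_def K_def)
  have D: "Ds ! i = (p, u - int n) \<and> H ! i = (p, u)"
    if i: "i < K" and p: "p = l + l' + 1 + 2 * i" and u: "u = t + int n - 1 - int i" for i p u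
  proof -
    have "Ds ! i = FD (1 + int i)" unfolding Ds_def e using i by (simp add: nth_upto)
    also have "\<dots> = (p, u - int n)" unfolding FD_def p u by (simp add: nat_eq_iff)
    finally have 1: "Ds ! i = (p, u - int n)" .
    have "H ! i = hw_high l (n - l') (t + int l') ! (K - 1 - i)"
      unfolding H_def using i by (simp add: hw_high_def K_def rev_nth)
    also have "\<dots> = (\<lambda>i. (n + l + (n - l') - 1 - 2 * i, t + int l' + int i)) ([(l + (n - l')) div 2..<n - l'] ! (K - 1 - i))"
      unfolding hw_high_def using i by (subst nth_map) (auto simp: K_def)
    also have "[(l + (n - l')) div 2..<n - l'] ! (K - 1 - i) = n - l' - 1 - i"
      using i by (subst nth_upt) (auto simp: K_def)
    also have "(\<lambda>i. (n + l + (n - l') - 1 - 2 * i, t + int l' + int i)) (n - l' - 1 - i) = (p, u)"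
    proof -
      have "i < n - l'" using i unfolding K_def by linarith
      then have "n + l + (n - l') - 1 - 2 * (n - l' - 1 - i) = p" "t + int l' + int (n - l' - 1 - i) = u"
        unfolding p u using assms(7) by linarith+
      then show ?thesis by (simp only:)
    qed
    finally show ?thesis using 1 by blast
  qed
  have DV: "map (case_prod (V q)) Ds = map (case_prod (V q)) H"
  proof (rule nth_equalityI)
    fix i assume "i < length (map (case_prod (V q)) Ds)"
    then have i: "i < K" using len by simp
    obtain p u where d: "Ds ! i = (p, u - int n)" "H ! i = (p, u)" using D[OF i refl refl] by blast
    have "V q p (u - int n) = V q p u" by (rule V_cong) simp
    then show "map (case_prod (V q)) Ds ! i = map (case_prod (V q)) H ! i"
      using d i len by simp
  qed (simp add: len)
  have D1: "map fst Ds = map fst H"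
  proof (rule nth_equalityI)
    fix i assume "i < length (map fst Ds)"
    then have i: "i < K" using len by simp
    show "map fst Ds ! i = map fst H ! i" using D[OF i refl refl] i len by simp
  qed (simp add: len)
  \<comment> \<open>\<open>X\<close> and \<open>Y\<close> are the low parts for l' and n - l',
    occurring twice; \<open>Z\<close> and \<open>W\<close> are the corresponding high parts,
    occurring four times.\<close>
  have four: "repeat_mset 2 X + (repeat_mset 2 Y + (repeat_mset 4 Z + repeat_mset 4 W)) = (X + (Z + Z)) + ((Y + (W + W)) + ((Y + (W + W)) + (X + (Z + Z))))"
    for X Y Z W :: "'x multiset" by (rule multiset_eqI) simp
  \<comment> \<open>Applied to \<open>g = case_prod (V q)\<close> and to \<open>g = fst\<close>, the
    two comparisons that \<open>P_tensor_P_iso\<close> asks for.\<close>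
  have T: "mset (map g T) = mset (map g (tops l l' t @ tops l (n - l') (t + int l') @ tops l (n - l') (t + int l') @ tops l l' t))"
    if "map g Ds = map g H" for g :: "nat \<times> int \<Rightarrow> 'x"
  proof -
    have "mset (map g Ds) = mset (map g H)" unfolding that ..
    then have D': "image_mset g (mset Ds) = image_mset g (mset (hw_high l (n - l') (t + int l')))" by (simp add: H_def)
    have rep: "image_mset g (repeat_mset k X) = repeat_mset k (image_mset g X)" for k X by (induction k) auto
    show ?thesis
      unfolding mset_map[of g] T_def mset_append mset_concat_replicate A B C Ds_def[symmetric] image_mset_union rep D' tops_def by (rule four)
  qed
  have "hm_iso n q (hm_tensor n q (P l r) (P l' r')) (hm_dsum (map (case_prod P) T))"
    by (rule P_tensor_P_iso[OF _ assms(6-8) T[OF DV, unfolded t_def] T[OF D1, unfolded t_def]]) (use assms(5) in simp)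
  also have "map (case_prod P) T = concat (map (\<lambda>i. replicate 2 (P (nat (int l + int l' - 1 - 2 * i)) (r + r' + i))) [0..int l - 1])
    @ concat (map (\<lambda>i. replicate 2 (P (nat (int n + int l + int l' - 1 - 2 * i)) (r + r' + i))) [int l'..int l' + int l - 1])
    @ concat (map (\<lambda>i. replicate 4 (P (nat (int n + int l + int l' - 1 - 2 * i)) (r + r' + i))) [?c..int l' - 1])
    @ concat (map (\<lambda>i. replicate 4 (P (nat (int l + int l' - 1 + 2 * i)) (r + r' - i))) [1..?e])"
    unfolding T_def by (simp add: map_concat o_def FA_def FB_def FD_def t_def)
  finally show ?thesis unfolding hm_sum_copies hm_dsum_append .
qed

end
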